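(* Let $k$ be a perfect field of characteristic $p>0$, and let $m\ge1$, $n\ge2$ be integers. Put $k_{m+1}=k[t]/(t^{m+1})$. Then $$\widehat K^M_n(k_{m+1},(t))=0\quad\text{and}\quad\widehat K^M_n(k_{m+1})=K^M_n(k),$$ the second equality being the identification induced by the reduction map $t\mapsto0$. In particular, if $k$ is finite, then $\widehat K^M_n(k_{m+1})=0$.
   Context: For a commutative ring $R$, $K^M_n(R)$ is the degree $n$ part of the tensor algebra $T_{\mathbb Z}(R^\times)$ modulo the two-sided ideal generated by $a\otimes(1-a)$ with $a,1-a\in R^\times$. For a local ring $A$, let $A(s_1,\dots,s_r)$ be the localization of $A[s_1,\dots,s_r]$ at the polynomials whose coefficients generate the unit ideal; the improved (Gabber–Kerz) Milnor $K$-group is $\widehat K^M_n(A)=\ker(K^M_n(A(s_1))\xrightarrow{i_1-i_2}K^M_n(A(s_1,s_2)))$, $i_j$ induced by $s_1\mapsto s_j$. There is a natural surjection $K^M_n(A)\to\widehat K^M_n(A)$, which is an isomorphism when $A$ is a field or $n=1$. $\widehat K^M_n(A,I)=\ker(\widehat K^M_n(A)\to\widehat K^M_n(A/I))$. *)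

theory Defs
  imports "HOL-Algebra.UnivPoly" "HOL-Algebra.QuotRing" "HOL-Algebra.Elementary_Groups"
    "HOL-Algebra.Free_Abelian_Groups" "HOL-Computational_Algebra.Primes"
begin

section \<open>Perfect fields\<close>

definition has_char :: "('a, 'b) ring_scheme \<Rightarrow> nat \<Rightarrow> bool" where
  "has_char R p \<longleftrightarrow> (\<forall>n::nat. [n] \<cdot>\<^bsub>R\<^esub> \<one>\<^bsub>R\<^esub> = \<zero>\<^bsub>R\<^esub> \<longleftrightarrow> p dvd n)"

definition perfect_field :: "('a, 'b) ring_scheme \<Rightarrow> bool" where
  "perfect_field k \<longleftrightarrow> field k \<and>
     (\<forall>p::nat. prime p \<and> has_char k p \<longrightarrow> (\<lambda>x. x [^]\<^bsub>k\<^esub> p) ` carrier k = carrier k)"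


section \<open>Tensor algebra of an abelian group\<close>

text \<open>The ring of noncommutative polynomials with integer coefficients in the elements of
  \<open>X\<close>: integer combinations of words over \<open>X\<close>, multiplied by concatenating words.\<close>

definition free_ring :: "'a set \<Rightarrow> ('a list \<Rightarrow>\<^sub>0 int) ring" where
  "free_ring X = \<lparr>carrier = {c. Poly_Mapping.keys c \<subseteq> lists X},
     monoid.mult = (\<lambda>c d. frag_extend (\<lambda>u. frag_extend (\<lambda>v. frag_of (u @ v)) d) c),
     one = frag_of [], ring.zero = 0, add = (+)\<rparr>"

text \<open>For an abelian group \<open>G\<close>, written multiplicatively, the tensor algebra over the integers is
  the free ring on the elements of \<open>G\<close> modulo additivity in each letter; the class of the word
  \<open>[a\<^sub>1, \<dots>, a\<^sub>n]\<close> is the tensor \<open>a\<^sub>1 \<otimes> \<dots> \<otimes> a\<^sub>n\<close>.\<close>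

definition tensor_ideal :: "('a, 'b) monoid_scheme \<Rightarrow> ('a list \<Rightarrow>\<^sub>0 int) set" where
  "tensor_ideal G = Idl\<^bsub>free_ring (carrier G)\<^esub>
     {frag_of [a \<otimes>\<^bsub>G\<^esub> b] - frag_of [a] - frag_of [b] | a b. a \<in> carrier G \<and> b \<in> carrier G}"

definition tensor_class ::
    "('a, 'b) monoid_scheme \<Rightarrow> ('a list \<Rightarrow>\<^sub>0 int) \<Rightarrow> ('a list \<Rightarrow>\<^sub>0 int) set" where
  "tensor_class G c = tensor_ideal G +>\<^bsub>free_ring (carrier G)\<^esub> c"

definition tensor_algebra :: "('a, 'b) monoid_scheme \<Rightarrow> ('a list \<Rightarrow>\<^sub>0 int) set ring" where
  "tensor_algebra G = free_ring (carrier G) Quot tensor_ideal G"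

definition tensor_degree :: "('a, 'b) monoid_scheme \<Rightarrow> nat \<Rightarrow> ('a list \<Rightarrow>\<^sub>0 int) set set" where
  "tensor_degree G n =
     tensor_class G ` {c. Poly_Mapping.keys c \<subseteq> {w \<in> lists (carrier G). length w = n}}"

text \<open>The map of tensor algebras induced by a homomorphism \<open>f\<close> from some group to \<open>H\<close>; it is
  applied to residue classes of the source.\<close>

definition tensor_map ::
    "('c, 'd) monoid_scheme \<Rightarrow> ('a \<Rightarrow> 'c) \<Rightarrow> ('a list \<Rightarrow>\<^sub>0 int) set \<Rightarrow> ('c list \<Rightarrow>\<^sub>0 int) set" where
  "tensor_map H f X =
     the_elem ((\<lambda>c. tensor_class H (frag_extend (\<lambda>w. frag_of (map f w)) c)) ` X)"


section \<open>Milnor K-theory\<close>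

definition steinberg_ideal :: "('a, 'b) ring_scheme \<Rightarrow> ('a list \<Rightarrow>\<^sub>0 int) set set" where
  "steinberg_ideal R = Idl\<^bsub>tensor_algebra (units_of R)\<^esub>
     {tensor_class (units_of R) (frag_of [a]) \<otimes>\<^bsub>tensor_algebra (units_of R)\<^esub>
        tensor_class (units_of R) (frag_of [\<one>\<^bsub>R\<^esub> \<ominus>\<^bsub>R\<^esub> a])
      | a. a \<in> Units R \<and> \<one>\<^bsub>R\<^esub> \<ominus>\<^bsub>R\<^esub> a \<in> Units R}"

definition milnor_class ::
    "('a, 'b) ring_scheme \<Rightarrow> ('a list \<Rightarrow>\<^sub>0 int) set \<Rightarrow> ('a list \<Rightarrow>\<^sub>0 int) set set" where
  "milnor_class R x = steinberg_ideal R +>\<^bsub>tensor_algebra (units_of R)\<^esub> x"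

definition milnor_ring :: "('a, 'b) ring_scheme \<Rightarrow> ('a list \<Rightarrow>\<^sub>0 int) set set ring" where
  "milnor_ring R = tensor_algebra (units_of R) Quot steinberg_ideal R"

text \<open>The degree \<open>n\<close> part as a multiplicatively written group: its operation is the addition
  of the Milnor ring, and its neutral element is the zero.\<close>

definition milnor_K :: "nat \<Rightarrow> ('a, 'b) ring_scheme \<Rightarrow> ('a list \<Rightarrow>\<^sub>0 int) set set monoid" where
  "milnor_K n R = (add_monoid (milnor_ring R))
     \<lparr>carrier := milnor_class R ` tensor_degree (units_of R) n\<rparr>"

text \<open>The map induced by a ring homomorphism \<open>f\<close> into \<open>S\<close> (in all degrees).\<close>

definition milnor_map ::
    "('c, 'd) ring_scheme \<Rightarrow> ('a \<Rightarrow> 'c) \<Rightarrow>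
     ('a list \<Rightarrow>\<^sub>0 int) set set \<Rightarrow> ('c list \<Rightarrow>\<^sub>0 int) set set" where
  "milnor_map S f X = the_elem ((\<lambda>x. milnor_class S (tensor_map (units_of S) f x)) ` X)"


section \<open>Localization\<close>

definition loc_rel :: "('a, 'b) ring_scheme \<Rightarrow> 'a set \<Rightarrow> (('a \<times> 'a) \<times> ('a \<times> 'a)) set" where
  "loc_rel R S = {((a, s), (b, t)). a \<in> carrier R \<and> s \<in> S \<and> b \<in> carrier R \<and> t \<in> S \<and>
     (\<exists>u\<in>S. u \<otimes>\<^bsub>R\<^esub> (t \<otimes>\<^bsub>R\<^esub> a) = u \<otimes>\<^bsub>R\<^esub> (s \<otimes>\<^bsub>R\<^esub> b))}"

definition loc_frac :: "('a, 'b) ring_scheme \<Rightarrow> 'a set \<Rightarrow> 'a \<Rightarrow> 'a \<Rightarrow> ('a \<times> 'a) set" where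
  "loc_frac R S a s = loc_rel R S `` {(a, s)}"

definition localization :: "('a, 'b) ring_scheme \<Rightarrow> 'a set \<Rightarrow> ('a \<times> 'a) set ring" where
  "localization R S = \<lparr>carrier = (carrier R \<times> S) // loc_rel R S,
     monoid.mult = (\<lambda>X Y. \<Union>(a, s)\<in>X. \<Union>(b, t)\<in>Y. loc_frac R S (a \<otimes>\<^bsub>R\<^esub> b) (s \<otimes>\<^bsub>R\<^esub> t)),
     one = loc_frac R S \<one>\<^bsub>R\<^esub> \<one>\<^bsub>R\<^esub>, ring.zero = loc_frac R S \<zero>\<^bsub>R\<^esub> \<one>\<^bsub>R\<^esub>,
     add = (\<lambda>X Y. \<Union>(a, s)\<in>X. \<Union>(b, t)\<in>Y.
       loc_frac R S ((a \<otimes>\<^bsub>R\<^esub> t) \<oplus>\<^bsub>R\<^esub> (b \<otimes>\<^bsub>R\<^esub> s)) (s \<otimes>\<^bsub>R\<^esub> t))\<rparr>"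

text \<open>The map into the localization of \<open>R'\<close> at \<open>S'\<close> induced by a ring homomorphism \<open>f\<close> into \<open>R'\<close>
  that sends the denominators of the source into \<open>S'\<close>.\<close>

definition loc_map ::
    "('c, 'd) ring_scheme \<Rightarrow> 'c set \<Rightarrow> ('a \<Rightarrow> 'c) \<Rightarrow> ('a \<times> 'a) set \<Rightarrow> ('c \<times> 'c) set" where
  "loc_map R' S' f X = the_elem ((\<lambda>(a, s). loc_frac R' S' (f a) (f s)) ` X)"


section \<open>The rings \<open>A(s\<^sub>1)\<close> and \<open>A(s\<^sub>1, s\<^sub>2)\<close>\<close>

text \<open>\<open>A[s\<^sub>1]\<close> is \<open>UP A\<close>, and \<open>A[s\<^sub>1, s\<^sub>2]\<close> is \<open>UP (UP A)\<close>, where \<open>s\<^sub>1\<close> is the inner and \<open>s\<^sub>2\<close> the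
  outer variable.\<close>

definition poly_const :: "('a, 'b) ring_scheme \<Rightarrow> 'a \<Rightarrow> nat \<Rightarrow> 'a" where
  "poly_const A a = monom (UP A) a 0"

definition poly_var :: "('a, 'b) ring_scheme \<Rightarrow> nat \<Rightarrow> 'a" where
  "poly_var A = monom (UP A) \<one>\<^bsub>A\<^esub> 1"

definition unit_content1 :: "('a, 'b) ring_scheme \<Rightarrow> (nat \<Rightarrow> 'a) set" where
  "unit_content1 A = {f \<in> carrier (UP A). Idl\<^bsub>A\<^esub> (range (coeff (UP A) f)) = carrier A}"

definition unit_content2 :: "('a, 'b) ring_scheme \<Rightarrow> (nat \<Rightarrow> nat \<Rightarrow> 'a) set" where
  "unit_content2 A = {f \<in> carrier (UP (UP A)).
     Idl\<^bsub>A\<^esub> {coeff (UP A) (coeff (UP (UP A)) f i) j | i j. True} = carrier A}"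

definition rat1 :: "('a, 'b) ring_scheme \<Rightarrow> ((nat \<Rightarrow> 'a) \<times> (nat \<Rightarrow> 'a)) set ring" where
  "rat1 A = localization (UP A) (unit_content1 A)"

definition rat2 ::
    "('a, 'b) ring_scheme \<Rightarrow> ((nat \<Rightarrow> nat \<Rightarrow> 'a) \<times> (nat \<Rightarrow> nat \<Rightarrow> 'a)) set ring" where
  "rat2 A = localization (UP (UP A)) (unit_content2 A)"

definition poly_const2 :: "('a, 'b) ring_scheme \<Rightarrow> 'a \<Rightarrow> nat \<Rightarrow> nat \<Rightarrow> 'a" where
  "poly_const2 A a = poly_const (UP A) (poly_const A a)"

definition rat_incl1 ::
    "('a, 'b) ring_scheme \<Rightarrow> ((nat \<Rightarrow> 'a) \<times> (nat \<Rightarrow> 'a)) set \<Rightarrow>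
     ((nat \<Rightarrow> nat \<Rightarrow> 'a) \<times> (nat \<Rightarrow> nat \<Rightarrow> 'a)) set" where
  "rat_incl1 A = loc_map (UP (UP A)) (unit_content2 A)
     (eval A (UP (UP A)) (poly_const2 A) (poly_const (UP A) (poly_var A)))"

definition rat_incl2 ::
    "('a, 'b) ring_scheme \<Rightarrow> ((nat \<Rightarrow> 'a) \<times> (nat \<Rightarrow> 'a)) set \<Rightarrow>
     ((nat \<Rightarrow> nat \<Rightarrow> 'a) \<times> (nat \<Rightarrow> nat \<Rightarrow> 'a)) set" where
  "rat_incl2 A = loc_map (UP (UP A)) (unit_content2 A)
     (eval A (UP (UP A)) (poly_const2 A) (poly_var (UP A)))"

definition rat_const :: "('a, 'b) ring_scheme \<Rightarrow> 'a \<Rightarrow> ((nat \<Rightarrow> 'a) \<times> (nat \<Rightarrow> 'a)) set" where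
  "rat_const A a = loc_frac (UP A) (unit_content1 A) (poly_const A a) \<one>\<^bsub>UP A\<^esub>"

text \<open>The map from \<open>A(s\<^sub>1)\<close> to \<open>B(s\<^sub>1)\<close> that applies \<open>f\<close> to all coefficients.\<close>

definition rat_map ::
    "('a, 'b) ring_scheme \<Rightarrow> ('c, 'd) ring_scheme \<Rightarrow> ('a \<Rightarrow> 'c) \<Rightarrow>
     ((nat \<Rightarrow> 'a) \<times> (nat \<Rightarrow> 'a)) set \<Rightarrow> ((nat \<Rightarrow> 'c) \<times> (nat \<Rightarrow> 'c)) set" where
  "rat_map A B f = loc_map (UP B) (unit_content1 B)
     (eval A (UP B) (\<lambda>a. poly_const B (f a)) (poly_var B))"


section \<open>Improved Milnor K-theory\<close>

definition improved_K ::
    "nat \<Rightarrow> ('a, 'b) ring_scheme \<Rightarrow>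
     (((nat \<Rightarrow> 'a) \<times> (nat \<Rightarrow> 'a)) set list \<Rightarrow>\<^sub>0 int) set set monoid" where
  "improved_K n A = (milnor_K n (rat1 A))
     \<lparr>carrier := kernel (milnor_K n (rat1 A)) (milnor_K n (rat2 A))
       (\<lambda>x. milnor_map (rat2 A) (rat_incl1 A) x \<otimes>\<^bsub>milnor_K n (rat2 A)\<^esub>
          inv\<^bsub>milnor_K n (rat2 A)\<^esub> (milnor_map (rat2 A) (rat_incl2 A) x))\<rparr>"

definition improved_map ::
    "('a, 'b) ring_scheme \<Rightarrow> ('c, 'd) ring_scheme \<Rightarrow> ('a \<Rightarrow> 'c) \<Rightarrow>
     (((nat \<Rightarrow> 'a) \<times> (nat \<Rightarrow> 'a)) set list \<Rightarrow>\<^sub>0 int) set set \<Rightarrow>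
     (((nat \<Rightarrow> 'c) \<times> (nat \<Rightarrow> 'c)) set list \<Rightarrow>\<^sub>0 int) set set" where
  "improved_map A B f = milnor_map (rat1 B) (rat_map A B f)"

text \<open>The natural map from Milnor K-theory to improved Milnor K-theory.\<close>

definition milnor_to_improved ::
    "('a, 'b) ring_scheme \<Rightarrow> ('a list \<Rightarrow>\<^sub>0 int) set set \<Rightarrow>
     (((nat \<Rightarrow> 'a) \<times> (nat \<Rightarrow> 'a)) set list \<Rightarrow>\<^sub>0 int) set set" where
  "milnor_to_improved A = milnor_map (rat1 A) (rat_const A)"

definition relative_improved_K ::
    "nat \<Rightarrow> ('a, 'b) ring_scheme \<Rightarrow> 'a set \<Rightarrow>
     (((nat \<Rightarrow> 'a) \<times> (nat \<Rightarrow> 'a)) set list \<Rightarrow>\<^sub>0 int) set set monoid" where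
  "relative_improved_K n A I = (improved_K n A)
     \<lparr>carrier := kernel (improved_K n A) (improved_K n (A Quot I))
       (improved_map A (A Quot I) (\<lambda>a. I +>\<^bsub>A\<^esub> a))\<rparr>"


section \<open>Truncated polynomial rings\<close>

definition trunc_ideal :: "('a, 'b) ring_scheme \<Rightarrow> nat \<Rightarrow> (nat \<Rightarrow> 'a) set" where
  "trunc_ideal k N = Idl\<^bsub>UP k\<^esub> {poly_var k [^]\<^bsub>UP k\<^esub> N}"

definition trunc_poly :: "('a, 'b) ring_scheme \<Rightarrow> nat \<Rightarrow> (nat \<Rightarrow> 'a) set ring" where
  "trunc_poly k N = UP k Quot trunc_ideal k N"

definition trunc_var :: "('a, 'b) ring_scheme \<Rightarrow> nat \<Rightarrow> (nat \<Rightarrow> 'a) set" where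
  "trunc_var k N = trunc_ideal k N +>\<^bsub>UP k\<^esub> poly_var k"

text \<open>The reduction map from \<open>k[t]/(t\<^sup>N)\<close> to \<open>k\<close> sending \<open>t\<close> to zero, for \<open>N > 0\<close>.\<close>

definition trunc_red :: "('a, 'b) ring_scheme \<Rightarrow> (nat \<Rightarrow> 'a) set \<Rightarrow> 'a" where
  "trunc_red k X = the_elem (eval k k (\<lambda>a. a) \<zero>\<^bsub>k\<^esub> ` X)"

end

theory Submission
  imports Defs "HOL-Algebra.Multiplicative_Group" "HOL-Algebra.Subrings"
begin

text \<open>Let \<open>R = k\<^bsub>m+1\<^esub>(s\<^sub>1)\<close>, a thickening of the infinite field \<open>F = k(s\<^sub>1)\<close>. For \<open>M = p\<^sup>N\<close> large, the
  substitution \<open>s\<^sub>2 \<mapsto> s\<^sub>1\<^sup>M\<close> respects any given finite set of relations over \<open>k\<^bsub>m+1\<^esub>(s\<^sub>1, s\<^sub>2)\<close>, so a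
  class in the improved group is fixed by \<open>frob M: s\<^sub>1 \<mapsto> s\<^sub>1\<^sup>M\<close>. As \<open>k\<close> is perfect, \<open>frob M\<close> sends \<open>F\<close> to
  \<open>M\<close>-th powers, while the \<open>M\<close>-th powers of principal units are trivial; hence \<open>frob M\<close> kills the
  symbols of a principal unit with a constant. Symbols of two principal units are written as
  Dennis-Stein symbols \<open>D(t, c t\<^sup>l)\<close>, which vanish as soon as \<open>c\<close> is a \<open>p\<^sup>l\<close>-th power of a constant. So in degree at least \<open>2\<close> a class is the image under \<open>frob M\<close> of its reduction to
  \<open>F\<close>. The reductions come from \<open>k\<close> because taking lowest coefficients in \<open>s\<^sub>2\<close> preserves
  Steinberg symbols: it recovers a class from its image under \<open>i\<^sub>1\<close>, and maps its image under
  \<open>i\<^sub>2\<close> to a class of constants.\<close>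

section \<open>Geometric sums in characteristic \<open>p\<close>\<close>

text \<open>The obstacle is the symbol \<open>{1 - t x, 1 - t y}\<close> of two principal units:
  bilinearity and nilpotency only show that a power of \<open>p\<close> kills it. Dennis-Stein
  symbols supply a second bound. The product rule and antisymmetry give
  \<open>D(a t^i, b t^j) = i D(t, a b t^(i+j-1))\<close> for \<open>i > 0\<close> and constants
  \<open>a\<close>, \<open>b\<close>, hence \<open>(l+1) D(t, a t^l) = 0\<close>, in analogy with
  the exactness of \<open>(l+1) t^l dt\<close>. If \<open>p\<close> does not divide
  \<open>l+1\<close>, the two bounds are coprime. If \<open>l+1 = p k\<close>, then
  \<open>D(t, e^p t^l) = p D(t, e t^(k-1))\<close>, and the descent continues as long as the
  coefficient has \<open>p\<close>-th roots; hence the demand for high powers as coefficients. A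
  first substitution \<open>frob (p^m)\<close> provides these powers, and a second one,
  \<open>frob (p^N)\<close> with \<open>p^N > m\<close>, removes the symbols that involve a
  constant. Both fit into \<open>M = p^L\<close> when \<open>L\<close> is at least
  \<open>2 m\<close>. Throughout, elements must be moved away from finitely many residue classes.
  This is possible even when \<open>k\<close> is finite, because the constants used are those of
  \<open>k(s_1)\<close>, not those of \<open>k\<close>.\<close>

context cring
begin

lemmas cr = minus_eq minus_add r_minus l_minus l_distr r_distr a_ac m_ac
  l_neg r_neg r_neg1 r_neg2 minus_minus

lemma add_eq_zero: "\<lbrakk>a \<in> carrier R; b \<in> carrier R\<rbrakk> \<Longrightarrow> a \<oplus> b = \<zero> \<longleftrightarrow> b = \<ominus> a"
  by (metis a_comm add.inv_comm add.inv_equality r_neg)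

primrec geo :: "'a \<Rightarrow> nat \<Rightarrow> 'a" where
  "geo w 0 = \<zero>"
| "geo w (Suc n) = \<one> \<oplus> w \<otimes> geo w n"

lemma geo_closed [simp]: "w \<in> carrier R \<Longrightarrow> geo w n \<in> carrier R"
  by (induction n) auto

lemma geo_finsum: "w \<in> carrier R \<Longrightarrow> geo w (Suc n) = (\<Oplus>i\<in>{..n}. w [^] i)"
proof (induction n)
  case (Suc n)
  have "(\<Oplus>i\<in>{..Suc n}. w [^] i) = (\<Oplus>i\<in>{..n}. w [^] Suc i) \<oplus> w [^] (0::nat)"
    using Suc.prems by (intro finsum_Suc2) auto
  also have "(\<Oplus>i\<in>{..n}. w [^] Suc i) = (\<Oplus>i\<in>{..n}. w \<otimes> w [^] i)"
    using Suc.prems by (intro finsum_cong') (auto simp: m_comm)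
  also have "\<dots> = w \<otimes> (\<Oplus>i\<in>{..n}. w [^] i)"
    using Suc.prems by (intro finsum_rdistr[symmetric]) auto
  finally show ?case using Suc by (simp add: a_comm)
qed simp

lemma binomial:
  assumes a: "a \<in> carrier R" and b: "b \<in> carrier R"
  shows "(a \<oplus> b) [^] n = (\<Oplus>i\<in>{..n}. [(n choose i)] \<cdot> (a [^] i \<otimes> b [^] (n - i)))"
proof (induction n)
  case 0 then show ?case using a b by simp
next
  case (Suc n)
  let ?f = "\<lambda>i. [(n choose i)] \<cdot> (a [^] i \<otimes> b [^] (n - i))"
  have f: "?f \<in> {..n} \<rightarrow> carrier R" using a b by auto
  have A: "finsum R ?f {..n} \<otimes> a = (\<Oplus>i\<in>{..n}. [(n choose i)] \<cdot> (a [^] Suc i \<otimes> b [^] (n - i)))"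
    unfolding finsum_ldistr[OF finite_atMost a f] using a b
    by (intro finsum_cong') (auto simp: add_pow_ldistr add_pow_rdistr m_ac)
  have "finsum R ?f {..n} \<otimes> b = (\<Oplus>i\<in>{..n}. [(n choose i)] \<cdot> (a [^] i \<otimes> b [^] (Suc n - i)))"
    unfolding finsum_ldistr[OF finite_atMost b f] using a b
    by (intro finsum_cong') (auto simp: add_pow_ldistr add_pow_rdistr m_ac Suc_diff_le)
  also have "\<dots> = (\<Oplus>i\<in>{..Suc n}. [(n choose i)] \<cdot> (a [^] i \<otimes> b [^] (Suc n - i)))"
    using a b by (subst finsum_Suc) (auto simp: binomial_eq_0)
  also have "\<dots> = (\<Oplus>i\<in>{..n}. [(n choose Suc i)] \<cdot> (a [^] Suc i \<otimes> b [^] (n - i))) \<oplus> b [^] Suc n"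
    using a b by (subst finsum_Suc2) auto
  finally have B: "finsum R ?f {..n} \<otimes> b =
    (\<Oplus>i\<in>{..n}. [(n choose Suc i)] \<cdot> (a [^] Suc i \<otimes> b [^] (n - i))) \<oplus> b [^] Suc n" .
  have "(a \<oplus> b) [^] Suc n = finsum R ?f {..n} \<otimes> a \<oplus> finsum R ?f {..n} \<otimes> b"
    using Suc a b f by (simp add: r_distr)
  also have "\<dots> = ((\<Oplus>i\<in>{..n}. [(n choose i)] \<cdot> (a [^] Suc i \<otimes> b [^] (n - i))) \<oplus>
     (\<Oplus>i\<in>{..n}. [(n choose Suc i)] \<cdot> (a [^] Suc i \<otimes> b [^] (n - i)))) \<oplus> b [^] Suc n"
    unfolding A B using a b by (intro a_assoc[symmetric] finsum_closed) auto
  also have "\<dots> = (\<Oplus>i\<in>{..n}. [(n choose i)] \<cdot> (a [^] Suc i \<otimes> b [^] (n - i)) \<oplus>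
     [(n choose Suc i)] \<cdot> (a [^] Suc i \<otimes> b [^] (n - i))) \<oplus> b [^] Suc n"
    using a b by (subst finsum_addf) auto
  also have "\<dots> = (\<Oplus>i\<in>{..n}. [(Suc n choose Suc i)] \<cdot> (a [^] Suc i \<otimes> b [^] (Suc n - Suc i))) \<oplus> b [^] Suc n"
    using a b by (intro arg_cong2[of _ _ _ _ "(\<oplus>)"] finsum_cong') (auto simp: add.nat_pow_mult)
  also have "\<dots> = (\<Oplus>i\<in>{..Suc n}. [(Suc n choose i)] \<cdot> (a [^] i \<otimes> b [^] (Suc n - i)))"
    using a b by (subst finsum_Suc2) auto
  finally show ?case .
qed

context
  fixes p :: nat
  assumes p: "prime p" and char: "[p] \<cdot> \<one> = \<zero>"
begin

lemma char_mult_zero: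
  assumes "p dvd n" "x \<in> carrier R" shows "[n] \<cdot> x = \<zero>"
proof -
  obtain k where k: "n = p * k" using assms by (elim dvdE)
  have "[p] \<cdot> x = \<zero>"
    using add_pow_ldistr[of \<one> x p] char assms by simp
  then show ?thesis
    using assms add.nat_pow_pow[of x k p] by (simp add: k)
qed

lemma frobenius_add:
  assumes "a \<in> carrier R" "b \<in> carrier R"
  shows "(a \<oplus> b) [^] p = a [^] p \<oplus> b [^] p"
proof -
  let ?f = "\<lambda>i. [(p choose i)] \<cdot> (a [^] i \<otimes> b [^] (p - i))"
  have p0: "p > 0" using p by (rule prime_gt_0_nat)
  have "finsum R ?f {..p} = finsum R ?f {0, p}"
  proof (rule add.finprod_mono_neutral_cong_right)
    fix i assume "i \<in> {..p} - {0, p}"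
    then have "p dvd (p choose i)" using p by (intro dvd_choose_prime) auto
    then show "?f i = \<zero>" using char_mult_zero assms by auto
  qed (use assms in auto)
  also have "\<dots> = a [^] p \<oplus> b [^] p"
    using p0 assms by (subst finsum_insert) (auto simp: a_comm)
  finally show ?thesis using binomial[OF assms] by simp
qed

lemma frobenius_add_pow:
  assumes "a \<in> carrier R" "b \<in> carrier R"
  shows "(a \<oplus> b) [^] (p ^ N) = a [^] (p ^ N) \<oplus> b [^] (p ^ N)"
proof (induction N)
  case (Suc N)
  have e: "x [^] (p ^ Suc N) = (x [^] (p ^ N)) [^] p" if "x \<in> carrier R" for x
    using that by (simp add: nat_pow_pow mult.commute)
  show ?case using assms Suc e frobenius_add by simp
qed (use assms in simp)

text \<open>For odd \<open>p\<close> the exponent is even; for \<open>p = 2\<close> the signs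
  disappear because \<open>-1 = 1\<close>.\<close>

lemma minus_one_pow: "(\<ominus> \<one>) [^] (p - 1) = \<one>"
proof (cases "p = 2")
  case True
  then have "\<one> \<oplus> \<one> = \<zero>" using char by (simp add: numeral_2_eq_2)
  then have "\<ominus> \<one> = \<one>" by (simp add: minus_equality)
  then show ?thesis by simp
next
  case False
  then have "odd p" using p prime_odd_nat prime_ge_2_nat[OF p] by fastforce
  then obtain k where "p = 2 * k + 1" by (elim oddE)
  moreover have "(\<ominus> \<one>) [^] (2 * k) = ((\<ominus> \<one>) [^] (2::nat)) [^] k" for k :: nat
    by (simp add: nat_pow_pow)
  ultimately show ?thesis by (simp add: numeral_2_eq_2 l_minus)
qed

text \<open>By Pascal's rule two neighbours in row \<open>p - 1\<close> add up to an inner entry of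
  row \<open>p\<close>, which is divisible by \<open>p\<close>; so the entries alternate in sign,
  starting from 1.\<close>

lemma choose_pred_prime: "i \<le> p - 1 \<Longrightarrow> [((p - 1) choose i)] \<cdot> \<one> = (\<ominus> \<one>) [^] i"
proof (induction i)
  case (Suc i)
  have "Suc (p - 1) = p" using p prime_gt_0_nat by simp
  then have "p choose Suc i = (p - 1 choose i) + (p - 1 choose Suc i)"
    by (metis binomial_Suc_Suc)
  moreover have "p dvd (p choose Suc i)"
    using p Suc.prems by (intro dvd_choose_prime) auto
  ultimately have "[((p - 1 choose i) + (p - 1 choose Suc i))] \<cdot> \<one> = \<zero>"
    using char_mult_zero[of _ \<one>] by simp
  then have "[(p - 1 choose i)] \<cdot> \<one> \<oplus> [(p - 1 choose Suc i)] \<cdot> \<one> = \<zero>"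
    by (simp add: add.nat_pow_mult)
  then have "[(p - 1 choose Suc i)] \<cdot> \<one> = \<ominus> ([(p - 1 choose i)] \<cdot> \<one>)"
    by (subst (asm) add_eq_zero) auto
  also have "\<dots> = (\<ominus> \<one>) [^] Suc i"
    using Suc by (simp add: r_minus)
  finally show ?case .
qed simp

text \<open>Formally \<open>(1 - w^p) / (1 - w) = (1 - w)^(p - 1)\<close> with
  \<open>w = 1 - z\<close>. Division by \<open>z\<close> is impossible in the intended use, where
  \<open>z\<close> is nilpotent, so the identity is read off from the binomial expansion of
  \<open>(w - 1)^(p - 1)\<close>, all of whose coefficients turn out to be 1.\<close>

lemma geo_char:
  assumes z: "z \<in> carrier R" shows "geo (\<one> \<ominus> z) p = z [^] (p - 1)"
proof -
  define w where "w = \<one> \<ominus> z"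
  have w: "w \<in> carrier R" using z by (simp add: w_def)
  have sp: "Suc (p - 1) = p" using p prime_gt_0_nat by simp
  have "w \<oplus> \<ominus> \<one> = \<ominus> z" using z by (simp add: w_def minus_eq a_comm[of \<one>] a_assoc r_neg)
  moreover have "(w \<oplus> \<ominus> \<one>) [^] (p - 1) =
      (\<Oplus>i\<in>{..p - 1}. [((p - 1) choose i)] \<cdot> (w [^] i \<otimes> (\<ominus> \<one>) [^] (p - 1 - i)))"
    using w by (intro binomial) auto
  moreover have "\<dots> = (\<Oplus>i\<in>{..p - 1}. w [^] i)"
  proof (intro finsum_cong')
    fix i assume i: "i \<in> {..p - 1}"
    have "[((p - 1) choose i)] \<cdot> (w [^] i \<otimes> (\<ominus> \<one>) [^] (p - 1 - i)) =
       ([((p - 1) choose i)] \<cdot> \<one>) \<otimes> (w [^] i \<otimes> (\<ominus> \<one>) [^] (p - 1 - i))"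
      using w by (simp add: add_pow_ldistr)
    also have "\<dots> = w [^] i \<otimes> ((\<ominus> \<one>) [^] i \<otimes> (\<ominus> \<one>) [^] (p - 1 - i))"
      using i choose_pred_prime w by (simp add: m_ac)
    also have "(\<ominus> \<one>) [^] i \<otimes> (\<ominus> \<one>) [^] (p - 1 - i) = (\<ominus> \<one>) [^] (p - 1)"
    proof -
      have "i + (p - 1 - i) = p - 1" using i by auto
      then show ?thesis by (subst nat_pow_mult) (simp_all only: a_inv_closed one_closed)
    qed
    finally show "[((p - 1) choose i)] \<cdot> (w [^] i \<otimes> (\<ominus> \<one>) [^] (p - 1 - i)) = w [^] i"
      using minus_one_pow w by simp
  qed (use w in auto)
  ultimately have "geo w p = (\<ominus> z) [^] (p - 1)"
    using geo_finsum[OF w, of "p - 1"] sp by simp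
  also have "\<dots> = (\<ominus> \<one> \<otimes> z) [^] (p - 1)" using z by (simp add: l_minus)
  also have "\<dots> = z [^] (p - 1)"
    using z minus_one_pow by (simp add: pow_mult_distrib m_comm l_minus)
  finally show ?thesis by (simp add: w_def)
qed

end

end

section \<open>Steinberg symbols on principal units\<close>

text \<open>Identities between symbols are stated as membership in a subgroup \<open>Z\<close> of a
  free abelian group instead of equations in a quotient. With \<open>s a b\<close> a word in which
  two adjacent letters vary and \<open>Z\<close> the Milnor relations, everything proved here holds
  inside longer words.\<close>

locale steinberg_symbol = cring R for R (structure) +
  fixes s :: "'a \<Rightarrow> 'a \<Rightarrow> ('w \<Rightarrow>\<^sub>0 int)" and Z :: "('w \<Rightarrow>\<^sub>0 int) set"
  assumes Z_zero: "0 \<in> Z" and Z_diff: "x \<in> Z \<Longrightarrow> y \<in> Z \<Longrightarrow> x - y \<in> Z"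
    and mult_left: "\<lbrakk>a \<in> Units R; b \<in> Units R; c \<in> Units R\<rbrakk> \<Longrightarrow> s (a \<otimes> b) c - s a c - s b c \<in> Z"
    and mult_right: "\<lbrakk>a \<in> Units R; b \<in> Units R; c \<in> Units R\<rbrakk> \<Longrightarrow> s a (b \<otimes> c) - s a b - s a c \<in> Z"
    and steinberg: "\<lbrakk>a \<in> Units R; \<one> \<ominus> a \<in> Units R\<rbrakk> \<Longrightarrow> s a (\<one> \<ominus> a) \<in> Z"
begin

lemma Z_uminus: "x \<in> Z \<Longrightarrow> - x \<in> Z"
  using Z_diff[OF Z_zero] by simp

lemma Z_add: "x \<in> Z \<Longrightarrow> y \<in> Z \<Longrightarrow> x + y \<in> Z"
  using Z_diff[OF _ Z_uminus] by simp

lemma Z_cmul_nat: "x \<in> Z \<Longrightarrow> frag_cmul (int n) x \<in> Z"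
  by (induction n) (auto simp: Z_zero frag_cmul_distrib intro: Z_add)

lemma Z_cmul: "x \<in> Z \<Longrightarrow> frag_cmul c x \<in> Z"
  by (cases c) (use Z_cmul_nat Z_uminus in \<open>fastforce simp del: of_nat_Suc\<close>)+

lemma one_left: "b \<in> Units R \<Longrightarrow> s \<one> b \<in> Z"
  using mult_left[of \<one> \<one> b] Z_uminus by force

lemma one_right: "b \<in> Units R \<Longrightarrow> s b \<one> \<in> Z"
  using mult_right[of b \<one> \<one>] Z_uminus by force

lemma inv_left:
  assumes "a \<in> Units R" "b \<in> Units R" shows "s (inv a) b + s a b \<in> Z"
proof -
  have "s \<one> b - (s (inv a \<otimes> a) b - s (inv a) b - s a b) \<in> Z"
    using assms by (intro Z_diff one_left mult_left) auto
  then show ?thesis using assms by (simp add: add.commute)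
qed

lemma inv_right:
  assumes "a \<in> Units R" "b \<in> Units R" shows "s b (inv a) + s b a \<in> Z"
proof -
  have "s b \<one> - (s b (inv a \<otimes> a) - s b (inv a) - s b a) \<in> Z"
    using assms by (intro Z_diff one_right mult_right) auto
  then show ?thesis using assms by (simp add: add.commute)
qed

lemma pow_left:
  assumes "a \<in> Units R" "b \<in> Units R" shows "s (a [^] n) b - frag_cmul (int n) (s a b) \<in> Z"
proof (induction n)
  case 0 then show ?case using one_left assms by simp
next
  case (Suc n)
  have "(s (a [^] n \<otimes> a) b - s (a [^] n) b - s a b) + (s (a [^] n) b - frag_cmul (int n) (s a b)) \<in> Z"
    using assms Suc by (intro Z_add mult_left Units_pow_closed)
  then show ?case by (simp add: frag_cmul_distrib algebra_simps)
qed

lemma pow_right: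
  assumes "a \<in> Units R" "b \<in> Units R" shows "s b (a [^] n) - frag_cmul (int n) (s b a) \<in> Z"
proof (induction n)
  case 0 then show ?case using one_right assms by simp
next
  case (Suc n)
  have "(s b (a [^] n \<otimes> a) - s b (a [^] n) - s b a) + (s b (a [^] n) - frag_cmul (int n) (s b a)) \<in> Z"
    using assms Suc by (intro Z_add mult_right Units_pow_closed)
  then show ?case by (simp add: frag_cmul_distrib algebra_simps)
qed

text \<open>The classical factorization \<open>-b = (1 - b) / (1 - 1/b)\<close>. The symbol of
  \<open>b\<close> with the numerator is a Steinberg relation, and the one with the denominator is,
  up to sign, the Steinberg relation of \<open>1/b\<close>.\<close>

lemma neg_zero:
  assumes b: "b \<in> Units R" and u1: "\<one> \<ominus> b \<in> Units R" shows "s b (\<ominus> b) \<in> Z"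
proof -
  have c: "b \<in> carrier R" "inv b \<in> Units R" "inv b \<in> carrier R" using b by auto
  have mU: "\<ominus> x \<in> Units R" if "x \<in> Units R" for x
  proof -
    have "\<ominus> x = \<ominus> \<one> \<otimes> x" using that by (simp add: l_minus Units_closed)
    then show ?thesis using that Units_minus_one_closed by simp
  qed
  have "b \<otimes> (\<one> \<ominus> inv b) = b \<ominus> \<one>" using b c by (simp add: minus_eq r_distr r_minus)
  then have "\<ominus> b \<otimes> (\<one> \<ominus> inv b) = \<ominus> (b \<ominus> \<one>)" using c by (simp add: l_minus)
  then have e: "\<ominus> b \<otimes> (\<one> \<ominus> inv b) = \<one> \<ominus> b" using c by (simp add: minus_eq minus_add a_ac)
  have u2: "\<one> \<ominus> inv b \<in> Units R"
  proof -
    have "\<ominus> (inv b) \<otimes> (\<one> \<ominus> b) = \<one> \<ominus> inv b"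
      using b c by (simp add: minus_eq r_distr r_minus l_minus a_comm)
    then show ?thesis using Units_m_closed[OF mU[OF c(2)] u1] by simp
  qed
  have f1: "s b (\<one> \<ominus> b) \<in> Z" by (rule steinberg[OF b u1])
  have f2: "s (inv b) (\<one> \<ominus> inv b) \<in> Z"
    by (rule steinberg[OF c(2)]) (rule u2)
  have f3: "s (inv b) (\<one> \<ominus> inv b) + s b (\<one> \<ominus> inv b) \<in> Z" by (rule inv_left[OF b u2])
  have f4: "s b (\<ominus> b \<otimes> (\<one> \<ominus> inv b)) - s b (\<ominus> b) - s b (\<one> \<ominus> inv b) \<in> Z"
    by (rule mult_right[OF b mU[OF b] u2])
  have "s b (\<one> \<ominus> b) - (s b (\<ominus> b \<otimes> (\<one> \<ominus> inv b)) - s b (\<ominus> b) - s b (\<one> \<ominus> inv b))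
      - (s (inv b) (\<one> \<ominus> inv b) + s b (\<one> \<ominus> inv b) - s (inv b) (\<one> \<ominus> inv b)) \<in> Z"
    by (intro Z_diff[OF Z_diff[OF f1 f4] Z_diff[OF f3 f2]])
  then show ?thesis unfolding e by simp
qed

end

text \<open>The image of \<open>eps\<close> is an infinite field of constants, on which the symbol is trivial.\<close>

locale reduced_symbol = steinberg_symbol R s Z for R (structure)
    and s :: "'a \<Rightarrow> 'a \<Rightarrow> ('w \<Rightarrow>\<^sub>0 int)" and Z +
  fixes eps :: "'a \<Rightarrow> 'a"
  assumes eps_hom: "eps \<in> ring_hom R R"
    and eps_idem: "a \<in> carrier R \<Longrightarrow> eps (eps a) = eps a"
    and eps_unit: "\<lbrakk>a \<in> carrier R; eps a \<noteq> \<zero>\<rbrakk> \<Longrightarrow> a \<in> Units R"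
    and one_neq_zero: "\<one> \<noteq> \<zero>"
    and infinite_eps: "infinite (eps ` carrier R)"
    and eps_left: "\<lbrakk>a \<in> Units R; b \<in> Units R\<rbrakk> \<Longrightarrow> s (eps a) b \<in> Z"
    and eps_right: "\<lbrakk>a \<in> Units R; b \<in> Units R\<rbrakk> \<Longrightarrow> s a (eps b) \<in> Z"
begin

lemma eps_closed [simp]: "a \<in> carrier R \<Longrightarrow> eps a \<in> carrier R"
  using ring_hom_closed[OF eps_hom] .

lemma eps_mult [simp]: "\<lbrakk>a \<in> carrier R; b \<in> carrier R\<rbrakk> \<Longrightarrow> eps (a \<otimes> b) = eps a \<otimes> eps b"
  using ring_hom_mult[OF eps_hom] .

lemma eps_add [simp]: "\<lbrakk>a \<in> carrier R; b \<in> carrier R\<rbrakk> \<Longrightarrow> eps (a \<oplus> b) = eps a \<oplus> eps b"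
  using ring_hom_add[OF eps_hom] .

lemma eps_one [simp]: "eps \<one> = \<one>"
  using ring_hom_one[OF eps_hom] .

lemma eps_zero [simp]: "eps \<zero> = \<zero>"
  using ring_hom_zero[OF eps_hom ring_axioms ring_axioms] .

lemma eps_uminus [simp]: "a \<in> carrier R \<Longrightarrow> eps (\<ominus> a) = \<ominus> eps a"
  by (metis a_inv_closed add.inv_equality eps_add eps_closed eps_zero l_neg)

lemma eps_minus [simp]: "\<lbrakk>a \<in> carrier R; b \<in> carrier R\<rbrakk> \<Longrightarrow> eps (a \<ominus> b) = eps a \<ominus> eps b"
  by (simp add: minus_eq)

lemma Units_iff: "a \<in> Units R \<longleftrightarrow> a \<in> carrier R \<and> eps a \<noteq> \<zero>"
proof
  assume a: "a \<in> Units R"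
  then have "eps a \<otimes> eps (inv a) = \<one>"
    using eps_mult[of a "inv a"] by (simp add: Units_closed)
  then show "a \<in> carrier R \<and> eps a \<noteq> \<zero>"
    using a one_neq_zero by (auto simp: Units_closed)
qed (use eps_unit in auto)

lemma eps_Units [simp]: "a \<in> Units R \<Longrightarrow> eps a \<in> Units R"
  by (simp add: Units_iff eps_idem)

lemma obtain_const:
  assumes "finite F" obtains e where "e \<in> carrier R" "eps e = e" "e \<notin> F"
proof -
  have "\<not> eps ` carrier R \<subseteq> F"
    using infinite_eps assms finite_subset by blast
  then obtain x where "x \<in> carrier R" "eps x \<notin> F" by blast
  then show thesis using that[of "eps x"] eps_idem by auto
qed

lemma const_left: "\<lbrakk>e \<in> Units R; eps e = e; b \<in> Units R\<rbrakk> \<Longrightarrow> s e b \<in> Z"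
  using eps_left[of e b] by simp

lemma const_right: "\<lbrakk>e \<in> Units R; eps e = e; b \<in> Units R\<rbrakk> \<Longrightarrow> s b e \<in> Z"
  using eps_right[of b e] by simp

lemma scale_left:
  assumes "e \<in> Units R" "eps e = e" "a \<in> Units R" "b \<in> Units R"
  shows "s (e \<otimes> a) b - s a b \<in> Z"
  using Z_add[OF mult_left[of e a b] const_left[of e b]] assms by simp

lemma scale_right:
  assumes "e \<in> Units R" "eps e = e" "a \<in> Units R" "b \<in> Units R"
  shows "s b (e \<otimes> a) - s b a \<in> Z"
  using Z_add[OF mult_right[of b e a] const_right[of e b]] assms by simp

lemma uminus_right:
  assumes "a \<in> Units R" "b \<in> Units R" shows "s b (\<ominus> a) - s b a \<in> Z"
  using scale_right[of "\<ominus> \<one>" a b] assms Units_minus_one_closed by (simp add: Units_closed l_minus)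

text \<open>A constant multiple of \<open>a\<close> avoids the residue class of \<open>1\<close>, where the usual proof of
  \<open>{a, -a} = 0\<close> breaks down.\<close>

lemma self_zero:
  assumes "a \<in> Units R" shows "s a a \<in> Z"
proof -
  have a: "a \<in> carrier R" "inv a \<in> Units R" "inv a \<in> carrier R" using assms by auto
  obtain c where c: "c \<in> carrier R" "eps c = c" "c \<notin> {\<zero>, inv (eps a)}"
    using obtain_const[of "{\<zero>, inv (eps a)}"] by auto
  have cu: "c \<in> Units R" using c by (simp add: Units_iff)
  define b where "b = c \<otimes> a"
  have b: "b \<in> Units R" "b \<in> carrier R"
    using cu assms by (auto simp: b_def)
  have nb: "eps b \<noteq> \<one>"
  proof
    assume "eps b = \<one>"
    then have "c \<otimes> eps a = \<one>" using c a by (simp add: b_def)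
    then have "c = inv (eps a)"
      using c a assms by (metis comm_inv_char eps_closed m_comm)
    then show False using c by simp
  qed
  have u1: "\<one> \<ominus> b \<in> Units R"
    using b nb by (simp add: Units_iff)
  have "s b (\<ominus> b) - (s b (\<ominus> b) - s b b) \<in> Z"
    by (rule Z_diff[OF neg_zero[OF b(1) u1] uminus_right[OF b(1) b(1)]])
  then have "s b b \<in> Z" by simp
  moreover have "s b b - s b a \<in> Z" using scale_right[OF cu c(2) assms b(1)] by (simp add: b_def)
  moreover have "s b a - s a a \<in> Z" using scale_left[OF cu c(2) assms assms] by (simp add: b_def)
  ultimately have "s b b - (s b b - s b a) - (s b a - s a a) \<in> Z"
    using Z_diff by presburger
  then show ?thesis by simp
qed

lemma antisym:
  assumes "a \<in> Units R" "b \<in> Units R" shows "s a b + s b a \<in> Z"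
proof -
  have ab: "a \<otimes> b \<in> Units R" using assms by simp
  have "s (a \<otimes> b) (a \<otimes> b) - (s (a \<otimes> b) (a \<otimes> b) - s a (a \<otimes> b) - s b (a \<otimes> b))
      - (s a (a \<otimes> b) - s a a - s a b) - (s b (a \<otimes> b) - s b a - s b b) - s a a - s b b \<in> Z"
    using assms ab by (intro Z_diff self_zero mult_left mult_right) auto
  then show ?thesis by simp
qed

text \<open>Division by \<open>c\<close> turns the equation into the Steinberg relation between
  \<open>a/c\<close> and \<open>b/c\<close>. Expanded bilinearly, it leaves the three terms shown
  and \<open>s c c\<close>, which is trivial by \<open>self_zero\<close>.\<close>

lemma three_term:
  assumes "a \<in> Units R" "b \<in> Units R" "c \<in> Units R" "a \<oplus> b = c"
  shows "s a b - s a c - s c b \<in> Z"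
proof -
  have cl: "a \<in> carrier R" "b \<in> carrier R" "c \<in> carrier R" "inv c \<in> Units R" "inv c \<in> carrier R"
    using assms by auto
  have "a \<otimes> inv c \<oplus> b \<otimes> inv c = \<one>"
    using assms cl by (metis Units_r_inv l_distr)
  then have e: "\<one> \<ominus> a \<otimes> inv c = b \<otimes> inv c"
    using cl by (metis a_comm add.inv_solve_right m_closed minus_eq one_closed)
  have h1: "s (a \<otimes> inv c) (b \<otimes> inv c) \<in> Z"
    using steinberg[of "a \<otimes> inv c"] assms cl e by simp
  have h2: "s (a \<otimes> inv c) (b \<otimes> inv c) - s a (b \<otimes> inv c) - s (inv c) (b \<otimes> inv c) \<in> Z"
    using assms cl by (intro mult_left) auto
  have h3: "s a (b \<otimes> inv c) - s a b - s a (inv c) \<in> Z"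
    using assms cl by (intro mult_right) auto
  have h4: "s (inv c) (b \<otimes> inv c) + s c (b \<otimes> inv c) \<in> Z"
    using assms cl by (intro inv_left) auto
  have h5: "s c (b \<otimes> inv c) - s c b - s c (inv c) \<in> Z"
    using assms cl by (intro mult_right) auto
  have h6: "s a (inv c) + s a c \<in> Z" "s c (inv c) + s c c \<in> Z" "s c c \<in> Z"
    using assms cl inv_right self_zero by auto
  have "s a b - s a c - s c b = s (a \<otimes> inv c) (b \<otimes> inv c)
     - (s (a \<otimes> inv c) (b \<otimes> inv c) - s a (b \<otimes> inv c) - s (inv c) (b \<otimes> inv c))
     - (s a (b \<otimes> inv c) - s a b - s a (inv c)) - (s a (inv c) + s a c)
     - (s (inv c) (b \<otimes> inv c) + s c (b \<otimes> inv c)) + (s c (b \<otimes> inv c) - s c b - s c (inv c))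
     + (s c (inv c) + s c c) - s c c"
    by simp
  also have "\<dots> \<in> Z"
    by (rule h1 h2 h3 h4 h5 h6 | rule Z_add Z_diff)+
  finally show ?thesis .
qed

text \<open>The constant \<open>e\<close> is seen by the equation in the ring but not by the symbol.
  This extra freedom is what makes the two relations in \<open>D_antisym\<close> available.\<close>

lemma three_term_scaled:
  assumes "a \<in> Units R" "b \<in> Units R" "c \<in> Units R" "e \<in> Units R" "eps e = e"
    and "a \<oplus> e \<otimes> b = c"
  shows "s a b - s a c - s c b \<in> Z"
  using Z_diff[OF Z_add[OF three_term[of a "e \<otimes> b" c] scale_right[of e b c]] scale_right[of e b a]] assms
  by (simp add: algebra_simps)

text \<open>\<open>D x y\<close> is the Dennis-Stein symbol for \<open>x\<close> in the kernel of \<open>eps\<close>; it is additive in \<open>y\<close> with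
  respect to \<open>circ x\<close>. When \<open>y\<close> is not a unit, it is moved to a unit by adding the trivial symbol
  \<open>D x 1\<close>.\<close>

definition circ :: "'a \<Rightarrow> 'a \<Rightarrow> 'a \<Rightarrow> 'a" where
  "circ x y z = y \<oplus> z \<ominus> x \<otimes> y \<otimes> z"

definition D :: "'a \<Rightarrow> 'a \<Rightarrow> ('w \<Rightarrow>\<^sub>0 int)" where
  "D x y = (if y \<in> Units R then s (\<one> \<ominus> x \<otimes> y) y
            else s (\<one> \<ominus> x \<otimes> circ x y \<one>) (circ x y \<one>))"

lemma circ_closed [simp]:
  "\<lbrakk>x \<in> carrier R; y \<in> carrier R; z \<in> carrier R\<rbrakk> \<Longrightarrow> circ x y z \<in> carrier R"
  by (simp add: circ_def)

lemma circ_assoc: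
  "\<lbrakk>x \<in> carrier R; y \<in> carrier R; z \<in> carrier R; w \<in> carrier R\<rbrakk>
    \<Longrightarrow> circ x (circ x y z) w = circ x y (circ x z w)"
  by (simp add: circ_def cr)

lemma circ_lcomm:
  "\<lbrakk>x \<in> carrier R; y \<in> carrier R; z \<in> carrier R; w \<in> carrier R\<rbrakk>
    \<Longrightarrow> circ x y (circ x z w) = circ x z (circ x y w)"
  by (simp add: circ_def cr)

lemma one_minus_circ:
  "\<lbrakk>x \<in> carrier R; y \<in> carrier R; z \<in> carrier R\<rbrakk>
    \<Longrightarrow> \<one> \<ominus> x \<otimes> circ x y z = (\<one> \<ominus> x \<otimes> y) \<otimes> (\<one> \<ominus> x \<otimes> z)"
  by (simp add: circ_def cr)

lemma eps_circ:
  "\<lbrakk>x \<in> carrier R; eps x = \<zero>; y \<in> carrier R; z \<in> carrier R\<rbrakk> \<Longrightarrow> eps (circ x y z) = eps y \<oplus> eps z"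
  by (simp add: circ_def minus_eq)

lemma du_add:
  assumes x: "x \<in> carrier R" and u: "u \<in> Units R" "v \<in> Units R" "circ x u v \<in> Units R"
    and n: "\<one> \<ominus> x \<otimes> u \<in> Units R" "\<one> \<ominus> x \<otimes> v \<in> Units R"
  shows "s (\<one> \<ominus> x \<otimes> u) u + s (\<one> \<ominus> x \<otimes> v) v
    - s (\<one> \<ominus> x \<otimes> circ x u v) (circ x u v) \<in> Z"
proof -
  define X Y w where "X = \<one> \<ominus> x \<otimes> u" and "Y = \<one> \<ominus> x \<otimes> v" and "w = circ x u v"
  have U [simp]: "X \<in> Units R" "Y \<in> Units R" "w \<in> Units R" "u \<in> Units R" "v \<in> Units R"
    using u n by (auto simp: X_def Y_def w_def)
  have c: "u \<in> carrier R" "v \<in> carrier R" using u Units_closed by blast+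
  \<comment> \<open>The element \<open>u + v - x u v\<close> is split in two ways, as
    \<open>u (1 - x v) + v\<close> and as \<open>v (1 - x u) + u\<close>. In the sum of the two
    three-term relations the symbols between \<open>u\<close>, \<open>v\<close> and \<open>w\<close>
    cancel by antisymmetry.\<close>
  have w: "u \<otimes> Y \<oplus> v = w" "v \<otimes> X \<oplus> u = w"
    using x c by (simp_all add: X_def Y_def w_def circ_def cr)
  have T: "s (u \<otimes> Y) v - s (u \<otimes> Y) w - s w v \<in> Z" "s (v \<otimes> X) u - s (v \<otimes> X) w - s w u \<in> Z"
    using three_term[of "u \<otimes> Y" v w] three_term[of "v \<otimes> X" u w] w by auto
  have M: "s (u \<otimes> Y) v - s u v - s Y v \<in> Z" "s (u \<otimes> Y) w - s u w - s Y w \<in> Z"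
    "s (v \<otimes> X) u - s v u - s X u \<in> Z" "s (v \<otimes> X) w - s v w - s X w \<in> Z"
    "s (X \<otimes> Y) w - s X w - s Y w \<in> Z"
    by (rule mult_left; simp)+
  have A: "s u v + s v u \<in> Z" "s u w + s w u \<in> Z" "s v w + s w v \<in> Z"
    by (rule antisym; simp)+
  have "s X u + s Y v - s (X \<otimes> Y) w =
      (s (u \<otimes> Y) v - s (u \<otimes> Y) w - s w v) - (s (u \<otimes> Y) v - s u v - s Y v)
      + (s (u \<otimes> Y) w - s u w - s Y w) + (s (v \<otimes> X) u - s (v \<otimes> X) w - s w u)
      - (s (v \<otimes> X) u - s v u - s X u) + (s (v \<otimes> X) w - s v w - s X w)
      - (s u v + s v u) + (s u w + s w u) + (s v w + s w v) - (s (X \<otimes> Y) w - s X w - s Y w)"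
    by simp
  also have "\<dots> \<in> Z" by (rule T M A | rule Z_add Z_diff)+
  finally show ?thesis
    using one_minus_circ[OF x c] by (simp add: X_def Y_def w_def)
qed

lemma one_minus_unit:
  "\<lbrakk>x \<in> carrier R; eps x = \<zero>; y \<in> carrier R\<rbrakk> \<Longrightarrow> \<one> \<ominus> x \<otimes> y \<in> Units R"
  using one_neq_zero by (simp add: Units_iff minus_eq)

lemma D_unit: "y \<in> Units R \<Longrightarrow> D x y = s (\<one> \<ominus> x \<otimes> y) y"
  by (simp add: D_def)

lemma D_add_units:
  assumes "x \<in> carrier R" "eps x = \<zero>" "y \<in> Units R" "z \<in> Units R" "circ x y z \<in> Units R"
  shows "D x y + D x z - D x (circ x y z) \<in> Z"
  using du_add[of x y z] one_minus_unit[of x] assms by (simp add: D_unit Units_closed)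

lemma D_const:
  assumes "x \<in> carrier R" "eps x = \<zero>" "e \<in> carrier R" "eps e = e"
  shows "D x e \<in> Z"
proof (cases "e = \<zero>")
  case True
  have "circ x e \<one> = \<one>" using True assms by (simp add: circ_def minus_eq)
  moreover have "\<zero> \<notin> Units R" using one_neq_zero by (simp add: Units_iff)
  ultimately show ?thesis
    using one_right[OF one_minus_unit[OF assms(1,2) one_closed]] True by (simp add: D_def)
next
  case False
  then have "e \<in> Units R" using assms by (simp add: Units_iff)
  then show ?thesis using const_right[OF _ assms(4)] one_minus_unit assms by (simp add: D_unit)
qed

lemma D_shift:
  assumes x: "x \<in> carrier R" "eps x = \<zero>" and y: "y \<in> carrier R"
    and w: "w \<in> Units R" "D x w \<in> Z" "circ x y w \<in> Units R"
  shows "D x y - D x (circ x y w) \<in> Z"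
proof (cases "y \<in> Units R")
  case True
  show ?thesis using Z_diff[OF D_add_units[OF x True w(1) w(3)] w(2)] by simp
next
  case False
  then have ey: "eps y = \<zero>" using y by (simp add: Units_iff)
  have wc: "w \<in> carrier R" using w by auto
  have o: "\<one> \<noteq> \<zero>" using one_neq_zero .
  \<comment> \<open>The forbidden values are those for which \<open>e\<close>, \<open>w + e\<close>,
    \<open>1 + w + e\<close> or \<open>1 + e\<close> would reduce to zero.\<close>
  obtain e where e: "e \<in> carrier R" "eps e = e"
    "e \<notin> {\<zero>, \<ominus> eps w, \<ominus> (\<one> \<oplus> eps w), \<ominus> \<one>}"
    using obtain_const[of "{\<zero>, \<ominus> eps w, \<ominus> (\<one> \<oplus> eps w), \<ominus> \<one>}"] by auto
  have eu: "e \<in> Units R" using e by (simp add: Units_iff)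
  have nz: "eps w \<oplus> e \<noteq> \<zero>" "\<one> \<oplus> eps w \<oplus> e \<noteq> \<zero>" "\<one> \<oplus> e \<noteq> \<zero>" "eps w \<oplus> (\<one> \<oplus> e) \<noteq> \<zero>"
    using e wc add_eq_zero[of "eps w" e] add_eq_zero[of "\<one> \<oplus> eps w" e] add_eq_zero[of \<one> e]
      a_assoc[of "eps w" \<one> e] a_comm[of "eps w" \<one>]
    by auto
  have u: "circ x w e \<in> Units R" "circ x \<one> e \<in> Units R" "circ x y \<one> \<in> Units R"
    "circ x (circ x y \<one>) (circ x w e) \<in> Units R" "circ x (circ x y w) (circ x \<one> e) \<in> Units R"
    using nz o e wc x y ey by (simp_all add: Units_iff eps_circ a_assoc)
  have k: "D x w + D x e - D x (circ x w e) \<in> Z" "D x \<one> + D x e - D x (circ x \<one> e) \<in> Z"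
    "D x (circ x y \<one>) + D x (circ x w e) - D x (circ x (circ x y \<one>) (circ x w e)) \<in> Z"
    "D x (circ x y w) + D x (circ x \<one> e) - D x (circ x (circ x y w) (circ x \<one> e)) \<in> Z"
    using u w eu by (intro D_add_units x; simp)+
  have ke: "D x e \<in> Z" "D x \<one> \<in> Z" using D_const x e by auto
  have "circ x (circ x y w) (circ x \<one> e) = circ x (circ x y \<one>) (circ x w e)"
    using x y wc e circ_assoc[of x y w "circ x \<one> e"] circ_assoc[of x y \<one> "circ x w e"]
      circ_lcomm[of x w \<one> e] by simp
  moreover have "D x y = D x (circ x y \<one>)" using False u by (simp add: D_def)
  ultimately have "D x y - D x (circ x y w) =
     (D x (circ x y \<one>) + D x (circ x w e) - D x (circ x (circ x y \<one>) (circ x w e)))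
     - (D x (circ x y w) + D x (circ x \<one> e) - D x (circ x (circ x y w) (circ x \<one> e)))
     + (D x w + D x e - D x (circ x w e)) - (D x \<one> + D x e - D x (circ x \<one> e)) - D x w + D x \<one>"
    by simp
  also have "\<dots> \<in> Z" by (rule k w ke | rule Z_add Z_diff)+
  finally show ?thesis .
qed

text \<open>Constants \<open>e\<close> and \<open>f\<close>, whose symbols are trivial, move
  \<open>y\<close>, \<open>z\<close> and their \<open>circ\<close>-sum into the units, where
  additivity has been proved.\<close>

lemma D_add:
  assumes x: "x \<in> carrier R" "eps x = \<zero>" and y: "y \<in> carrier R" and z: "z \<in> carrier R"
  shows "D x y + D x z - D x (circ x y z) \<in> Z"
proof -
  obtain e where e: "e \<in> carrier R" "eps e = e" "e \<notin> {\<zero>, \<ominus> eps y}"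
    using obtain_const[of "{\<zero>, \<ominus> eps y}"] by auto
  obtain f where f: "f \<in> carrier R" "eps f = f"
    "f \<notin> {\<zero>, \<ominus> eps z, \<ominus> e, \<ominus> (eps y \<oplus> e \<oplus> eps z)}"
    using obtain_const[of "{\<zero>, \<ominus> eps z, \<ominus> e, \<ominus> (eps y \<oplus> e \<oplus> eps z)}"] by auto
  have eu: "e \<in> Units R" "f \<in> Units R" using e f by (auto simp: Units_iff)
  have nz: "eps y \<oplus> e \<noteq> \<zero>" "eps z \<oplus> f \<noteq> \<zero>" "e \<oplus> f \<noteq> \<zero>" "eps y \<oplus> e \<oplus> eps z \<oplus> f \<noteq> \<zero>"
    using e f y z add_eq_zero[of "eps y" e] add_eq_zero[of "eps z" f] add_eq_zero[of e f]
      add_eq_zero[of "eps y \<oplus> e \<oplus> eps z" f] by auto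
  have eq: "circ x (circ x y e) (circ x z f) = circ x (circ x y z) (circ x e f)"
    using x y z e f circ_assoc[of x y e "circ x z f"] circ_assoc[of x y z "circ x e f"]
      circ_lcomm[of x e z f] by simp
  have u: "circ x y e \<in> Units R" "circ x z f \<in> Units R" "circ x e f \<in> Units R"
    "circ x (circ x y e) (circ x z f) \<in> Units R"
    using nz e f x y z by (auto simp: Units_iff eps_circ a_assoc)
  have ke: "D x e \<in> Z" "D x f \<in> Z" using D_const x e f by auto
  have kf: "D x e + D x f - D x (circ x e f) \<in> Z"
    by (rule D_add_units; (rule x eu u))
  have "(D x e + D x f) - (D x e + D x f - D x (circ x e f)) \<in> Z"
    by (rule ke kf | rule Z_add Z_diff)+
  then have kg: "D x (circ x e f) \<in> Z" by simp
  have h: "D x y - D x (circ x y e) \<in> Z" "D x z - D x (circ x z f) \<in> Z"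
    "D x (circ x y z) - D x (circ x (circ x y z) (circ x e f)) \<in> Z"
    "D x (circ x y e) + D x (circ x z f) - D x (circ x (circ x y e) (circ x z f)) \<in> Z"
    using D_shift[OF x y eu(1) ke(1) u(1)] D_shift[OF x z eu(2) ke(2) u(2)]
      D_shift[OF x _ u(3) kg, of "circ x y z"] D_add_units[OF x u(1) u(2) u(4)] u(4) x(1) y z
    unfolding eq by simp_all
  have "D x y + D x z - D x (circ x y z) = (D x y - D x (circ x y e)) + (D x z - D x (circ x z f))
     - (D x (circ x y z) - D x (circ x (circ x y z) (circ x e f)))
     + (D x (circ x y e) + D x (circ x z f) - D x (circ x (circ x y e) (circ x z f)))"
    using eq by simp
  also have "\<dots> \<in> Z" by (rule h | rule Z_add Z_diff)+
  finally show ?thesis .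
qed

lemma eps_zero_or_unit: "y \<in> carrier R \<Longrightarrow> eps y = \<zero> \<or> y \<in> Units R"
  by (auto simp: Units_iff)

text \<open>The three-term relation is applied to \<open>K = L + c u P\<close> and to \<open>K (1 - c y) = L + c\<close>.\<close>

lemma D_antisym:
  assumes x: "x \<in> carrier R" "eps x = \<zero>" and y: "y \<in> carrier R" "eps y = \<zero>"
  shows "D x y + D y x \<in> Z"
proof -
  define u P K where "u = y \<oplus> \<one>" and "P = \<one> \<ominus> x \<otimes> y" and "K = \<one> \<ominus> x \<otimes> u"
  \<comment> \<open>The residues of \<open>v\<close> and \<open>L\<close> will be \<open>c\<close>
    and \<open>1 - c\<close>; excluding 0 and 1 makes both units.\<close>
  obtain c where c: "c \<in> carrier R" "eps c = c" "c \<notin> {\<zero>, \<one>}"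
    using obtain_const[of "{\<zero>, \<one>}"] by auto
  define v Q L B where "v = circ y x c" and "Q = \<one> \<ominus> y \<otimes> v" and "L = \<one> \<ominus> v \<otimes> u"
    and "B = \<one> \<ominus> c \<otimes> y"
  have cU [simp]: "c \<in> Units R" using c by (simp add: Units_iff)
  have cl [simp]: "u \<in> carrier R" "P \<in> carrier R" "K \<in> carrier R" "v \<in> carrier R" "Q \<in> carrier R"
    "L \<in> carrier R" "B \<in> carrier R" "c \<in> carrier R" "x \<in> carrier R" "y \<in> carrier R"
    using x y c by (auto simp: u_def P_def K_def v_def Q_def L_def B_def)
  have ev: "eps u = \<one>" "eps P = \<one>" "eps K = \<one>" "eps v = c" "eps Q = \<one>" "eps B = \<one>" "eps L = \<one> \<ominus> c"
    using x y c by (simp_all add: u_def P_def K_def v_def Q_def B_def L_def eps_circ minus_eq)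
  have U [simp]: "u \<in> Units R" "P \<in> Units R" "K \<in> Units R" "v \<in> Units R" "Q \<in> Units R"
    "L \<in> Units R" "B \<in> Units R"
    using ev one_neq_zero c by (auto simp: Units_iff)
  have QB: "Q = P \<otimes> B"
    using one_minus_circ[of y x c] by (simp add: Q_def P_def B_def v_def m_comm)
  have uu: "u \<otimes> P \<in> Units R" "K \<otimes> B \<in> Units R" "P \<otimes> B \<in> Units R" by simp_all
  \<comment> \<open>\<open>z\<close> solves \<open>circ x u z = y\<close>. Thus
    \<open>D x y\<close>, whose second entry is not a unit, becomes a sum of two symbols with the
    unit second entries \<open>u\<close> and \<open>z\<close>.\<close>
  define z where "z = \<ominus> (inv K)"
  have iK [simp]: "inv K \<in> Units R" "inv K \<in> carrier R" by auto
  have z: "z \<in> Units R" "z \<in> carrier R" using iK by (auto simp: z_def Units_iff)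
  have "circ x u z = y"
  proof -
    have "circ x u z = u \<oplus> z \<otimes> K"
      using z by (simp add: circ_def K_def cr)
    also have "\<dots> = y"
      using U(3) iK(2) cl by (simp add: z_def l_minus u_def cr)
    finally show ?thesis .
  qed
  then have d1: "D x u + D x z - D x y \<in> Z"
    using D_add[of x u z] x z by simp
  have xz: "\<one> \<ominus> x \<otimes> z = P \<otimes> inv K"
  proof -
    have "\<one> \<ominus> x \<otimes> z = (K \<oplus> x) \<otimes> inv K"
      using U(3) iK(2) cl by (simp add: z_def l_distr minus_eq r_minus)
    also have "K \<oplus> x = P"
    proof -
      have "K = P \<ominus> x" by (simp add: K_def P_def u_def cr)
      then show ?thesis by (simp add: cr)
    qed
    finally show ?thesis .
  qed
  have d2: "D x u = s K u" by (simp add: D_unit K_def)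
  have d3: "D x z = s (P \<otimes> inv K) (\<ominus> (inv K))" using z xz by (simp add: D_unit z_def)
  have d4: "s (P \<otimes> inv K) (\<ominus> (inv K)) - s (P \<otimes> inv K) (inv K) \<in> Z"
    "s (P \<otimes> inv K) (inv K) + s (P \<otimes> inv K) K \<in> Z"
    "s (P \<otimes> inv K) K - s P K - s (inv K) K \<in> Z" "s (inv K) K + s K K \<in> Z" "s K K \<in> Z"
    "s P K + s K P \<in> Z"
    by (auto intro: uminus_right inv_right mult_left inv_left self_zero antisym)
  \<comment> \<open>On the other side \<open>x\<close> is shifted to the unit \<open>v\<close> by
    the constant \<open>c\<close>, whose symbol \<open>D y c\<close> is trivial.\<close>
  have d5: "D y x + D y c - D y v \<in> Z" "D y c \<in> Z"
    using D_add[of y x c] D_const[of y c] y c by (simp_all add: v_def)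
  have d6: "D y v = s Q v" by (simp add: D_unit Q_def)
  have e1: "L \<oplus> c \<otimes> (u \<otimes> P) = K"
  proof -
    have "L = K \<ominus> c \<otimes> (u \<otimes> P)"
      by (simp add: L_def v_def K_def P_def circ_def cr)
    then show ?thesis by (simp add: cr)
  qed
  have e2: "L \<oplus> c \<otimes> \<one> = K \<otimes> B"
  proof -
    have "K \<otimes> B \<ominus> c = L"
      by (simp add: L_def v_def K_def B_def u_def circ_def cr)
    then show ?thesis by (metis B_def U(3,7) Units_closed a_comm add.inv_solve_right cl(3) c(1) m_closed minus_eq r_one cl(7) cl(6))
  qed
  have e3: "L \<oplus> v = Q"
  proof -
    have "L = Q \<ominus> v"
      by (simp add: L_def Q_def u_def cr)
    then show ?thesis by (simp add: cr)
  qed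
  have e4: "\<one> \<ominus> v \<otimes> u = L" by (simp add: L_def)
  have T: "s L (u \<otimes> P) - s L K - s K (u \<otimes> P) \<in> Z" "s L \<one> - s L (K \<otimes> B) - s (K \<otimes> B) \<one> \<in> Z"
    "s L v - s L Q - s Q v \<in> Z" "s (v \<otimes> u) L \<in> Z" "s (v \<otimes> u) L + s L (v \<otimes> u) \<in> Z"
    using three_term_scaled[of L "u \<otimes> P" K c] three_term_scaled[of L \<one> "K \<otimes> B" c]
      three_term[of L v Q] steinberg[of "v \<otimes> u"] antisym[of "v \<otimes> u" L] e1 e2 e3 e4 c by auto
  have M: "s L (u \<otimes> P) - s L u - s L P \<in> Z" "s L (K \<otimes> B) - s L K - s L B \<in> Z"
    "s L (P \<otimes> B) - s L P - s L B \<in> Z" "s L (v \<otimes> u) - s L v - s L u \<in> Z"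
    "s K (u \<otimes> P) - s K u - s K P \<in> Z" "s L \<one> \<in> Z" "s (K \<otimes> B) \<one> \<in> Z"
    by (auto intro: mult_right one_right)
  have "D x y + D y x = - (D x u + D x z - D x y) + (D y x + D y c - D y v) - D y c
     + (s (P \<otimes> inv K) (\<ominus> (inv K)) - s (P \<otimes> inv K) (inv K))
     + (s (P \<otimes> inv K) (inv K) + s (P \<otimes> inv K) K) - (s (P \<otimes> inv K) K - s P K - s (inv K) K)
     - (s (inv K) K + s K K) + s K K - (s P K + s K P) - (s K (u \<otimes> P) - s K u - s K P)
     - (s L (u \<otimes> P) - s L K - s K (u \<otimes> P)) + (s L (u \<otimes> P) - s L u - s L P)
     + (s L \<one> - s L (K \<otimes> B) - s (K \<otimes> B) \<one>) - s L \<one> + s (K \<otimes> B) \<one>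
     + (s L (K \<otimes> B) - s L K - s L B) - (s L (P \<otimes> B) - s L P - s L B)
     - (s L v - s L Q - s Q v) - (s L (v \<otimes> u) - s L v - s L u)
     + (s (v \<otimes> u) L + s L (v \<otimes> u)) - s (v \<otimes> u) L"
    unfolding d2 d3 d6 QB by (simp add: algebra_simps)
  also have "\<dots> \<in> Z"
    by (rule d1 d4 d5 T M | rule Z_add Z_diff Z_uminus)+
  finally show ?thesis .
qed

text \<open>For a unit \<open>y\<close> this is multiplicativity in the first entry of
  \<open>s\<close>. For \<open>y\<close> in the kernel of \<open>eps\<close> antisymmetry reduces it
  to additivity in the second argument.\<close>

lemma D_add_left:
  assumes x: "x \<in> carrier R" "eps x = \<zero>" "x' \<in> carrier R" "eps x' = \<zero>" and y: "y \<in> carrier R"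
  shows "D x y + D x' y - D (circ y x x') y \<in> Z"
proof (cases "y \<in> Units R")
  case True
  have "\<one> \<ominus> circ y x x' \<otimes> y = (\<one> \<ominus> x \<otimes> y) \<otimes> (\<one> \<ominus> x' \<otimes> y)"
    using one_minus_circ[of y x x'] x y by (simp add: m_comm)
  moreover have "- (s ((\<one> \<ominus> x \<otimes> y) \<otimes> (\<one> \<ominus> x' \<otimes> y)) y - s (\<one> \<ominus> x \<otimes> y) y - s (\<one> \<ominus> x' \<otimes> y) y) \<in> Z"
    using one_minus_unit x y True by (intro Z_uminus mult_left) auto
  ultimately show ?thesis using True by (simp add: D_unit algebra_simps)
next
  case False
  then have ey: "eps y = \<zero>" using y eps_zero_or_unit by blast
  have c: "circ y x x' \<in> carrier R" "eps (circ y x x') = \<zero>"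
    using x y ey by (simp_all add: eps_circ)
  have "(D x y + D y x) + (D x' y + D y x') - (D (circ y x x') y + D y (circ y x x'))
     - (D y x + D y x' - D y (circ y x x')) \<in> Z"
    using x y ey c by (intro Z_diff Z_add[OF D_antisym D_antisym] D_antisym D_add) auto
  then show ?thesis by (simp add: algebra_simps)
qed

text \<open>Passing from \<open>z\<close> to its \<open>circ\<close>-sum with 1 changes the three
  terms by \<open>D x y\<close>, by the trivial \<open>D (x y) 1\<close>, and by
  \<open>D x y\<close>. These changes cancel, so the product rule for the shifted \<open>z\<close>
  implies the rule for \<open>z\<close>.\<close>

lemma D_mult_step:
  assumes x: "x \<in> carrier R" "eps x = \<zero>" and y: "y \<in> carrier R" and z: "z \<in> carrier R"
    and h: "D x (y \<otimes> circ (x \<otimes> y) z \<one>) - D (x \<otimes> y) (circ (x \<otimes> y) z \<one>)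
        - D (x \<otimes> circ (x \<otimes> y) z \<one>) y \<in> Z"
  shows "D x (y \<otimes> z) - D (x \<otimes> y) z - D (x \<otimes> z) y \<in> Z"
proof -
  let ?z = "circ (x \<otimes> y) z \<one>"
  have e: "circ x (y \<otimes> z) y = y \<otimes> ?z" "circ y (x \<otimes> z) x = x \<otimes> ?z"
    using x y z by (simp_all add: circ_def cr)
  have a: "D x (y \<otimes> z) + D x y - D x (y \<otimes> ?z) \<in> Z"
    using D_add[of x "y \<otimes> z" y] x y z e by simp
  have b: "D (x \<otimes> y) z + D (x \<otimes> y) \<one> - D (x \<otimes> y) ?z \<in> Z" "D (x \<otimes> y) \<one> \<in> Z"
    using D_add[of "x \<otimes> y" z \<one>] D_const[of "x \<otimes> y" \<one>] x y z by simp_all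
  have c: "D (x \<otimes> z) y + D x y - D (x \<otimes> ?z) y \<in> Z"
    using D_add_left[of "x \<otimes> z" x y] x y z e by simp
  have "D x (y \<otimes> z) - D (x \<otimes> y) z - D (x \<otimes> z) y =
      (D x (y \<otimes> z) + D x y - D x (y \<otimes> ?z)) - (D (x \<otimes> y) z + D (x \<otimes> y) \<one> - D (x \<otimes> y) ?z)
      + D (x \<otimes> y) \<one> - (D (x \<otimes> z) y + D x y - D (x \<otimes> ?z) y)
      + (D x (y \<otimes> ?z) - D (x \<otimes> y) ?z - D (x \<otimes> ?z) y)"
    by simp
  also have "\<dots> \<in> Z" by (rule a b c h | rule Z_add Z_diff)+
  finally show ?thesis .
qed

text \<open>The product relation of Dennis and Stein. For units \<open>y\<close> and
  \<open>z\<close> all three symbols have the same first entry \<open>1 - x y z\<close>, and the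
  claim is multiplicativity in the second entry. Non-units are shifted to units one variable at a
  time, the rule being symmetric in \<open>y\<close> and \<open>z\<close>.\<close>

lemma D_mult:
  assumes x: "x \<in> carrier R" "eps x = \<zero>" and y: "y \<in> carrier R" and z: "z \<in> carrier R"
  shows "D x (y \<otimes> z) - D (x \<otimes> y) z - D (x \<otimes> z) y \<in> Z"
proof -
  have u: "circ (x \<otimes> y) z \<one> \<in> Units R" if "y \<in> carrier R" "z \<in> carrier R" "z \<notin> Units R" for y z
    using that x eps_zero_or_unit[of z] one_neq_zero by (auto simp: Units_iff eps_circ)
  have 0: "D x (y \<otimes> z) - D (x \<otimes> y) z - D (x \<otimes> z) y \<in> Z" if "y \<in> Units R" "z \<in> Units R" for y z
  proof -
    have c: "y \<in> carrier R" "z \<in> carrier R" using that by auto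
    have "x \<otimes> (y \<otimes> z) = x \<otimes> y \<otimes> z" "x \<otimes> z \<otimes> y = x \<otimes> y \<otimes> z"
      using x c by (simp_all add: m_ac)
    moreover have "s (\<one> \<ominus> x \<otimes> y \<otimes> z) (y \<otimes> z) - s (\<one> \<ominus> x \<otimes> y \<otimes> z) y - s (\<one> \<ominus> x \<otimes> y \<otimes> z) z \<in> Z"
      using that c x one_minus_unit[of x "y \<otimes> z"] by (intro mult_right) (auto simp: m_assoc)
    ultimately show ?thesis using that by (simp add: D_unit algebra_simps)
  qed
  have 1: "D x (y \<otimes> z) - D (x \<otimes> y) z - D (x \<otimes> z) y \<in> Z"
    if "y \<in> Units R" "z \<in> carrier R" for y z
    using 0[OF that(1)] u[of y z] D_mult_step[OF x _ that(2), of y] that by blast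
  have 2: "D x (y \<otimes> z) - D (x \<otimes> y) z - D (x \<otimes> z) y \<in> Z"
    if "y \<in> carrier R" "z \<in> Units R" for y z
    using 1[of z y] that m_comm[of y z] by (simp add: Units_closed algebra_simps)
  show ?thesis
    using 2[OF y] u[OF y z] D_mult_step[OF x y z] by (cases "z \<in> Units R") auto
qed

lemma D_zero_left: "y \<in> carrier R \<Longrightarrow> D \<zero> y \<in> Z"
  using one_left[of y] one_left[of "circ \<zero> y \<one>"] eps_zero_or_unit[of y] one_neq_zero
  by (auto simp: D_def Units_iff eps_circ minus_eq)

text \<open>The analogue of \<open>d(t^(i+1)) = (i+1) t^i dt\<close>. Each induction step splits off
  one factor \<open>t\<close> by the product rule and interchanges the two arguments of the
  remaining symbol by antisymmetry, which adds one more copy of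
  \<open>D t (a b t^(i+j))\<close>.\<close>

lemma D_monom:
  assumes t: "t \<in> carrier R" "eps t = \<zero>" and a: "a \<in> carrier R" "eps a = a" and b: "b \<in> carrier R" "eps b = b"
  shows "D (a \<otimes> t [^] Suc i) (b \<otimes> t [^] j) - frag_cmul (int (Suc i)) (D t (a \<otimes> b \<otimes> t [^] (i + j))) \<in> Z"
proof (induction i arbitrary: j)
  case 0
  have "D t (a \<otimes> (b \<otimes> t [^] j)) - D (t \<otimes> a) (b \<otimes> t [^] j) - D (t \<otimes> (b \<otimes> t [^] j)) a \<in> Z"
    using t a b by (intro D_mult) auto
  moreover have "D (t \<otimes> (b \<otimes> t [^] j)) a \<in> Z"
    using t a b by (intro D_const) auto
  ultimately have "- (D t (a \<otimes> (b \<otimes> t [^] j)) - D (t \<otimes> a) (b \<otimes> t [^] j) - D (t \<otimes> (b \<otimes> t [^] j)) a)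
     - D (t \<otimes> (b \<otimes> t [^] j)) a \<in> Z"
    using Z_diff[OF Z_uminus] by blast
  then show ?case using t a b by (simp add: m_assoc m_comm[of t a])
next
  case (Suc i)
  let ?y = "a \<otimes> t [^] Suc i" and ?z = "b \<otimes> t [^] j"
  have e: "?y \<otimes> ?z = a \<otimes> b \<otimes> t [^] (Suc i + j)" "t \<otimes> ?y = a \<otimes> t [^] Suc (Suc i)" "t \<otimes> ?z = b \<otimes> t [^] Suc j"
    using t a b nat_pow_mult[of t "Suc i" j, symmetric] by (simp_all add: m_ac)
  have A: "D t (?y \<otimes> ?z) - D (t \<otimes> ?y) ?z - D (t \<otimes> ?z) ?y \<in> Z"
    using t a b by (intro D_mult) auto
  have B: "D (b \<otimes> t [^] Suc j) ?y + D ?y (b \<otimes> t [^] Suc j) \<in> Z"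
    using t a b by (intro D_antisym) auto
  have C: "D ?y (b \<otimes> t [^] Suc j) - frag_cmul (int (Suc i)) (D t (a \<otimes> b \<otimes> t [^] (i + Suc j))) \<in> Z"
    by (rule Suc)
  have "(D ?y (b \<otimes> t [^] Suc j) - frag_cmul (int (Suc i)) (D t (a \<otimes> b \<otimes> t [^] (i + Suc j))))
     - (D t (?y \<otimes> ?z) - D (t \<otimes> ?y) ?z - D (t \<otimes> ?z) ?y)
     - (D (b \<otimes> t [^] Suc j) ?y + D ?y (b \<otimes> t [^] Suc j)) \<in> Z"
    by (rule A B C | rule Z_diff)+
  moreover have "frag_cmul (int (Suc (Suc i))) h = frag_cmul (int (Suc i)) h + h" for h :: "'w \<Rightarrow>\<^sub>0 int"
    using frag_cmul_distrib[of "int (Suc i)" 1 h] by (simp add: add.commute)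
  ultimately show ?case unfolding e by (simp add: algebra_simps del: nat_pow_Suc of_nat_Suc)
qed

text \<open>Antisymmetry says \<open>D t (a t^l) = - D (a t^l) t\<close>, and \<open>D_monom\<close>
  evaluates the right-hand side as \<open>-l D t (a t^l)\<close>.\<close>

lemma D_monom_torsion:
  assumes t: "t \<in> carrier R" "eps t = \<zero>" and a: "a \<in> carrier R" "eps a = a"
  shows "frag_cmul (int (Suc l)) (D t (a \<otimes> t [^] l)) \<in> Z"
proof (cases l)
  case 0
  then show ?thesis using D_const[OF t a] a t by simp
next
  case (Suc i)
  have A: "D t (a \<otimes> t [^] l) + D (a \<otimes> t [^] l) t \<in> Z"
    using t a Suc by (intro D_antisym) auto
  have B: "D (a \<otimes> t [^] Suc i) (\<one> \<otimes> t [^] (1::nat)) - frag_cmul (int (Suc i)) (D t (a \<otimes> \<one> \<otimes> t [^] (i + 1))) \<in> Z"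
    using t a by (intro D_monom) auto
  then have B: "D (a \<otimes> t [^] l) t - frag_cmul (int l) (D t (a \<otimes> t [^] l)) \<in> Z"
    using Suc t a by (simp del: of_nat_Suc)
  have "D t (a \<otimes> t [^] l) + frag_cmul (int l) (D t (a \<otimes> t [^] l)) =
      (D t (a \<otimes> t [^] l) + D (a \<otimes> t [^] l) t)
      - (D (a \<otimes> t [^] l) t - frag_cmul (int l) (D t (a \<otimes> t [^] l)))"
    by (simp add: algebra_simps)
  also have "\<dots> \<in> Z" by (rule Z_diff[OF A B])
  finally show ?thesis
    using frag_cmul_distrib[of "int l" 1 "D t (a \<otimes> t [^] l)"] by (simp add: add.commute)
qed

text \<open>The element on the left is the \<open>n\<close>-fold \<open>circ\<close>-sum of
  \<open>y\<close> with itself, as \<open>1 - x geo (1 - x y) n y = (1 - x y)^n\<close>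
  suggests.\<close>

lemma D_geo:
  assumes x: "x \<in> carrier R" "eps x = \<zero>" and y: "y \<in> carrier R"
  shows "D x (geo (\<one> \<ominus> x \<otimes> y) n \<otimes> y) - frag_cmul (int n) (D x y) \<in> Z"
proof (induction n)
  case 0
  then show ?case using D_const[of x \<zero>] x y by simp
next
  case (Suc n)
  let ?g = "geo (\<one> \<ominus> x \<otimes> y) n"
  have g: "?g \<in> carrier R" using x y by simp
  have "circ x y (?g \<otimes> y) = (\<one> \<oplus> (\<one> \<ominus> x \<otimes> y) \<otimes> ?g) \<otimes> y"
    using x y g by (simp add: circ_def cr)
  then have "D x y + D x (?g \<otimes> y) - D x (geo (\<one> \<ominus> x \<otimes> y) (Suc n) \<otimes> y) \<in> Z"
    using D_add[of x y "?g \<otimes> y"] x y g by simp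
  from Z_diff[OF Suc this] show ?case
    by (simp add: frag_cmul_distrib algebra_simps)
qed

text \<open>After a shift of \<open>y\<close> to a unit the symbol has a first entry of the form
  \<open>1 - x u\<close>, whose \<open>q\<close>-th power is 1.\<close>

lemma D_torsion:
  assumes x: "x \<in> carrier R" "eps x = \<zero>" and y: "y \<in> carrier R"
    and nil: "\<And>r. r \<in> carrier R \<Longrightarrow> (\<one> \<ominus> x \<otimes> r) [^] (q::nat) = \<one>"
  shows "frag_cmul (int q) (D x y) \<in> Z"
proof -
  obtain u where u: "u \<in> Units R" "D x y = s (\<one> \<ominus> x \<otimes> u) u"
  proof (cases "y \<in> Units R")
    case True then show thesis using that D_unit by blast
  next
    case False
    then have "circ x y \<one> \<in> Units R"
      using x y eps_zero_or_unit[of y] one_neq_zero by (auto simp: Units_iff eps_circ)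
    then show thesis using that False by (simp add: D_def)
  qed
  have n: "\<one> \<ominus> x \<otimes> u \<in> Units R" using one_minus_unit x u by auto
  have "s ((\<one> \<ominus> x \<otimes> u) [^] q) u \<in> Z"
    using nil[of u] u one_left by (simp add: Units_closed)
  from Z_diff[OF this pow_left[OF n u(1), of q]] show ?thesis using u by simp
qed

text \<open>Strong induction on \<open>l\<close>, balancing the bounds \<open>l + 1\<close> and
  \<open>p^N\<close> on the order of the symbol. When they are not coprime, one \<open>p\<close>-th
  root of the coefficient is spent to pass from \<open>l\<close> to \<open>k - 1\<close>, where
  \<open>l + 1 = p k\<close>.\<close>

lemma D_power_coeff:
  assumes t: "t \<in> carrier R" "eps t = \<zero>" and p: "prime p"
    and geo: "\<And>z. z \<in> carrier R \<Longrightarrow> geo (\<one> \<ominus> z) p = z [^] (p - 1)"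
    and nil: "\<And>r. r \<in> carrier R \<Longrightarrow> (\<one> \<ominus> t \<otimes> r) [^] (p ^ N) = \<one>"
    and a: "a \<in> carrier R" "eps a = a"
  shows "D t (a [^] (p ^ l) \<otimes> t [^] l) \<in> Z"
  using a
proof (induction l arbitrary: a rule: less_induct)
  case (less l)
  have epow: "eps (a [^] (n::nat)) = a [^] n" for n
    using less.prems by (induction n) auto
  define c where "c = a [^] (p ^ l)"
  have c: "c \<in> carrier R" "eps c = c" using less.prems epow by (auto simp: c_def)
  have tor: "frag_cmul (int (Suc l)) (D t (c \<otimes> t [^] l)) \<in> Z"
    by (rule D_monom_torsion[OF t c])
  have tq: "frag_cmul (int (p ^ N)) (D t (c \<otimes> t [^] l)) \<in> Z"
    using t c nil by (intro D_torsion) auto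
  show ?case
  proof (cases "p dvd Suc l")
    case False
    then have "coprime (p ^ N) (Suc l)" using p by (simp add: prime_imp_coprime)
    then have "gcd (int (Suc l)) (int (p ^ N)) = 1"
      by (metis coprime_iff_gcd_eq_1 gcd.commute gcd_int_int_eq of_nat_1)
    then obtain u v where uv: "u * int (Suc l) + v * int (p ^ N) = 1"
      using bezout_int by metis
    have "frag_cmul (u * int (Suc l) + v * int (p ^ N)) (D t (c \<otimes> t [^] l)) \<in> Z"
      using Z_add[OF Z_cmul[OF tor, of u] Z_cmul[OF tq, of v]] by (simp add: frag_cmul_distrib del: of_nat_Suc)
    then show ?thesis using uv by (simp add: c_def)
  next
    case True
    then obtain k where k: "Suc l = p * k" by (elim dvdE)
    have p2: "p \<ge> 2" using p by (rule prime_ge_2_nat)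
    have k0: "k > 0" using k by (cases k) auto
    have kl: "k \<le> l" using k p2 k0 by (metis Suc_leI le_neq_implies_less less_Suc_eq_le mult_le_mono1 n_less_m_mult_n nat_mult_1 numeral_2_eq_2 Suc_le_lessD)
    \<comment> \<open>The induction hypothesis at \<open>k - 1\<close> asks for a coefficient that
      is a \<open>p^(k-1)\<close>-th power. Since \<open>(k - 1) + (l - k) = l - 1\<close>, this
      \<open>d\<close> has \<open>e\<close> as that power.\<close>
    define d where "d = a [^] (p ^ (l - k))"
    have d: "d \<in> carrier R" "eps d = d" using less.prems epow by (auto simp: d_def)
    define e where "e = a [^] (p ^ (l - 1))"
    have e: "e \<in> carrier R" "eps e = e" using less.prems epow by (auto simp: e_def)
    have ed: "e = d [^] (p ^ (k - 1))"
      using less.prems kl k0 by (simp add: e_def d_def nat_pow_pow power_add[symmetric])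
    have ce: "c = e [^] p"
      using less.prems kl k0 by (simp add: e_def c_def nat_pow_pow flip: power_Suc2)
    have ih: "D t (e \<otimes> t [^] (k - 1)) \<in> Z"
      using less.IH[of "k - 1" d] kl k0 d ed by simp
    let ?y = "e \<otimes> t [^] (k - 1)"
    have ty: "t \<otimes> ?y = e \<otimes> t [^] k"
      using k0 t e by (cases k) (simp_all add: m_ac)
    \<comment> \<open>By the hypothesis on \<open>geo\<close> the geometric sum collapses to
      \<open>(e t^k)^(p-1)\<close>. The resulting exponent of \<open>t\<close> is
      \<open>k (p - 1) + (k - 1) = p k - 1 = l\<close>.\<close>
    have "geo (\<one> \<ominus> t \<otimes> ?y) p \<otimes> ?y = (e \<otimes> t [^] k) [^] (p - 1) \<otimes> ?y"
      using geo[of "t \<otimes> ?y"] t e ty by simp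
    also have "\<dots> = (e [^] (p - 1) \<otimes> e) \<otimes> (t [^] (k * (p - 1)) \<otimes> t [^] (k - 1))"
      using t e by (simp add: pow_mult_distrib m_comm nat_pow_pow m_ac)
    also have "\<dots> = e [^] p \<otimes> t [^] (k * (p - 1) + (k - 1))"
      using t e p2 nat_pow_Suc[of e "p - 1"] by (simp add: nat_pow_mult)
    also have "k * (p - 1) + (k - 1) = l"
      using k k0 p2 by (simp add: algebra_simps diff_mult_distrib2)
    finally have "D t (c \<otimes> t [^] l) - frag_cmul (int p) (D t ?y) \<in> Z"
      using D_geo[of t ?y p] t e ce by simp
    then have "(D t (c \<otimes> t [^] l) - frag_cmul (int p) (D t ?y)) + frag_cmul (int p) (D t ?y) \<in> Z"
      using Z_cmul[OF ih] by (intro Z_add)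
    then show ?thesis by (simp add: c_def)
  qed
qed

text \<open>The elements of \<open>B\<close> have a \<open>t\<close>-adic expansion whose coefficients are \<open>p\<^sup>m\<close>-th powers of
  constants, so that every \<open>D t (c t\<^sup>l)\<close> occurring below is one of those just treated.\<close>

lemma D_power_series:
  assumes t: "t \<in> carrier R" "eps t = \<zero>" "t [^] Suc m = \<zero>" and p: "prime p"
    and geo: "\<And>z. z \<in> carrier R \<Longrightarrow> geo (\<one> \<ominus> z) p = z [^] (p - 1)"
    and nil: "\<And>r. r \<in> carrier R \<Longrightarrow> (\<one> \<ominus> t \<otimes> r) [^] (p ^ N) = \<one>"
    and B: "subring B R" "t \<in> B"
    and inv: "\<And>b. b \<in> B \<Longrightarrow> inv (\<one> \<ominus> t \<otimes> b) \<in> B"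
    and dec: "\<And>b. b \<in> B \<Longrightarrow> \<exists>d \<in> carrier R. \<exists>b' \<in> B. eps d = d \<and> b = d [^] (p ^ m) \<oplus> t \<otimes> b'"
    and xy: "x \<in> B" "y \<in> B"
  shows "D (t [^] Suc i \<otimes> x) (t [^] (j::nat) \<otimes> y) \<in> Z"
  using xy
\<comment> \<open>Downward induction on the orders in \<open>t\<close>: splitting off a leading
  coefficient raises \<open>i\<close> or \<open>j\<close> by one, and as soon as one of them exceeds
  \<open>m\<close> the corresponding argument is zero.\<close>
proof (induction "(Suc m - i) + (Suc m - j)" arbitrary: i j x y rule: less_induct)
  case less
  note Bc = subringE(1)[OF B(1)]
  have tB: "t [^] (n::nat) \<in> B" for n
    by (induction n) (use B subringE[OF B(1)] in auto)
  have tz: "t [^] n = \<zero>" if "n \<ge> Suc m" for n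
    using t that nat_pow_mult[of t "Suc m" "n - Suc m"] by (simp del: nat_pow_Suc)
  have xc: "x \<in> carrier R" "y \<in> carrier R" using less.prems Bc by auto
  show ?case
  proof (cases "i \<ge> Suc m \<or> j \<ge> Suc m")
    case True
    then show ?thesis
      using D_zero_left[of "t [^] j \<otimes> y"] D_const[of "t [^] Suc i \<otimes> x" \<zero>] t xc tz[of "Suc i"] tz[of j]
      by (auto simp del: nat_pow_Suc)
  next
    case False
    obtain d b where d: "d \<in> carrier R" "b \<in> B" "eps d = d" "x = d [^] (p ^ m) \<oplus> t \<otimes> b"
      using dec less.prems by blast
    obtain d' b' where d': "d' \<in> carrier R" "b' \<in> B" "eps d' = d'" "y = d' [^] (p ^ m) \<oplus> t \<otimes> b'"
      using dec less.prems by blast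
    have epow: "eps (a [^] (n::nat)) = a [^] n" if "a \<in> carrier R" "eps a = a" for a n
      using that by (induction n) auto
    define a where "a = d [^] (p ^ m)"
    define a' where "a' = d' [^] (p ^ m)"
    have a: "a \<in> carrier R" "eps a = a" "a' \<in> carrier R" "eps a' = a'"
      using d d' epow by (auto simp: a_def a'_def)
    have bc: "b \<in> carrier R" "b' \<in> carrier R" using d d' Bc by auto
    have aB: "a \<in> B" "a' \<in> B"
    proof -
      have "a = x \<ominus> t \<otimes> b" "a' = y \<ominus> t \<otimes> b'"
        using d d' a bc t by (simp_all add: a_def[symmetric] a'_def[symmetric] cr)
      then show "a \<in> B" "a' \<in> B"
        using less.prems d d' B subringE[OF B(1)] by (simp_all add: minus_eq)
    qed
    let ?xc = "t [^] Suc i \<otimes> a" and ?y = "t [^] j \<otimes> y" and ?yc = "t [^] j \<otimes> a'"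
    have mB: "u \<otimes> v \<in> B" if "u \<in> B" "v \<in> B" for u v using that subringE(6)[OF B(1)] by blast
    \<comment> \<open>Expansions are ordinary sums, whereas \<open>D\<close> is additive for
      \<open>circ\<close>. The conversion is \<open>h + r = circ g h (r v)\<close> with
      \<open>v\<close> inverse to \<open>1 - g h\<close>; the factors \<open>w\<close> and
      \<open>w'\<close> are these inverses, and they must stay in \<open>B\<close> for the induction
      hypothesis to apply.\<close>
    define w where "w = inv (\<one> \<ominus> t \<otimes> (t [^] i \<otimes> a \<otimes> ?y))"
    define w' where "w' = inv (\<one> \<ominus> t \<otimes> (t [^] i \<otimes> a \<otimes> ?yc))"
    have wB: "w \<in> B" "w' \<in> B"
      unfolding w_def w'_def using less.prems aB tB by (auto intro!: inv mB)
    have wc: "w \<in> carrier R" "w' \<in> carrier R" using wB Bc by auto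
    have x0c: "?xc \<in> carrier R" "?yc \<in> carrier R" "?y \<in> carrier R" using t a xc by auto
    have ww: "(\<one> \<ominus> ?xc \<otimes> ?y) \<otimes> w = \<one>" "(\<one> \<ominus> ?xc \<otimes> ?yc) \<otimes> w' = \<one>"
    proof -
      have "?xc \<otimes> z = t \<otimes> (t [^] i \<otimes> a \<otimes> z)" if "z \<in> carrier R" for z
        using t a that by (simp add: m_ac)
      then show "(\<one> \<ominus> ?xc \<otimes> ?y) \<otimes> w = \<one>" "(\<one> \<ominus> ?xc \<otimes> ?yc) \<otimes> w' = \<one>"
        using one_minus_unit[of t "t [^] i \<otimes> a \<otimes> ?y"] one_minus_unit[of t "t [^] i \<otimes> a \<otimes> ?yc"] t a xc
        by (simp_all add: w_def w'_def del: nat_pow_Suc)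
    qed
    have circ_split: "circ g h (r \<otimes> v) = h \<oplus> r"
      if "g \<in> carrier R" "h \<in> carrier R" "r \<in> carrier R" "v \<in> carrier R" "(\<one> \<ominus> g \<otimes> h) \<otimes> v = \<one>" for g h r v
    proof -
      have "circ g h (r \<otimes> v) = h \<oplus> r \<otimes> ((\<one> \<ominus> g \<otimes> h) \<otimes> v)"
        using that(1-4) by (simp add: circ_def cr)
      then show ?thesis using that by simp
    qed
    have c1: "circ ?y ?xc (t [^] Suc (Suc i) \<otimes> (b \<otimes> w)) = t [^] Suc i \<otimes> x"
    proof -
      have "circ ?y ?xc ((t [^] Suc i \<otimes> (t \<otimes> b)) \<otimes> w) = ?xc \<oplus> t [^] Suc i \<otimes> (t \<otimes> b)"
        using t a bc wc x0c ww by (intro circ_split) (auto simp: m_comm)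
      also have "\<dots> = t [^] Suc i \<otimes> x"
        using t a bc d by (simp add: a_def r_distr del: nat_pow_Suc)
      finally show ?thesis using t bc wc by (simp add: m_ac)
    qed
    have c2: "circ ?xc ?yc (t [^] Suc j \<otimes> (b' \<otimes> w')) = ?y"
    proof -
      have "circ ?xc ?yc ((t [^] j \<otimes> (t \<otimes> b')) \<otimes> w') = ?yc \<oplus> t [^] j \<otimes> (t \<otimes> b')"
        using t a bc wc x0c ww by (intro circ_split) auto
      also have "\<dots> = ?y"
        using t a bc by (simp add: r_distr d'(4)[folded a'_def])
      finally show ?thesis using t bc wc by (simp add: m_ac)
    qed
    have A: "D ?xc ?y + D (t [^] Suc (Suc i) \<otimes> (b \<otimes> w)) ?y - D (t [^] Suc i \<otimes> x) ?y \<in> Z"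
      using D_add_left[of ?xc "t [^] Suc (Suc i) \<otimes> (b \<otimes> w)" ?y] c1 t a bc wc x0c by simp
    have A': "D ?xc ?yc + D ?xc (t [^] Suc j \<otimes> (b' \<otimes> w')) - D ?xc ?y \<in> Z"
      using D_add[of ?xc ?yc "t [^] Suc j \<otimes> (b' \<otimes> w')"] c2 t a bc wc x0c by simp
    have I1: "D (t [^] Suc (Suc i) \<otimes> (b \<otimes> w)) ?y \<in> Z"
      using False less.prems d wB by (intro less.hyps mB) auto
    have I2: "D ?xc (t [^] Suc j \<otimes> (b' \<otimes> w')) \<in> Z"
      using False aB d' wB by (intro less.hyps mB) auto
    define h where "h = frag_cmul (int (Suc i)) (D t (a \<otimes> a' \<otimes> t [^] (i + j)))"
    have C: "D (a \<otimes> t [^] Suc i) (a' \<otimes> t [^] j) - h \<in> Z"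
      unfolding h_def
      using t a by (intro D_monom) auto
    have E: "D t (a \<otimes> a' \<otimes> t [^] (i + j)) \<in> Z"
    proof (cases "i + j \<ge> Suc m")
      case True
      then show ?thesis using D_const[of t \<zero>] t a tz by simp
    next
      case False
      \<comment> \<open>In the remaining range \<open>i + j\<close> is at most \<open>m\<close>, so
        a \<open>p^m\<close>-th power is in particular a \<open>p^(i+j)\<close>-th power, as
        \<open>D_power_coeff\<close> requires.\<close>
      define g where "g = (d \<otimes> d') [^] (p ^ (m - (i + j)))"
      have "a \<otimes> a' = g [^] (p ^ (i + j))"
        using d d' False by (simp add: a_def a'_def g_def nat_pow_pow pow_mult_distrib m_comm flip: power_add)
      moreover have "g \<in> carrier R" "eps g = g"
        using d d' epow[of "d \<otimes> d'"] by (auto simp: g_def)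
      ultimately show ?thesis using D_power_coeff[OF t(1,2) p geo nil] by simp
    qed
    have hZ: "h \<in> Z" unfolding h_def by (rule Z_cmul[OF E])
    have e: "a \<otimes> t [^] Suc i = ?xc" "a' \<otimes> t [^] j = ?yc"
      using t a by (simp_all add: m_comm)
    have "D (t [^] Suc i \<otimes> x) ?y = D (t [^] Suc (Suc i) \<otimes> (b \<otimes> w)) ?y + D ?xc (t [^] Suc j \<otimes> (b' \<otimes> w'))
      - (D ?xc ?y + D (t [^] Suc (Suc i) \<otimes> (b \<otimes> w)) ?y - D (t [^] Suc i \<otimes> x) ?y)
      - (D ?xc ?yc + D ?xc (t [^] Suc j \<otimes> (b' \<otimes> w')) - D ?xc ?y)
      + (D (a \<otimes> t [^] Suc i) (a' \<otimes> t [^] j) - h) + h"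
      unfolding e by (simp del: nat_pow_Suc)
    also have "\<dots> \<in> Z"
      by (rule A A' I1 I2 C hZ | rule Z_add Z_diff)+
    finally show ?thesis .
  qed
qed

text \<open>With the unit \<open>w = 1 - t y\<close> the symbol is \<open>D (t x / w) w\<close>, the
  case \<open>i = j = 0\<close> of the preceding lemma.\<close>

lemma principal_units_zero:
  assumes t: "t \<in> carrier R" "eps t = \<zero>" "t [^] Suc m = \<zero>" and p: "prime p"
    and geo: "\<And>z. z \<in> carrier R \<Longrightarrow> geo (\<one> \<ominus> z) p = z [^] (p - 1)"
    and nil: "\<And>r. r \<in> carrier R \<Longrightarrow> (\<one> \<ominus> t \<otimes> r) [^] (p ^ N) = \<one>"
    and B: "subring B R" "t \<in> B"
    and inv: "\<And>b. b \<in> B \<Longrightarrow> inv (\<one> \<ominus> t \<otimes> b) \<in> B"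
    and dec: "\<And>b. b \<in> B \<Longrightarrow> \<exists>d \<in> carrier R. \<exists>b' \<in> B. eps d = d \<and> b = d [^] (p ^ m) \<oplus> t \<otimes> b'"
    and xy: "x \<in> B" "y \<in> B"
  shows "s (\<one> \<ominus> t \<otimes> x) (\<one> \<ominus> t \<otimes> y) \<in> Z"
proof -
  have c: "x \<in> carrier R" "y \<in> carrier R" using xy subringE(1)[OF B(1)] by auto
  define w where "w = \<one> \<ominus> t \<otimes> y"
  have w: "w \<in> Units R" "inv w \<in> B" "w \<in> carrier R" "inv w \<in> carrier R"
    using one_minus_unit[of t y] inv xy t c by (auto simp: w_def)
  have wB: "w \<in> B"
    using xy B subringE[OF B(1)] by (simp add: w_def minus_eq)
  have "D (t [^] Suc 0 \<otimes> (x \<otimes> inv w)) (t [^] (0::nat) \<otimes> w) \<in> Z"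
    using D_power_series[OF t p geo nil B inv dec, of "x \<otimes> inv w" w 0 0] wB w xy subringE(6)[OF B(1)] by blast
  moreover have "t \<otimes> (x \<otimes> inv w) \<otimes> w = t \<otimes> x"
    using t c w by (simp add: m_assoc)
  ultimately show ?thesis using w t c by (simp add: D_unit w_def)
qed

end

section \<open>Milnor K-groups as groups of words\<close>

text \<open>The product of \<open>free_ring\<close> freed from its alphabet, so that bilinearity and
  associativity hold without carrier conditions.\<close>

definition cat :: "('a list \<Rightarrow>\<^sub>0 int) \<Rightarrow> ('a list \<Rightarrow>\<^sub>0 int) \<Rightarrow> ('a list \<Rightarrow>\<^sub>0 int)" where
  "cat c d = frag_extend (\<lambda>u. frag_extend (\<lambda>v. frag_of (u @ v)) d) c"

lemma cat_zero [simp]: "cat 0 d = 0" "cat c 0 = 0"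
  by (simp_all add: cat_def frag_extend_eq_0)

lemma cat_of: "cat (frag_of u) (frag_of v) = frag_of (u @ v)"
  by (simp add: cat_def)

lemma cat_diff_left: "cat (c - c') d = cat c d - cat c' d"
  by (simp add: cat_def frag_extend_diff)

lemma frag_induct [case_names zero one diff]:
  assumes "P 0" "\<And>x. P (frag_of x)" "\<And>a b. P a \<Longrightarrow> P b \<Longrightarrow> P (a - b)" shows "P c"
  by (rule frag_induction[of c UNIV]) (use assms in auto)

lemma cat_diff_right: "cat c (d - d') = cat c d - cat c d'"
  by (induction c rule: frag_induct) (simp_all add: cat_def frag_extend_diff)

lemma cat_add_left: "cat (c + c') d = cat c d + cat c' d"
  by (simp add: cat_def frag_extend_add)

lemma cat_add_right: "cat c (d + d') = cat c d + cat c d'"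
  using cat_diff_right[of c "d + d'" d'] by simp

lemma cat_one [simp]: "cat (frag_of []) d = d" "cat d (frag_of []) = d"
  by (induction d rule: frag_induct) (simp_all add: cat_of cat_diff_left cat_diff_right)

lemma cat_assoc: "cat (cat c d) e = cat c (cat d e)"
proof (induction c rule: frag_induct)
  case (one u)
  show ?case
  proof (induction d rule: frag_induct)
    case (one v)
    show ?case by (induction e rule: frag_induct) (simp_all add: cat_of cat_diff_right)
  qed (simp_all add: cat_diff_left cat_diff_right)
qed (simp_all add: cat_diff_left)

lemma keys_diff_subset: "\<lbrakk>Poly_Mapping.keys a \<subseteq> S; Poly_Mapping.keys b \<subseteq> S\<rbrakk> \<Longrightarrow> Poly_Mapping.keys (a - b) \<subseteq> S"
  for a b :: "'b \<Rightarrow>\<^sub>0 int"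
  using keys_diff[of a b] by blast

lemma keys_add_subset: "\<lbrakk>Poly_Mapping.keys a \<subseteq> S; Poly_Mapping.keys b \<subseteq> S\<rbrakk> \<Longrightarrow> Poly_Mapping.keys (a + b) \<subseteq> S"
  for a b :: "'b \<Rightarrow>\<^sub>0 int"
  using keys_add[of a b] by blast

lemma keys_cat: "\<lbrakk>Poly_Mapping.keys c \<subseteq> lists X; Poly_Mapping.keys d \<subseteq> lists X\<rbrakk> \<Longrightarrow> Poly_Mapping.keys (cat c d) \<subseteq> lists X"
proof (induction c rule: frag_induction)
  case (one u)
  show ?case using one(2)
  proof (induction d rule: frag_induction)
    case (diff a b) then show ?case unfolding cat_diff_right by (rule keys_diff_subset)
  qed (use one in \<open>auto simp: cat_of\<close>)
next
  case (diff a b) then show ?case unfolding cat_diff_left by (intro keys_diff_subset)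
qed simp

lemma free_ring_simps:
  "carrier (free_ring X) = {c. Poly_Mapping.keys c \<subseteq> lists X}"
  "c \<otimes>\<^bsub>free_ring X\<^esub> d = cat c d" "\<one>\<^bsub>free_ring X\<^esub> = frag_of []"
  "\<zero>\<^bsub>free_ring X\<^esub> = 0" "c \<oplus>\<^bsub>free_ring X\<^esub> d = c + d"
  by (simp_all add: free_ring_def cat_def)

lemma ring_free_ring: "ring (free_ring X)"
proof (intro ringI abelian_groupI monoidI)
  fix x assume "x \<in> carrier (free_ring X)"
  then show "\<exists>y\<in>carrier (free_ring X). y \<oplus>\<^bsub>free_ring X\<^esub> x = \<zero>\<^bsub>free_ring X\<^esub>"
    by (intro bexI[of _ "- x"]) (auto simp: free_ring_simps keys_minus)
qed (auto simp: free_ring_simps cat_assoc cat_add_left cat_add_right keys_cat algebra_simps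
  dest: keys_cat[THEN subsetD, rotated 2] dest!: keys_add[THEN subsetD])

lemma free_ring_minus:
  assumes "Poly_Mapping.keys d \<subseteq> lists X" shows "c \<ominus>\<^bsub>free_ring X\<^esub> d = c - d"
proof -
  interpret ring "free_ring X" by (rule ring_free_ring)
  have "\<ominus>\<^bsub>free_ring X\<^esub> d = - d"
    using assms by (intro minus_equality) (auto simp: free_ring_simps keys_minus)
  then show ?thesis by (simp add: a_minus_def free_ring_simps)
qed

text \<open>One family covers both quotients: with \<open>P\<close> empty it is the tensor ideal,
  with the Steinberg pairs it is the kernel of the map from words to the Milnor ring. The contexts
  \<open>u\<close> and \<open>v\<close> are built into the generators; this makes the set a
  two-sided ideal and gives rule induction over relations.\<close>

inductive_set word_rel :: "('a, 'b) monoid_scheme \<Rightarrow> ('a \<times> 'a) set \<Rightarrow> ('a list \<Rightarrow>\<^sub>0 int) set"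
  for G :: "('a, 'b) monoid_scheme" and P :: "('a \<times> 'a) set" where
  zero: "0 \<in> word_rel G P"
| diff: "x \<in> word_rel G P \<Longrightarrow> y \<in> word_rel G P \<Longrightarrow> x - y \<in> word_rel G P"
| mult: "\<lbrakk>u \<in> lists (carrier G); v \<in> lists (carrier G); a \<in> carrier G; b \<in> carrier G\<rbrakk>
    \<Longrightarrow> frag_of (u @ (a \<otimes>\<^bsub>G\<^esub> b) # v) - frag_of (u @ a # v) - frag_of (u @ b # v) \<in> word_rel G P"
| pair: "\<lbrakk>u \<in> lists (carrier G); v \<in> lists (carrier G); (a, b) \<in> P\<rbrakk>
    \<Longrightarrow> frag_of (u @ a # b # v) \<in> word_rel G P"

lemma word_rel_uminus: "x \<in> word_rel G P \<Longrightarrow> - x \<in> word_rel G P"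
  using word_rel.diff[OF word_rel.zero] by force

lemma word_rel_add: "x \<in> word_rel G P \<Longrightarrow> y \<in> word_rel G P \<Longrightarrow> x + y \<in> word_rel G P"
  using word_rel.diff[OF _ word_rel_uminus] by force

lemma word_rel_carrier:
  assumes "\<And>a b. \<lbrakk>a \<in> carrier G; b \<in> carrier G\<rbrakk> \<Longrightarrow> a \<otimes>\<^bsub>G\<^esub> b \<in> carrier G" "P \<subseteq> carrier G \<times> carrier G"
    "x \<in> word_rel G P"
  shows "x \<in> carrier (free_ring (carrier G))"
  using assms(3)
proof (induction rule: word_rel.induct)
  case (mult u v a b)
  have "Poly_Mapping.keys (frag_of w) \<subseteq> lists (carrier G)" if "w \<in> lists (carrier G)" for w
    using that by simp
  then show ?case
    unfolding free_ring_simps mem_Collect_eq using assms(1) mult by (intro keys_diff_subset) auto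
qed (use assms(2) in \<open>auto simp: free_ring_simps dest!: keys_diff[THEN subsetD]\<close>)

lemma cat_word_rel:
  assumes c: "c \<in> word_rel G P"
  shows "Poly_Mapping.keys d \<subseteq> lists (carrier G) \<Longrightarrow> cat d c \<in> word_rel G P"
    and "Poly_Mapping.keys d \<subseteq> lists (carrier G) \<Longrightarrow> cat c d \<in> word_rel G P"
proof -
  have "cat (frag_of w) c \<in> word_rel G P \<and> cat c (frag_of w) \<in> word_rel G P" if w: "w \<in> lists (carrier G)" for w
    using c
  proof (induction rule: word_rel.induct)
    case (mult u v a b)
    then show ?case
      using w word_rel.mult[of "w @ u" G v a b P] word_rel.mult[of u G "v @ w" a b P]
      by (simp add: cat_of cat_diff_left cat_diff_right)
  next
    case (pair u v a b)
    then show ?case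
      using w word_rel.pair[of "w @ u" G v a b P] word_rel.pair[of u G "v @ w" a b P]
      by (simp add: cat_of)
  qed (auto simp: cat_diff_left cat_diff_right intro: word_rel.zero word_rel.diff)
  note w = this
  show "Poly_Mapping.keys d \<subseteq> lists (carrier G) \<Longrightarrow> cat d c \<in> word_rel G P"
    by (induction d rule: frag_induction) (auto simp: cat_diff_left w intro: word_rel.zero word_rel.diff)
  show "Poly_Mapping.keys d \<subseteq> lists (carrier G) \<Longrightarrow> cat c d \<in> word_rel G P"
    by (induction d rule: frag_induction) (auto simp: cat_diff_right w intro: word_rel.zero word_rel.diff)
qed

lemma ideal_word_rel:
  assumes "\<And>a b. \<lbrakk>a \<in> carrier G; b \<in> carrier G\<rbrakk> \<Longrightarrow> a \<otimes>\<^bsub>G\<^esub> b \<in> carrier G" "P \<subseteq> carrier G \<times> carrier G"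
  shows "ideal (word_rel G P) (free_ring (carrier G))"
proof -
  interpret ring "free_ring (carrier G)" by (rule ring_free_ring)
  note wc = word_rel_carrier[of G P, OF assms]
  have inv: "inv\<^bsub>add_monoid (free_ring (carrier G))\<^esub> x = - x" if "x \<in> carrier (free_ring (carrier G))" for x
    using free_ring_minus[of x "carrier G" 0] that
    by (simp add: a_minus_def a_inv_def free_ring_simps)
  show ?thesis
  proof (intro idealI[OF ring_axioms] subgroup.intro)
    show "word_rel G P \<subseteq> carrier (add_monoid (free_ring (carrier G)))" using wc by auto
  next
    fix x assume "x \<in> word_rel G P"
    then show "inv\<^bsub>add_monoid (free_ring (carrier G))\<^esub> x \<in> word_rel G P"
      using inv wc word_rel_uminus by metis
  qed (auto simp: free_ring_simps intro: word_rel_add word_rel.zero cat_word_rel)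
qed

lemma tensor_ideal_eq:
  assumes m: "\<And>a b. \<lbrakk>a \<in> carrier G; b \<in> carrier G\<rbrakk> \<Longrightarrow> a \<otimes>\<^bsub>G\<^esub> b \<in> carrier G"
  shows "tensor_ideal G = word_rel G {}"
proof
  interpret ring "free_ring (carrier G)" by (rule ring_free_ring)
  let ?S = "{frag_of [a \<otimes>\<^bsub>G\<^esub> b] - frag_of [a] - frag_of [b] | a b. a \<in> carrier G \<and> b \<in> carrier G}"
  have S: "?S \<subseteq> carrier (free_ring (carrier G))"
    using m by (auto simp: free_ring_simps dest!: keys_diff[THEN subsetD])
  interpret I: ideal "tensor_ideal G" "free_ring (carrier G)"
    unfolding tensor_ideal_def by (rule genideal_ideal[OF S])
  have S': "?S \<subseteq> tensor_ideal G" unfolding tensor_ideal_def by (rule genideal_self[OF S])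
  show "tensor_ideal G \<subseteq> word_rel G {}"
    unfolding tensor_ideal_def
    using word_rel.mult[of "[]" G "[]" _ _ "{}"] by (intro genideal_minimal ideal_word_rel m) auto
  show "word_rel G {} \<subseteq> tensor_ideal G"
  proof
    fix x assume "x \<in> word_rel G {}"
    then show "x \<in> tensor_ideal G"
    proof (induction rule: word_rel.induct)
      case zero then show ?case using I.zero_closed by (simp add: free_ring_simps)
    next
      case (diff x y)
      then have "x \<ominus>\<^bsub>free_ring (carrier G)\<^esub> y \<in> tensor_ideal G"
        by (simp add: I.a_closed I.a_inv_closed a_minus_def)
      moreover have "Poly_Mapping.keys y \<subseteq> lists (carrier G)"
        using diff I.Icarr by (auto simp: free_ring_simps)
      ultimately show ?case by (simp add: free_ring_minus)
    next
      case (mult u v a b)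
      let ?g = "frag_of [a \<otimes>\<^bsub>G\<^esub> b] - frag_of [a] - frag_of [b]"
      have "?g \<in> tensor_ideal G" using S' mult by blast
      then have "frag_of u \<otimes>\<^bsub>free_ring (carrier G)\<^esub> ?g \<otimes>\<^bsub>free_ring (carrier G)\<^esub> frag_of v \<in> tensor_ideal G"
        using mult by (intro I.I_r_closed I.I_l_closed) (auto simp: free_ring_simps)
      then show ?case by (simp add: free_ring_simps cat_of cat_diff_left cat_diff_right)
    qed simp
  qed
qed

text \<open>A pair in \<open>P\<close> need not go to a pair in \<open>Q\<close>; it suffices that
  its image is a relation in every context. The lowest-coefficient map needs this weaker condition,
  since it can send a Steinberg pair to \<open>(1, b)\<close> or \<open>(y, -y)\<close>.\<close>

lemma frag_map_word_rel:
  assumes f: "\<And>a. a \<in> carrier G \<Longrightarrow> f a \<in> carrier H"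
    and m: "\<And>a b. \<lbrakk>a \<in> carrier G; b \<in> carrier G\<rbrakk> \<Longrightarrow> f (a \<otimes>\<^bsub>G\<^esub> b) = f a \<otimes>\<^bsub>H\<^esub> f b"
    and p: "\<And>a b u v. \<lbrakk>(a, b) \<in> P; u \<in> lists (carrier H); v \<in> lists (carrier H)\<rbrakk>
        \<Longrightarrow> frag_of (u @ f a # f b # v) \<in> word_rel H Q"
    and c: "c \<in> word_rel G P"
  shows "frag_extend (\<lambda>w. frag_of (map f w)) c \<in> word_rel H Q"
  using c
proof (induction rule: word_rel.induct)
  case (mult u v a b)
  have "map f u \<in> lists (carrier H)" "map f v \<in> lists (carrier H)" using f mult by auto
  then show ?case
    using f mult word_rel.mult[of "map f u" H "map f v" "f a" "f b" Q] m by (simp add: frag_extend_diff)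
next
  case (pair u v a b)
  then show ?case using f by (auto intro!: p)
qed (auto simp: frag_extend_diff intro: word_rel.zero word_rel.diff)

definition steinberg_pairs :: "('a, 'b) ring_scheme \<Rightarrow> ('a \<times> 'a) set" where
  "steinberg_pairs R = {(a, \<one>\<^bsub>R\<^esub> \<ominus>\<^bsub>R\<^esub> a) | a. a \<in> Units R \<and> \<one>\<^bsub>R\<^esub> \<ominus>\<^bsub>R\<^esub> a \<in> Units R}"

abbreviation milnor_rel :: "('a, 'b) ring_scheme \<Rightarrow> ('a list \<Rightarrow>\<^sub>0 int) set" where
  "milnor_rel R \<equiv> word_rel (units_of R) (steinberg_pairs R)"

definition milnor_elem :: "('a, 'b) ring_scheme \<Rightarrow> ('a list \<Rightarrow>\<^sub>0 int) \<Rightarrow> ('a list \<Rightarrow>\<^sub>0 int) set set" where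
  "milnor_elem R c = milnor_class R (tensor_class (units_of R) c)"

abbreviation words :: "('a, 'b) ring_scheme \<Rightarrow> nat \<Rightarrow> 'a list set" where
  "words R n \<equiv> {w \<in> lists (Units R). length w = n}"

abbreviation frag_map :: "('a \<Rightarrow> 'c) \<Rightarrow> ('a list \<Rightarrow>\<^sub>0 int) \<Rightarrow> ('c list \<Rightarrow>\<^sub>0 int)" where
  "frag_map f \<equiv> frag_extend (\<lambda>w. frag_of (map f w))"

context ring
begin

lemma units_of_mult_closed:
  "\<lbrakk>a \<in> carrier (units_of R); b \<in> carrier (units_of R)\<rbrakk>
    \<Longrightarrow> a \<otimes>\<^bsub>units_of R\<^esub> b \<in> carrier (units_of R)"
  by (simp add: units_of_carrier units_of_mult)

lemma steinberg_pairs_subset: "steinberg_pairs R \<subseteq> carrier (units_of R) \<times> carrier (units_of R)"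
  by (auto simp: steinberg_pairs_def units_of_carrier)

lemma ideal_tensor_ideal: "ideal (tensor_ideal (units_of R)) (free_ring (Units R))"
  using ideal_word_rel[OF units_of_mult_closed, of "{}"] tensor_ideal_eq[OF units_of_mult_closed]
  by (simp add: units_of_carrier)

lemma ring_tensor_algebra: "ring (tensor_algebra (units_of R))"
  unfolding tensor_algebra_def using ideal.quotient_is_ring[OF ideal_tensor_ideal]
  by (simp add: units_of_carrier)

lemma tensor_class_hom: "tensor_class (units_of R) \<in> ring_hom (free_ring (Units R)) (tensor_algebra (units_of R))"
  using ideal.rcos_ring_hom[OF ideal_tensor_ideal]
  unfolding tensor_class_def[abs_def] tensor_algebra_def by (simp add: units_of_carrier)

lemma tensor_class_eq_iff:
  assumes "Poly_Mapping.keys c \<subseteq> lists (Units R)" "Poly_Mapping.keys d \<subseteq> lists (Units R)"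
  shows "tensor_class (units_of R) c = tensor_class (units_of R) d \<longleftrightarrow> c - d \<in> word_rel (units_of R) {}"
proof -
  interpret F: ring "free_ring (Units R)" by (rule ring_free_ring)
  show ?thesis
    using F.quotient_eq_iff_same_a_r_cos[OF ideal_tensor_ideal, of c d] assms
      tensor_ideal_eq[OF units_of_mult_closed]
    by (simp add: tensor_class_def units_of_carrier free_ring_simps free_ring_minus)
qed

lemma carrier_tensor_algebra:
  "carrier (tensor_algebra (units_of R)) = tensor_class (units_of R) ` {c. Poly_Mapping.keys c \<subseteq> lists (Units R)}"
  by (auto simp: tensor_algebra_def FactRing_def A_RCOSETS_def' tensor_class_def units_of_carrier free_ring_simps)

lemma tensor_class_diff:
  assumes "Poly_Mapping.keys c \<subseteq> lists (Units R)" "Poly_Mapping.keys d \<subseteq> lists (Units R)"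
  shows "tensor_class (units_of R) (c - d)
    = tensor_class (units_of R) c \<ominus>\<^bsub>tensor_algebra (units_of R)\<^esub> tensor_class (units_of R) d"
proof -
  interpret F: ring "free_ring (Units R)" by (rule ring_free_ring)
  interpret T: ring "tensor_algebra (units_of R)" by (rule ring_tensor_algebra)
  interpret h: ring_hom_ring "free_ring (Units R)" "tensor_algebra (units_of R)" "tensor_class (units_of R)"
    by (rule ring_hom_ringI2[OF F.ring_axioms T.ring_axioms tensor_class_hom])
  have "tensor_class (units_of R) (c \<ominus>\<^bsub>free_ring (Units R)\<^esub> d) =
      tensor_class (units_of R) c \<ominus>\<^bsub>tensor_algebra (units_of R)\<^esub> tensor_class (units_of R) d"
  proof -
    have "c \<in> carrier (free_ring (Units R))" "d \<in> carrier (free_ring (Units R))"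
      using assms by (simp_all add: free_ring_simps)
    then show ?thesis by (simp add: a_minus_def)
  qed
  then show ?thesis using assms by (simp add: free_ring_minus)
qed

lemma ideal_steinberg_ideal: "ideal (steinberg_ideal R) (tensor_algebra (units_of R))"
proof -
  interpret T: ring "tensor_algebra (units_of R)" by (rule ring_tensor_algebra)
  show ?thesis
    unfolding steinberg_ideal_def
  proof (rule T.genideal_ideal, safe)
    fix a assume "a \<in> Units R" "\<one> \<ominus> a \<in> Units R"
    then show "tensor_class (units_of R) (frag_of [a]) \<otimes>\<^bsub>tensor_algebra (units_of R)\<^esub>
          tensor_class (units_of R) (frag_of [\<one> \<ominus> a]) \<in> carrier (tensor_algebra (units_of R))"
      by (intro T.m_closed) (auto simp: carrier_tensor_algebra)
  qed
qed

lemma ideal_milnor_rel: "ideal (milnor_rel R) (free_ring (Units R))"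
  using ideal_word_rel[OF units_of_mult_closed steinberg_pairs_subset] by (simp add: units_of_carrier)

lemma milnor_rel_keys: "c \<in> milnor_rel R \<Longrightarrow> Poly_Mapping.keys c \<subseteq> lists (Units R)"
  using word_rel_carrier[OF units_of_mult_closed steinberg_pairs_subset]
  by (simp add: units_of_carrier free_ring_simps)

lemma word_rel_mono: "P \<subseteq> Q \<Longrightarrow> c \<in> word_rel G P \<Longrightarrow> c \<in> word_rel G Q" for G :: "('c, 'd) monoid_scheme"
  by (rotate_tac, induction rule: word_rel.induct) (auto intro: word_rel.intros)

text \<open>The Milnor ring is a quotient of a quotient. Here the second ideal is described as the
  image of one ideal of words, so that both quotients can be undone at once.\<close>

lemma steinberg_ideal_eq: "steinberg_ideal R = tensor_class (units_of R) ` milnor_rel R"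
proof
  interpret F: ring "free_ring (Units R)" by (rule ring_free_ring)
  interpret T: ring "tensor_algebra (units_of R)" by (rule ring_tensor_algebra)
  interpret I: ideal "steinberg_ideal R" "tensor_algebra (units_of R)" by (rule ideal_steinberg_ideal)
  interpret h: ring_hom_ring "free_ring (Units R)" "tensor_algebra (units_of R)" "tensor_class (units_of R)"
    by (rule ring_hom_ringI2[OF F.ring_axioms T.ring_axioms tensor_class_hom])
  let ?S = "{tensor_class (units_of R) (frag_of [a]) \<otimes>\<^bsub>tensor_algebra (units_of R)\<^esub>
        tensor_class (units_of R) (frag_of [\<one> \<ominus> a]) | a. a \<in> Units R \<and> \<one> \<ominus> a \<in> Units R}"
  have S: "?S \<subseteq> carrier (tensor_algebra (units_of R))"
  proof safe
    fix a assume "a \<in> Units R" "\<one> \<ominus> a \<in> Units R"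
    then show "tensor_class (units_of R) (frag_of [a]) \<otimes>\<^bsub>tensor_algebra (units_of R)\<^esub>
          tensor_class (units_of R) (frag_of [\<one> \<ominus> a]) \<in> carrier (tensor_algebra (units_of R))"
      by (intro T.m_closed) (auto simp: carrier_tensor_algebra)
  qed
  have "ideal (tensor_class (units_of R) ` milnor_rel R) (tensor_algebra (units_of R))"
    using F.ring_ideal_imp_quot_ideal[OF ideal_tensor_ideal ideal_milnor_rel]
    unfolding tensor_class_def[abs_def] tensor_algebra_def by (simp add: units_of_carrier)
  moreover have "?S \<subseteq> tensor_class (units_of R) ` milnor_rel R"
  proof safe
    fix a assume a: "a \<in> Units R" "\<one> \<ominus> a \<in> Units R"
    then have "frag_of ([] @ a # (\<one> \<ominus> a) # []) \<in> milnor_rel R"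
      by (intro word_rel.pair) (auto simp: steinberg_pairs_def)
    moreover have "tensor_class (units_of R) (frag_of [a]) \<otimes>\<^bsub>tensor_algebra (units_of R)\<^esub>
        tensor_class (units_of R) (frag_of [\<one> \<ominus> a]) = tensor_class (units_of R) (frag_of [a, \<one> \<ominus> a])"
      using h.hom_mult[of "frag_of [a]" "frag_of [\<one> \<ominus> a]"] a by (simp add: free_ring_simps cat_of)
    ultimately show "tensor_class (units_of R) (frag_of [a]) \<otimes>\<^bsub>tensor_algebra (units_of R)\<^esub>
        tensor_class (units_of R) (frag_of [\<one> \<ominus> a]) \<in> tensor_class (units_of R) ` milnor_rel R"
      by auto
  qed
  ultimately show "steinberg_ideal R \<subseteq> tensor_class (units_of R) ` milnor_rel R"
    unfolding steinberg_ideal_def by (intro T.genideal_minimal)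
  have "tensor_class (units_of R) c \<in> steinberg_ideal R" if "c \<in> milnor_rel R" for c
    using that
  proof (induction rule: word_rel.induct)
    case zero
    show ?case using I.zero_closed h.hom_zero by (simp add: free_ring_simps)
  next
    case (diff x y)
    then show ?case
      by (simp add: tensor_class_diff milnor_rel_keys a_minus_def I.a_closed I.a_inv_closed)
  next
    case (mult u v a b)
    then have "frag_of (u @ (a \<otimes>\<^bsub>units_of R\<^esub> b) # v) - frag_of (u @ a # v) - frag_of (u @ b # v)
      \<in> word_rel (units_of R) {}" (is "?g \<in> _") by (intro word_rel.mult)
    moreover have "Poly_Mapping.keys ?g \<subseteq> lists (Units R)"
      using milnor_rel_keys word_rel_mono calculation by blast
    ultimately have "tensor_class (units_of R) ?g = tensor_class (units_of R) 0"
      by (subst tensor_class_eq_iff) auto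
    then show ?case using I.zero_closed h.hom_zero by (simp add: free_ring_simps)
  next
    case (pair u v a b)
    then have ab: "a \<in> Units R" "b \<in> Units R" "b = \<one> \<ominus> a" by (auto simp: steinberg_pairs_def)
    have uv: "u \<in> lists (Units R)" "v \<in> lists (Units R)" using pair by (auto simp: units_of_carrier)
    have "?S \<subseteq> steinberg_ideal R" unfolding steinberg_ideal_def by (rule T.genideal_self[OF S])
    then have "tensor_class (units_of R) (frag_of [a]) \<otimes>\<^bsub>tensor_algebra (units_of R)\<^esub>
        tensor_class (units_of R) (frag_of [b]) \<in> steinberg_ideal R" using ab by blast
    note ab' = this
    have uvT: "tensor_class (units_of R) (frag_of u) \<in> carrier (tensor_algebra (units_of R))"
      "tensor_class (units_of R) (frag_of v) \<in> carrier (tensor_algebra (units_of R))"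
      using uv by (auto simp: carrier_tensor_algebra)
    have "tensor_class (units_of R) (frag_of u) \<otimes>\<^bsub>tensor_algebra (units_of R)\<^esub>
       (tensor_class (units_of R) (frag_of [a]) \<otimes>\<^bsub>tensor_algebra (units_of R)\<^esub>
        tensor_class (units_of R) (frag_of [b])) \<otimes>\<^bsub>tensor_algebra (units_of R)\<^esub>
        tensor_class (units_of R) (frag_of v) \<in> steinberg_ideal R"
      by (rule I.I_r_closed[OF I.I_l_closed[OF ab' uvT(1)] uvT(2)])
    moreover have "tensor_class (units_of R) (frag_of (u @ a # b # v)) =
      tensor_class (units_of R) (frag_of u) \<otimes>\<^bsub>tensor_algebra (units_of R)\<^esub>
       (tensor_class (units_of R) (frag_of [a]) \<otimes>\<^bsub>tensor_algebra (units_of R)\<^esub>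
        tensor_class (units_of R) (frag_of [b])) \<otimes>\<^bsub>tensor_algebra (units_of R)\<^esub>
        tensor_class (units_of R) (frag_of v)"
      using uv ab h.hom_mult[of "frag_of [a]" "frag_of [b]"] h.hom_mult[of "frag_of u" "frag_of [a, b]"]
        h.hom_mult[of "frag_of (u @ [a, b])" "frag_of v"]
      by (simp add: free_ring_simps cat_of)
    ultimately show ?case by simp
  qed
  then show "tensor_class (units_of R) ` milnor_rel R \<subseteq> steinberg_ideal R" by auto
qed

lemma tensor_class_in_steinberg_iff:
  assumes "Poly_Mapping.keys c \<subseteq> lists (Units R)"
  shows "tensor_class (units_of R) c \<in> steinberg_ideal R \<longleftrightarrow> c \<in> milnor_rel R"
proof
  assume "tensor_class (units_of R) c \<in> steinberg_ideal R"
  then obtain d where d: "d \<in> milnor_rel R" "tensor_class (units_of R) c = tensor_class (units_of R) d"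
    by (auto simp: steinberg_ideal_eq)
  then have "c - d \<in> milnor_rel R"
    using tensor_class_eq_iff[OF assms milnor_rel_keys] word_rel_mono by blast
  from word_rel_add[OF this d(1)] show "c \<in> milnor_rel R" by simp
qed (auto simp: steinberg_ideal_eq)

text \<open>The working criterion for later sections: equality of cosets of cosets becomes
  membership of a difference of word combinations in an inductively generated set.\<close>

lemma milnor_elem_eq_iff:
  assumes "Poly_Mapping.keys c \<subseteq> lists (Units R)" "Poly_Mapping.keys d \<subseteq> lists (Units R)"
  shows "milnor_elem R c = milnor_elem R d \<longleftrightarrow> c - d \<in> milnor_rel R"
proof -
  interpret T: ring "tensor_algebra (units_of R)" by (rule ring_tensor_algebra)
  have "tensor_class (units_of R) c \<ominus>\<^bsub>tensor_algebra (units_of R)\<^esub> tensor_class (units_of R) d \<in> steinberg_ideal R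
      \<longleftrightarrow> milnor_elem R c = milnor_elem R d"
    unfolding milnor_elem_def milnor_class_def using assms
    by (intro T.quotient_eq_iff_same_a_r_cos[OF ideal_steinberg_ideal]) (auto simp: carrier_tensor_algebra)
  then show ?thesis
    using tensor_class_diff[OF assms] tensor_class_in_steinberg_iff[of "c - d"] assms
    by (simp add: keys_diff_subset)
qed

lemma ring_milnor_ring: "ring (milnor_ring R)"
  unfolding milnor_ring_def by (rule ideal.quotient_is_ring[OF ideal_steinberg_ideal])

lemma milnor_class_hom: "milnor_class R \<in> ring_hom (tensor_algebra (units_of R)) (milnor_ring R)"
  using ideal.rcos_ring_hom[OF ideal_steinberg_ideal]
  unfolding milnor_class_def[abs_def] milnor_ring_def .

lemma milnor_elem_hom: "milnor_elem R \<in> ring_hom (free_ring (Units R)) (milnor_ring R)"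
  using ring_hom_trans[OF tensor_class_hom milnor_class_hom]
  by (simp add: milnor_elem_def[abs_def] comp_def)

lemma milnor_elem_add:
  "\<lbrakk>Poly_Mapping.keys c \<subseteq> lists (Units R); Poly_Mapping.keys d \<subseteq> lists (Units R)\<rbrakk>
    \<Longrightarrow> milnor_elem R c \<oplus>\<^bsub>milnor_ring R\<^esub> milnor_elem R d = milnor_elem R (c + d)"
  using ring_hom_add[OF milnor_elem_hom, of c d] by (simp add: free_ring_simps)

lemma milnor_elem_zero: "milnor_elem R 0 = \<zero>\<^bsub>milnor_ring R\<^esub>"
  using ring_hom_zero[OF milnor_elem_hom ring_free_ring ring_milnor_ring] by (simp add: free_ring_simps)

lemma words_keys: "Poly_Mapping.keys c \<subseteq> words R n \<Longrightarrow> Poly_Mapping.keys c \<subseteq> lists (Units R)"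
  for c :: "'a list \<Rightarrow>\<^sub>0 int"
  by auto

lemma milnor_K_simps:
  shows "carrier (milnor_K n R) = milnor_elem R ` {c. Poly_Mapping.keys c \<subseteq> words R n}"
    and "x \<otimes>\<^bsub>milnor_K n R\<^esub> y = x \<oplus>\<^bsub>milnor_ring R\<^esub> y"
    and "\<one>\<^bsub>milnor_K n R\<^esub> = milnor_elem R 0"
  by (auto simp: milnor_K_def tensor_degree_def milnor_elem_def[symmetric] units_of_carrier milnor_elem_zero
      image_image)

lemma milnor_K_mult:
  "\<lbrakk>Poly_Mapping.keys c \<subseteq> words R n; Poly_Mapping.keys d \<subseteq> words R n\<rbrakk>
    \<Longrightarrow> milnor_elem R c \<otimes>\<^bsub>milnor_K n R\<^esub> milnor_elem R d = milnor_elem R (c + d)"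
  using milnor_elem_add[OF words_keys words_keys] by (simp add: milnor_K_simps)

lemma comm_group_milnor_K: "comm_group (milnor_K n R)"
proof -
  interpret M: ring "milnor_ring R" by (rule ring_milnor_ring)
  have cl: "x \<in> carrier (milnor_ring R)" if "x \<in> carrier (milnor_K n R)" for x
    using that ring_hom_closed[OF milnor_elem_hom] words_keys
    by (auto simp: milnor_K_simps free_ring_simps)
  show ?thesis
  proof (intro comm_groupI)
    fix x y assume "x \<in> carrier (milnor_K n R)" "y \<in> carrier (milnor_K n R)"
    then obtain c d where "x = milnor_elem R c" "y = milnor_elem R d"
      "Poly_Mapping.keys c \<subseteq> words R n" "Poly_Mapping.keys d \<subseteq> words R n"
      by (auto simp: milnor_K_simps)
    then show "x \<otimes>\<^bsub>milnor_K n R\<^esub> y \<in> carrier (milnor_K n R)"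
      using milnor_K_mult[of c n d] keys_add_subset[of c "words R n" d] by (auto simp: milnor_K_simps(1))
  next
    fix x assume "x \<in> carrier (milnor_K n R)"
    then obtain c where c: "x = milnor_elem R c" "Poly_Mapping.keys c \<subseteq> words R n"
      by (auto simp: milnor_K_simps)
    then show "\<exists>y\<in>carrier (milnor_K n R). y \<otimes>\<^bsub>milnor_K n R\<^esub> x = \<one>\<^bsub>milnor_K n R\<^esub>"
      using milnor_K_mult[of "- c" n c]
      by (intro bexI[of _ "milnor_elem R (- c)"]) (auto simp: milnor_K_simps(1,3) keys_minus)
  next
    show "\<one>\<^bsub>milnor_K n R\<^esub> \<in> carrier (milnor_K n R)"
      unfolding milnor_K_simps(1,3) by (rule imageI) simp
  next
    fix x y z assume "x \<in> carrier (milnor_K n R)" "y \<in> carrier (milnor_K n R)" "z \<in> carrier (milnor_K n R)"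
    then show "x \<otimes>\<^bsub>milnor_K n R\<^esub> y \<otimes>\<^bsub>milnor_K n R\<^esub> z = x \<otimes>\<^bsub>milnor_K n R\<^esub> (y \<otimes>\<^bsub>milnor_K n R\<^esub> z)"
      unfolding milnor_K_simps(2) by (intro M.a_assoc cl)
  next
    fix x y assume "x \<in> carrier (milnor_K n R)" "y \<in> carrier (milnor_K n R)"
    then show "x \<otimes>\<^bsub>milnor_K n R\<^esub> y = y \<otimes>\<^bsub>milnor_K n R\<^esub> x"
      unfolding milnor_K_simps(2) by (intro M.a_comm cl)
  next
    fix x assume "x \<in> carrier (milnor_K n R)"
    then show "\<one>\<^bsub>milnor_K n R\<^esub> \<otimes>\<^bsub>milnor_K n R\<^esub> x = x"
      unfolding milnor_K_simps(2,3) milnor_elem_zero by (intro M.l_zero cl)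
  qed
qed

lemma milnor_K_inv:
  assumes "Poly_Mapping.keys c \<subseteq> words R n"
  shows "inv\<^bsub>milnor_K n R\<^esub> (milnor_elem R c) = milnor_elem R (- c)"
proof -
  interpret K: comm_group "milnor_K n R" by (rule comm_group_milnor_K)
  show ?thesis
    using assms milnor_K_mult[of "- c" n c]
    by (intro K.inv_equality) (auto simp: milnor_K_simps(1,3) keys_minus)
qed

end

lemma frag_map_keys:
  assumes "\<And>a. a \<in> A \<Longrightarrow> f a \<in> B" "Poly_Mapping.keys c \<subseteq> lists A"
  shows "Poly_Mapping.keys (frag_map f c) \<subseteq> lists B"
proof -
  have "Poly_Mapping.keys (frag_map f c) \<subseteq> (\<Union>w \<in> Poly_Mapping.keys c. {map f w})"
    using keys_frag_extend[of "\<lambda>w. frag_of (map f w)" c] by simp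
  also have "\<dots> \<subseteq> lists B" using assms by force
  finally show ?thesis .
qed

lemma frag_map_words:
  assumes "\<And>a. a \<in> Units R \<Longrightarrow> f a \<in> Units S" "Poly_Mapping.keys c \<subseteq> words R n"
  shows "Poly_Mapping.keys (frag_map f c) \<subseteq> words S n"
proof -
  have "Poly_Mapping.keys (frag_map f c) \<subseteq> (\<Union>w \<in> Poly_Mapping.keys c. {map f w})"
    using keys_frag_extend[of "\<lambda>w. frag_of (map f w)" c] by simp
  also have "\<dots> \<subseteq> words S n" using assms by force
  finally show ?thesis .
qed

lemma frag_map_comp: "frag_map f (frag_map g c) = frag_map (f \<circ> g) c"
  by (induction c rule: frag_induct) (simp_all add: frag_extend_diff comp_def)

lemma frag_map_cong:
  "(\<And>a. a \<in> A \<Longrightarrow> f a = g a) \<Longrightarrow> Poly_Mapping.keys c \<subseteq> lists A \<Longrightarrow> frag_map f c = frag_map g c"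
  by (intro frag_extend_eq arg_cong[where f = frag_of] map_cong) auto

text \<open>A multiplicative map on units that preserves the Steinberg relation, without having to come
  from a ring homomorphism.\<close>

definition symbol_map :: "('a, 'b) ring_scheme \<Rightarrow> ('c, 'd) ring_scheme \<Rightarrow> ('a \<Rightarrow> 'c) \<Rightarrow> bool" where
  "symbol_map R S f \<longleftrightarrow> (\<forall>a \<in> Units R. f a \<in> Units S) \<and>
     (\<forall>a \<in> Units R. \<forall>b \<in> Units R. f (a \<otimes>\<^bsub>R\<^esub> b) = f a \<otimes>\<^bsub>S\<^esub> f b) \<and>
     (\<forall>a \<in> Units R. \<forall>u v. \<one>\<^bsub>R\<^esub> \<ominus>\<^bsub>R\<^esub> a \<in> Units R \<longrightarrow> u \<in> lists (Units S) \<longrightarrow> v \<in> lists (Units S) \<longrightarrow>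
        frag_of (u @ f a # f (\<one>\<^bsub>R\<^esub> \<ominus>\<^bsub>R\<^esub> a) # v) \<in> milnor_rel S)"

lemma symbol_map_milnor_rel:
  assumes "symbol_map R S f" "c \<in> milnor_rel R" shows "frag_map f c \<in> milnor_rel S"
proof (rule frag_map_word_rel[OF _ _ _ assms(2)])
  fix a b u v assume "(a, b) \<in> steinberg_pairs R" "u \<in> lists (carrier (units_of S))" "v \<in> lists (carrier (units_of S))"
  then show "frag_of (u @ f a # f b # v) \<in> milnor_rel S"
    using assms(1) by (auto simp: symbol_map_def steinberg_pairs_def units_of_carrier)
qed (use assms(1) in \<open>auto simp: symbol_map_def units_of_carrier units_of_mult\<close>)

lemma the_elem_image:
  assumes "x \<in> X" "\<And>e. e \<in> X \<Longrightarrow> h e = y" shows "the_elem (h ` X) = y"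
proof -
  have "h ` X = {y}" using assms by auto
  then show ?thesis by simp
qed

text \<open>\<open>milnor_map\<close> applies \<open>the_elem\<close> to images of cosets, so
  independence of the representative is proved on two levels, for tensor classes and for Milnor
  classes. Afterwards the map is simply computed letter by letter.\<close>

lemma symbol_map_milnor_map:
  assumes R: "ring R" and S: "ring S" and f: "symbol_map R S f"
    and c: "Poly_Mapping.keys c \<subseteq> lists (Units R)"
  shows "milnor_map S f (milnor_elem R c) = milnor_elem S (frag_map f c)"
proof -
  interpret R: ring R by fact
  interpret S: ring S by fact
  interpret T: ring "tensor_algebra (units_of R)" by (rule R.ring_tensor_algebra)
  interpret I: ideal "steinberg_ideal R" "tensor_algebra (units_of R)" by (rule R.ideal_steinberg_ideal)
  interpret F: ring "free_ring (Units R)" by (rule ring_free_ring)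
  interpret TI: ideal "tensor_ideal (units_of R)" "free_ring (Units R)" by (rule R.ideal_tensor_ideal)
  have fU: "\<And>a. a \<in> Units R \<Longrightarrow> f a \<in> Units S" using f by (simp add: symbol_map_def)
  have fk: "Poly_Mapping.keys (frag_map f d) \<subseteq> lists (Units S)" if "Poly_Mapping.keys d \<subseteq> lists (Units R)" for d
    using frag_map_keys[OF fU that] .
  have ft: "frag_map f d \<in> word_rel (units_of S) {}" if "d \<in> word_rel (units_of R) {}" for d
    using that f by (intro frag_map_word_rel[where P = "{}" and G = "units_of R"])
      (auto simp: symbol_map_def units_of_carrier units_of_mult)
  have tm: "tensor_map (units_of S) f (tensor_class (units_of R) d) = tensor_class (units_of S) (frag_map f d)"
    if d: "Poly_Mapping.keys d \<subseteq> lists (Units R)" for d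
    unfolding tensor_map_def
  proof (rule the_elem_image)
    show "d \<in> tensor_class (units_of R) d"
      using TI.a_rcos_self[of d] d by (simp add: tensor_class_def units_of_carrier free_ring_simps)
  next
    fix e assume e: "e \<in> tensor_class (units_of R) d"
    then obtain g where g: "g \<in> tensor_ideal (units_of R)" "e = g + d"
      by (auto simp: tensor_class_def a_r_coset_def' units_of_carrier free_ring_simps)
    have gk: "Poly_Mapping.keys g \<subseteq> lists (Units R)"
      using TI.Icarr[OF g(1)] by (simp add: free_ring_simps)
    have "frag_map f g \<in> word_rel (units_of S) {}"
    proof (rule ft)
      have "tensor_ideal (units_of R) = word_rel (units_of R) {}"
        by (rule tensor_ideal_eq) (rule R.units_of_mult_closed)
      then show "g \<in> word_rel (units_of R) {}" using g(1) by simp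
    qed
    then show "tensor_class (units_of S) (frag_map f e) = tensor_class (units_of S) (frag_map f d)"
      unfolding S.tensor_class_eq_iff[OF fk fk, OF keys_add_subset[OF gk d, folded g(2)] d]
      by (simp add: g(2) frag_extend_add)
  qed
  show ?thesis
    unfolding milnor_map_def
  proof (rule the_elem_image)
    have tc: "tensor_class (units_of R) c \<in> carrier (tensor_algebra (units_of R))"
      using c by (auto simp: R.carrier_tensor_algebra)
    show "tensor_class (units_of R) c \<in> milnor_elem R c"
      using I.a_rcos_self[OF tc] by (simp add: milnor_elem_def milnor_class_def)
  next
    fix x assume "x \<in> milnor_elem R c"
    then obtain i where i: "i \<in> steinberg_ideal R" "x = i \<oplus>\<^bsub>tensor_algebra (units_of R)\<^esub> tensor_class (units_of R) c"
      by (auto simp: milnor_elem_def milnor_class_def a_r_coset_def')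
    then obtain d where d: "d \<in> milnor_rel R" "i = tensor_class (units_of R) d"
      by (auto simp: R.steinberg_ideal_eq)
    have dk: "Poly_Mapping.keys d \<subseteq> lists (Units R)" by (rule R.milnor_rel_keys[OF d(1)])
    have "tensor_class (units_of R) (d + c) =
        tensor_class (units_of R) d \<oplus>\<^bsub>tensor_algebra (units_of R)\<^esub> tensor_class (units_of R) c"
      using ring_hom_add[OF R.tensor_class_hom, of d c] dk c by (simp add: free_ring_simps)
    then have "x = tensor_class (units_of R) (d + c)" by (simp add: i d)
    then have "milnor_class S (tensor_map (units_of S) f x) = milnor_elem S (frag_map f (d + c))"
      using tm[OF keys_add_subset[OF dk c]] by (simp add: milnor_elem_def)
    also have "\<dots> = milnor_elem S (frag_map f c)"
      unfolding S.milnor_elem_eq_iff[OF fk[OF keys_add_subset[OF dk c]] fk[OF c]]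
      using symbol_map_milnor_rel[OF f d(1)] by (simp add: frag_extend_add)
    finally show "milnor_class S (tensor_map (units_of S) f x) = milnor_elem S (frag_map f c)" .
  qed
qed

lemma symbol_map_ring_hom:
  assumes R: "ring R" and S: "ring S" and f: "f \<in> ring_hom R S"
  shows "symbol_map R S f"
proof -
  interpret h: ring_hom_ring R S f by (rule ring_hom_ringI2[OF R S f])
  have U: "f a \<in> Units S" if "a \<in> Units R" for a
  proof -
    have c: "a \<in> carrier R" "inv\<^bsub>R\<^esub> a \<in> carrier R"
      using h.R.Units_closed[OF that] h.R.Units_inv_closed[OF that] by auto
    have "f a \<otimes>\<^bsub>S\<^esub> f (inv\<^bsub>R\<^esub> a) = \<one>\<^bsub>S\<^esub>" "f (inv\<^bsub>R\<^esub> a) \<otimes>\<^bsub>S\<^esub> f a = \<one>\<^bsub>S\<^esub>"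
      using h.hom_mult[OF c] h.hom_mult[OF c(2) c(1)] that by simp_all
    moreover have "f a \<in> carrier S" "f (inv\<^bsub>R\<^esub> a) \<in> carrier S" using c by simp_all
    ultimately show ?thesis unfolding Units_def by blast
  qed
  have "frag_of (u @ f a # f (\<one>\<^bsub>R\<^esub> \<ominus>\<^bsub>R\<^esub> a) # v) \<in> milnor_rel S"
    if "a \<in> Units R" "\<one>\<^bsub>R\<^esub> \<ominus>\<^bsub>R\<^esub> a \<in> Units R" "u \<in> lists (Units S)" "v \<in> lists (Units S)" for a u v
  proof (rule word_rel.pair)
    have "f (\<one>\<^bsub>R\<^esub> \<ominus>\<^bsub>R\<^esub> a) = \<one>\<^bsub>S\<^esub> \<ominus>\<^bsub>S\<^esub> f a"
      using that(1) by (simp add: a_minus_def h.R.Units_closed)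
    then show "(f a, f (\<one>\<^bsub>R\<^esub> \<ominus>\<^bsub>R\<^esub> a)) \<in> steinberg_pairs S"
      using U[OF that(1)] U[OF that(2)] by (auto simp: steinberg_pairs_def)
  qed (use that in \<open>auto simp: units_of_carrier\<close>)
  then show ?thesis using U by (auto simp: symbol_map_def h.R.Units_closed)
qed

section \<open>Localizations and thickenings of a field\<close>

locale mult_set = cring R for R (structure) + fixes S :: "'a set"
  assumes S_carrier: "S \<subseteq> carrier R" and one_S: "\<one> \<in> S"
    and mult_S: "\<lbrakk>s \<in> S; t \<in> S\<rbrakk> \<Longrightarrow> s \<otimes> t \<in> S"
begin

lemma S_closed: "s \<in> S \<Longrightarrow> s \<in> carrier R"
  using S_carrier by auto

context
  notes S_closed [simp] one_S [simp] mult_S [simp]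
begin

lemma loc_rel_iff:
  "((a, s), (b, t)) \<in> loc_rel R S \<longleftrightarrow> a \<in> carrier R \<and> s \<in> S \<and> b \<in> carrier R \<and> t \<in> S \<and>
     (\<exists>u\<in>S. u \<otimes> (t \<otimes> a) = u \<otimes> (s \<otimes> b))"
  by (simp add: loc_rel_def)

lemma equiv_loc_rel: "equiv (carrier R \<times> S) (loc_rel R S)"
proof (rule equivI)
  show "loc_rel R S \<subseteq> (carrier R \<times> S) \<times> carrier R \<times> S" by (auto simp: loc_rel_def)
  show "refl_on (carrier R \<times> S) (loc_rel R S)"
  proof (rule refl_onI)
    fix x assume "x \<in> carrier R \<times> S"
    then show "(x, x) \<in> loc_rel R S"
      unfolding loc_rel_def by (auto intro: one_S)
  qed
  show "sym (loc_rel R S)"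
  proof (rule symI)
    fix x y assume "(x, y) \<in> loc_rel R S"
    then obtain a s b t u where xy: "x = (a, s)" "y = (b, t)"
      and cl: "a \<in> carrier R" "s \<in> S" "b \<in> carrier R" "t \<in> S" "u \<in> S"
      and e: "u \<otimes> (t \<otimes> a) = u \<otimes> (s \<otimes> b)"
      by (auto simp: loc_rel_def)
    show "(y, x) \<in> loc_rel R S"
      using cl e[symmetric] unfolding xy loc_rel_iff by (intro conjI bexI[of _ u])
  qed
  show "trans (loc_rel R S)"
  proof (rule transI)
    fix x y z assume "(x, y) \<in> loc_rel R S" "(y, z) \<in> loc_rel R S"
    then obtain a s b t c r u v where xyz: "x = (a, s)" "y = (b, t)" "z = (c, r)"
      and cl: "a \<in> carrier R" "s \<in> S" "b \<in> carrier R" "t \<in> S" "c \<in> carrier R" "r \<in> S" "u \<in> S" "v \<in> S"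
      and e: "u \<otimes> (t \<otimes> a) = u \<otimes> (s \<otimes> b)" "v \<otimes> (r \<otimes> b) = v \<otimes> (t \<otimes> c)"
      by (auto simp: loc_rel_def)
    have "(u \<otimes> v \<otimes> t) \<otimes> (r \<otimes> a) = (v \<otimes> r) \<otimes> (u \<otimes> (t \<otimes> a))"
      using cl by (simp add: m_ac)
    also have "\<dots> = (u \<otimes> s) \<otimes> (v \<otimes> (r \<otimes> b))"
      unfolding e(1) using cl by (simp add: m_ac)
    also have "\<dots> = (u \<otimes> v \<otimes> t) \<otimes> (s \<otimes> c)"
      unfolding e(2) using cl by (simp add: m_ac)
    finally show "(x, z) \<in> loc_rel R S"
      using cl unfolding xyz loc_rel_iff by (intro conjI bexI[of _ "u \<otimes> v \<otimes> t"]) auto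
  qed
qed

lemma loc_frac_eq_iff:
  assumes "a \<in> carrier R" "s \<in> S" "b \<in> carrier R" "t \<in> S"
  shows "loc_frac R S a s = loc_frac R S b t \<longleftrightarrow> (\<exists>u\<in>S. u \<otimes> (t \<otimes> a) = u \<otimes> (s \<otimes> b))"
  using eq_equiv_class_iff[OF equiv_loc_rel, of "(a, s)" "(b, t)"] assms
  by (simp add: loc_frac_def loc_rel_iff)

lemma loc_frac_eqI:
  assumes "a \<in> carrier R" "s \<in> S" "b \<in> carrier R" "t \<in> S" "t \<otimes> a = s \<otimes> b"
  shows "loc_frac R S a s = loc_frac R S b t"
  unfolding loc_frac_eq_iff[OF assms(1-4)] by (rule bexI[of _ \<one>]) (simp_all add: assms(5))

lemma loc_frac_self: "\<lbrakk>a \<in> carrier R; s \<in> S\<rbrakk> \<Longrightarrow> (a, s) \<in> loc_frac R S a s"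
  unfolding loc_frac_def by (rule equiv_class_self[OF equiv_loc_rel]) simp

lemma loc_frac_mem:
  assumes "a \<in> carrier R" "s \<in> S" "(b, t) \<in> loc_frac R S a s"
  shows "b \<in> carrier R" "t \<in> S" "loc_frac R S b t = loc_frac R S a s"
proof -
  have r: "((a, s), (b, t)) \<in> loc_rel R S" using assms by (simp add: loc_frac_def)
  then show "b \<in> carrier R" "t \<in> S" by (simp_all add: loc_rel_iff)
  show "loc_frac R S b t = loc_frac R S a s"
    using equiv_class_eq[OF equiv_loc_rel r] by (simp add: loc_frac_def)
qed

lemma carrier_localization:
  "carrier (localization R S) = {loc_frac R S a s | a s. a \<in> carrier R \<and> s \<in> S}"
  unfolding localization_def quotient_def loc_frac_def by auto

lemma loc_frac_closed [simp]: "\<lbrakk>a \<in> carrier R; s \<in> S\<rbrakk> \<Longrightarrow> loc_frac R S a s \<in> carrier (localization R S)"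
  by (auto simp: carrier_localization)

text \<open>Operations on fractions are unions over all representatives; this evaluates such a union
  once every pair of representatives is known to give the same class.\<close>

lemma UN_const2:
  assumes "x \<in> X" "y \<in> Y" "\<And>a s b t. (a, s) \<in> X \<Longrightarrow> (b, t) \<in> Y \<Longrightarrow> f a s b t = c"
  shows "(\<Union>(a, s)\<in>X. \<Union>(b, t)\<in>Y. f a s b t) = c"
proof -
  have "(case q of (b, t) \<Rightarrow> f a s b t) = c" if "(a, s) \<in> X" "q \<in> Y" for a s q
    using assms(3)[of a s "fst q" "snd q"] that by (simp add: case_prod_unfold)
  then have "(\<Union>(b, t)\<in>Y. f a s b t) = c" if "(a, s) \<in> X" for a s
    using that assms(2) by blast
  then have "(case p of (a, s) \<Rightarrow> \<Union>(b, t)\<in>Y. f a s b t) = c" if "p \<in> X" for p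
    using that by (cases p) simp
  then show ?thesis using assms(1) by blast
qed

lemma loc_mult:
  assumes "a \<in> carrier R" "s \<in> S" "b \<in> carrier R" "t \<in> S"
  shows "loc_frac R S a s \<otimes>\<^bsub>localization R S\<^esub> loc_frac R S b t = loc_frac R S (a \<otimes> b) (s \<otimes> t)"
proof -
  have "loc_frac R S (a' \<otimes> b') (s' \<otimes> t') = loc_frac R S (a \<otimes> b) (s \<otimes> t)"
    if x: "(a', s') \<in> loc_frac R S a s" and y: "(b', t') \<in> loc_frac R S b t" for a' s' b' t'
  proof -
    note X = loc_frac_mem[OF assms(1,2) x] and Y = loc_frac_mem[OF assms(3,4) y]
    obtain u v where uv: "u \<in> S" "v \<in> S" "u \<otimes> (s \<otimes> a') = u \<otimes> (s' \<otimes> a)" "v \<otimes> (t \<otimes> b') = v \<otimes> (t' \<otimes> b)"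
      using X Y assms loc_frac_eq_iff by metis
    have "(u \<otimes> v) \<otimes> ((s \<otimes> t) \<otimes> (a' \<otimes> b')) = (u \<otimes> (s \<otimes> a')) \<otimes> (v \<otimes> (t \<otimes> b'))"
      using uv(1,2) X(1,2) Y(1,2) assms by (simp add: m_ac)
    also have "\<dots> = (u \<otimes> v) \<otimes> ((s' \<otimes> t') \<otimes> (a \<otimes> b))"
      unfolding uv(3,4) using uv(1,2) X(1,2) Y(1,2) assms by (simp add: m_ac)
    finally have e: "(u \<otimes> v) \<otimes> ((s \<otimes> t) \<otimes> (a' \<otimes> b')) = (u \<otimes> v) \<otimes> ((s' \<otimes> t') \<otimes> (a \<otimes> b))" .
    show ?thesis
    proof (subst loc_frac_eq_iff)
      show "\<exists>u\<in>S. u \<otimes> ((s \<otimes> t) \<otimes> (a' \<otimes> b')) = u \<otimes> ((s' \<otimes> t') \<otimes> (a \<otimes> b))"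
        using e mult_S[OF uv(1,2)] by (rule bexI)
    qed (use X(1,2) Y(1,2) assms in auto)
  qed
  then show ?thesis
    unfolding localization_def monoid.simps
    by (intro UN_const2[OF loc_frac_self[OF assms(1,2)] loc_frac_self[OF assms(3,4)]])
qed

lemma loc_add:
  assumes "a \<in> carrier R" "s \<in> S" "b \<in> carrier R" "t \<in> S"
  shows "loc_frac R S a s \<oplus>\<^bsub>localization R S\<^esub> loc_frac R S b t
    = loc_frac R S ((a \<otimes> t) \<oplus> (b \<otimes> s)) (s \<otimes> t)"
proof -
  have "loc_frac R S ((a' \<otimes> t') \<oplus> (b' \<otimes> s')) (s' \<otimes> t') = loc_frac R S ((a \<otimes> t) \<oplus> (b \<otimes> s)) (s \<otimes> t)"
    if x: "(a', s') \<in> loc_frac R S a s" and y: "(b', t') \<in> loc_frac R S b t" for a' s' b' t'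
  proof -
    note X = loc_frac_mem[OF assms(1,2) x] and Y = loc_frac_mem[OF assms(3,4) y]
    obtain u v where uv: "u \<in> S" "v \<in> S" "u \<otimes> (s \<otimes> a') = u \<otimes> (s' \<otimes> a)" "v \<otimes> (t \<otimes> b') = v \<otimes> (t' \<otimes> b)"
      using X Y assms loc_frac_eq_iff by metis
    have "(u \<otimes> v) \<otimes> ((s \<otimes> t) \<otimes> ((a' \<otimes> t') \<oplus> (b' \<otimes> s'))) =
        (v \<otimes> t \<otimes> t') \<otimes> (u \<otimes> (s \<otimes> a')) \<oplus> (u \<otimes> s \<otimes> s') \<otimes> (v \<otimes> (t \<otimes> b'))"
      using uv(1,2) X(1,2) Y(1,2) assms by (simp add: m_ac r_distr)
    also have "\<dots> = (u \<otimes> v) \<otimes> ((s' \<otimes> t') \<otimes> ((a \<otimes> t) \<oplus> (b \<otimes> s)))"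
      unfolding uv(3,4) using uv(1,2) X(1,2) Y(1,2) assms by (simp add: m_ac r_distr)
    finally have e: "(u \<otimes> v) \<otimes> ((s \<otimes> t) \<otimes> ((a' \<otimes> t') \<oplus> (b' \<otimes> s'))) = (u \<otimes> v) \<otimes> ((s' \<otimes> t') \<otimes> ((a \<otimes> t) \<oplus> (b \<otimes> s)))" .
    show ?thesis
    proof (subst loc_frac_eq_iff)
      show "\<exists>u\<in>S. u \<otimes> ((s \<otimes> t) \<otimes> ((a' \<otimes> t') \<oplus> (b' \<otimes> s'))) = u \<otimes> ((s' \<otimes> t') \<otimes> ((a \<otimes> t) \<oplus> (b \<otimes> s)))"
        using e mult_S[OF uv(1,2)] by (rule bexI)
    qed (use X(1,2) Y(1,2) assms in auto)
  qed
  then show ?thesis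
    unfolding localization_def ring_record_simps
    by (intro UN_const2[OF loc_frac_self[OF assms(1,2)] loc_frac_self[OF assms(3,4)]])
qed

lemma loc_one: "\<one>\<^bsub>localization R S\<^esub> = loc_frac R S \<one> \<one>"
  and loc_zero: "\<zero>\<^bsub>localization R S\<^esub> = loc_frac R S \<zero> \<one>"
  by (simp_all add: localization_def)

lemma cring_localization: "cring (localization R S)"
proof (intro cringI abelian_groupI comm_monoidI)
  fix x assume "x \<in> carrier (localization R S)"
  then obtain a s where x: "x = loc_frac R S a s" "a \<in> carrier R" "s \<in> S"
    by (auto simp: carrier_localization)
  show "\<exists>y\<in>carrier (localization R S). y \<oplus>\<^bsub>localization R S\<^esub> x = \<zero>\<^bsub>localization R S\<^esub>"
  proof (rule bexI[of _ "loc_frac R S (\<ominus> a) s"])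
    show "loc_frac R S (\<ominus> a) s \<oplus>\<^bsub>localization R S\<^esub> x = \<zero>\<^bsub>localization R S\<^esub>"
      using x unfolding loc_zero by (simp add: loc_add l_minus l_neg, intro loc_frac_eqI) auto
  qed (use x in auto)
next
  fix x y assume "x \<in> carrier (localization R S)" "y \<in> carrier (localization R S)"
  then obtain a s b t where x: "x = loc_frac R S a s" "a \<in> carrier R" "s \<in> S"
    and y: "y = loc_frac R S b t" "b \<in> carrier R" "t \<in> S"
    by (auto simp: carrier_localization)
  show "x \<oplus>\<^bsub>localization R S\<^esub> y \<in> carrier (localization R S)"
    "x \<otimes>\<^bsub>localization R S\<^esub> y \<in> carrier (localization R S)"
    using x y by (simp_all add: loc_add loc_mult)
  show "x \<otimes>\<^bsub>localization R S\<^esub> y = y \<otimes>\<^bsub>localization R S\<^esub> x"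
    using x y by (simp add: loc_mult m_comm)
  show "x \<oplus>\<^bsub>localization R S\<^esub> y = y \<oplus>\<^bsub>localization R S\<^esub> x"
    using x y a_comm[of "a \<otimes> t" "b \<otimes> s"] m_comm[of s t] by (simp add: loc_add)
next
  fix x y z assume "x \<in> carrier (localization R S)" "y \<in> carrier (localization R S)"
    "z \<in> carrier (localization R S)"
  then obtain a s b t c r where x: "x = loc_frac R S a s" "a \<in> carrier R" "s \<in> S"
    and y: "y = loc_frac R S b t" "b \<in> carrier R" "t \<in> S"
    and z: "z = loc_frac R S c r" "c \<in> carrier R" "r \<in> S"
    by (auto simp: carrier_localization)
  show "x \<otimes>\<^bsub>localization R S\<^esub> y \<otimes>\<^bsub>localization R S\<^esub> z
      = x \<otimes>\<^bsub>localization R S\<^esub> (y \<otimes>\<^bsub>localization R S\<^esub> z)"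
    using x y z by (simp add: loc_mult m_assoc)
  have "(a \<otimes> t \<oplus> b \<otimes> s) \<otimes> r \<oplus> c \<otimes> (s \<otimes> t) = a \<otimes> (t \<otimes> r) \<oplus> (b \<otimes> r \<oplus> c \<otimes> t) \<otimes> s"
    using x y z by (simp add: l_distr r_distr m_ac a_assoc)
  then show "x \<oplus>\<^bsub>localization R S\<^esub> y \<oplus>\<^bsub>localization R S\<^esub> z
      = x \<oplus>\<^bsub>localization R S\<^esub> (y \<oplus>\<^bsub>localization R S\<^esub> z)"
    using x y z by (simp add: loc_add m_assoc)
  have "loc_frac R S ((a \<otimes> t \<oplus> b \<otimes> s) \<otimes> c) (s \<otimes> t \<otimes> r) =
      loc_frac R S (a \<otimes> c \<otimes> (t \<otimes> r) \<oplus> b \<otimes> c \<otimes> (s \<otimes> r)) (s \<otimes> r \<otimes> (t \<otimes> r))"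
    using x y z by (intro loc_frac_eqI) (simp_all add: l_distr r_distr m_ac)
  then show "(x \<oplus>\<^bsub>localization R S\<^esub> y) \<otimes>\<^bsub>localization R S\<^esub> z
      = x \<otimes>\<^bsub>localization R S\<^esub> z \<oplus>\<^bsub>localization R S\<^esub> y \<otimes>\<^bsub>localization R S\<^esub> z"
    using x y z by (simp add: loc_add loc_mult)
next
  show "\<zero>\<^bsub>localization R S\<^esub> \<in> carrier (localization R S)"
    "\<one>\<^bsub>localization R S\<^esub> \<in> carrier (localization R S)"
    by (simp_all add: loc_one loc_zero)
qed (auto simp: carrier_localization loc_add loc_mult loc_one loc_zero)

lemma loc_frac_cancel:
  "\<lbrakk>a \<in> carrier R; s \<in> S; u \<in> S\<rbrakk> \<Longrightarrow> loc_frac R S (u \<otimes> a) (u \<otimes> s) = loc_frac R S a s"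
  by (intro loc_frac_eqI) (auto simp: m_ac)

lemma loc_frac_unit: "\<lbrakk>a \<in> S; s \<in> S\<rbrakk> \<Longrightarrow> loc_frac R S a s \<in> Units (localization R S)"
  unfolding Units_def mem_Collect_eq loc_one
  by (intro conjI bexI[of _ "loc_frac R S s a"]) (simp_all add: loc_mult, (intro loc_frac_eqI; simp add: m_comm)+)

lemma loc_minus:
  assumes "a \<in> carrier R" "s \<in> S" "b \<in> carrier R" "t \<in> S"
  shows "loc_frac R S a s \<ominus>\<^bsub>localization R S\<^esub> loc_frac R S b t
    = loc_frac R S ((a \<otimes> t) \<ominus> (b \<otimes> s)) (s \<otimes> t)"
proof -
  interpret L: cring "localization R S" by (rule cring_localization)
  have "loc_frac R S (\<ominus> b) t \<oplus>\<^bsub>localization R S\<^esub> loc_frac R S b t = \<zero>\<^bsub>localization R S\<^esub>"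
    using assms unfolding loc_zero by (simp add: loc_add l_minus l_neg, intro loc_frac_eqI) auto
  then have "\<ominus>\<^bsub>localization R S\<^esub> loc_frac R S b t = loc_frac R S (\<ominus> b) t"
    using assms by (intro L.minus_equality) auto
  then show ?thesis using assms by (simp add: L.minus_eq loc_add l_minus minus_eq)
qed

end

end

lemma loc_map_frac:
  assumes R: "mult_set R S" and R': "mult_set R' S'" and f: "f \<in> ring_hom R R'" and S: "f ` S \<subseteq> S'"
    and a: "a \<in> carrier R" "s \<in> S"
  shows "loc_map R' S' f (loc_frac R S a s) = loc_frac R' S' (f a) (f s)"
proof -
  interpret R: mult_set R S by fact
  interpret R': mult_set R' S' by fact
  note [simp] = R.S_closed R.one_S R.mult_S R'.S_closed R'.one_S R'.mult_S
  note fc = ring_hom_closed[OF f]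
  show ?thesis
    unfolding loc_map_def
  proof (rule the_elem_image[where h = "\<lambda>(a, s). loc_frac R' S' (f a) (f s)"])
    show "(a, s) \<in> loc_frac R S a s" by (rule R.loc_frac_self[OF a])
  next
    fix e assume e: "e \<in> loc_frac R S a s"
    obtain b t where bt: "e = (b, t)" by (cases e)
    have b: "b \<in> carrier R" "t \<in> S" "loc_frac R S b t = loc_frac R S a s"
      using R.loc_frac_mem[OF a] e bt by auto
    then obtain u where u: "u \<in> S" "u \<otimes>\<^bsub>R\<^esub> (s \<otimes>\<^bsub>R\<^esub> b) = u \<otimes>\<^bsub>R\<^esub> (t \<otimes>\<^bsub>R\<^esub> a)"
      using a R.loc_frac_eq_iff by metis
    then have "f u \<otimes>\<^bsub>R'\<^esub> (f s \<otimes>\<^bsub>R'\<^esub> f b) = f u \<otimes>\<^bsub>R'\<^esub> (f t \<otimes>\<^bsub>R'\<^esub> f a)"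
      using ring_hom_mult[OF f] a b by (metis R.S_closed R.m_closed)
    then show "(case e of (a, s) \<Rightarrow> loc_frac R' S' (f a) (f s)) = loc_frac R' S' (f a) (f s)"
      unfolding bt prod.case using a b u S fc
      by (subst R'.loc_frac_eq_iff) (auto intro!: bexI[of _ "f u"])
  qed
qed

lemma loc_map_hom:
  assumes R: "mult_set R S" and R': "mult_set R' S'" and f: "f \<in> ring_hom R R'" and S: "f ` S \<subseteq> S'"
  shows "loc_map R' S' f \<in> ring_hom (localization R S) (localization R' S')"
proof -
  interpret R: mult_set R S by fact
  interpret R': mult_set R' S' by fact
  note [simp] = R.S_closed R.one_S R.mult_S R'.S_closed R'.one_S R'.mult_S
  note fs = loc_map_frac[OF assms] ring_hom_closed[OF f] ring_hom_mult[OF f] ring_hom_add[OF f] ring_hom_one[OF f]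
  have S': "f s \<in> S'" if "s \<in> S" for s using that S by auto
  show ?thesis
    by (intro ring_hom_memI)
      (auto simp: R.carrier_localization R.loc_mult R.loc_add R'.loc_mult R'.loc_add R.loc_one R'.loc_one fs S'
        simp del: ring_hom_closed)
qed

section \<open>Polynomial rings: coefficientwise maps and substitutions of powers of the
  variable\<close>

definition up_map :: "('a \<Rightarrow> 'c) \<Rightarrow> (nat \<Rightarrow> 'a) \<Rightarrow> nat \<Rightarrow> 'c" where
  "up_map f p = (\<lambda>n. f (p n))"

lemma up_map_apply [simp]: "up_map f p n = f (p n)"
  by (simp add: up_map_def)

lemma UP_cring_intro: "cring R \<Longrightarrow> UP_cring R"
  by (simp add: UP_cring_def)

lemma cring_UP: "cring R \<Longrightarrow> cring (UP R)"
  using UP_cring.UP_cring[OF UP_cring_intro] .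

lemma UP_apply:
  assumes "cring R"
  shows "p \<in> carrier (UP R) \<Longrightarrow> coeff (UP R) p n = p n"
    and "p \<in> carrier (UP R) \<Longrightarrow> p n \<in> carrier R"
    and "\<lbrakk>p \<in> carrier (UP R); q \<in> carrier (UP R)\<rbrakk> \<Longrightarrow> (p \<oplus>\<^bsub>UP R\<^esub> q) n = p n \<oplus>\<^bsub>R\<^esub> q n"
    and "\<lbrakk>p \<in> carrier (UP R); q \<in> carrier (UP R)\<rbrakk> \<Longrightarrow>
      (p \<otimes>\<^bsub>UP R\<^esub> q) n = (\<Oplus>\<^bsub>R\<^esub>i\<in>{..n}. p i \<otimes>\<^bsub>R\<^esub> q (n - i))"
    and "\<one>\<^bsub>UP R\<^esub> n = (if n = 0 then \<one>\<^bsub>R\<^esub> else \<zero>\<^bsub>R\<^esub>)"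
    and "\<zero>\<^bsub>UP R\<^esub> n = \<zero>\<^bsub>R\<^esub>"
    and "a \<in> carrier R \<Longrightarrow> monom (UP R) a m n = (if m = n then a else \<zero>\<^bsub>R\<^esub>)"
    and "a \<in> carrier R \<Longrightarrow> poly_const R a n = (if n = 0 then a else \<zero>\<^bsub>R\<^esub>)"
    and "poly_var R n = (if n = 1 then \<one>\<^bsub>R\<^esub> else \<zero>\<^bsub>R\<^esub>)"
proof -
  interpret UP_cring R "UP R" by (rule UP_cring_intro[OF assms])
  show "p \<in> carrier (UP R) \<Longrightarrow> coeff (UP R) p n = p n" for p n by (simp add: UP_def)
  show "p \<in> carrier (UP R) \<Longrightarrow> p n \<in> carrier R" for p by (auto simp: UP_def up_def)
qed (use cring.cring_simprules[OF assms] in \<open>auto simp: UP_def poly_const_def poly_var_def\<close>)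

lemma UP_memI: "\<lbrakk>\<And>n. p n \<in> carrier R; \<And>n. n > d \<Longrightarrow> p n = \<zero>\<^bsub>R\<^esub>\<rbrakk> \<Longrightarrow> p \<in> carrier (UP R)"
  by (auto simp: UP_def up_def bound_def)

lemma UP_memD: "p \<in> carrier (UP R) \<Longrightarrow> \<exists>d. \<forall>n > d. p n = \<zero>\<^bsub>R\<^esub>"
  by (auto simp: UP_def up_def bound_def)

lemma UP_closed:
  assumes "cring R"
  shows "a \<in> carrier R \<Longrightarrow> poly_const R a \<in> carrier (UP R)" "poly_var R \<in> carrier (UP R)"
proof -
  interpret UP_cring R "UP R" by (rule UP_cring_intro[OF assms])
  show "a \<in> carrier R \<Longrightarrow> poly_const R a \<in> carrier (UP R)" "poly_var R \<in> carrier (UP R)"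
    by (simp_all add: poly_const_def poly_var_def)
qed

lemma poly_const_hom: "cring R \<Longrightarrow> poly_const R \<in> ring_hom R (UP R)"
proof -
  assume "cring R"
  then interpret UP_cring R "UP R" by (rule UP_cring_intro)
  show ?thesis using const_ring_hom by (simp add: poly_const_def[abs_def])
qed

text \<open>The universal property as an extensionality rule. It identifies maps given by
  \<open>eval\<close> with maps given coefficientwise, without computing coefficients of
  evaluations.\<close>

lemma UP_hom_ext:
  assumes R: "cring R" and S: "cring S" and f: "f \<in> ring_hom (UP R) S" and g: "g \<in> ring_hom (UP R) S"
    and c: "\<And>a. a \<in> carrier R \<Longrightarrow> f (poly_const R a) = g (poly_const R a)"
    and x: "f (poly_var R) = g (poly_var R)" and p: "p \<in> carrier (UP R)"
  shows "f p = g p"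
proof -
  have h: "(\<lambda>a. f (poly_const R a)) \<in> ring_hom R S"
    using ring_hom_trans[OF poly_const_hom[OF R] f] by (simp add: comp_def)
  interpret ring_hom_cring R S "\<lambda>a. f (poly_const R a)" by (rule ring_hom_cringI[OF R S h])
  interpret UP_pre_univ_prop R S "\<lambda>a. f (poly_const R a)" "UP R"
    by (intro UP_pre_univ_prop.intro ring_hom_cring_axioms UP_cring_intro R)
  show ?thesis
    using UP_hom_unique[OF ring_hom_cringI[OF cring_UP[OF R] S f] _ _ ring_hom_cringI[OF cring_UP[OF R] S g],
        of "f (poly_var R)" p] c x p ring_hom_closed[OF f UP_closed(2)[OF R]]
    by (simp add: poly_const_def poly_var_def)
qed

lemma eval_hom:
  assumes R: "cring R" and S: "cring S" and h: "h \<in> ring_hom R S" and s: "s \<in> carrier S"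
  shows "eval R S h s \<in> ring_hom (UP R) S"
    and "a \<in> carrier R \<Longrightarrow> eval R S h s (poly_const R a) = h a"
    and "eval R S h s (poly_var R) = s"
proof -
  interpret ring_hom_cring R S h by (rule ring_hom_cringI[OF R S h])
  interpret UP_pre_univ_prop R S h "UP R"
    by (intro UP_pre_univ_prop.intro ring_hom_cring_axioms UP_cring_intro R)
  show "eval R S h s \<in> ring_hom (UP R) S" by (rule eval_ring_hom[OF s])
  show "a \<in> carrier R \<Longrightarrow> eval R S h s (poly_const R a) = h a"
    using eval_const[OF s] by (simp add: poly_const_def)
  show "eval R S h s (poly_var R) = s"
    using eval_monom1[OF s] by (simp add: poly_var_def)
qed

lemma up_map_closed:
  assumes A: "cring A" and B: "cring B" and f: "f \<in> ring_hom A B" and p: "p \<in> carrier (UP A)"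
  shows "up_map f p \<in> carrier (UP B)"
proof -
  obtain d where d: "\<forall>n > d. p n = \<zero>\<^bsub>A\<^esub>" using UP_memD[OF p] by auto
  show ?thesis
    using d UP_apply(2)[OF A p] ring_hom_closed[OF f]
      ring_hom_zero[OF f cring.axioms(1)[OF A] cring.axioms(1)[OF B]]
    by (intro UP_memI[of _ _ d]) auto
qed

lemma up_map_hom:
  assumes A: "cring A" and B: "cring B" and f: "f \<in> ring_hom A B"
  shows "up_map f \<in> ring_hom (UP A) (UP B)"
proof -
  interpret h: ring_hom_cring A B f by (rule ring_hom_cringI[OF A B f])
  interpret PA: cring "UP A" by (rule cring_UP[OF A])
  interpret PB: cring "UP B" by (rule cring_UP[OF B])
  note cl = up_map_closed[OF A B f]
  note a = UP_apply(2)[OF A]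
  show ?thesis
  proof (rule ring_hom_memI)
    fix p q assume p: "p \<in> carrier (UP A)" and q: "q \<in> carrier (UP A)"
    show "up_map f (p \<oplus>\<^bsub>UP A\<^esub> q) = up_map f p \<oplus>\<^bsub>UP B\<^esub> up_map f q"
      using a[OF p] a[OF q] p q cl by (intro ext) (simp add: UP_apply(3)[OF A] UP_apply(3)[OF B])
    have "f (\<Oplus>\<^bsub>A\<^esub>i\<in>{..n}. p i \<otimes>\<^bsub>A\<^esub> q (n - i)) = (\<Oplus>\<^bsub>B\<^esub>i\<in>{..n}. f (p i) \<otimes>\<^bsub>B\<^esub> f (q (n - i)))" for n
      using a[OF p] a[OF q] by (subst h.hom_finsum) (auto simp: comp_def)
    then show "up_map f (p \<otimes>\<^bsub>UP A\<^esub> q) = up_map f p \<otimes>\<^bsub>UP B\<^esub> up_map f q"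
      using p q cl by (intro ext) (simp add: UP_apply(4)[OF A] UP_apply(4)[OF B])
  next
    show "up_map f \<one>\<^bsub>UP A\<^esub> = \<one>\<^bsub>UP B\<^esub>"
      by (intro ext) (simp add: UP_apply(5)[OF A] UP_apply(5)[OF B])
  qed (rule cl)
qed

lemma up_map_const:
  assumes A: "cring A" and B: "cring B" and f: "f \<in> ring_hom A B" and "a \<in> carrier A"
  shows "up_map f (poly_const A a) = poly_const B (f a)"
  using ring_hom_zero[OF f cring.axioms(1)[OF A] cring.axioms(1)[OF B]] assms(4) ring_hom_closed[OF f]
  by (intro ext) (simp add: UP_apply(8)[OF A] UP_apply(8)[OF B])

lemma up_map_var:
  assumes A: "cring A" and B: "cring B" and f: "f \<in> ring_hom A B"
  shows "up_map f (poly_var A) = poly_var B"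
  using ring_hom_zero[OF f cring.axioms(1)[OF A] cring.axioms(1)[OF B]] ring_hom_one[OF f]
  by (intro ext) (simp add: UP_apply(9)[OF A] UP_apply(9)[OF B])

lemma eval_eq_up_map:
  assumes A: "cring A" and B: "cring B" and f: "f \<in> ring_hom A B" and p: "p \<in> carrier (UP A)"
  shows "eval A (UP B) (\<lambda>a. poly_const B (f a)) (poly_var B) p = up_map f p"
proof -
  have h: "(\<lambda>a. poly_const B (f a)) \<in> ring_hom A (UP B)"
    using ring_hom_trans[OF f poly_const_hom[OF B]] by (simp add: comp_def)
  note e = eval_hom[OF A cring_UP[OF B] h UP_closed(2)[OF B]]
  show ?thesis
    using e(2,3) up_map_const[OF A B f] up_map_var[OF A B f]
    by (intro UP_hom_ext[OF A cring_UP[OF B] e(1) up_map_hom[OF A B f] _ _ p]) simp_all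
qed

lemma id_hom: "(\<lambda>p. p) \<in> ring_hom R R"
  by (rule ring_hom_memI) auto

text \<open>The coefficient map is the identity because the inner variable \<open>s_1\<close> stays;
  only the outer variable \<open>s_2\<close> is specialized, to \<open>s_1^M\<close>.\<close>

definition subst_poly :: "('a, 'b) ring_scheme \<Rightarrow> nat \<Rightarrow> (nat \<Rightarrow> nat \<Rightarrow> 'a) \<Rightarrow> nat \<Rightarrow> 'a" where
  "subst_poly A M = eval (UP A) (UP A) (\<lambda>p. p) (poly_var A [^]\<^bsub>UP A\<^esub> M)"

definition pow_poly :: "('a, 'b) ring_scheme \<Rightarrow> nat \<Rightarrow> (nat \<Rightarrow> 'a) \<Rightarrow> nat \<Rightarrow> 'a" where
  "pow_poly A M = eval A (UP A) (poly_const A) (poly_var A [^]\<^bsub>UP A\<^esub> M)"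

context
  fixes A :: "('a, 'b) ring_scheme" assumes A: "cring A"
begin

lemma var_pow_closed: "poly_var A [^]\<^bsub>UP A\<^esub> (M::nat) \<in> carrier (UP A)"
proof -
  interpret cring "UP A" by (rule cring_UP[OF A])
  show ?thesis using UP_closed(2)[OF A] by simp
qed

lemmas subst_poly_eval = eval_hom[OF cring_UP[OF A] cring_UP[OF A] id_hom var_pow_closed, folded subst_poly_def]

lemmas pow_poly_eval = eval_hom[OF A cring_UP[OF A] poly_const_hom[OF A] var_pow_closed, folded pow_poly_def]

text \<open>The endomorphism \<open>s_1 -> s_1^M\<close> factors through two variables: rename
  \<open>s_1\<close> to \<open>s_2\<close>, which is what \<open>i_2\<close> does, and then
  specialize. For this reason specialization after \<open>i_2\<close> will be
  \<open>frob M\<close>.\<close>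

lemma pow_poly_eq:
  assumes p: "p \<in> carrier (UP A)"
  shows "pow_poly A M p = subst_poly A M (up_map (poly_const A) p)"
proof -
  note c = poly_const_hom[OF A]
  have h: "(\<lambda>p. subst_poly A M (up_map (poly_const A) p)) \<in> ring_hom (UP A) (UP A)"
    using ring_hom_trans[OF up_map_hom[OF A cring_UP[OF A] c] subst_poly_eval(1)] by (simp add: comp_def)
  show ?thesis
    by (rule UP_hom_ext[OF A cring_UP[OF A] pow_poly_eval(1) h _ _ p])
      (simp_all add: up_map_const[OF A cring_UP[OF A] c] up_map_var[OF A cring_UP[OF A] c]
        pow_poly_eval subst_poly_eval UP_closed[OF A])
qed

lemma incl1_poly:
  assumes p: "p \<in> carrier (UP A)"
  shows "eval A (UP (UP A)) (poly_const2 A) (poly_const (UP A) (poly_var A)) p = poly_const (UP A) p"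
proof -
  note AA = cring_UP[OF A] and c = poly_const_hom[OF A] and cc = poly_const_hom[OF cring_UP[OF A]]
  have h: "poly_const2 A \<in> ring_hom A (UP (UP A))"
    using ring_hom_trans[OF c cc] by (simp add: poly_const2_def[abs_def] comp_def)
  note e = eval_hom[OF A cring_UP[OF AA] h UP_closed(1)[OF AA UP_closed(2)[OF A]]]
  show ?thesis
    by (rule UP_hom_ext[OF A cring_UP[OF AA] e(1) cc _ _ p]) (simp_all add: e poly_const2_def)
qed

lemma incl2_poly:
  assumes p: "p \<in> carrier (UP A)"
  shows "eval A (UP (UP A)) (poly_const2 A) (poly_var (UP A)) p = up_map (poly_const A) p"
  using eval_eq_up_map[OF A cring_UP[OF A] poly_const_hom[OF A] p] by (simp add: poly_const2_def[abs_def])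

lemma var_pow_monom: "poly_var A [^]\<^bsub>UP A\<^esub> (M::nat) = monom (UP A) \<one>\<^bsub>A\<^esub> M"
proof -
  interpret UP_cring A "UP A" by (rule UP_cring_intro[OF A])
  show ?thesis by (simp add: poly_var_def monom_pow)
qed

lemma monom_shift:
  assumes p: "p \<in> carrier (UP A)"
  shows "(p \<otimes>\<^bsub>UP A\<^esub> monom (UP A) \<one>\<^bsub>A\<^esub> d) n = (if d \<le> n then p (n - d) else \<zero>\<^bsub>A\<^esub>)"
proof -
  interpret A: cring A by fact
  interpret P: UP_cring A "UP A" by (rule UP_cring_intro[OF A])
  note pc = UP_apply(2)[OF A p]
  have "(p \<otimes>\<^bsub>UP A\<^esub> monom (UP A) \<one>\<^bsub>A\<^esub> d) n =
      (\<Oplus>\<^bsub>A\<^esub>i\<in>{..n}. p i \<otimes>\<^bsub>A\<^esub> (if d = n - i then \<one>\<^bsub>A\<^esub> else \<zero>\<^bsub>A\<^esub>))"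
    using p by (simp add: UP_apply(4)[OF A] UP_apply(7)[OF A])
  also have "\<dots> = (\<Oplus>\<^bsub>A\<^esub>i\<in>{..n}. if n - d = i then (if d \<le> n then p i else \<zero>\<^bsub>A\<^esub>) else \<zero>\<^bsub>A\<^esub>)"
    using pc by (intro A.finsum_cong') auto
  also have "\<dots> = (if d \<le> n then p (n - d) else \<zero>\<^bsub>A\<^esub>)"
    using A.finsum_singleton[of "n - d" "{..n}" "\<lambda>i. if d \<le> n then p i else \<zero>\<^bsub>A\<^esub>"] pc by simp
  finally show ?thesis .
qed

text \<open>The lowest term of \<open>g\<close> survives the substitution of \<open>s\<^sub>1\<^sup>M\<close> for \<open>s\<^sub>2\<close> when \<open>M\<close> is large.\<close>

lemma subst_poly_coeff:
  assumes g: "g \<in> carrier (UP (UP A))" and low: "\<And>i. i < l \<Longrightarrow> g i = \<zero>\<^bsub>UP A\<^esub>" and r: "r < M"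
  shows "subst_poly A M g (M * l + r) = g l r"
proof -
  interpret A: cring A by fact
  interpret P: UP_cring A "UP A" by (rule UP_cring_intro[OF A])
  interpret PA: cring "UP A" by (rule cring_UP[OF A])
  interpret PP: UP_cring "UP A" "UP (UP A)" by (rule UP_cring_intro[OF cring_UP[OF A]])
  note gc = UP_apply(2)[OF cring_UP[OF A] g]
  let ?x = "poly_var A [^]\<^bsub>UP A\<^esub> M"
  let ?N = "M * l + r"
  have t: "(g i \<otimes>\<^bsub>UP A\<^esub> ?x [^]\<^bsub>UP A\<^esub> i) ?N = (if i = l then g l r else \<zero>\<^bsub>A\<^esub>)" for i
  proof -
    have xi: "?x [^]\<^bsub>UP A\<^esub> i = monom (UP A) \<one>\<^bsub>A\<^esub> (M * i)"
      by (simp add: var_pow_monom P.monom_pow)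
    have m: "(g i \<otimes>\<^bsub>UP A\<^esub> monom (UP A) \<one>\<^bsub>A\<^esub> (M * i)) ?N =
        (if M * i \<le> ?N then g i (?N - M * i) else \<zero>\<^bsub>A\<^esub>)"
      by (rule monom_shift[OF gc])
    show ?thesis
    proof (cases "i < l")
      case True
      then show ?thesis using m xi low by (simp add: UP_apply(6)[OF A])
    next
      case False
      show ?thesis
      proof (cases "i = l")
        case False
        \<comment> \<open>The terms with \<open>i > l\<close> begin in degree
          \<open>M (l + 1)\<close> or later, which lies beyond \<open>M l + r\<close> because
          \<open>r < M\<close>.\<close>
        then have "M * Suc l \<le> M * i" using \<open>\<not> i < l\<close> by (intro mult_le_mono2) auto
        then have "\<not> M * i \<le> ?N" using r by simp
        then show ?thesis using m xi False by simp
      qed (use m xi in simp)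
    qed
  qed
  have "subst_poly A M g = (\<Oplus>\<^bsub>UP A\<^esub>i\<in>{..deg (UP A) g}. g i \<otimes>\<^bsub>UP A\<^esub> ?x [^]\<^bsub>UP A\<^esub> i)"
    using g unfolding subst_poly_def PP.eval_on_carrier[OF g] by (simp add: UP_apply(1)[OF cring_UP[OF A]])
  then have "subst_poly A M g ?N = (\<Oplus>\<^bsub>A\<^esub>i\<in>{..deg (UP A) g}. (g i \<otimes>\<^bsub>UP A\<^esub> ?x [^]\<^bsub>UP A\<^esub> i) ?N)"
    using P.coeff_finsum[of "{..deg (UP A) g}" "\<lambda>i. g i \<otimes>\<^bsub>UP A\<^esub> ?x [^]\<^bsub>UP A\<^esub> i" ?N]
      gc var_pow_closed subst_poly_eval(1)
    by (simp add: UP_apply(1)[OF A] P.P.finsum_closed Pi_def)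
  also have "\<dots> = (\<Oplus>\<^bsub>A\<^esub>i\<in>{..deg (UP A) g}. if i = l then g l r else \<zero>\<^bsub>A\<^esub>)"
    using UP_apply(2)[OF A gc] by (intro A.finsum_cong') (auto simp: t)
  also have "\<dots> = g l r"
  proof (cases "l \<le> deg (UP A) g")
    case True
    then show ?thesis
      using A.finsum_singleton[of l "{..deg (UP A) g}" "\<lambda>_. g l r"] UP_apply(2)[OF A gc]
      by (simp add: eq_commute)
  next
    case False
    then have "g l = \<zero>\<^bsub>UP A\<^esub>"
      using PP.deg_aboveD[of g l] g by (simp add: UP_apply(1)[OF cring_UP[OF A]])
    then have "g l r = \<zero>\<^bsub>A\<^esub>" by (simp add: UP_apply(6)[OF A])
    then show ?thesis using False by (simp add: A.add.finprod_one_eqI)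
  qed
  finally show ?thesis .
qed

end

lemma subst_poly_natural:
  assumes A: "cring A" and B: "cring B" and f: "f \<in> ring_hom A B" and g: "g \<in> carrier (UP (UP A))"
  shows "up_map f (subst_poly A M g) = subst_poly B M (up_map (up_map f) g)"
proof -
  note AA = cring_UP[OF A] and BB = cring_UP[OF B] and ff = up_map_hom[OF A B f]
  interpret h: ring_hom_cring "UP A" "UP B" "up_map f" by (rule ring_hom_cringI[OF AA BB ff])
  have h1: "(\<lambda>g. up_map f (subst_poly A M g)) \<in> ring_hom (UP (UP A)) (UP B)"
    using ring_hom_trans[OF subst_poly_eval(1)[OF A] ff] by (simp add: comp_def)
  have h2: "(\<lambda>g. subst_poly B M (up_map (up_map f) g)) \<in> ring_hom (UP (UP A)) (UP B)"
    using ring_hom_trans[OF up_map_hom[OF AA BB ff] subst_poly_eval(1)[OF B]] by (simp add: comp_def)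
  show ?thesis
    by (rule UP_hom_ext[OF AA BB h1 h2 _ _ g])
      (simp_all add: subst_poly_eval[OF A] subst_poly_eval[OF B] up_map_const[OF AA BB ff]
        up_map_var[OF AA BB ff] up_map_var[OF A B f] UP_closed[OF A])
qed

lemma pow_poly_natural:
  assumes A: "cring A" and B: "cring B" and f: "f \<in> ring_hom A B" and p: "p \<in> carrier (UP A)"
  shows "up_map f (pow_poly A M p) = pow_poly B M (up_map f p)"
proof -
  note AA = cring_UP[OF A] and BB = cring_UP[OF B] and ff = up_map_hom[OF A B f]
  interpret h: ring_hom_cring "UP A" "UP B" "up_map f" by (rule ring_hom_cringI[OF AA BB ff])
  have h1: "(\<lambda>g. up_map f (pow_poly A M g)) \<in> ring_hom (UP A) (UP B)"
    using ring_hom_trans[OF pow_poly_eval(1)[OF A] ff] by (simp add: comp_def)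
  have h2: "(\<lambda>g. pow_poly B M (up_map f g)) \<in> ring_hom (UP A) (UP B)"
    using ring_hom_trans[OF ff pow_poly_eval(1)[OF B]] by (simp add: comp_def)
  show ?thesis
    using ring_hom_closed[OF f]
    by (intro UP_hom_ext[OF A BB h1 h2 _ _ p])
      (simp_all add: pow_poly_eval[OF A] pow_poly_eval[OF B] up_map_const[OF A B f]
        up_map_var[OF A B f] UP_closed[OF A])
qed

lemma pow_poly_mult:
  assumes A: "cring A" and p: "p \<in> carrier (UP A)"
  shows "pow_poly A M (pow_poly A N p) = pow_poly A (M * N) p"
proof -
  note AA = cring_UP[OF A]
  interpret P: cring "UP A" by (rule AA)
  interpret h: ring_hom_cring "UP A" "UP A" "pow_poly A M" by (rule ring_hom_cringI[OF AA AA pow_poly_eval(1)[OF A]])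
  have h1: "(\<lambda>g. pow_poly A M (pow_poly A N g)) \<in> ring_hom (UP A) (UP A)"
    using ring_hom_trans[OF pow_poly_eval(1)[OF A] pow_poly_eval(1)[OF A]] by (simp add: comp_def)
  show ?thesis
    by (rule UP_hom_ext[OF A AA h1 pow_poly_eval(1)[OF A] _ _ p])
      (simp_all add: pow_poly_eval[OF A] UP_closed[OF A] P.nat_pow_pow)
qed

lemma ring_hom_cong:
  assumes "f \<in> ring_hom R S" "\<And>x. x \<in> carrier R \<Longrightarrow> g x = f x" "ring R"
  shows "g \<in> ring_hom R S"
proof -
  interpret ring R by fact
  show ?thesis
    using assms(1,2) by (intro ring_hom_memI) (auto simp: ring_hom_def)
qed

section \<open>Split nilpotent thickenings of a domain, their polynomial rings and
  localizations\<close>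

lemma (in cring) geo_mult: "w \<in> carrier R \<Longrightarrow> (\<one> \<ominus> w) \<otimes> geo w n = \<one> \<ominus> w [^] n"
proof (induction n)
  case (Suc n)
  have "(\<one> \<ominus> w) \<otimes> geo w (Suc n) = (\<one> \<ominus> w) \<oplus> w \<otimes> ((\<one> \<ominus> w) \<otimes> geo w n)"
    using Suc.prems by (simp add: r_distr m_ac minus_eq)
  also have "\<dots> = \<one> \<ominus> w [^] Suc n"
    using Suc by (simp add: minus_eq r_distr r_minus a_assoc r_neg1 m_comm)
  finally show ?case .
qed (simp add: minus_eq r_neg)

lemma (in cring) one_minus_nilpotent:
  assumes "w \<in> carrier R" "w [^] (n::nat) = \<zero>" shows "\<one> \<ominus> w \<in> Units R"
proof -
  have "(\<one> \<ominus> w) \<otimes> geo w n = \<one>" using geo_mult[OF assms(1), of n] assms by (simp add: minus_eq)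
  moreover have "geo w n \<in> carrier R" "\<one> \<ominus> w \<in> carrier R" using assms by simp_all
  ultimately show ?thesis
    unfolding Units_def using m_comm[of "\<one> \<ominus> w" "geo w n"] by auto
qed

text \<open>The residue ring is only required to be a domain, so that the notion passes to
  polynomial rings in one and then two variables before any localization. The splitting
  \<open>\<iota>\<close> singles out the constants.\<close>

locale thickening =
  fixes A :: "('a, 'b) ring_scheme" and k :: "('c, 'd) ring_scheme"
    and \<iota> :: "'c \<Rightarrow> 'a" and \<pi> :: "'a \<Rightarrow> 'c" and t :: 'a and m :: nat
  assumes A: "cring A" and k: "domain k" and iota: "\<iota> \<in> ring_hom k A" and pi: "\<pi> \<in> ring_hom A k"
    and pi_iota: "c \<in> carrier k \<Longrightarrow> \<pi> (\<iota> c) = c"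
    and t_closed: "t \<in> carrier A" and t_nil: "t [^]\<^bsub>A\<^esub> Suc m = \<zero>\<^bsub>A\<^esub>"
    and decomp: "a \<in> carrier A \<Longrightarrow> \<exists>b \<in> carrier A. a = \<iota> (\<pi> a) \<oplus>\<^bsub>A\<^esub> t \<otimes>\<^bsub>A\<^esub> b"
begin

sublocale A: cring A by (rule A)
sublocale k: domain k by (rule k)
sublocale iota: ring_hom_cring k A \<iota> by (rule ring_hom_cringI[OF k.is_cring A iota])
sublocale pi: ring_hom_cring A k \<pi> by (rule ring_hom_cringI[OF A k.is_cring pi])

lemma pi_t: "\<pi> t = \<zero>\<^bsub>k\<^esub>"
proof -
  have "\<pi> t [^]\<^bsub>k\<^esub> Suc m = \<zero>\<^bsub>k\<^esub>"
    using pi.hom_pow[OF t_closed, of "Suc m"] t_nil pi.hom_zero by simp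
  moreover have "x [^]\<^bsub>k\<^esub> n \<noteq> \<zero>\<^bsub>k\<^esub>" if "x \<in> carrier k" "x \<noteq> \<zero>\<^bsub>k\<^esub>" for x and n :: nat
    using that by (induction n) (auto simp: k.integral_iff)
  ultimately show ?thesis using t_closed pi.hom_closed by blast
qed

lemma t_mult_nil:
  assumes "b \<in> carrier A" "n \<ge> Suc m" shows "(t \<otimes>\<^bsub>A\<^esub> b) [^]\<^bsub>A\<^esub> n = \<zero>\<^bsub>A\<^esub>"
proof -
  have "t [^]\<^bsub>A\<^esub> n = t [^]\<^bsub>A\<^esub> Suc m \<otimes>\<^bsub>A\<^esub> t [^]\<^bsub>A\<^esub> (n - Suc m)"
    using assms t_closed by (subst A.nat_pow_mult) auto
  then have "t [^]\<^bsub>A\<^esub> n = \<zero>\<^bsub>A\<^esub>" using t_nil t_closed by simp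
  then show ?thesis using assms t_closed A.m_comm by (simp add: A.pow_mult_distrib)
qed

lemma one_minus_t_unit: "b \<in> carrier A \<Longrightarrow> \<one>\<^bsub>A\<^esub> \<ominus>\<^bsub>A\<^esub> t \<otimes>\<^bsub>A\<^esub> b \<in> Units A"
  using A.one_minus_nilpotent[OF _ t_mult_nil[of b "Suc m"]] t_closed by simp

lemma pi_Units: "a \<in> Units A \<Longrightarrow> \<pi> a \<in> Units k"
  using symbol_map_ring_hom[OF A.ring_axioms k.ring_axioms pi] by (simp add: symbol_map_def)

lemma iota_Units: "a \<in> Units k \<Longrightarrow> \<iota> a \<in> Units A"
  using symbol_map_ring_hom[OF k.ring_axioms A.ring_axioms iota] by (simp add: symbol_map_def)

text \<open>Multiplied by a lift of the inverse of its residue, the element becomes 1 plus a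
  multiple of the nilpotent \<open>t\<close>.\<close>

lemma Units_iff: "a \<in> Units A \<longleftrightarrow> a \<in> carrier A \<and> \<pi> a \<in> Units k"
proof
  assume a: "a \<in> carrier A \<and> \<pi> a \<in> Units k"
  define b where "b = \<iota> (inv\<^bsub>k\<^esub> (\<pi> a))"
  have b: "b \<in> Units A" "b \<in> carrier A" using a iota_Units by (auto simp: b_def)
  have "\<pi> (a \<otimes>\<^bsub>A\<^esub> b) = \<one>\<^bsub>k\<^esub>"
    using a b pi_iota by (simp add: b_def)
  then obtain c where c: "c \<in> carrier A" "a \<otimes>\<^bsub>A\<^esub> b = \<one>\<^bsub>A\<^esub> \<oplus>\<^bsub>A\<^esub> t \<otimes>\<^bsub>A\<^esub> c"
    using decomp[of "a \<otimes>\<^bsub>A\<^esub> b"] a b by auto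
  have "a \<otimes>\<^bsub>A\<^esub> b = \<one>\<^bsub>A\<^esub> \<ominus>\<^bsub>A\<^esub> t \<otimes>\<^bsub>A\<^esub> (\<ominus>\<^bsub>A\<^esub> c)"
    using c t_closed by (simp add: A.minus_eq A.r_minus)
  then have "a \<otimes>\<^bsub>A\<^esub> b \<in> Units A" using one_minus_t_unit c by simp
  then have "a \<otimes>\<^bsub>A\<^esub> b \<otimes>\<^bsub>A\<^esub> inv\<^bsub>A\<^esub> b \<in> Units A" using b by simp
  then show "a \<in> Units A" using a b by (simp add: A.m_assoc)
qed (use pi_Units in auto)

lemma UP_thickening:
  "thickening (UP A) (UP k) (up_map \<iota>) (up_map \<pi>) (poly_const A t) m"
proof -
  interpret UPk: UP_domain k "UP k" by (simp add: UP_domain_def k)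
  note AA = cring_UP[OF A] and kk = cring_UP[OF k.is_cring]
  interpret PA: UP_cring A "UP A" by (rule UP_cring_intro[OF A])
  interpret c: ring_hom_cring A "UP A" "poly_const A" by (rule ring_hom_cringI[OF A AA poly_const_hom[OF A]])
  show ?thesis
  proof (rule thickening.intro)
    fix f assume f: "f \<in> carrier (UP A)"
    \<comment> \<open>The cofactor of \<open>t\<close> is chosen coefficient by coefficient. The
      value at zero is fixed to be zero, so that the chosen coefficients again have finite
      support.\<close>
    define h where "h a = (if a = \<zero>\<^bsub>A\<^esub> then \<zero>\<^bsub>A\<^esub> else
       SOME b. b \<in> carrier A \<and> a = \<iota> (\<pi> a) \<oplus>\<^bsub>A\<^esub> t \<otimes>\<^bsub>A\<^esub> b)" for a
    have h: "h a \<in> carrier A \<and> a = \<iota> (\<pi> a) \<oplus>\<^bsub>A\<^esub> t \<otimes>\<^bsub>A\<^esub> h a" if "a \<in> carrier A" for a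
    proof (cases "a = \<zero>\<^bsub>A\<^esub>")
      case True then show ?thesis using t_closed by (simp add: h_def)
    next
      case False
      then show ?thesis using someI_ex[of "\<lambda>b. b \<in> carrier A \<and> a = \<iota> (\<pi> a) \<oplus>\<^bsub>A\<^esub> t \<otimes>\<^bsub>A\<^esub> b"] decomp[OF that]
        by (auto simp: h_def)
    qed
    note fc = UP_apply(2)[OF A f]
    obtain d where d: "\<forall>n > d. f n = \<zero>\<^bsub>A\<^esub>" using UP_memD[OF f] by auto
    have g: "up_map h f \<in> carrier (UP A)"
      using h fc d by (intro UP_memI[of _ _ d]) (auto simp: h_def)
    have "f = up_map \<iota> (up_map \<pi> f) \<oplus>\<^bsub>UP A\<^esub> poly_const A t \<otimes>\<^bsub>UP A\<^esub> up_map h f"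
    proof
      fix n
      have "(poly_const A t \<otimes>\<^bsub>UP A\<^esub> up_map h f) n = t \<otimes>\<^bsub>A\<^esub> h (f n)"
        using PA.monom_mult_is_smult[OF t_closed g] PA.coeff_smult[OF t_closed g, of n] g t_closed
        by (simp add: poly_const_def UP_apply(1)[OF A])
      moreover have "up_map \<iota> (up_map \<pi> f) \<in> carrier (UP A)"
        using up_map_closed[OF k.is_cring A iota] up_map_closed[OF A k.is_cring pi f] by blast
      ultimately show "f n = (up_map \<iota> (up_map \<pi> f) \<oplus>\<^bsub>UP A\<^esub> poly_const A t \<otimes>\<^bsub>UP A\<^esub> up_map h f) n"
        using h[OF fc[of n]] g t_closed by (simp add: UP_apply(3)[OF A] c.hom_closed)
    qed
    with g show "\<exists>b\<in>carrier (UP A). f = up_map \<iota> (up_map \<pi> f) \<oplus>\<^bsub>UP A\<^esub> poly_const A t \<otimes>\<^bsub>UP A\<^esub> b"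
      by blast
  next
    show "poly_const A t [^]\<^bsub>UP A\<^esub> Suc m = \<zero>\<^bsub>UP A\<^esub>"
      using c.hom_pow[OF t_closed, of "Suc m"] t_nil c.hom_zero by simp
  next
    fix c assume c: "c \<in> carrier (UP k)"
    show "up_map \<pi> (up_map \<iota> c) = c"
      using pi_iota UP_apply(2)[OF k.is_cring c] by (intro ext) simp
  qed (rule AA UPk.UP_domain up_map_hom[OF k.is_cring A iota] up_map_hom[OF A k.is_cring pi]
      UP_closed(1)[OF A t_closed])+
qed

definition residue_units :: "'a set" where
  "residue_units = {a \<in> carrier A. \<pi> a \<noteq> \<zero>\<^bsub>k\<^esub>}"

lemma mult_set_residue_units: "mult_set A residue_units"
  by unfold_locales (auto simp: residue_units_def k.integral_iff)

lemma mult_set_nonzero: "mult_set k (carrier k - {\<zero>\<^bsub>k\<^esub>})"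
  by unfold_locales (auto simp: k.integral_iff)

lemma field_localization: "field (localization k (carrier k - {\<zero>\<^bsub>k\<^esub>}))" (is "field ?L")
proof -
  interpret mult_set k "carrier k - {\<zero>\<^bsub>k\<^esub>}" by (rule mult_set_nonzero)
  interpret L: cring ?L by (rule cring_localization)
  have z: "loc_frac k (carrier k - {\<zero>\<^bsub>k\<^esub>}) a s = \<zero>\<^bsub>?L\<^esub> \<longleftrightarrow> a = \<zero>\<^bsub>k\<^esub>"
    if "a \<in> carrier k" "s \<in> carrier k - {\<zero>\<^bsub>k\<^esub>}" for a s
  proof -
    have "loc_frac k (carrier k - {\<zero>\<^bsub>k\<^esub>}) a s = \<zero>\<^bsub>?L\<^esub> \<longleftrightarrow>
       (\<exists>u\<in>carrier k - {\<zero>\<^bsub>k\<^esub>}. u \<otimes>\<^bsub>k\<^esub> (\<one>\<^bsub>k\<^esub> \<otimes>\<^bsub>k\<^esub> a) = u \<otimes>\<^bsub>k\<^esub> (s \<otimes>\<^bsub>k\<^esub> \<zero>\<^bsub>k\<^esub>))"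
      unfolding loc_zero using that by (intro loc_frac_eq_iff) auto
    also have "\<dots> \<longleftrightarrow> a = \<zero>\<^bsub>k\<^esub>"
      using that by (auto simp: k.integral_iff)
    finally show ?thesis .
  qed
  show ?thesis
  proof (rule L.cring_fieldI)
    show "Units ?L = carrier ?L - {\<zero>\<^bsub>?L\<^esub>}"
    proof (intro equalityI subsetI)
      fix x assume x: "x \<in> carrier ?L - {\<zero>\<^bsub>?L\<^esub>}"
      then obtain a s where "x = loc_frac k (carrier k - {\<zero>\<^bsub>k\<^esub>}) a s" "a \<in> carrier k" "s \<in> carrier k - {\<zero>\<^bsub>k\<^esub>}"
        by (auto simp: carrier_localization)
      then show "x \<in> Units ?L" using x z by (auto intro!: loc_frac_unit)
    next
      fix x assume x: "x \<in> Units ?L"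
      have "\<one>\<^bsub>?L\<^esub> \<noteq> \<zero>\<^bsub>?L\<^esub>" unfolding loc_one using z[of "\<one>\<^bsub>k\<^esub>" "\<one>\<^bsub>k\<^esub>"] by simp
      moreover have "inv\<^bsub>?L\<^esub> x \<otimes>\<^bsub>?L\<^esub> x = \<one>\<^bsub>?L\<^esub>" "inv\<^bsub>?L\<^esub> x \<in> carrier ?L"
        using L.Units_l_inv[OF x] L.Units_inv_closed[OF x] by simp_all
      ultimately have "x \<noteq> \<zero>\<^bsub>?L\<^esub>" using L.r_null by metis
      then show "x \<in> carrier ?L - {\<zero>\<^bsub>?L\<^esub>}" using x L.Units_closed by auto
    qed
  qed
qed

lemma localization_thickening:
  "thickening (localization A residue_units) (localization k (carrier k - {\<zero>\<^bsub>k\<^esub>}))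
    (loc_map A residue_units \<iota>) (loc_map k (carrier k - {\<zero>\<^bsub>k\<^esub>}) \<pi>) (loc_frac A residue_units t \<one>\<^bsub>A\<^esub>) m"
proof -
  let ?S = residue_units and ?T = "carrier k - {\<zero>\<^bsub>k\<^esub>}"
  interpret S: mult_set A ?S by (rule mult_set_residue_units)
  interpret T: mult_set k ?T by (rule mult_set_nonzero)
  interpret L: cring "localization A ?S" by (rule S.cring_localization)
  have iS: "\<iota> ` ?T \<subseteq> ?S" by (simp add: residue_units_def pi_iota image_subset_iff)
  have pT: "\<pi> ` ?S \<subseteq> ?T" by (simp add: residue_units_def image_subset_iff)
  note i = loc_map_frac[OF mult_set_nonzero mult_set_residue_units iota iS]
  note p = loc_map_frac[OF mult_set_residue_units mult_set_nonzero pi pT]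
  have pow: "loc_frac A ?S t \<one>\<^bsub>A\<^esub> [^]\<^bsub>localization A ?S\<^esub> n = loc_frac A ?S (t [^]\<^bsub>A\<^esub> n) \<one>\<^bsub>A\<^esub>" for n :: nat
    using t_closed by (induction n) (simp_all add: S.loc_one S.loc_mult S.one_S)
  note [simp] = S.S_closed S.mult_S S.one_S
  show ?thesis
  proof (rule thickening.intro)
    fix x assume "x \<in> carrier (localization A ?S)"
    then obtain a s where x: "x = loc_frac A ?S a s" "a \<in> carrier A" "s \<in> ?S"
      unfolding S.carrier_localization by blast
    have sc: "s \<in> carrier A" using x by simp
    have ps: "\<pi> s \<noteq> \<zero>\<^bsub>k\<^esub>" using x(3) unfolding residue_units_def by blast
    define a0 s0 where "a0 = \<iota> (\<pi> a)" and "s0 = \<iota> (\<pi> s)"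
    have pa: "\<pi> a \<in> carrier k" "\<pi> s \<in> ?T" "\<pi> s \<in> carrier k"
      using x(2) sc ps by simp_all
    have c0: "a0 \<in> carrier A" "s0 \<in> ?S" "s0 \<in> carrier A"
      using pa iS unfolding a0_def s0_def by (simp_all add: image_subset_iff)
    obtain b where b: "b \<in> carrier A" "a = a0 \<oplus>\<^bsub>A\<^esub> t \<otimes>\<^bsub>A\<^esub> b"
      using decomp[OF x(2)] unfolding a0_def by blast
    obtain c where c: "c \<in> carrier A" "s = s0 \<oplus>\<^bsub>A\<^esub> t \<otimes>\<^bsub>A\<^esub> c"
      using decomp[OF sc] unfolding s0_def by blast
    \<comment> \<open>From \<open>a = a0 + t b\<close> and \<open>s = s0 + t c\<close> one gets
      \<open>a/s - a0/s0 = t n / (s s0)\<close> with this numerator.\<close>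
    define n where "n = b \<otimes>\<^bsub>A\<^esub> s0 \<ominus>\<^bsub>A\<^esub> a0 \<otimes>\<^bsub>A\<^esub> c"
    have n: "n \<in> carrier A" using b c c0 by (simp add: n_def)
    define y where "y = loc_frac A ?S n (s \<otimes>\<^bsub>A\<^esub> s0)"
    have y: "y \<in> carrier (localization A ?S)" using n x c0 by (simp add: y_def)
    have e1: "a \<otimes>\<^bsub>A\<^esub> s0 = a0 \<otimes>\<^bsub>A\<^esub> s \<oplus>\<^bsub>A\<^esub> t \<otimes>\<^bsub>A\<^esub> n"
    proof -
      have "a0 \<otimes>\<^bsub>A\<^esub> s \<oplus>\<^bsub>A\<^esub> t \<otimes>\<^bsub>A\<^esub> n =
         (a0 \<otimes>\<^bsub>A\<^esub> s0 \<oplus>\<^bsub>A\<^esub> t \<otimes>\<^bsub>A\<^esub> (b \<otimes>\<^bsub>A\<^esub> s0)) \<oplus>\<^bsub>A\<^esub> (t \<otimes>\<^bsub>A\<^esub> (a0 \<otimes>\<^bsub>A\<^esub> c) \<ominus>\<^bsub>A\<^esub> t \<otimes>\<^bsub>A\<^esub> (a0 \<otimes>\<^bsub>A\<^esub> c))"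
        using b(1) c(1) c0 t_closed unfolding c(2) by (simp add: n_def A.cr)
      also have "\<dots> = a \<otimes>\<^bsub>A\<^esub> s0"
        using b(1) c(1) c0 t_closed unfolding b(2) by (simp add: A.minus_eq A.r_neg A.l_distr A.m_assoc)
      finally show ?thesis ..
    qed
    have "loc_map A ?S \<iota> (loc_map k ?T \<pi> x) \<oplus>\<^bsub>localization A ?S\<^esub>
        loc_frac A ?S t \<one>\<^bsub>A\<^esub> \<otimes>\<^bsub>localization A ?S\<^esub> y
      = loc_frac A ?S (a0 \<otimes>\<^bsub>A\<^esub> (s \<otimes>\<^bsub>A\<^esub> s0) \<oplus>\<^bsub>A\<^esub> t \<otimes>\<^bsub>A\<^esub> n \<otimes>\<^bsub>A\<^esub> s0) (s0 \<otimes>\<^bsub>A\<^esub> (s \<otimes>\<^bsub>A\<^esub> s0))"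
      using x pa c0 n sc t_closed p[OF x(2,3)] i[OF pa(1,2)]
      by (simp add: y_def a0_def[symmetric] s0_def[symmetric] S.loc_mult S.loc_add)
    also have "a0 \<otimes>\<^bsub>A\<^esub> (s \<otimes>\<^bsub>A\<^esub> s0) \<oplus>\<^bsub>A\<^esub> t \<otimes>\<^bsub>A\<^esub> n \<otimes>\<^bsub>A\<^esub> s0 = (a0 \<otimes>\<^bsub>A\<^esub> s \<oplus>\<^bsub>A\<^esub> t \<otimes>\<^bsub>A\<^esub> n) \<otimes>\<^bsub>A\<^esub> s0"
      using c0 sc n t_closed by (simp add: A.l_distr A.m_assoc)
    also have "\<dots> = (s0 \<otimes>\<^bsub>A\<^esub> s0) \<otimes>\<^bsub>A\<^esub> a"
      unfolding e1[symmetric] using c0 x by (simp add: A.m_ac)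
    also have "s0 \<otimes>\<^bsub>A\<^esub> (s \<otimes>\<^bsub>A\<^esub> s0) = (s0 \<otimes>\<^bsub>A\<^esub> s0) \<otimes>\<^bsub>A\<^esub> s"
      using c0 sc by (simp add: A.m_ac)
    also have "loc_frac A ?S ((s0 \<otimes>\<^bsub>A\<^esub> s0) \<otimes>\<^bsub>A\<^esub> a) ((s0 \<otimes>\<^bsub>A\<^esub> s0) \<otimes>\<^bsub>A\<^esub> s) = x"
      unfolding x(1) using x c0 by (intro S.loc_frac_cancel S.mult_S)
    finally show "\<exists>b\<in>carrier (localization A ?S). x = loc_map A ?S \<iota> (loc_map k ?T \<pi> x)
        \<oplus>\<^bsub>localization A ?S\<^esub> loc_frac A ?S t \<one>\<^bsub>A\<^esub> \<otimes>\<^bsub>localization A ?S\<^esub> b"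
      using y by (intro bexI[OF _ y]) (rule sym)
  next
    fix x assume "x \<in> carrier (localization k ?T)"
    then obtain a s where x: "x = loc_frac k ?T a s" "a \<in> carrier k" "s \<in> ?T"
      unfolding T.carrier_localization by blast
    have "\<iota> a \<in> carrier A" "\<iota> s \<in> ?S" using x(2,3) iS by (simp_all add: image_subset_iff)
    then show "loc_map k ?T \<pi> (loc_map A ?S \<iota> x) = x"
      using x i[OF x(2,3)] p[of "\<iota> a" "\<iota> s"] pi_iota by simp
  next
    show "loc_frac A ?S t \<one>\<^bsub>A\<^esub> [^]\<^bsub>localization A ?S\<^esub> Suc m = \<zero>\<^bsub>localization A ?S\<^esub>"
      unfolding pow t_nil S.loc_zero ..
  qed (rule S.cring_localization field.axioms(1)[OF field_localization]
      loc_map_hom[OF mult_set_nonzero mult_set_residue_units iota iS]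
      loc_map_hom[OF mult_set_residue_units mult_set_nonzero pi pT]
      S.loc_frac_closed[OF t_closed S.one_S])+
qed

end

text \<open>A relation is derived from finitely many generators, each involving finitely many units.
  Hence it suffices that each single product, difference or unit is respected for almost all
  \<open>i\<close>, and no individual \<open>f i\<close> has to be a homomorphism.\<close>

lemma word_rel_eventually:
  assumes c: "c \<in> milnor_rel R"
    and unit: "\<And>a. a \<in> Units R \<Longrightarrow> eventually (\<lambda>i. f i a \<in> Units S) F"
    and mult: "\<And>a b. \<lbrakk>a \<in> Units R; b \<in> Units R\<rbrakk> \<Longrightarrow>
        eventually (\<lambda>i. f i (a \<otimes>\<^bsub>R\<^esub> b) = f i a \<otimes>\<^bsub>S\<^esub> f i b) F"
    and minus: "\<And>a. a \<in> Units R \<Longrightarrow> eventually (\<lambda>i. f i (\<one>\<^bsub>R\<^esub> \<ominus>\<^bsub>R\<^esub> a) = \<one>\<^bsub>S\<^esub> \<ominus>\<^bsub>S\<^esub> f i a) F"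
  shows "eventually (\<lambda>i. frag_map (f i) c \<in> milnor_rel S) F"
  using c
proof (induction rule: word_rel.induct)
  case zero then show ?case by (simp add: word_rel.zero)
next
  case (diff x y)
  from eventually_conj[OF diff(3,4)] show ?case
    by (rule eventually_mono) (simp add: frag_extend_diff word_rel.diff)
next
  case (mult u v a b)
  have w: "eventually (\<lambda>i. map (f i) w \<in> lists (Units S)) F" if "w \<in> lists (Units R)" for w
    using that
  proof (induction w)
    case (Cons x w)
    then have "eventually (\<lambda>i. map (f i) w \<in> lists (Units S) \<and> f i x \<in> Units S) F"
      using unit by (intro eventually_conj) auto
    then show ?case by (rule eventually_mono) auto
  qed simp
  have "eventually (\<lambda>i. (map (f i) u \<in> lists (Units S) \<and> map (f i) v \<in> lists (Units S)) \<and>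
      (f i a \<in> Units S \<and> f i b \<in> Units S) \<and> f i (a \<otimes>\<^bsub>R\<^esub> b) = f i a \<otimes>\<^bsub>S\<^esub> f i b) F"
    using mult by (intro eventually_conj w unit assms(3)) (auto simp: units_of_carrier)
  then show ?case
  proof (rule eventually_mono)
    fix i assume h: "(map (f i) u \<in> lists (Units S) \<and> map (f i) v \<in> lists (Units S)) \<and>
      (f i a \<in> Units S \<and> f i b \<in> Units S) \<and> f i (a \<otimes>\<^bsub>R\<^esub> b) = f i a \<otimes>\<^bsub>S\<^esub> f i b"
    then show "frag_map (f i) (frag_of (u @ (a \<otimes>\<^bsub>units_of R\<^esub> b) # v) - frag_of (u @ a # v) - frag_of (u @ b # v))
        \<in> milnor_rel S"
      using word_rel.mult[of "map (f i) u" "units_of S" "map (f i) v" "f i a" "f i b" "steinberg_pairs S"]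
      by (simp add: frag_extend_diff units_of_mult units_of_carrier)
  qed
next
  case (pair u v a b)
  then have ab: "a \<in> Units R" "b \<in> Units R" "b = \<one>\<^bsub>R\<^esub> \<ominus>\<^bsub>R\<^esub> a" by (auto simp: steinberg_pairs_def)
  have w: "eventually (\<lambda>i. map (f i) w \<in> lists (Units S)) F" if "w \<in> lists (Units R)" for w
    using that
  proof (induction w)
    case (Cons x w)
    then have "eventually (\<lambda>i. map (f i) w \<in> lists (Units S) \<and> f i x \<in> Units S) F"
      using unit by (intro eventually_conj) auto
    then show ?case by (rule eventually_mono) auto
  qed simp
  have "eventually (\<lambda>i. (map (f i) u \<in> lists (Units S) \<and> map (f i) v \<in> lists (Units S)) \<and>
      (f i a \<in> Units S \<and> f i b \<in> Units S) \<and> f i (\<one>\<^bsub>R\<^esub> \<ominus>\<^bsub>R\<^esub> a) = \<one>\<^bsub>S\<^esub> \<ominus>\<^bsub>S\<^esub> f i a) F"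
    using pair ab by (intro eventually_conj w unit minus) (auto simp: units_of_carrier)
  then show ?case
  proof (rule eventually_mono)
    fix i assume h: "(map (f i) u \<in> lists (Units S) \<and> map (f i) v \<in> lists (Units S)) \<and>
      (f i a \<in> Units S \<and> f i b \<in> Units S) \<and> f i (\<one>\<^bsub>R\<^esub> \<ominus>\<^bsub>R\<^esub> a) = \<one>\<^bsub>S\<^esub> \<ominus>\<^bsub>S\<^esub> f i a"
    then have "(f i a, f i b) \<in> steinberg_pairs S" using ab by (auto simp: steinberg_pairs_def)
    then show "frag_map (f i) (frag_of (u @ a # b # v)) \<in> milnor_rel S"
      using h word_rel.pair[of "map (f i) u" "units_of S" "map (f i) v" "f i a" "f i b" "steinberg_pairs S"]
      by (simp add: units_of_carrier)
  qed
qed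

locale field_thickening = thickening +
  assumes field_k: "field k"
begin

lemma Units_k: "Units k = carrier k - {\<zero>\<^bsub>k\<^esub>}"
  using field.field_Units[OF field_k] .

text \<open>\<open>A\<close> is local with maximal ideal the kernel of \<open>\<pi>\<close>, since a
  nonzero residue already makes an element a unit. The unit-content condition on polynomials thereby
  becomes nonvanishing of the reduction.\<close>

lemma genideal_eq_carrier_iff:
  assumes X: "X \<subseteq> carrier A"
  shows "Idl\<^bsub>A\<^esub> X = carrier A \<longleftrightarrow> (\<exists>x\<in>X. \<pi> x \<noteq> \<zero>\<^bsub>k\<^esub>)"
proof
  assume e: "Idl\<^bsub>A\<^esub> X = carrier A"
  have ker: "ideal (a_kernel A k \<pi>) A" by (rule ring_hom_ring.kernel_is_ideal[OF ring_hom_ringI2[OF A.ring_axioms k.ring_axioms pi]])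
  show "\<exists>x\<in>X. \<pi> x \<noteq> \<zero>\<^bsub>k\<^esub>"
  proof (rule ccontr)
    assume "\<not> ?thesis"
    then have "X \<subseteq> a_kernel A k \<pi>" using X unfolding a_kernel_def' by blast
    then have "carrier A \<subseteq> a_kernel A k \<pi>" unfolding e[symmetric] by (rule A.genideal_minimal[OF ker])
    then have "\<pi> \<one>\<^bsub>A\<^esub> = \<zero>\<^bsub>k\<^esub>" using A.one_closed unfolding a_kernel_def' by blast
    then show False using k.one_not_zero by simp
  qed
next
  assume "\<exists>x\<in>X. \<pi> x \<noteq> \<zero>\<^bsub>k\<^esub>"
  then obtain x where x: "x \<in> X" "\<pi> x \<noteq> \<zero>\<^bsub>k\<^esub>" by blast
  have xc: "x \<in> carrier A" using x(1) X by blast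
  have u: "x \<in> Units A" unfolding Units_iff Units_k using x(2) xc by simp
  interpret I: ideal "Idl\<^bsub>A\<^esub> X" A by (rule A.genideal_ideal[OF X])
  have "x \<in> Idl\<^bsub>A\<^esub> X" using A.genideal_self[OF X] x(1) by blast
  then have "inv\<^bsub>A\<^esub> x \<otimes>\<^bsub>A\<^esub> x \<in> Idl\<^bsub>A\<^esub> X" using A.Units_inv_closed[OF u] by (rule I.I_l_closed)
  then have "\<one>\<^bsub>A\<^esub> \<in> Idl\<^bsub>A\<^esub> X" using u by simp
  then show "Idl\<^bsub>A\<^esub> X = carrier A" by (rule I.one_imp_carrier)
qed

section \<open>The rings \<open>A(s_1)\<close> and \<open>A(s_1, s_2)\<close> over a thickening, and
  the specialization of \<open>s_2\<close>\<close>

lemma UPA: "cring (UP A)" by (rule cring_UP[OF A])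
lemma UPUPA: "cring (UP (UP A))" by (rule cring_UP[OF UPA])

sublocale U: thickening "UP A" "UP k" "up_map \<iota>" "up_map \<pi>" "poly_const A t" m
  by (rule UP_thickening)

sublocale UU: thickening "UP (UP A)" "UP (UP k)" "up_map (up_map \<iota>)" "up_map (up_map \<pi>)"
    "poly_const (UP A) (poly_const A t)" m
  by (rule U.UP_thickening)

lemma unit_content1_eq: "unit_content1 A = U.residue_units"
proof -
  have "Idl\<^bsub>A\<^esub> (range (coeff (UP A) f)) = carrier A \<longleftrightarrow> up_map \<pi> f \<noteq> \<zero>\<^bsub>UP k\<^esub>"
    if f: "f \<in> carrier (UP A)" for f
  proof -
    have c: "coeff (UP A) f = f" using UP_apply(1)[OF A f] by (intro ext)
    have "range f \<subseteq> carrier A" using UP_apply(2)[OF A f] by auto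
    then have "Idl\<^bsub>A\<^esub> (range f) = carrier A \<longleftrightarrow> (\<exists>n. \<pi> (f n) \<noteq> \<zero>\<^bsub>k\<^esub>)"
      by (subst genideal_eq_carrier_iff) auto
    also have "\<dots> \<longleftrightarrow> up_map \<pi> f \<noteq> \<zero>\<^bsub>UP k\<^esub>"
      using UP_apply(6)[OF k.is_cring] by (auto simp: fun_eq_iff)
    finally show ?thesis unfolding c .
  qed
  then show ?thesis unfolding unit_content1_def U.residue_units_def by blast
qed

lemma unit_content2_eq: "unit_content2 A = UU.residue_units"
proof -
  have "Idl\<^bsub>A\<^esub> {coeff (UP A) (coeff (UP (UP A)) f i) j | i j. True} = carrier A
      \<longleftrightarrow> up_map (up_map \<pi>) f \<noteq> \<zero>\<^bsub>UP (UP k)\<^esub>"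
    if f: "f \<in> carrier (UP (UP A))" for f
  proof -
    note fi = UP_apply(2)[OF UPA f]
    have c: "coeff (UP A) (coeff (UP (UP A)) f i) j = f i j" for i j
      using UP_apply(1)[OF UPA f] UP_apply(1)[OF A fi] by simp
    have "{f i j | i j. True} \<subseteq> carrier A" using UP_apply(2)[OF A fi] by auto
    then have "Idl\<^bsub>A\<^esub> {f i j | i j. True} = carrier A \<longleftrightarrow> (\<exists>i j. \<pi> (f i j) \<noteq> \<zero>\<^bsub>k\<^esub>)"
      by (subst genideal_eq_carrier_iff) auto
    also have "\<dots> \<longleftrightarrow> up_map (up_map \<pi>) f \<noteq> \<zero>\<^bsub>UP (UP k)\<^esub>"
      using UP_apply(6)[OF k.is_cring] UP_apply(6)[OF cring_UP[OF k.is_cring]]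
      by (auto simp: fun_eq_iff)
    finally show ?thesis unfolding c .
  qed
  then show ?thesis unfolding unit_content2_def UU.residue_units_def by blast
qed

lemma mem_unit_content1: "f \<in> unit_content1 A \<longleftrightarrow> f \<in> carrier (UP A) \<and> up_map \<pi> f \<noteq> \<zero>\<^bsub>UP k\<^esub>"
  unfolding unit_content1_eq U.residue_units_def by simp

lemma mem_unit_content2: "f \<in> unit_content2 A \<longleftrightarrow> f \<in> carrier (UP (UP A)) \<and> up_map (up_map \<pi>) f \<noteq> \<zero>\<^bsub>UP (UP k)\<^esub>"
  unfolding unit_content2_eq UU.residue_units_def by simp

lemma mult_set1: "mult_set (UP A) (unit_content1 A)"
  unfolding unit_content1_eq by (rule U.mult_set_residue_units)

lemma mult_set2: "mult_set (UP (UP A)) (unit_content2 A)"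
  unfolding unit_content2_eq by (rule UU.mult_set_residue_units)

sublocale R1: mult_set "UP A" "unit_content1 A" by (rule mult_set1)
sublocale R2: mult_set "UP (UP A)" "unit_content2 A" by (rule mult_set2)

lemma cring_rat1: "cring (rat1 A)" unfolding rat1_def by (rule R1.cring_localization)
lemma cring_rat2: "cring (rat2 A)" unfolding rat2_def by (rule R2.cring_localization)

lemma const_unit_content2:
  assumes f: "f \<in> unit_content1 A"
  shows "poly_const (UP A) f \<in> unit_content2 A"
proof -
  have fc: "f \<in> carrier (UP A)" "up_map \<pi> f \<noteq> \<zero>\<^bsub>UP k\<^esub>" using f by (simp_all add: mem_unit_content1)
  have "up_map (up_map \<pi>) (poly_const (UP A) f) = poly_const (UP k) (up_map \<pi> f)"
    by (rule up_map_const[OF UPA U.k.is_cring U.pi fc(1)])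
  moreover have "poly_const (UP k) (up_map \<pi> f) 0 = up_map \<pi> f"
    using UP_apply(8)[OF U.k.is_cring] fc(1) by simp
  moreover have "\<zero>\<^bsub>UP (UP k)\<^esub> 0 = \<zero>\<^bsub>UP k\<^esub>" by (rule UP_apply(6)[OF U.k.is_cring])
  ultimately have "up_map (up_map \<pi>) (poly_const (UP A) f) \<noteq> \<zero>\<^bsub>UP (UP k)\<^esub>"
    using fc(2) by metis
  then show ?thesis using UP_closed(1)[OF UPA fc(1)] by (simp add: mem_unit_content2)
qed

lemma up_const_unit_content2:
  assumes f: "f \<in> unit_content1 A"
  shows "up_map (poly_const A) f \<in> unit_content2 A"
proof -
  have fc: "f \<in> carrier (UP A)" "up_map \<pi> f \<noteq> \<zero>\<^bsub>UP k\<^esub>" using f by (simp_all add: mem_unit_content1)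
  obtain n where n: "\<pi> (f n) \<noteq> \<zero>\<^bsub>k\<^esub>"
    using fc(2) UP_apply(6)[OF k.is_cring] by (auto simp: fun_eq_iff)
  have fn: "f n \<in> carrier A" by (rule UP_apply(2)[OF A fc(1)])
  have "up_map (up_map \<pi>) (up_map (poly_const A) f) n 0 = \<pi> (f n)"
    using fn by (simp add: UP_apply(8)[OF A])
  moreover have "\<zero>\<^bsub>UP (UP k)\<^esub> n 0 = \<zero>\<^bsub>k\<^esub>"
    by (simp add: UP_apply(6)[OF U.k.is_cring] UP_apply(6)[OF k.is_cring])
  ultimately have "up_map (up_map \<pi>) (up_map (poly_const A) f) \<noteq> \<zero>\<^bsub>UP (UP k)\<^esub>"
    using n by metis
  then show ?thesis
    using up_map_closed[OF A UPA poly_const_hom[OF A] fc(1)] by (simp add: mem_unit_content2)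
qed

lemma poly_const2_hom: "poly_const2 A \<in> ring_hom A (UP (UP A))"
  using ring_hom_trans[OF poly_const_hom[OF A] poly_const_hom[OF UPA]]
  by (simp add: poly_const2_def[abs_def] comp_def)

lemma eval_incl1: "eval A (UP (UP A)) (poly_const2 A) (poly_const (UP A) (poly_var A)) \<in> ring_hom (UP A) (UP (UP A))"
  by (rule eval_hom(1)[OF A UPUPA poly_const2_hom UP_closed(1)[OF UPA UP_closed(2)[OF A]]])

lemma eval_incl2: "eval A (UP (UP A)) (poly_const2 A) (poly_var (UP A)) \<in> ring_hom (UP A) (UP (UP A))"
  by (rule eval_hom(1)[OF A UPUPA poly_const2_hom UP_closed(2)[OF UPA]])

lemma eval_incl1_units:
  "eval A (UP (UP A)) (poly_const2 A) (poly_const (UP A) (poly_var A)) ` unit_content1 A \<subseteq> unit_content2 A"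
  using const_unit_content2 incl1_poly[OF A] R1.S_closed by auto

lemma eval_incl2_units:
  "eval A (UP (UP A)) (poly_const2 A) (poly_var (UP A)) ` unit_content1 A \<subseteq> unit_content2 A"
  using up_const_unit_content2 incl2_poly[OF A] R1.S_closed by auto

lemma rat_incl1_hom: "rat_incl1 A \<in> ring_hom (rat1 A) (rat2 A)"
  unfolding rat_incl1_def rat1_def rat2_def
  by (rule loc_map_hom[OF mult_set1 mult_set2 eval_incl1 eval_incl1_units])

lemma rat_incl2_hom: "rat_incl2 A \<in> ring_hom (rat1 A) (rat2 A)"
  unfolding rat_incl2_def rat1_def rat2_def
  by (rule loc_map_hom[OF mult_set1 mult_set2 eval_incl2 eval_incl2_units])

lemma rat_incl1_frac:
  assumes "a \<in> carrier (UP A)" "s \<in> unit_content1 A"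
  shows "rat_incl1 A (loc_frac (UP A) (unit_content1 A) a s) =
    loc_frac (UP (UP A)) (unit_content2 A) (poly_const (UP A) a) (poly_const (UP A) s)"
  unfolding rat_incl1_def loc_map_frac[OF mult_set1 mult_set2 eval_incl1 eval_incl1_units assms]
  using incl1_poly[OF A] assms R1.S_closed by simp

lemma rat_incl2_frac:
  assumes "a \<in> carrier (UP A)" "s \<in> unit_content1 A"
  shows "rat_incl2 A (loc_frac (UP A) (unit_content1 A) a s) =
    loc_frac (UP (UP A)) (unit_content2 A) (up_map (poly_const A) a) (up_map (poly_const A) s)"
  unfolding rat_incl2_def loc_map_frac[OF mult_set1 mult_set2 eval_incl2 eval_incl2_units assms]
  using incl2_poly[OF A] assms R1.S_closed by simp

lemma rat_cases:
  assumes "x \<in> carrier (rat1 A)"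
  obtains a s where "x = loc_frac (UP A) (unit_content1 A) a s" "a \<in> carrier (UP A)" "s \<in> unit_content1 A"
  using assms unfolding rat1_def R1.carrier_localization by blast

text \<open>The images of \<open>s\<^sub>2\<close> under \<open>s\<^sub>2 \<mapsto> s\<^sub>1\<^sup>M\<close> are denominators only for almost all \<open>M\<close>. Choosing the
  representative of a fraction independently of \<open>M\<close> makes \<open>spec M\<close> a total function that
  behaves as a ring homomorphism for almost all \<open>M\<close>, on any finite set of fractions.\<close>

lemma subst_poly_unit_content:
  assumes s: "s \<in> unit_content2 A"
  shows "eventually (\<lambda>M. subst_poly A M s \<in> unit_content1 A) sequentially"
proof -
  have sc: "s \<in> carrier (UP (UP A))" using s by (simp add: mem_unit_content2)
  define g where "g = up_map (up_map \<pi>) s"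
  have g: "g \<in> carrier (UP (UP k))" "g \<noteq> \<zero>\<^bsub>UP (UP k)\<^esub>"
    using s by (auto simp: mem_unit_content2 g_def)
  have ex: "\<exists>i. g i \<noteq> \<zero>\<^bsub>UP k\<^esub>"
    using g(2) UP_apply(6)[OF U.k.is_cring] by (auto simp: fun_eq_iff)
  define l where "l = (LEAST i. g i \<noteq> \<zero>\<^bsub>UP k\<^esub>)"
  have l: "g l \<noteq> \<zero>\<^bsub>UP k\<^esub>" unfolding l_def by (rule LeastI_ex[OF ex])
  have low: "g i = \<zero>\<^bsub>UP k\<^esub>" if "i < l" for i using not_less_Least[of i] that unfolding l_def by blast
  obtain r where r: "g l r \<noteq> \<zero>\<^bsub>k\<^esub>" using l UP_apply(6)[OF k.is_cring] by (auto simp: fun_eq_iff)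
  show ?thesis
    using eventually_gt_at_top[of r]
  proof eventually_elim
    case (elim M)
    have "subst_poly k M g (M * l + r) = g l r"
      by (rule subst_poly_coeff[OF k.is_cring g(1) low elim])
    then have "subst_poly k M g \<noteq> \<zero>\<^bsub>UP k\<^esub>" using r UP_apply(6)[OF k.is_cring] by metis
    then have "up_map \<pi> (subst_poly A M s) \<noteq> \<zero>\<^bsub>UP k\<^esub>"
      using subst_poly_natural[OF A k.is_cring pi sc] by (simp add: g_def)
    then show ?case
      using ring_hom_closed[OF subst_poly_eval(1)[OF A] sc] by (simp add: mem_unit_content1)
  qed
qed

definition spec :: "nat \<Rightarrow> ((nat \<Rightarrow> nat \<Rightarrow> 'a) \<times> (nat \<Rightarrow> nat \<Rightarrow> 'a)) set \<Rightarrow> ((nat \<Rightarrow> 'a) \<times> (nat \<Rightarrow> 'a)) set" where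
  "spec M x = (case (SOME as. as \<in> x) of (a, s) \<Rightarrow>
     loc_frac (UP A) (unit_content1 A) (subst_poly A M a) (subst_poly A M s))"

text \<open>The representative \<open>(b, t)\<close> picked by \<open>spec\<close> and the given one
  \<open>(a, s)\<close> are equal as fractions by a single witness \<open>u\<close>. Once the images
  of \<open>u\<close>, \<open>s\<close> and \<open>t\<close> are denominators, that same equation
  identifies the specialized fractions.\<close>

lemma spec_frac:
  assumes a: "a \<in> carrier (UP (UP A))" "s \<in> unit_content2 A"
  shows "eventually (\<lambda>M. subst_poly A M s \<in> unit_content1 A \<and>
    spec M (loc_frac (UP (UP A)) (unit_content2 A) a s) =
      loc_frac (UP A) (unit_content1 A) (subst_poly A M a) (subst_poly A M s)) sequentially"
proof -
  let ?x = "loc_frac (UP (UP A)) (unit_content2 A) a s"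
  obtain b t where bt: "(SOME as. as \<in> ?x) = (b, t)" by (cases "SOME as. as \<in> ?x")
  have "(b, t) \<in> ?x" using someI[of "\<lambda>as. as \<in> ?x", OF R2.loc_frac_self[OF a]] bt by simp
  note b = R2.loc_frac_mem[OF a this]
  obtain u where u: "u \<in> unit_content2 A"
    "u \<otimes>\<^bsub>UP (UP A)\<^esub> (s \<otimes>\<^bsub>UP (UP A)\<^esub> b) = u \<otimes>\<^bsub>UP (UP A)\<^esub> (t \<otimes>\<^bsub>UP (UP A)\<^esub> a)"
    using b(3) R2.loc_frac_eq_iff[OF b(1,2) a] by blast
  note cl = R2.S_closed[OF u(1)] R2.S_closed[OF a(2)] R2.S_closed[OF b(2)]
  have "eventually (\<lambda>M. subst_poly A M u \<in> unit_content1 A \<and> subst_poly A M s \<in> unit_content1 A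
      \<and> subst_poly A M t \<in> unit_content1 A) sequentially"
    by (intro eventually_conj subst_poly_unit_content u a b)
  then show ?thesis
  proof eventually_elim
    case (elim M)
    note h = subst_poly_eval(1)[OF A, of M]
    have "subst_poly A M (u \<otimes>\<^bsub>UP (UP A)\<^esub> (s \<otimes>\<^bsub>UP (UP A)\<^esub> b)) =
        subst_poly A M (u \<otimes>\<^bsub>UP (UP A)\<^esub> (t \<otimes>\<^bsub>UP (UP A)\<^esub> a))" using u(2) by simp
    then have "subst_poly A M u \<otimes>\<^bsub>UP A\<^esub> (subst_poly A M s \<otimes>\<^bsub>UP A\<^esub> subst_poly A M b) =
        subst_poly A M u \<otimes>\<^bsub>UP A\<^esub> (subst_poly A M t \<otimes>\<^bsub>UP A\<^esub> subst_poly A M a)"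
      using cl a(1) b(1) ring_hom_mult[OF h] by simp
    then have "loc_frac (UP A) (unit_content1 A) (subst_poly A M b) (subst_poly A M t) =
        loc_frac (UP A) (unit_content1 A) (subst_poly A M a) (subst_poly A M s)"
      using elim a(1) b(1) ring_hom_closed[OF h] by (subst R1.loc_frac_eq_iff) auto
    then show ?case using elim by (simp add: spec_def bt)
  qed
qed

lemma rat2_cases:
  assumes "x \<in> carrier (rat2 A)"
  obtains a s where "x = loc_frac (UP (UP A)) (unit_content2 A) a s" "a \<in> carrier (UP (UP A))" "s \<in> unit_content2 A"
  using assms unfolding rat2_def R2.carrier_localization by blast

lemma spec_closed:
  assumes x: "x \<in> carrier (rat2 A)" shows "eventually (\<lambda>M. spec M x \<in> carrier (rat1 A)) sequentially"
proof -
  obtain a s where a: "x = loc_frac (UP (UP A)) (unit_content2 A) a s" "a \<in> carrier (UP (UP A))" "s \<in> unit_content2 A"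
    using x by (rule rat2_cases)
  show ?thesis
    using spec_frac[OF a(2,3)]
    by eventually_elim (use ring_hom_closed[OF subst_poly_eval(1)[OF A] a(2)] in \<open>simp add: a(1) rat1_def R1.loc_frac_closed\<close>)
qed

lemma spec_mult:
  assumes x: "x \<in> carrier (rat2 A)" and y: "y \<in> carrier (rat2 A)"
  shows "eventually (\<lambda>M. spec M (x \<otimes>\<^bsub>rat2 A\<^esub> y) = spec M x \<otimes>\<^bsub>rat1 A\<^esub> spec M y) sequentially"
proof -
  obtain a s where a: "x = loc_frac (UP (UP A)) (unit_content2 A) a s" "a \<in> carrier (UP (UP A))" "s \<in> unit_content2 A"
    using x by (rule rat2_cases)
  obtain b t where b: "y = loc_frac (UP (UP A)) (unit_content2 A) b t" "b \<in> carrier (UP (UP A))" "t \<in> unit_content2 A"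
    using y by (rule rat2_cases)
  have ab: "a \<otimes>\<^bsub>UP (UP A)\<^esub> b \<in> carrier (UP (UP A))" "s \<otimes>\<^bsub>UP (UP A)\<^esub> t \<in> unit_content2 A"
    using a b R2.mult_S by auto
  show ?thesis
    using spec_frac[OF a(2,3)] spec_frac[OF b(2,3)] spec_frac[OF ab]
  proof eventually_elim
    case (elim M)
    note h = subst_poly_eval(1)[OF A, of M]
    show ?case
      using elim a b ring_hom_mult[OF h] ring_hom_closed[OF h] R2.S_closed
      by (simp add: rat1_def rat2_def R1.loc_mult R2.loc_mult)
  qed
qed

lemma spec_one: "eventually (\<lambda>M. spec M \<one>\<^bsub>rat2 A\<^esub> = \<one>\<^bsub>rat1 A\<^esub>) sequentially"
  using spec_frac[OF UU.A.one_closed R2.one_S]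
proof eventually_elim
  case (elim M)
  then show ?case
    using ring_hom_one[OF subst_poly_eval(1)[OF A, of M]]
    by (simp add: rat1_def rat2_def R1.loc_one R2.loc_one)
qed

lemma spec_one_minus:
  assumes x: "x \<in> carrier (rat2 A)"
  shows "eventually (\<lambda>M. spec M (\<one>\<^bsub>rat2 A\<^esub> \<ominus>\<^bsub>rat2 A\<^esub> x) = \<one>\<^bsub>rat1 A\<^esub> \<ominus>\<^bsub>rat1 A\<^esub> spec M x) sequentially"
proof -
  obtain a s where a: "x = loc_frac (UP (UP A)) (unit_content2 A) a s" "a \<in> carrier (UP (UP A))" "s \<in> unit_content2 A"
    using x by (rule rat2_cases)
  have sc: "s \<in> carrier (UP (UP A))" by (rule R2.S_closed[OF a(3)])
  have sa: "s \<ominus>\<^bsub>UP (UP A)\<^esub> a \<in> carrier (UP (UP A))" using a sc by simp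
  have e: "\<one>\<^bsub>rat2 A\<^esub> \<ominus>\<^bsub>rat2 A\<^esub> x = loc_frac (UP (UP A)) (unit_content2 A) (s \<ominus>\<^bsub>UP (UP A)\<^esub> a) s"
    using a sc by (simp add: rat2_def R2.loc_one R2.loc_minus R2.one_S)
  show ?thesis
    using spec_frac[OF a(2,3)] spec_frac[OF sa a(3)]
  proof eventually_elim
    case (elim M)
    interpret h: ring_hom_cring "UP (UP A)" "UP A" "subst_poly A M"
      by (rule ring_hom_cringI[OF UPUPA UPA subst_poly_eval(1)[OF A]])
    have "subst_poly A M (s \<ominus>\<^bsub>UP (UP A)\<^esub> a) = subst_poly A M s \<ominus>\<^bsub>UP A\<^esub> subst_poly A M a"
      using a sc by (simp add: a_minus_def)
    then show ?case
      using elim a sc unfolding e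
      by (simp add: rat1_def R1.loc_one R1.loc_minus R1.one_S)
  qed
qed

lemma spec_unit:
  assumes x: "x \<in> Units (rat2 A)" shows "eventually (\<lambda>M. spec M x \<in> Units (rat1 A)) sequentially"
proof -
  interpret L1: cring "rat1 A" by (rule cring_rat1)
  interpret L2: cring "rat2 A" by (rule cring_rat2)
  define y where "y = inv\<^bsub>rat2 A\<^esub> x"
  have y: "y \<in> carrier (rat2 A)" "x \<otimes>\<^bsub>rat2 A\<^esub> y = \<one>\<^bsub>rat2 A\<^esub>" "x \<in> carrier (rat2 A)"
    using x L2.Units_inv_closed L2.Units_r_inv L2.Units_closed by (auto simp: y_def)
  show ?thesis
    using spec_mult[OF y(3,1)] spec_one spec_closed[OF y(3)] spec_closed[OF y(1)]
  proof eventually_elim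
    case (elim M)
    then have "spec M x \<otimes>\<^bsub>rat1 A\<^esub> spec M y = \<one>\<^bsub>rat1 A\<^esub>" using y by simp
    moreover have "spec M y \<otimes>\<^bsub>rat1 A\<^esub> spec M x = \<one>\<^bsub>rat1 A\<^esub>" using calculation elim L1.m_comm by metis
    ultimately show ?case using elim unfolding Units_def by blast
  qed
qed

text \<open>The \<open>A\<close>-linear substitution \<open>s_1 -> s_1^M\<close>. Over
  \<open>k\<close> and for \<open>M = p^N\<close> this is the relative Frobenius: it differs from
  the \<open>M\<close>-th power map only by the powers taken of the coefficients, which perfectness
  makes reversible.\<close>

definition frob :: "nat \<Rightarrow> ((nat \<Rightarrow> 'a) \<times> (nat \<Rightarrow> 'a)) set \<Rightarrow> ((nat \<Rightarrow> 'a) \<times> (nat \<Rightarrow> 'a)) set" where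
  "frob M = loc_map (UP A) (unit_content1 A) (pow_poly A M)"

lemma pow_poly_nonzero:
  assumes M: "M > 0" and f: "f \<in> carrier (UP k)" "f \<noteq> \<zero>\<^bsub>UP k\<^esub>"
  shows "pow_poly k M f \<noteq> \<zero>\<^bsub>UP k\<^esub>"
proof -
  define g where "g = up_map (poly_const k) f"
  have g: "g \<in> carrier (UP (UP k))"
    unfolding g_def by (rule up_map_closed[OF k.is_cring U.k.is_cring poly_const_hom[OF k.is_cring] f(1)])
  have fc: "f i \<in> carrier k" for i by (rule UP_apply(2)[OF k.is_cring f(1)])
  have ex: "\<exists>i. f i \<noteq> \<zero>\<^bsub>k\<^esub>"
    using f(2) UP_apply(6)[OF k.is_cring] by (auto simp: fun_eq_iff)
  define l where "l = (LEAST i. f i \<noteq> \<zero>\<^bsub>k\<^esub>)"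
  have l: "f l \<noteq> \<zero>\<^bsub>k\<^esub>" unfolding l_def by (rule LeastI_ex[OF ex])
  have "f i = \<zero>\<^bsub>k\<^esub>" if "i < l" for i using not_less_Least[of i] that unfolding l_def by blast
  then have low: "g i = \<zero>\<^bsub>UP k\<^esub>" if "i < l" for i
    using that fc by (intro ext) (simp add: g_def UP_apply(6)[OF k.is_cring] UP_apply(8)[OF k.is_cring])
  have "subst_poly k M g (M * l + 0) = g l 0"
    by (rule subst_poly_coeff[OF k.is_cring g low M])
  then have "pow_poly k M f (M * l + 0) = f l"
    using fc pow_poly_eq[OF k.is_cring f(1), of M] by (simp add: g_def UP_apply(8)[OF k.is_cring])
  then show ?thesis using l UP_apply(6)[OF k.is_cring] by metis
qed

lemma pow_poly_units: "M > 0 \<Longrightarrow> pow_poly A M ` unit_content1 A \<subseteq> unit_content1 A"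
proof (rule image_subsetI)
  fix s assume M: "M > 0" and s: "s \<in> unit_content1 A"
  then have sc: "s \<in> carrier (UP A)" "up_map \<pi> s \<noteq> \<zero>\<^bsub>UP k\<^esub>" by (simp_all add: mem_unit_content1)
  have "up_map \<pi> (pow_poly A M s) \<noteq> \<zero>\<^bsub>UP k\<^esub>"
    using pow_poly_natural[OF A k.is_cring pi sc(1), of M] pow_poly_nonzero[OF M _ sc(2)] sc(1) by simp
  then show "pow_poly A M s \<in> unit_content1 A"
    using ring_hom_closed[OF pow_poly_eval(1)[OF A] sc(1)] by (simp add: mem_unit_content1)
qed

lemma frob_frac:
  "\<lbrakk>M > 0; a \<in> carrier (UP A); s \<in> unit_content1 A\<rbrakk> \<Longrightarrow>
   frob M (loc_frac (UP A) (unit_content1 A) a s) = loc_frac (UP A) (unit_content1 A) (pow_poly A M a) (pow_poly A M s)"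
  unfolding frob_def by (rule loc_map_frac[OF mult_set1 mult_set1 pow_poly_eval(1)[OF A] pow_poly_units])

lemma frob_hom: "M > 0 \<Longrightarrow> frob M \<in> ring_hom (rat1 A) (rat1 A)"
  unfolding frob_def rat1_def
  by (rule loc_map_hom[OF mult_set1 mult_set1 pow_poly_eval(1)[OF A] pow_poly_units])

lemma frob_frob:
  assumes "M > 0" "N > 0" "x \<in> carrier (rat1 A)"
  shows "frob M (frob N x) = frob (M * N) x"
proof -
  obtain a s where a: "x = loc_frac (UP A) (unit_content1 A) a s" "a \<in> carrier (UP A)" "s \<in> unit_content1 A"
    using assms(3) by (rule rat_cases)
  have sc: "s \<in> carrier (UP A)" by (rule R1.S_closed[OF a(3)])
  have "pow_poly A N s \<in> unit_content1 A" using pow_poly_units[OF assms(2)] a(3) by auto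
  moreover have "pow_poly A N a \<in> carrier (UP A)" by (rule ring_hom_closed[OF pow_poly_eval(1)[OF A] a(2)])
  ultimately show ?thesis using assms a sc by (simp add: frob_frac pow_poly_mult[OF A])
qed

lemma spec_incl1:
  assumes x: "x \<in> carrier (rat1 A)"
  shows "eventually (\<lambda>M. spec M (rat_incl1 A x) = x) sequentially"
proof -
  obtain a s where a: "x = loc_frac (UP A) (unit_content1 A) a s" "a \<in> carrier (UP A)" "s \<in> unit_content1 A"
    using x by (rule rat_cases)
  have sc: "s \<in> carrier (UP A)" by (rule R1.S_closed[OF a(3)])
  show ?thesis
    using spec_frac[OF UP_closed(1)[OF UPA a(2)] const_unit_content2[OF a(3)]]
    by eventually_elim (use a sc in \<open>simp add: rat_incl1_frac subst_poly_eval(2)[OF A]\<close>)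
qed

text \<open>The image of \<open>i_2\<close> involves only \<open>s_2\<close>, so
  \<open>s_1^M\<close> replaces the variable everywhere. Together with \<open>spec_incl1\<close>
  this makes improved classes invariant under \<open>frob M\<close>. Positivity of \<open>M\<close>
  keeps the denominators admissible.\<close>

lemma spec_incl2:
  assumes x: "x \<in> carrier (rat1 A)"
  shows "eventually (\<lambda>M. spec M (rat_incl2 A x) = frob M x) sequentially"
proof -
  obtain a s where a: "x = loc_frac (UP A) (unit_content1 A) a s" "a \<in> carrier (UP A)" "s \<in> unit_content1 A"
    using x by (rule rat_cases)
  have sc: "s \<in> carrier (UP A)" by (rule R1.S_closed[OF a(3)])
  show ?thesis
    using spec_frac[OF up_map_closed[OF A UPA poly_const_hom[OF A] a(2)] up_const_unit_content2[OF a(3)]]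
      eventually_gt_at_top[of 0]
    by eventually_elim (use a sc in \<open>simp add: rat_incl2_frac frob_frac pow_poly_eq[OF A]\<close>)
qed

end

text \<open>The bridge to the symbol calculus: any two adjacent letters of a word, with the rest
  fixed, form a Steinberg symbol modulo the Milnor relations. Results about two entries thus reach
  every degree at least 2.\<close>

lemma word_symbol:
  assumes R: "cring R" and u: "u \<in> lists (Units R)" and v: "v \<in> lists (Units R)"
  shows "steinberg_symbol R (\<lambda>a b. frag_of (u @ a # b # v)) (milnor_rel R)"
proof -
  interpret cring R by (rule R)
  note uv = u v
  show ?thesis
  proof (rule steinberg_symbol.intro[OF R], unfold_locales)
    fix a b c assume h: "a \<in> Units R" "b \<in> Units R" "c \<in> Units R"
    show "frag_of (u @ (a \<otimes>\<^bsub>R\<^esub> b) # c # v) - frag_of (u @ a # c # v) - frag_of (u @ b # c # v) \<in> milnor_rel R"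
      using word_rel.mult[of u "units_of R" "c # v" a b "steinberg_pairs R"] h uv
      by (simp add: units_of_carrier units_of_mult)
    show "frag_of (u @ a # (b \<otimes>\<^bsub>R\<^esub> c) # v) - frag_of (u @ a # b # v) - frag_of (u @ a # c # v) \<in> milnor_rel R"
      using word_rel.mult[of "u @ [a]" "units_of R" v b c "steinberg_pairs R"] h uv
      by (simp add: units_of_carrier units_of_mult)
  next
    fix a assume h: "a \<in> Units R" "\<one>\<^bsub>R\<^esub> \<ominus>\<^bsub>R\<^esub> a \<in> Units R"
    then have "(a, \<one>\<^bsub>R\<^esub> \<ominus>\<^bsub>R\<^esub> a) \<in> steinberg_pairs R" by (auto simp: steinberg_pairs_def)
    then show "frag_of (u @ a # (\<one>\<^bsub>R\<^esub> \<ominus>\<^bsub>R\<^esub> a) # v) \<in> milnor_rel R"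
      using uv by (intro word_rel.pair) (auto simp: units_of_carrier)
  qed (auto intro: word_rel.zero word_rel.diff)
qed

text \<open>Over a field only \<open>x = 1\<close> escapes \<open>neg_zero\<close>, and there the
  symbol has an entry 1.\<close>

lemma field_word_neg:
  assumes L: "field L" and x: "x \<in> Units L" and u: "u \<in> lists (Units L)" and v: "v \<in> lists (Units L)"
  shows "frag_of (u @ x # (\<ominus>\<^bsub>L\<^esub> x) # v) \<in> milnor_rel L"
proof -
  interpret L: field L by (rule L)
  interpret s: steinberg_symbol L "\<lambda>a b. frag_of (u @ a # b # v)" "milnor_rel L"
    by (rule word_symbol[OF L.is_cring u v])
  have xc: "x \<in> carrier L" using x by auto
  show ?thesis
  proof (cases "x = \<one>\<^bsub>L\<^esub>")
    case True
    have "\<ominus>\<^bsub>L\<^esub> \<one>\<^bsub>L\<^esub> \<in> Units L" by (rule L.Units_minus_one_closed)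
    then show ?thesis using s.one_left True by simp
  next
    case False
    then have "\<one>\<^bsub>L\<^esub> \<ominus>\<^bsub>L\<^esub> x \<noteq> \<zero>\<^bsub>L\<^esub>" using xc by auto
    then have "\<one>\<^bsub>L\<^esub> \<ominus>\<^bsub>L\<^esub> x \<in> Units L" using xc by (simp add: L.field_Units)
    then show ?thesis by (rule s.neg_zero[OF x])
  qed
qed

lemma domain_mult_set: "domain k \<Longrightarrow> mult_set k (carrier k - {\<zero>\<^bsub>k\<^esub>})"
proof -
  assume "domain k"
  then interpret k: domain k .
  show ?thesis by unfold_locales (auto simp: k.integral_iff)
qed

section \<open>The specialization at the origin\<close>

definition ord0 :: "('a, 'b) ring_scheme \<Rightarrow> (nat \<Rightarrow> 'a) \<Rightarrow> nat" where
  "ord0 D p = (LEAST n. p n \<noteq> \<zero>\<^bsub>D\<^esub>)"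

definition low_coeff :: "('a, 'b) ring_scheme \<Rightarrow> (nat \<Rightarrow> 'a) \<Rightarrow> 'a" where
  "low_coeff D p = p (ord0 D p)"

text \<open>On units this is the specialization map of Milnor K-theory at the place
  \<open>s = 0\<close> with uniformizer \<open>s\<close>: the value is the residue of
  \<open>x\<close> divided by \<open>s\<close> to its valuation. The map \<open>j\<close> into a
  field allows the coefficients to form a domain such as \<open>k[s_1]\<close>.\<close>

definition low_map :: "('a, 'b) ring_scheme \<Rightarrow> ('c, 'd) ring_scheme \<Rightarrow> ('a \<Rightarrow> 'c) \<Rightarrow>
    ((nat \<Rightarrow> 'a) \<times> (nat \<Rightarrow> 'a)) set \<Rightarrow> 'c" where
  "low_map D L j x = (case (SOME as. as \<in> x) of (a, s) \<Rightarrow>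
     j (low_coeff D a) \<otimes>\<^bsub>L\<^esub> inv\<^bsub>L\<^esub> (j (low_coeff D s)))"

context domain
begin

interpretation P: UP_domain R "UP R" by unfold_locales

abbreviation nonzero_polys :: "(nat \<Rightarrow> 'a) set" where
  "nonzero_polys \<equiv> carrier (UP R) - {\<zero>\<^bsub>UP R\<^esub>}"

lemma poly_nonzero_ex: "p \<noteq> \<zero>\<^bsub>UP R\<^esub> \<Longrightarrow> \<exists>n. p n \<noteq> \<zero>"
  using UP_apply(6)[OF is_cring] by (auto simp: fun_eq_iff)

lemma low_coeff_nonzero: "p \<noteq> \<zero>\<^bsub>UP R\<^esub> \<Longrightarrow> low_coeff R p \<noteq> \<zero>"
  unfolding low_coeff_def ord0_def by (rule LeastI_ex[OF poly_nonzero_ex])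

lemma below_ord0: "n < ord0 R p \<Longrightarrow> p n = \<zero>"
  unfolding ord0_def using not_less_Least[of n "\<lambda>n. p n \<noteq> \<zero>"] by blast

lemma low_coeff_closed: "p \<in> carrier (UP R) \<Longrightarrow> low_coeff R p \<in> carrier R"
  unfolding low_coeff_def by (rule UP_apply(2)[OF is_cring])

lemma ord0_eqI:
  assumes "p n \<noteq> \<zero>" "\<And>m. m < n \<Longrightarrow> p m = \<zero>" shows "ord0 R p = n"
  unfolding ord0_def using assms by (intro Least_equality) (auto simp: not_less[symmetric])

lemma low_coeff_eqI:
  "\<lbrakk>p n \<noteq> \<zero>; \<And>m. m < n \<Longrightarrow> p m = \<zero>\<rbrakk> \<Longrightarrow> low_coeff R p = p n"
  using ord0_eqI by (simp add: low_coeff_def)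

text \<open>Let \<open>i\<close> and \<open>j\<close> be the two orders. Below degree
  \<open>i + j\<close>, and in that degree away from the summand \<open>r = i\<close>, one factor
  lies below its order; the surviving product is nonzero in a domain.\<close>

lemma low_coeff_mult:
  assumes p: "p \<in> nonzero_polys" and q: "q \<in> nonzero_polys"
  shows "low_coeff R (p \<otimes>\<^bsub>UP R\<^esub> q) = low_coeff R p \<otimes> low_coeff R q"
proof -
  define i j where "i = ord0 R p" and "j = ord0 R q"
  have pc: "p \<in> carrier (UP R)" "p n \<in> carrier R" for n
    using p UP_apply(2)[OF is_cring] by auto
  have qc: "q \<in> carrier (UP R)" "q n \<in> carrier R" for n
    using q UP_apply(2)[OF is_cring] by auto
  have z: "p r \<otimes> q (n - r) = \<zero>" if "r \<le> n" "n < i + j \<or> n = i + j \<and> r \<noteq> i" for r n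
  proof -
    have "r < i \<or> n - r < j" using that by auto
    then consider "r < i" | "n - r < j" by blast
    then show ?thesis
    proof cases
      case 1
      then have "p r = \<zero>" unfolding i_def by (rule below_ord0)
      then show ?thesis using qc by simp
    next
      case 2
      then have "q (n - r) = \<zero>" unfolding j_def by (rule below_ord0)
      then show ?thesis using pc by simp
    qed
  qed
  have low: "(p \<otimes>\<^bsub>UP R\<^esub> q) n = \<zero>" if "n < i + j" for n
    unfolding UP_apply(4)[OF is_cring pc(1) qc(1)] by (rule add.finprod_one_eqI) (use z that in auto)
  have "(p \<otimes>\<^bsub>UP R\<^esub> q) (i + j) = (\<Oplus>r\<in>{..i + j}. if i = r then p r \<otimes> q (i + j - r) else \<zero>)"
    unfolding UP_apply(4)[OF is_cring pc(1) qc(1)] using z pc qc by (intro finsum_cong') auto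
  also have "\<dots> = p i \<otimes> q j"
    using finsum_singleton[of i "{..i + j}" "\<lambda>r. p r \<otimes> q (i + j - r)"] pc qc by simp
  finally have top: "(p \<otimes>\<^bsub>UP R\<^esub> q) (i + j) = low_coeff R p \<otimes> low_coeff R q"
    by (simp add: low_coeff_def i_def j_def)
  moreover have "low_coeff R p \<otimes> low_coeff R q \<noteq> \<zero>"
    using p q low_coeff_nonzero low_coeff_closed by (simp add: integral_iff)
  ultimately show ?thesis using low_coeff_eqI[of "p \<otimes>\<^bsub>UP R\<^esub> q" "i + j"] low by metis
qed

lemma low_coeff_const:
  assumes "a \<in> carrier R" shows "low_coeff R (poly_const R a) = a"
proof (cases "a = \<zero>")
  case True
  then have "poly_const R a n = \<zero>" for n using assms by (simp add: UP_apply(8)[OF is_cring])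
  then show ?thesis using True by (simp add: low_coeff_def)
next
  case False
  then show ?thesis
    using low_coeff_eqI[of "poly_const R a" 0] assms by (simp add: UP_apply(8)[OF is_cring])
qed

text \<open>The three cases of the Steinberg relation \<open>a/s + b/s = 1\<close> for the lowest coefficients.\<close>

lemma low_coeff_add:
  assumes a: "a \<in> nonzero_polys" and b: "b \<in> nonzero_polys" and s: "a \<oplus>\<^bsub>UP R\<^esub> b = s" "s \<in> nonzero_polys"
  shows "low_coeff R s = low_coeff R a \<or> low_coeff R s = low_coeff R b \<or>
    low_coeff R s = low_coeff R a \<oplus> low_coeff R b \<or> low_coeff R b = \<ominus> low_coeff R a"
proof -
  have c: "a n \<in> carrier R" "b n \<in> carrier R" for n
    using a b UP_apply(2)[OF is_cring] by auto
  have sn: "s n = a n \<oplus> b n" for n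
    using UP_apply(3)[OF is_cring, of a b n] a b s by auto
  have na: "a (ord0 R a) \<noteq> \<zero>" and nb: "b (ord0 R b) \<noteq> \<zero>"
    using low_coeff_nonzero a b by (auto simp: low_coeff_def)
  consider "ord0 R a < ord0 R b" | "ord0 R b < ord0 R a" | "ord0 R a = ord0 R b" by linarith
  then show ?thesis
  proof cases
    case 1
    have "low_coeff R s = s (ord0 R a)"
      using na below_ord0[of _ a] below_ord0[of _ b] 1 sn c by (intro low_coeff_eqI) auto
    then show ?thesis using 1 sn below_ord0[of _ b] c by (simp add: low_coeff_def)
  next
    case 2
    have "low_coeff R s = s (ord0 R b)"
      using nb below_ord0[of _ a] below_ord0[of _ b] 2 sn c by (intro low_coeff_eqI) auto
    then show ?thesis using 2 sn below_ord0[of _ a] c by (simp add: low_coeff_def)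
  next
    case 3
    show ?thesis
    proof (cases "s (ord0 R a) = \<zero>")
      case True
      then have "b (ord0 R a) = \<ominus> a (ord0 R a)"
        using sn add_eq_zero c by metis
      then show ?thesis using 3 by (simp add: low_coeff_def)
    next
      case False
      then have "low_coeff R s = s (ord0 R a)"
        using below_ord0[of _ a] below_ord0[of _ b] 3 sn c by (intro low_coeff_eqI) auto
      then show ?thesis using 3 sn by (simp add: low_coeff_def)
    qed
  qed
qed

text \<open>Independence of the chosen representative: the witness of equality of fractions cancels
  in the domain of polynomials, and \<open>low_coeff\<close> is multiplicative on the
  cross-multiplied equation.\<close>

lemma low_map_frac:
  assumes L: "field L" and j: "j \<in> ring_hom R L" and inj: "\<And>a. \<lbrakk>a \<in> carrier R; j a = \<zero>\<^bsub>L\<^esub>\<rbrakk> \<Longrightarrow> a = \<zero>"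
    and a: "a \<in> nonzero_polys" and s: "s \<in> nonzero_polys"
  shows "low_map R L j (loc_frac (UP R) nonzero_polys a s) = j (low_coeff R a) \<otimes>\<^bsub>L\<^esub> inv\<^bsub>L\<^esub> (j (low_coeff R s))"
proof -
  interpret L: field L by (rule L)
  interpret M: mult_set "UP R" nonzero_polys by (rule domain_mult_set[OF P.domain_axioms])
  let ?x = "loc_frac (UP R) nonzero_polys a s"
  have ac: "a \<in> carrier (UP R)" using a by simp
  obtain b t where bt: "(SOME as. as \<in> ?x) = (b, t)" by (cases "SOME as. as \<in> ?x")
  have "(b, t) \<in> ?x" using someI[of "\<lambda>as. as \<in> ?x", OF M.loc_frac_self[OF ac s]] bt by simp
  note b = M.loc_frac_mem[OF ac s this]
  obtain u where u: "u \<in> nonzero_polys" "u \<otimes>\<^bsub>UP R\<^esub> (s \<otimes>\<^bsub>UP R\<^esub> b) = u \<otimes>\<^bsub>UP R\<^esub> (t \<otimes>\<^bsub>UP R\<^esub> a)"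
    using b(3) M.loc_frac_eq_iff[OF b(1,2) ac s] by blast
  have e: "s \<otimes>\<^bsub>UP R\<^esub> b = t \<otimes>\<^bsub>UP R\<^esub> a"
  proof -
    have "u \<noteq> \<zero>\<^bsub>UP R\<^esub>" "u \<in> carrier (UP R)" "s \<otimes>\<^bsub>UP R\<^esub> b \<in> carrier (UP R)" "t \<otimes>\<^bsub>UP R\<^esub> a \<in> carrier (UP R)"
      using u(1) b(1,2) ac s by simp_all
    then show ?thesis using u(2) P.m_lcancel by metis
  qed
  have "t \<otimes>\<^bsub>UP R\<^esub> a \<noteq> \<zero>\<^bsub>UP R\<^esub>" using a b(2) by (simp add: P.integral_iff)
  then have nb: "b \<in> nonzero_polys" using e b(1) s by auto
  have jc: "j (low_coeff R p) \<in> carrier L" "j (low_coeff R p) \<noteq> \<zero>\<^bsub>L\<^esub>" if "p \<in> nonzero_polys" for p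
    using ring_hom_closed[OF j low_coeff_closed] inj[OF low_coeff_closed] low_coeff_nonzero that by auto
  then have jU: "j (low_coeff R p) \<in> Units L" if "p \<in> nonzero_polys" for p
    using that by (simp add: L.field_Units)
  have "low_coeff R s \<otimes> low_coeff R b = low_coeff R t \<otimes> low_coeff R a"
    using e low_coeff_mult[OF s nb] low_coeff_mult[OF b(2) a] by simp
  then have "j (low_coeff R s) \<otimes>\<^bsub>L\<^esub> j (low_coeff R b) = j (low_coeff R t) \<otimes>\<^bsub>L\<^esub> j (low_coeff R a)"
  proof -
    assume h: "low_coeff R s \<otimes> low_coeff R b = low_coeff R t \<otimes> low_coeff R a"
    have "low_coeff R s \<in> carrier R" "low_coeff R b \<in> carrier R" "low_coeff R t \<in> carrier R" "low_coeff R a \<in> carrier R"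
      using low_coeff_closed a b(1,2) s by auto
    then show ?thesis
      using ring_hom_mult[OF j, of "low_coeff R s" "low_coeff R b"]
        ring_hom_mult[OF j, of "low_coeff R t" "low_coeff R a"] h by simp
  qed
  then have "j (low_coeff R b) \<otimes>\<^bsub>L\<^esub> inv\<^bsub>L\<^esub> j (low_coeff R t) = j (low_coeff R a) \<otimes>\<^bsub>L\<^esub> inv\<^bsub>L\<^esub> j (low_coeff R s)"
  proof -
    assume h: "j (low_coeff R s) \<otimes>\<^bsub>L\<^esub> j (low_coeff R b) = j (low_coeff R t) \<otimes>\<^bsub>L\<^esub> j (low_coeff R a)"
    let ?s = "j (low_coeff R s)" and ?b = "j (low_coeff R b)" and ?t = "j (low_coeff R t)" and ?a = "j (low_coeff R a)"
    have cl: "?s \<in> Units L" "?t \<in> Units L" "?s \<in> carrier L" "?t \<in> carrier L" "?a \<in> carrier L" "?b \<in> carrier L"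
      "inv\<^bsub>L\<^esub> ?s \<in> carrier L" "inv\<^bsub>L\<^esub> ?t \<in> carrier L"
      using jU jc a b(2) s nb by auto
    have "?b \<otimes>\<^bsub>L\<^esub> inv\<^bsub>L\<^esub> ?t = (?s \<otimes>\<^bsub>L\<^esub> ?b) \<otimes>\<^bsub>L\<^esub> (inv\<^bsub>L\<^esub> ?s \<otimes>\<^bsub>L\<^esub> inv\<^bsub>L\<^esub> ?t)"
    proof -
      have "(?s \<otimes>\<^bsub>L\<^esub> ?b) \<otimes>\<^bsub>L\<^esub> (inv\<^bsub>L\<^esub> ?s \<otimes>\<^bsub>L\<^esub> inv\<^bsub>L\<^esub> ?t) = (?s \<otimes>\<^bsub>L\<^esub> inv\<^bsub>L\<^esub> ?s) \<otimes>\<^bsub>L\<^esub> (?b \<otimes>\<^bsub>L\<^esub> inv\<^bsub>L\<^esub> ?t)"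
        using cl by (simp add: L.m_ac del: L.Units_r_inv L.Units_l_inv)
      also have "\<dots> = ?b \<otimes>\<^bsub>L\<^esub> inv\<^bsub>L\<^esub> ?t" using cl by simp
      finally show ?thesis by (rule sym)
    qed
    also have "\<dots> = (?t \<otimes>\<^bsub>L\<^esub> inv\<^bsub>L\<^esub> ?t) \<otimes>\<^bsub>L\<^esub> (?a \<otimes>\<^bsub>L\<^esub> inv\<^bsub>L\<^esub> ?s)"
      unfolding h using cl by (simp add: L.m_ac del: L.Units_r_inv L.Units_l_inv)
    also have "\<dots> = ?a \<otimes>\<^bsub>L\<^esub> inv\<^bsub>L\<^esub> ?s" using cl by simp
    finally show ?thesis .
  qed
  then show ?thesis by (simp add: low_map_def bt)
qed

lemma unit_frac:
  assumes x: "x \<in> Units (localization (UP R) nonzero_polys)"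
  obtains a s where "x = loc_frac (UP R) nonzero_polys a s" "a \<in> nonzero_polys" "s \<in> nonzero_polys"
proof -
  interpret M: mult_set "UP R" nonzero_polys by (rule domain_mult_set[OF P.domain_axioms])
  let ?Q = "localization (UP R) nonzero_polys"
  interpret Q: cring ?Q by (rule M.cring_localization)
  have xc: "x \<in> carrier ?Q" "inv\<^bsub>?Q\<^esub> x \<in> carrier ?Q" using x by auto
  obtain a s where a: "x = loc_frac (UP R) nonzero_polys a s" "a \<in> carrier (UP R)" "s \<in> nonzero_polys"
    using xc(1) unfolding M.carrier_localization by blast
  obtain b t where b: "inv\<^bsub>?Q\<^esub> x = loc_frac (UP R) nonzero_polys b t" "b \<in> carrier (UP R)" "t \<in> nonzero_polys"
    using xc(2) unfolding M.carrier_localization by blast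
  have st: "s \<otimes>\<^bsub>UP R\<^esub> t \<in> nonzero_polys" by (rule M.mult_S[OF a(3) b(3)])
  have ab: "a \<otimes>\<^bsub>UP R\<^esub> b \<in> carrier (UP R)" using a(2) b(2) by simp
  have "loc_frac (UP R) nonzero_polys a s \<otimes>\<^bsub>?Q\<^esub> loc_frac (UP R) nonzero_polys b t = \<one>\<^bsub>?Q\<^esub>"
    using Q.Units_r_inv[OF x] unfolding b(1) unfolding a(1) .
  then have fe: "loc_frac (UP R) nonzero_polys (a \<otimes>\<^bsub>UP R\<^esub> b) (s \<otimes>\<^bsub>UP R\<^esub> t) = loc_frac (UP R) nonzero_polys \<one>\<^bsub>UP R\<^esub> \<one>\<^bsub>UP R\<^esub>"
    unfolding M.loc_mult[OF a(2,3) b(2,3)] M.loc_one .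
  then obtain u where u: "u \<in> nonzero_polys" "u \<otimes>\<^bsub>UP R\<^esub> (\<one>\<^bsub>UP R\<^esub> \<otimes>\<^bsub>UP R\<^esub> (a \<otimes>\<^bsub>UP R\<^esub> b)) =
      u \<otimes>\<^bsub>UP R\<^esub> ((s \<otimes>\<^bsub>UP R\<^esub> t) \<otimes>\<^bsub>UP R\<^esub> \<one>\<^bsub>UP R\<^esub>)"
    using fe unfolding M.loc_frac_eq_iff[OF ab st P.UP_one_closed M.one_S] by blast
  have "a \<noteq> \<zero>\<^bsub>UP R\<^esub>"
  proof
    assume "a = \<zero>\<^bsub>UP R\<^esub>"
    then have "u \<otimes>\<^bsub>UP R\<^esub> (s \<otimes>\<^bsub>UP R\<^esub> t) = \<zero>\<^bsub>UP R\<^esub>" using u(1,2) b(2) st by simp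
    then show False using u(1) st P.integral_iff[of u "s \<otimes>\<^bsub>UP R\<^esub> t"] by blast
  qed
  then have "a \<in> nonzero_polys" using a(2) by blast
  from that[OF a(1) this a(3)] show thesis .
qed

text \<open>The map is not additive, yet it respects Steinberg relations. Writing
  \<open>x = a/s\<close> and \<open>1 - x = b/s\<close> with \<open>a + b = s\<close>, a comparison
  of lowest terms leaves three possibilities for the image: an entry equal to 1, a genuine Steinberg
  pair, or a pair \<open>(y, -y)\<close>.\<close>

lemma low_map_symbol_map:
  assumes L: "field L" and j: "j \<in> ring_hom R L" and inj: "\<And>a. \<lbrakk>a \<in> carrier R; j a = \<zero>\<^bsub>L\<^esub>\<rbrakk> \<Longrightarrow> a = \<zero>"
  shows "symbol_map (localization (UP R) nonzero_polys) L (low_map R L j)"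
proof -
  interpret L: field L by (rule L)
  interpret j: ring_hom_cring R L j by (rule ring_hom_cringI[OF is_cring L.is_cring j])
  interpret M: mult_set "UP R" nonzero_polys by (rule domain_mult_set[OF P.domain_axioms])
  let ?Q = "localization (UP R) nonzero_polys"
  have fr: "low_map R L j (loc_frac (UP R) nonzero_polys a s) = j (low_coeff R a) \<otimes>\<^bsub>L\<^esub> inv\<^bsub>L\<^esub> (j (low_coeff R s))"
    if "a \<in> nonzero_polys" "s \<in> nonzero_polys" for a s
    by (rule low_map_frac[OF L j _ that]) (rule inj)
  have jU: "j (low_coeff R p) \<in> Units L" if "p \<in> nonzero_polys" for p
    using inj[OF low_coeff_closed] low_coeff_nonzero low_coeff_closed that by (auto simp: L.field_Units)
  have U: "low_map R L j x \<in> Units L" if x: "x \<in> Units ?Q" for x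
  proof -
    obtain a s where a: "x = loc_frac (UP R) nonzero_polys a s" "a \<in> nonzero_polys" "s \<in> nonzero_polys"
      using x by (rule unit_frac)
    show ?thesis unfolding a(1) fr[OF a(2,3)] using jU a by simp
  qed
  have mult: "low_map R L j (x \<otimes>\<^bsub>?Q\<^esub> y) = low_map R L j x \<otimes>\<^bsub>L\<^esub> low_map R L j y"
    if x: "x \<in> Units ?Q" and y: "y \<in> Units ?Q" for x y
  proof -
    obtain a s where a: "x = loc_frac (UP R) nonzero_polys a s" "a \<in> nonzero_polys" "s \<in> nonzero_polys"
      using x by (rule unit_frac)
    obtain b t where b: "y = loc_frac (UP R) nonzero_polys b t" "b \<in> nonzero_polys" "t \<in> nonzero_polys"
      using y by (rule unit_frac)
    have c: "a \<in> carrier (UP R)" "b \<in> carrier (UP R)" using a b by auto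
    have xy: "x \<otimes>\<^bsub>?Q\<^esub> y = loc_frac (UP R) nonzero_polys (a \<otimes>\<^bsub>UP R\<^esub> b) (s \<otimes>\<^bsub>UP R\<^esub> t)"
      unfolding a(1) b(1) by (rule M.loc_mult[OF c(1) a(3) c(2) b(3)])
    have lc: "low_coeff R a \<in> carrier R" "low_coeff R b \<in> carrier R" "low_coeff R s \<in> carrier R" "low_coeff R t \<in> carrier R"
      using a b low_coeff_closed by auto
    have jc: "j (low_coeff R s) \<in> Units L" "j (low_coeff R t) \<in> Units L" using jU a b by auto
    have "low_map R L j (x \<otimes>\<^bsub>?Q\<^esub> y) = (j (low_coeff R a) \<otimes>\<^bsub>L\<^esub> j (low_coeff R b)) \<otimes>\<^bsub>L\<^esub>
        inv\<^bsub>L\<^esub> (j (low_coeff R s) \<otimes>\<^bsub>L\<^esub> j (low_coeff R t))"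
      unfolding xy fr[OF M.mult_S[OF a(2) b(2)] M.mult_S[OF a(3) b(3)]]
        low_coeff_mult[OF a(2) b(2)] low_coeff_mult[OF a(3) b(3)] using lc by simp
    also have "inv\<^bsub>L\<^esub> (j (low_coeff R s) \<otimes>\<^bsub>L\<^esub> j (low_coeff R t)) = inv\<^bsub>L\<^esub> j (low_coeff R s) \<otimes>\<^bsub>L\<^esub> inv\<^bsub>L\<^esub> j (low_coeff R t)"
    proof (rule L.inv_unique'[symmetric])
      show "(j (low_coeff R s) \<otimes>\<^bsub>L\<^esub> j (low_coeff R t)) \<otimes>\<^bsub>L\<^esub> (inv\<^bsub>L\<^esub> j (low_coeff R s) \<otimes>\<^bsub>L\<^esub> inv\<^bsub>L\<^esub> j (low_coeff R t)) = \<one>\<^bsub>L\<^esub>"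
      proof -
        have "(j (low_coeff R s) \<otimes>\<^bsub>L\<^esub> j (low_coeff R t)) \<otimes>\<^bsub>L\<^esub> (inv\<^bsub>L\<^esub> j (low_coeff R s) \<otimes>\<^bsub>L\<^esub> inv\<^bsub>L\<^esub> j (low_coeff R t)) =
          (j (low_coeff R s) \<otimes>\<^bsub>L\<^esub> inv\<^bsub>L\<^esub> j (low_coeff R s)) \<otimes>\<^bsub>L\<^esub> (j (low_coeff R t) \<otimes>\<^bsub>L\<^esub> inv\<^bsub>L\<^esub> j (low_coeff R t))"
          using lc jc L.Units_inv_closed by (simp add: L.m_ac del: L.Units_r_inv L.Units_l_inv)
        then show ?thesis using jc by simp
      qed
      then show "(inv\<^bsub>L\<^esub> j (low_coeff R s) \<otimes>\<^bsub>L\<^esub> inv\<^bsub>L\<^esub> j (low_coeff R t)) \<otimes>\<^bsub>L\<^esub> (j (low_coeff R s) \<otimes>\<^bsub>L\<^esub> j (low_coeff R t)) = \<one>\<^bsub>L\<^esub>"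
        using lc jc L.Units_inv_closed by (subst L.m_comm) auto
    qed (use lc jc L.Units_inv_closed in auto)
    finally show ?thesis
      unfolding a(1) b(1) fr[OF a(2,3)] fr[OF b(2,3)]
      using lc jc L.Units_inv_closed by (simp add: L.m_ac)
  qed
  have st: "frag_of (u @ low_map R L j x # low_map R L j (\<one>\<^bsub>?Q\<^esub> \<ominus>\<^bsub>?Q\<^esub> x) # v) \<in> milnor_rel L"
    if x: "x \<in> Units ?Q" and x': "\<one>\<^bsub>?Q\<^esub> \<ominus>\<^bsub>?Q\<^esub> x \<in> Units ?Q" and u: "u \<in> lists (Units L)" and v: "v \<in> lists (Units L)" for x u v
  proof -
    obtain a s where a: "x = loc_frac (UP R) nonzero_polys a s" "a \<in> nonzero_polys" "s \<in> nonzero_polys"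
      using x by (rule unit_frac)
    have c: "a \<in> carrier (UP R)" "s \<in> carrier (UP R)" using a by auto
    define b where "b = s \<ominus>\<^bsub>UP R\<^esub> a"
    have bc: "b \<in> carrier (UP R)" using c by (simp add: b_def)
    have e: "\<one>\<^bsub>?Q\<^esub> \<ominus>\<^bsub>?Q\<^esub> x = loc_frac (UP R) nonzero_polys b s"
      using M.loc_minus[OF P.UP_one_closed M.one_S c(1) a(3)] c by (simp add: a(1) M.loc_one b_def)
    have nb: "b \<noteq> \<zero>\<^bsub>UP R\<^esub>"
    proof
      assume "b = \<zero>\<^bsub>UP R\<^esub>"
      obtain b' t where b': "loc_frac (UP R) nonzero_polys b s = loc_frac (UP R) nonzero_polys b' t"
        "b' \<in> nonzero_polys" "t \<in> nonzero_polys" using x' unfolding e by (rule unit_frac)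
      have b'c: "b' \<in> carrier (UP R)" using b' by simp
      obtain w where w: "w \<in> nonzero_polys" "w \<otimes>\<^bsub>UP R\<^esub> (t \<otimes>\<^bsub>UP R\<^esub> b) = w \<otimes>\<^bsub>UP R\<^esub> (s \<otimes>\<^bsub>UP R\<^esub> b')"
        using b'(1) M.loc_frac_eq_iff[OF bc a(3) b'c b'(3)] by blast
      then have "w \<otimes>\<^bsub>UP R\<^esub> (s \<otimes>\<^bsub>UP R\<^esub> b') = \<zero>\<^bsub>UP R\<^esub>" using \<open>b = \<zero>\<^bsub>UP R\<^esub>\<close> b'(3) by simp
      then show False using w(1) a(3) b'(2) by (simp add: P.integral_iff)
    qed
    then have b: "b \<in> nonzero_polys" using bc by simp
    have ab: "a \<oplus>\<^bsub>UP R\<^esub> b = s" 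
    proof -
      have "a \<oplus>\<^bsub>UP R\<^esub> (s \<oplus>\<^bsub>UP R\<^esub> \<ominus>\<^bsub>UP R\<^esub> a) = s \<oplus>\<^bsub>UP R\<^esub> (a \<oplus>\<^bsub>UP R\<^esub> \<ominus>\<^bsub>UP R\<^esub> a)"
        using c by (intro P.a_lcomm) auto
      then show ?thesis using c by (simp add: b_def a_minus_def P.r_neg)
    qed
    interpret s: steinberg_symbol L "\<lambda>a b. frag_of (u @ a # b # v)" "milnor_rel L"
      by (rule word_symbol[OF L.is_cring u v])
    let ?a = "j (low_coeff R a)" and ?b = "j (low_coeff R b)" and ?s = "j (low_coeff R s)"
    have lU: "?a \<in> Units L" "?b \<in> Units L" "?s \<in> Units L" using jU a b by auto
    have lc: "low_coeff R a \<in> carrier R" "low_coeff R b \<in> carrier R" "low_coeff R s \<in> carrier R"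
      using low_coeff_closed a(2,3) b by auto
    have jc: "?a \<in> carrier L" "?b \<in> carrier L" "?s \<in> carrier L" "inv\<^bsub>L\<^esub> ?s \<in> carrier L" "inv\<^bsub>L\<^esub> ?s \<in> Units L"
      using lU by auto
    have "frag_of (u @ (?a \<otimes>\<^bsub>L\<^esub> inv\<^bsub>L\<^esub> ?s) # (?b \<otimes>\<^bsub>L\<^esub> inv\<^bsub>L\<^esub> ?s) # v) \<in> milnor_rel L"
      using low_coeff_add[OF a(2) b ab a(3)]
    proof (elim disjE)
      assume "low_coeff R s = low_coeff R a"
      then show ?thesis using s.one_left[of "?b \<otimes>\<^bsub>L\<^esub> inv\<^bsub>L\<^esub> ?s"] lU jc by simp
    next
      assume "low_coeff R s = low_coeff R b"
      then show ?thesis using s.one_right[of "?a \<otimes>\<^bsub>L\<^esub> inv\<^bsub>L\<^esub> ?s"] lU jc by simp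
    next
      assume h: "low_coeff R s = low_coeff R a \<oplus> low_coeff R b"
      have "?a \<otimes>\<^bsub>L\<^esub> inv\<^bsub>L\<^esub> ?s \<oplus>\<^bsub>L\<^esub> ?b \<otimes>\<^bsub>L\<^esub> inv\<^bsub>L\<^esub> ?s = (?a \<oplus>\<^bsub>L\<^esub> ?b) \<otimes>\<^bsub>L\<^esub> inv\<^bsub>L\<^esub> ?s"
        using jc by (simp add: L.l_distr)
      also have "?a \<oplus>\<^bsub>L\<^esub> ?b = ?s" using h lc by simp
      also have "?s \<otimes>\<^bsub>L\<^esub> inv\<^bsub>L\<^esub> ?s = \<one>\<^bsub>L\<^esub>" using lU by simp
      finally have "\<one>\<^bsub>L\<^esub> \<ominus>\<^bsub>L\<^esub> ?a \<otimes>\<^bsub>L\<^esub> inv\<^bsub>L\<^esub> ?s = ?b \<otimes>\<^bsub>L\<^esub> inv\<^bsub>L\<^esub> ?s"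
        using jc by (metis L.a_comm L.add.inv_solve_right L.m_closed L.minus_eq L.one_closed)
      then show ?thesis using s.steinberg[of "?a \<otimes>\<^bsub>L\<^esub> inv\<^bsub>L\<^esub> ?s"] lU jc by simp
    next
      assume h: "low_coeff R b = \<ominus> low_coeff R a"
      then have "?b = \<ominus>\<^bsub>L\<^esub> ?a" using lc by simp
      then have "?b \<otimes>\<^bsub>L\<^esub> inv\<^bsub>L\<^esub> ?s = \<ominus>\<^bsub>L\<^esub> (?a \<otimes>\<^bsub>L\<^esub> inv\<^bsub>L\<^esub> ?s)"
        using jc by (simp add: L.l_minus)
      then show ?thesis using field_word_neg[OF L _ u v, of "?a \<otimes>\<^bsub>L\<^esub> inv\<^bsub>L\<^esub> ?s"] lU jc by simp
    qed
    then show ?thesis unfolding e unfolding a(1) fr[OF a(2,3)] fr[OF b a(3)] .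
  qed
  show ?thesis unfolding symbol_map_def using U mult st by blast
qed

end

text \<open>Viewing \<open>k\<close> as its own thickening, with zero as nilpotent element, makes
  all results on rational function rings available for \<open>k\<close> itself.\<close>

lemma trivial_thickening:
  assumes "field k" shows "field_thickening k k (\<lambda>x. x) (\<lambda>x. x) \<zero>\<^bsub>k\<^esub> 0"
proof -
  interpret k: field k by fact
  show ?thesis
    by (intro field_thickening.intro thickening.intro field_thickening_axioms.intro
        k.is_cring k.domain_axioms k.field_axioms id_hom) auto
qed

lemma up_map_id: "up_map (\<lambda>x. x) f = f"
  by (simp add: up_map_def)

lemma unit_content1_field:
  assumes "field k" shows "unit_content1 k = carrier (UP k) - {\<zero>\<^bsub>UP k\<^esub>}"
proof -
  interpret field_thickening k k "\<lambda>x. x" "\<lambda>x. x" "\<zero>\<^bsub>k\<^esub>" 0 by (rule trivial_thickening[OF assms])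
  show ?thesis using mem_unit_content1 by (auto simp: up_map_id)
qed

lemma unit_content2_field:
  assumes "field k" shows "unit_content2 k = carrier (UP (UP k)) - {\<zero>\<^bsub>UP (UP k)\<^esub>}"
proof -
  interpret field_thickening k k "\<lambda>x. x" "\<lambda>x. x" "\<zero>\<^bsub>k\<^esub>" 0 by (rule trivial_thickening[OF assms])
  have "up_map (up_map (\<lambda>x. x)) f = f" for f :: "nat \<Rightarrow> nat \<Rightarrow> 'a" by (simp add: up_map_def)
  then show ?thesis using mem_unit_content2 by auto
qed

lemma field_rat1:
  assumes "field k" shows "field (rat1 k)"
proof -
  interpret field_thickening k k "\<lambda>x. x" "\<lambda>x. x" "\<zero>\<^bsub>k\<^esub>" 0 by (rule trivial_thickening[OF assms])
  show ?thesis using U.field_localization by (simp add: rat1_def unit_content1_field[OF assms])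
qed

text \<open>Compatibility with the projections is what preserves denominators. It covers the
  projection to \<open>k\<close>, the inclusion of constants, and the quotient by the ideal of
  \<open>t\<close>, none of which need respect the chosen \<open>t\<close> or the splittings on both
  sides.\<close>

locale thickening_map =
  A: field_thickening A k \<iota>A \<pi>A tA mA + B: field_thickening B k \<iota>B \<pi>B tB mB
  for A :: "('a, 'b) ring_scheme" and k :: "('c, 'd) ring_scheme" and \<iota>A \<pi>A tA mA
    and B :: "('e, 'f) ring_scheme" and \<iota>B \<pi>B tB mB +
  fixes f :: "'a \<Rightarrow> 'e"
  assumes f_hom: "f \<in> ring_hom A B" and f_pi: "a \<in> carrier A \<Longrightarrow> \<pi>B (f a) = \<pi>A a"
begin

lemma up_map_f: "up_map f \<in> ring_hom (UP A) (UP B)"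
  by (rule up_map_hom[OF A.A B.A f_hom])

lemma up_map2_f: "up_map (up_map f) \<in> ring_hom (UP (UP A)) (UP (UP B))"
  by (rule up_map_hom[OF A.UPA B.UPA up_map_f])

lemma up_map_pi: "p \<in> carrier (UP A) \<Longrightarrow> up_map \<pi>B (up_map f p) = up_map \<pi>A p"
  using f_pi UP_apply(2)[OF A.A] by (intro ext) simp

lemma up_map_units: "up_map f ` unit_content1 A \<subseteq> unit_content1 B"
  using up_map_pi ring_hom_closed[OF up_map_f]
  by (auto simp: A.mem_unit_content1 B.mem_unit_content1)

lemma up_map2_units: "up_map (up_map f) ` unit_content2 A \<subseteq> unit_content2 B"
proof -
  have "up_map (up_map \<pi>B) (up_map (up_map f) p) = up_map (up_map \<pi>A) p" if "p \<in> carrier (UP (UP A))" for p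
    using up_map_pi UP_apply(2)[OF A.UPA that] by (intro ext) (metis up_map_apply)
  then show ?thesis
    using ring_hom_closed[OF up_map2_f]
    by (auto simp: A.mem_unit_content2 B.mem_unit_content2)
qed

lemma eval_f_hom: "eval A (UP B) (\<lambda>a. poly_const B (f a)) (poly_var B) \<in> ring_hom (UP A) (UP B)"
  by (rule ring_hom_cong[OF up_map_f eval_eq_up_map[OF A.A B.A f_hom] A.U.A.ring_axioms])

lemma eval_f_units: "eval A (UP B) (\<lambda>a. poly_const B (f a)) (poly_var B) ` unit_content1 A \<subseteq> unit_content1 B"
  using up_map_units eval_eq_up_map[OF A.A B.A f_hom] A.R1.S_closed by (auto simp: image_subset_iff)

lemma rat_map_hom: "rat_map A B f \<in> ring_hom (rat1 A) (rat1 B)"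
  unfolding rat_map_def rat1_def
  by (rule loc_map_hom[OF A.mult_set1 B.mult_set1 eval_f_hom eval_f_units])

lemma rat_map_frac:
  assumes "a \<in> carrier (UP A)" "s \<in> unit_content1 A"
  shows "rat_map A B f (loc_frac (UP A) (unit_content1 A) a s) =
    loc_frac (UP B) (unit_content1 B) (up_map f a) (up_map f s)"
  unfolding rat_map_def loc_map_frac[OF A.mult_set1 B.mult_set1 eval_f_hom eval_f_units assms]
  using eval_eq_up_map[OF A.A B.A f_hom] assms A.R1.S_closed by simp

definition rat2_map :: "((nat \<Rightarrow> nat \<Rightarrow> 'a) \<times> (nat \<Rightarrow> nat \<Rightarrow> 'a)) set \<Rightarrow> ((nat \<Rightarrow> nat \<Rightarrow> 'e) \<times> (nat \<Rightarrow> nat \<Rightarrow> 'e)) set" where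
  "rat2_map = loc_map (UP (UP B)) (unit_content2 B) (up_map (up_map f))"

lemma rat2_map_hom: "rat2_map \<in> ring_hom (rat2 A) (rat2 B)"
  unfolding rat2_map_def rat2_def
  by (rule loc_map_hom[OF A.mult_set2 B.mult_set2 up_map2_f up_map2_units])

lemma rat2_map_frac:
  assumes "a \<in> carrier (UP (UP A))" "s \<in> unit_content2 A"
  shows "rat2_map (loc_frac (UP (UP A)) (unit_content2 A) a s) =
    loc_frac (UP (UP B)) (unit_content2 B) (up_map (up_map f) a) (up_map (up_map f) s)"
  unfolding rat2_map_def by (rule loc_map_frac[OF A.mult_set2 B.mult_set2 up_map2_f up_map2_units assms])

text \<open>Naturality of \<open>i_1\<close>; with its companion for \<open>i_2\<close> it shows
  that the reduction of an improved chain is improved again.\<close>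

lemma rat2_map_incl1:
  assumes x: "x \<in> carrier (rat1 A)"
  shows "rat2_map (rat_incl1 A x) = rat_incl1 B (rat_map A B f x)"
proof -
  obtain a s where a: "x = loc_frac (UP A) (unit_content1 A) a s" "a \<in> carrier (UP A)" "s \<in> unit_content1 A"
    using x by (rule A.rat_cases)
  have sc: "s \<in> carrier (UP A)" by (rule A.R1.S_closed[OF a(3)])
  have fs: "up_map f s \<in> unit_content1 B" using up_map_units a(3) by auto
  have c: "up_map (up_map f) (poly_const (UP A) p) = poly_const (UP B) (up_map f p)" if "p \<in> carrier (UP A)" for p
    by (rule up_map_const[OF A.UPA B.UPA up_map_f that])
  show ?thesis
    unfolding a(1) A.rat_incl1_frac[OF a(2,3)] rat_map_frac[OF a(2,3)]
      rat2_map_frac[OF UP_closed(1)[OF A.UPA a(2)] A.const_unit_content2[OF a(3)]]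
      B.rat_incl1_frac[OF ring_hom_closed[OF up_map_f a(2)] fs] c[OF a(2)] c[OF sc] ..
qed

lemma rat2_map_incl2:
  assumes x: "x \<in> carrier (rat1 A)"
  shows "rat2_map (rat_incl2 A x) = rat_incl2 B (rat_map A B f x)"
proof -
  obtain a s where a: "x = loc_frac (UP A) (unit_content1 A) a s" "a \<in> carrier (UP A)" "s \<in> unit_content1 A"
    using x by (rule A.rat_cases)
  have sc: "s \<in> carrier (UP A)" by (rule A.R1.S_closed[OF a(3)])
  have fs: "up_map f s \<in> unit_content1 B" using up_map_units a(3) by auto
  have c: "up_map (up_map f) (up_map (poly_const A) p) = up_map (poly_const B) (up_map f p)" if "p \<in> carrier (UP A)" for p
    using up_map_const[OF A.A B.A f_hom] UP_apply(2)[OF A.A that] by (intro ext) (metis up_map_apply)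
  show ?thesis
    unfolding a(1) A.rat_incl2_frac[OF a(2,3)] rat_map_frac[OF a(2,3)]
      rat2_map_frac[OF up_map_closed[OF A.A A.UPA poly_const_hom[OF A.A] a(2)] A.up_const_unit_content2[OF a(3)]]
      B.rat_incl2_frac[OF ring_hom_closed[OF up_map_f a(2)] fs] c[OF a(2)] c[OF sc] ..
qed

lemma rat_map_frob:
  assumes x: "x \<in> carrier (rat1 A)" and M: "M > 0"
  shows "rat_map A B f (A.frob M x) = B.frob M (rat_map A B f x)"
proof -
  obtain a s where a: "x = loc_frac (UP A) (unit_content1 A) a s" "a \<in> carrier (UP A)" "s \<in> unit_content1 A"
    using x by (rule A.rat_cases)
  have sc: "s \<in> carrier (UP A)" by (rule A.R1.S_closed[OF a(3)])
  have fs: "up_map f s \<in> unit_content1 B" using up_map_units a(3) by auto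
  have ps: "pow_poly A M s \<in> unit_content1 A" using A.pow_poly_units[OF M] a(3) by auto
  show ?thesis
    unfolding a(1) A.frob_frac[OF M a(2,3)] rat_map_frac[OF a(2,3)]
      rat_map_frac[OF ring_hom_closed[OF pow_poly_eval(1)[OF A.A] a(2)] ps]
      B.frob_frac[OF M ring_hom_closed[OF up_map_f a(2)] fs]
      pow_poly_natural[OF A.A B.A f_hom a(2)] pow_poly_natural[OF A.A B.A f_hom sc] ..
qed

lemma rat_map_const:
  assumes a: "a \<in> carrier A" shows "rat_map A B f (rat_const A a) = rat_const B (f a)"
  unfolding rat_const_def rat_map_frac[OF UP_closed(1)[OF A.A a] A.R1.one_S]
    up_map_const[OF A.A B.A f_hom a] ring_hom_one[OF up_map_f] ..

end

lemma rat_map_comp: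
  assumes "thickening_map A k \<iota>A \<pi>A tA mA B \<iota>B \<pi>B tB mB f" "thickening_map B k \<iota>B \<pi>B tB mB C \<iota>C \<pi>C tC mC g"
    "thickening_map A k \<iota>A \<pi>A tA mA C \<iota>C \<pi>C tC mC h"
    and h: "\<And>a. a \<in> carrier A \<Longrightarrow> h a = g (f a)" and x: "x \<in> carrier (rat1 A)"
  shows "rat_map B C g (rat_map A B f x) = rat_map A C h x"
proof -
  interpret f: thickening_map A k \<iota>A \<pi>A tA mA B \<iota>B \<pi>B tB mB f by fact
  interpret g: thickening_map B k \<iota>B \<pi>B tB mB C \<iota>C \<pi>C tC mC g by fact
  interpret h: thickening_map A k \<iota>A \<pi>A tA mA C \<iota>C \<pi>C tC mC h by fact
  obtain a s where a: "x = loc_frac (UP A) (unit_content1 A) a s" "a \<in> carrier (UP A)" "s \<in> unit_content1 A"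
    using x by (rule f.A.rat_cases)
  have sc: "s \<in> carrier (UP A)" by (rule f.A.R1.S_closed[OF a(3)])
  have fs: "up_map f s \<in> unit_content1 B" using f.up_map_units a(3) by auto
  have c: "up_map g (up_map f p) = up_map h p" if "p \<in> carrier (UP A)" for p
    using h UP_apply(2)[OF f.A.A that] by (intro ext) simp
  show ?thesis
    unfolding a(1) f.rat_map_frac[OF a(2,3)] h.rat_map_frac[OF a(2,3)]
      g.rat_map_frac[OF ring_hom_closed[OF f.up_map_f a(2)] fs] c[OF a(2)] c[OF sc] ..
qed

section \<open>The ring \<open>A(s_1)\<close> as a thickening of the field
  \<open>k(s_1)\<close>\<close>

context field_thickening
begin

interpretation K: field_thickening k k "\<lambda>x. x" "\<lambda>x. x" "\<zero>\<^bsub>k\<^esub>" 0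
  by (rule trivial_thickening[OF field_k])

lemma thickening_map_pi: "thickening_map A k \<iota> \<pi> t m k (\<lambda>x. x) (\<lambda>x. x) \<zero>\<^bsub>k\<^esub> 0 \<pi>"
  by (intro thickening_map.intro field_thickening_axioms K.field_thickening_axioms thickening_map_axioms.intro pi) simp

lemma thickening_map_iota: "thickening_map k k (\<lambda>x. x) (\<lambda>x. x) \<zero>\<^bsub>k\<^esub> 0 A \<iota> \<pi> t m \<iota>"
  by (intro thickening_map.intro field_thickening_axioms K.field_thickening_axioms thickening_map_axioms.intro iota)
    (simp add: pi_iota)

lemma rat_const_hom: "rat_const A \<in> ring_hom A (rat1 A)"
proof -
  interpret c: ring_hom_cring A "UP A" "poly_const A" by (rule ring_hom_cringI[OF A UPA poly_const_hom[OF A]])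
  show ?thesis
    unfolding rat_const_def[abs_def] rat1_def
    by (intro ring_hom_memI)
      (simp_all add: R1.loc_mult R1.loc_add R1.loc_one R1.one_S R1.loc_frac_closed UP_closed[OF A])
qed

text \<open>The symbol calculus will be applied to this thickening rather than to \<open>A\<close>
  over \<open>k\<close>, in order to have infinitely many constants.\<close>

lemma rat_thickening:
  "thickening (rat1 A) (rat1 k) (rat_map k A \<iota>) (rat_map A k \<pi>) (rat_const A t) m"
proof -
  interpret p: thickening_map A k \<iota> \<pi> t m k "\<lambda>x. x" "\<lambda>x. x" "\<zero>\<^bsub>k\<^esub>" 0 \<pi> by (rule thickening_map_pi)
  interpret i: thickening_map k k "\<lambda>x. x" "\<lambda>x. x" "\<zero>\<^bsub>k\<^esub>" 0 A \<iota> \<pi> t m \<iota> by (rule thickening_map_iota)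
  have uc: "unit_content1 k = carrier (UP k) - {\<zero>\<^bsub>UP k\<^esub>}" by (rule unit_content1_field[OF field_k])
  interpret L: thickening "rat1 A" "rat1 k" "loc_map (UP A) (unit_content1 A) (up_map \<iota>)"
      "loc_map (UP k) (unit_content1 k) (up_map \<pi>)" "rat_const A t" m
    using U.localization_thickening unfolding rat1_def rat_const_def unit_content1_eq[symmetric] uc[symmetric] .
  \<comment> \<open>\<open>rat_map\<close> is built from \<open>eval\<close>, the localized
    thickening from coefficientwise maps. The two agree on carriers only, so the locale axioms are
    transferred one by one.\<close>
  have e1: "loc_map (UP A) (unit_content1 A) (up_map \<iota>) x = rat_map k A \<iota> x" if x: "x \<in> carrier (rat1 k)" for x
  proof -
    obtain a s where a: "x = loc_frac (UP k) (unit_content1 k) a s" "a \<in> carrier (UP k)" "s \<in> unit_content1 k"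
      using x by (rule K.rat_cases)
    show ?thesis
      unfolding a(1) i.rat_map_frac[OF a(2,3)] loc_map_frac[OF K.mult_set1 mult_set1 i.up_map_f i.up_map_units a(2,3)] ..
  qed
  have e2: "loc_map (UP k) (unit_content1 k) (up_map \<pi>) x = rat_map A k \<pi> x" if x: "x \<in> carrier (rat1 A)" for x
  proof -
    obtain a s where a: "x = loc_frac (UP A) (unit_content1 A) a s" "a \<in> carrier (UP A)" "s \<in> unit_content1 A"
      using x by (rule rat_cases)
    show ?thesis
      unfolding a(1) p.rat_map_frac[OF a(2,3)] loc_map_frac[OF mult_set1 K.mult_set1 p.up_map_f p.up_map_units a(2,3)] ..
  qed
  show ?thesis
  proof (rule thickening.intro)
    fix c assume c: "c \<in> carrier (rat1 k)"
    show "rat_map A k \<pi> (rat_map k A \<iota> c) = c"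
      using L.pi_iota[OF c] e1[OF c] e2[OF L.iota.hom_closed[OF c]] by simp
  next
    fix a assume a: "a \<in> carrier (rat1 A)"
    show "\<exists>b\<in>carrier (rat1 A). a = rat_map k A \<iota> (rat_map A k \<pi> a) \<oplus>\<^bsub>rat1 A\<^esub> rat_const A t \<otimes>\<^bsub>rat1 A\<^esub> b"
      using L.decomp[OF a] e2[OF a] e1[OF L.pi.hom_closed[OF a]] by simp
  qed (rule L.A L.k i.rat_map_hom p.rat_map_hom L.t_closed L.t_nil)+
qed

text \<open>The powers of the variable are pairwise distinct, whatever the size of
  \<open>k\<close>.\<close>

lemma infinite_rat1: "infinite (carrier (rat1 k))"
proof -
  let ?f = "\<lambda>n. loc_frac (UP k) (unit_content1 k) (monom (UP k) \<one>\<^bsub>k\<^esub> n) \<one>\<^bsub>UP k\<^esub>"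
  interpret UPk: UP_domain k "UP k" by (simp add: UP_domain_def k)
  have mc: "monom (UP k) \<one>\<^bsub>k\<^esub> n \<in> carrier (UP k)" for n by (rule UPk.monom_closed[OF k.one_closed])
  have "inj ?f"
  proof (rule injI)
    fix m n assume "?f m = ?f n"
    then obtain u where u: "u \<in> unit_content1 k" "u \<otimes>\<^bsub>UP k\<^esub> (\<one>\<^bsub>UP k\<^esub> \<otimes>\<^bsub>UP k\<^esub> monom (UP k) \<one>\<^bsub>k\<^esub> m) =
        u \<otimes>\<^bsub>UP k\<^esub> (\<one>\<^bsub>UP k\<^esub> \<otimes>\<^bsub>UP k\<^esub> monom (UP k) \<one>\<^bsub>k\<^esub> n)"
      unfolding K.R1.loc_frac_eq_iff[OF mc K.R1.one_S mc K.R1.one_S] by blast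
    have uc: "u \<in> carrier (UP k)" "u \<noteq> \<zero>\<^bsub>UP k\<^esub>"
      using u(1) K.R1.S_closed unit_content1_field[OF field_k] by (blast, metis DiffE singletonI)
    have "u \<otimes>\<^bsub>UP k\<^esub> monom (UP k) \<one>\<^bsub>k\<^esub> m = u \<otimes>\<^bsub>UP k\<^esub> monom (UP k) \<one>\<^bsub>k\<^esub> n"
      using u(2) unfolding U.k.l_one[OF mc] .
    then have "monom (UP k) \<one>\<^bsub>k\<^esub> m = monom (UP k) \<one>\<^bsub>k\<^esub> n"
      unfolding U.k.m_lcancel[OF uc(2) uc(1) mc mc] .
    then have "monom (UP k) \<one>\<^bsub>k\<^esub> m m = monom (UP k) \<one>\<^bsub>k\<^esub> n m" by (rule fun_cong)
    then have "(if m = m then \<one>\<^bsub>k\<^esub> else \<zero>\<^bsub>k\<^esub>) = (if n = m then \<one>\<^bsub>k\<^esub> else \<zero>\<^bsub>k\<^esub>)"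
      unfolding UP_apply(7)[OF k.is_cring k.one_closed] .
    then show "m = n" using k.one_not_zero by metis
  qed
  moreover have "range ?f \<subseteq> carrier (rat1 k)"
    unfolding rat1_def using K.R1.loc_frac_closed[OF mc K.R1.one_S] by blast
  ultimately show ?thesis
    by (rule infinite_super[OF _ range_inj_infinite, rotated])
qed

end

lemma ring_hom_add_pow:
  assumes "ring R" "ring S" "f \<in> ring_hom R S" "x \<in> carrier R"
  shows "f ([(n::nat)] \<cdot>\<^bsub>R\<^esub> x) = [n] \<cdot>\<^bsub>S\<^esub> f x"
proof -
  interpret ring_hom_ring R S f by (rule ring_hom_ringI2[OF assms(1-3)])
  show ?thesis using assms(4) by (induction n) (simp_all add: R.add.nat_pow_closed)
qed

lemma ring_hom_char:
  assumes "ring R" "ring S" "f \<in> ring_hom R S" "[(n::nat)] \<cdot>\<^bsub>R\<^esub> \<one>\<^bsub>R\<^esub> = \<zero>\<^bsub>R\<^esub>"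
  shows "[n] \<cdot>\<^bsub>S\<^esub> \<one>\<^bsub>S\<^esub> = \<zero>\<^bsub>S\<^esub>"
  using ring_hom_add_pow[OF assms(1-3), of "\<one>\<^bsub>R\<^esub>" n] assms(4) ring_hom_one[OF assms(3)]
    ring_hom_zero[OF assms(3,1,2)] ring.ring_simprules(6)[OF assms(1)] by simp

lemma (in cring) frobenius_hom:
  assumes "prime (p::nat)" "[p] \<cdot> \<one> = \<zero>"
  shows "(\<lambda>x. x [^] (p ^ N)) \<in> ring_hom R R"
proof (rule ring_hom_memI)
  fix x y assume xy: "x \<in> carrier R" "y \<in> carrier R"
  show "(x \<otimes> y) [^] (p ^ N) = x [^] (p ^ N) \<otimes> y [^] (p ^ N)"
    by (rule pow_mult_distrib[OF m_comm[OF xy] xy])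
  show "(x \<oplus> y) [^] (p ^ N) = x [^] (p ^ N) \<oplus> y [^] (p ^ N)"
    by (rule frobenius_add_pow[OF assms xy])
qed simp_all

lemma (in comm_monoid) unit_of_product:
  assumes "a \<in> carrier G" "b \<in> carrier G" "a \<otimes> b \<in> Units G" shows "a \<in> Units G"
proof -
  let ?c = "b \<otimes> inv (a \<otimes> b)"
  have c: "?c \<in> carrier G" "a \<otimes> ?c = \<one>"
    using assms Units_r_inv[OF assms(3)] Units_inv_closed[OF assms(3)] m_assoc[of a b "inv (a \<otimes> b)"] by simp_all
  then have "?c \<otimes> a = \<one>" using m_comm[of a ?c] assms(1) by simp
  then show ?thesis using c assms(1) unfolding Units_def by blast
qed

lemma steinberg_symbol_pullback:
  assumes s: "steinberg_symbol R s Z" and R': "cring R'" and h: "h \<in> ring_hom R' R"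
  shows "steinberg_symbol R' (\<lambda>a b. s (h a) (h b)) Z"
proof -
  interpret s: steinberg_symbol R s Z by (rule s)
  interpret R': cring R' by (rule R')
  interpret h: ring_hom_cring R' R h by (rule ring_hom_cringI[OF R' s.is_cring h])
  have U: "h a \<in> Units R" if "a \<in> Units R'" for a
    using symbol_map_ring_hom[OF R'.ring_axioms s.ring_axioms h] that by (simp add: symbol_map_def)
  show ?thesis
  proof (rule steinberg_symbol.intro[OF R'], unfold_locales)
    fix a b c assume "a \<in> Units R'" "b \<in> Units R'" "c \<in> Units R'"
    then show "s (h (a \<otimes>\<^bsub>R'\<^esub> b)) (h c) - s (h a) (h c) - s (h b) (h c) \<in> Z"
      "s (h a) (h (b \<otimes>\<^bsub>R'\<^esub> c)) - s (h a) (h b) - s (h a) (h c) \<in> Z"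
      using s.mult_left[OF U U U] s.mult_right[OF U U U] by (simp_all add: R'.Units_closed)
  next
    fix a assume a: "a \<in> Units R'" "\<one>\<^bsub>R'\<^esub> \<ominus>\<^bsub>R'\<^esub> a \<in> Units R'"
    then have "h (\<one>\<^bsub>R'\<^esub> \<ominus>\<^bsub>R'\<^esub> a) = \<one>\<^bsub>R\<^esub> \<ominus>\<^bsub>R\<^esub> h a" by (simp add: a_minus_def R'.Units_closed)
    then show "s (h a) (h (\<one>\<^bsub>R'\<^esub> \<ominus>\<^bsub>R'\<^esub> a)) \<in> Z"
      using s.steinberg[of "h a"] U[OF a(1)] U[OF a(2)] by simp
  qed (rule s.Z_zero s.Z_diff; assumption)+
qed

section \<open>The reduction to the field\<close>

locale perfect_thickening = field_thickening +
  fixes p :: nat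
  assumes p: "prime p" and char_k: "[p] \<cdot>\<^bsub>k\<^esub> \<one>\<^bsub>k\<^esub> = \<zero>\<^bsub>k\<^esub>"
    and surj: "x \<in> carrier k \<Longrightarrow> \<exists>y \<in> carrier k. y [^]\<^bsub>k\<^esub> p = x"
begin

lemmas trivial = trivial_thickening[OF field_k]

lemma mult_set_k: "mult_set (UP k) (unit_content1 k)"
  by (rule field_thickening.mult_set1[OF trivial])

abbreviation "R \<equiv> rat1 A"
abbreviation "\<sigma> \<equiv> rat_map k A \<iota>"
abbreviation "\<rho> \<equiv> rat_map A k \<pi>"
abbreviation "T \<equiv> rat_const A t"

interpretation Q: thickening R "rat1 k" \<sigma> \<rho> T m by (rule rat_thickening)

lemma q_pos: "p ^ N > 0" using prime_gt_0_nat[OF p] by simp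

lemma char_UP: "[p] \<cdot>\<^bsub>UP k\<^esub> \<one>\<^bsub>UP k\<^esub> = \<zero>\<^bsub>UP k\<^esub>"
  by (rule ring_hom_char[OF k.ring_axioms U.k.ring_axioms poly_const_hom[OF k.is_cring] char_k])

lemma char_R: "[p] \<cdot>\<^bsub>R\<^esub> \<one>\<^bsub>R\<^esub> = \<zero>\<^bsub>R\<^esub>"
  by (rule ring_hom_char[OF A.ring_axioms Q.A.ring_axioms rat_const_hom
        ring_hom_char[OF k.ring_axioms A.ring_axioms iota char_k]])

lemma surj_pow:
  assumes "x \<in> carrier k"
  shows "\<exists>y \<in> carrier k. y [^]\<^bsub>k\<^esub> (p ^ N) = x"
  using assms
proof (induction N arbitrary: x)
  case 0
  have "x [^]\<^bsub>k\<^esub> (p ^ 0) = x" unfolding power_0 by (rule k.nat_pow_eone[OF 0])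
  then show ?case using 0 by (rule bexI)
next
  case (Suc N)
  obtain y where y: "y \<in> carrier k" "y [^]\<^bsub>k\<^esub> p = x" using surj[OF Suc.prems] by (rule bexE)
  obtain z where z: "z \<in> carrier k" "z [^]\<^bsub>k\<^esub> (p ^ N) = y" using Suc.IH[OF y(1)] by (rule bexE)
  have "z [^]\<^bsub>k\<^esub> (p ^ N * p) = (z [^]\<^bsub>k\<^esub> (p ^ N)) [^]\<^bsub>k\<^esub> p"
    by (rule k.nat_pow_pow[OF z(1), symmetric])
  then have "z [^]\<^bsub>k\<^esub> (p ^ Suc N) = x" unfolding z(2) y(2) power_Suc2 .
  then show ?case using z(1) by (rule bexI)
qed

text \<open>In characteristic \<open>p\<close>, with \<open>q = p^N\<close>, the \<open>q\<close>-th
  power of \<open>g(s)\<close> is obtained by raising all coefficients to the \<open>q\<close>-th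
  power and replacing \<open>s\<close> by \<open>s^q\<close>. So \<open>g\<close> arises from
  \<open>f\<close> by taking \<open>q\<close>-th roots of the coefficients.\<close>

lemma pow_poly_root:
  assumes f: "f \<in> carrier (UP k)"
  shows "\<exists>g \<in> carrier (UP k). pow_poly k (p ^ N) f = g [^]\<^bsub>UP k\<^esub> (p ^ N)"
proof -
  let ?q = "p ^ N"
  \<comment> \<open>The root of zero is prescribed to be zero; otherwise \<open>g\<close> need not
    have finite support.\<close>
  define r where "r x = (if x = \<zero>\<^bsub>k\<^esub> then \<zero>\<^bsub>k\<^esub> else SOME y. y \<in> carrier k \<and> y [^]\<^bsub>k\<^esub> ?q = x)" for x
  have r: "r x \<in> carrier k \<and> r x [^]\<^bsub>k\<^esub> ?q = x" if "x \<in> carrier k" for x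
  proof (cases "x = \<zero>\<^bsub>k\<^esub>")
    case True
    then show ?thesis using k.nat_pow_zero[of ?q] q_pos[of N] by (simp add: r_def)
  next
    case False
    then show ?thesis
      using someI_ex[of "\<lambda>y. y \<in> carrier k \<and> y [^]\<^bsub>k\<^esub> ?q = x"] surj_pow[OF that, of N] by (auto simp: r_def)
  qed
  obtain d where d: "\<forall>n > d. f n = \<zero>\<^bsub>k\<^esub>" using UP_memD[OF f] by auto
  note fc = UP_apply(2)[OF k.is_cring f]
  define g where "g = up_map r f"
  have g: "g \<in> carrier (UP k)"
    unfolding g_def
  proof (rule UP_memI[of _ _ d])
    show "up_map r f n \<in> carrier k" for n using r[OF fc] by simp
    show "up_map r f n = \<zero>\<^bsub>k\<^esub>" if "d < n" for n using d that by (simp add: r_def)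
  qed
  have fr: "(\<lambda>x. x [^]\<^bsub>k\<^esub> ?q) \<in> ring_hom k k" by (rule k.frobenius_hom[OF p char_k])
  have Fr: "(\<lambda>x. x [^]\<^bsub>UP k\<^esub> ?q) \<in> ring_hom (UP k) (UP k)" by (rule U.k.frobenius_hom[OF p char_UP])
  have gf: "up_map (\<lambda>x. x [^]\<^bsub>k\<^esub> ?q) g = f" using r[OF fc] by (intro ext) (simp add: g_def)
  have "pow_poly k ?q (up_map (\<lambda>x. x [^]\<^bsub>k\<^esub> ?q) h) = h [^]\<^bsub>UP k\<^esub> ?q" if h: "h \<in> carrier (UP k)" for h
  proof -
    have h1: "(\<lambda>h. pow_poly k ?q (up_map (\<lambda>x. x [^]\<^bsub>k\<^esub> ?q) h)) \<in> ring_hom (UP k) (UP k)"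
      using ring_hom_trans[OF up_map_hom[OF k.is_cring k.is_cring fr] pow_poly_eval(1)[OF k.is_cring]]
      by (simp add: comp_def)
    interpret c: ring_hom_cring k "UP k" "poly_const k"
      by (rule ring_hom_cringI[OF k.is_cring U.k.is_cring poly_const_hom[OF k.is_cring]])
    show ?thesis
    proof (rule UP_hom_ext[OF k.is_cring U.k.is_cring h1 Fr _ _ h])
      fix a assume a: "a \<in> carrier k"
      show "pow_poly k ?q (up_map (\<lambda>x. x [^]\<^bsub>k\<^esub> ?q) (poly_const k a)) = poly_const k a [^]\<^bsub>UP k\<^esub> ?q"
        unfolding up_map_const[OF k.is_cring k.is_cring fr a]
        using pow_poly_eval(2)[OF k.is_cring, of "a [^]\<^bsub>k\<^esub> ?q" ?q] a by simp
    next
      show "pow_poly k ?q (up_map (\<lambda>x. x [^]\<^bsub>k\<^esub> ?q) (poly_var k)) = poly_var k [^]\<^bsub>UP k\<^esub> ?q"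
        unfolding up_map_var[OF k.is_cring k.is_cring fr] by (rule pow_poly_eval(3)[OF k.is_cring])
    qed
  qed
  from this[OF g] show ?thesis unfolding gf using g by (rule bexI)
qed

lemma frob_root_k:
  assumes c: "c \<in> carrier (rat1 k)"
  shows "\<exists>d \<in> carrier (rat1 k). field_thickening.frob k (p ^ N) c = d [^]\<^bsub>rat1 k\<^esub> (p ^ N)"
proof -
  interpret S: mult_set "UP k" "unit_content1 k" by (rule mult_set_k)
  let ?q = "p ^ N"
  obtain a s where a: "c = loc_frac (UP k) (unit_content1 k) a s" "a \<in> carrier (UP k)" "s \<in> unit_content1 k"
    using c by (rule field_thickening.rat_cases[OF trivial])
  have sc: "s \<in> carrier (UP k)" by (rule S.S_closed[OF a(3)])
  obtain a' where a': "a' \<in> carrier (UP k)" "pow_poly k ?q a = a' [^]\<^bsub>UP k\<^esub> ?q"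
    using pow_poly_root[OF a(2)] by blast
  obtain s' where s': "s' \<in> carrier (UP k)" "pow_poly k ?q s = s' [^]\<^bsub>UP k\<^esub> ?q"
    using pow_poly_root[OF sc] by blast
  have ps: "pow_poly k ?q s \<in> unit_content1 k" using field_thickening.pow_poly_units[OF trivial q_pos] a(3) by blast
  have "s' \<noteq> \<zero>\<^bsub>UP k\<^esub>"
  proof
    assume "s' = \<zero>\<^bsub>UP k\<^esub>"
    then have "pow_poly k ?q s = \<zero>\<^bsub>UP k\<^esub>"
      using s' q_pos[of N] U.k.nat_pow_zero[of ?q] by simp
    then show False using ps unit_content1_field[OF field_k] by simp
  qed
  then have sU: "s' \<in> unit_content1 k" using s' unit_content1_field[OF field_k] by simp
  have pow: "loc_frac (UP k) (unit_content1 k) a' s' [^]\<^bsub>rat1 k\<^esub> n =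
      loc_frac (UP k) (unit_content1 k) (a' [^]\<^bsub>UP k\<^esub> n) (s' [^]\<^bsub>UP k\<^esub> n) \<and> s' [^]\<^bsub>UP k\<^esub> n \<in> unit_content1 k" for n :: nat
  proof (induction n)
    case 0 then show ?case by (simp add: rat1_def S.loc_one S.one_S)
  next
    case (Suc n)
    have "a' [^]\<^bsub>UP k\<^esub> n \<in> carrier (UP k)" using a' by simp
    then show ?case
      using Suc S.mult_S[of "s' [^]\<^bsub>UP k\<^esub> n" s'] sU a'(1)
        S.loc_mult[of "a' [^]\<^bsub>UP k\<^esub> n" "s' [^]\<^bsub>UP k\<^esub> n" a' s']
      by (simp add: rat1_def)
  qed
  have "field_thickening.frob k ?q c = loc_frac (UP k) (unit_content1 k) a' s' [^]\<^bsub>rat1 k\<^esub> ?q"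
    unfolding a(1) field_thickening.frob_frac[OF trivial q_pos a(2,3)] a'(2) s'(2) using pow[of ?q] by simp
  moreover have "loc_frac (UP k) (unit_content1 k) a' s' \<in> carrier (rat1 k)"
    unfolding rat1_def by (rule S.loc_frac_closed[OF a'(1) sU])
  ultimately show ?thesis by blast
qed

lemma frob_sigma:
  assumes c: "c \<in> carrier (rat1 k)"
  shows "\<exists>d \<in> carrier (rat1 k). frob (p ^ N) (\<sigma> c) = \<sigma> d [^]\<^bsub>R\<^esub> (p ^ N)"
proof -
  obtain d where d: "d \<in> carrier (rat1 k)" "field_thickening.frob k (p ^ N) c = d [^]\<^bsub>rat1 k\<^esub> (p ^ N)"
    using frob_root_k[OF c] by blast
  have "frob (p ^ N) (\<sigma> c) = \<sigma> d [^]\<^bsub>R\<^esub> (p ^ N)"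
    unfolding thickening_map.rat_map_frob[OF thickening_map_iota c q_pos, symmetric] d(2) by (rule Q.iota.hom_pow[OF d(1)])
  then show ?thesis using d(1) by blast
qed

lemma frob_T: "M > 0 \<Longrightarrow> frob M T = T"
  unfolding rat_const_def
  using frob_frac[OF _ UP_closed(1)[OF A t_closed] R1.one_S, of M] pow_poly_eval(2)[OF A t_closed, of M]
    ring_hom_one[OF pow_poly_eval(1)[OF A, of M]] by simp

lemma frob_Units: "M > 0 \<Longrightarrow> a \<in> Units R \<Longrightarrow> frob M a \<in> Units R"
  using symbol_map_ring_hom[OF Q.A.ring_axioms Q.A.ring_axioms frob_hom] by (simp add: symbol_map_def)

lemma frob_one_minus:
  assumes M: "M > 0" and r: "r \<in> carrier R"
  shows "frob M (\<one>\<^bsub>R\<^esub> \<ominus>\<^bsub>R\<^esub> T \<otimes>\<^bsub>R\<^esub> r) = \<one>\<^bsub>R\<^esub> \<ominus>\<^bsub>R\<^esub> T \<otimes>\<^bsub>R\<^esub> frob M r"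
proof -
  interpret h: ring_hom_cring R R "frob M" by (rule ring_hom_cringI[OF Q.A Q.A frob_hom[OF M]])
  show ?thesis using r Q.t_closed by (simp add: a_minus_def frob_T[OF M])
qed

lemma one_minus_T_pow:
  assumes q: "p ^ N \<ge> Suc m" and r: "r \<in> carrier R"
  shows "(\<one>\<^bsub>R\<^esub> \<ominus>\<^bsub>R\<^esub> T \<otimes>\<^bsub>R\<^esub> r) [^]\<^bsub>R\<^esub> (p ^ N) = \<one>\<^bsub>R\<^esub>"
proof -
  have e: "\<one>\<^bsub>R\<^esub> \<ominus>\<^bsub>R\<^esub> T \<otimes>\<^bsub>R\<^esub> r = \<one>\<^bsub>R\<^esub> \<oplus>\<^bsub>R\<^esub> T \<otimes>\<^bsub>R\<^esub> (\<ominus>\<^bsub>R\<^esub> r)"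
    using r Q.t_closed by (simp add: Q.A.minus_eq Q.A.r_minus)
  show ?thesis
    unfolding e using Q.A.frobenius_add_pow[OF p char_R, of "\<one>\<^bsub>R\<^esub>" "T \<otimes>\<^bsub>R\<^esub> (\<ominus>\<^bsub>R\<^esub> r)" N]
      Q.t_mult_nil[of "\<ominus>\<^bsub>R\<^esub> r" "p ^ N"] q r Q.t_closed by simp
qed

lemma unit_decomp:
  assumes b: "b \<in> Units R"
  shows "\<exists>y \<in> carrier R. b = \<sigma> (\<rho> b) \<otimes>\<^bsub>R\<^esub> (\<one>\<^bsub>R\<^esub> \<ominus>\<^bsub>R\<^esub> T \<otimes>\<^bsub>R\<^esub> y)"
proof -
  have bc: "b \<in> carrier R" using b by auto
  define e where "e = \<sigma> (\<rho> b)"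
  have e: "e \<in> Units R" "e \<in> carrier R" "inv\<^bsub>R\<^esub> e \<in> carrier R"
    using Q.iota_Units[OF Q.pi_Units[OF b]] by (auto simp: e_def)
  obtain c where c: "c \<in> carrier R" "b = e \<oplus>\<^bsub>R\<^esub> T \<otimes>\<^bsub>R\<^esub> c" using Q.decomp[OF bc] by (auto simp: e_def)
  let ?y = "\<ominus>\<^bsub>R\<^esub> (inv\<^bsub>R\<^esub> e \<otimes>\<^bsub>R\<^esub> c)"
  have "e \<otimes>\<^bsub>R\<^esub> (\<one>\<^bsub>R\<^esub> \<ominus>\<^bsub>R\<^esub> T \<otimes>\<^bsub>R\<^esub> ?y) = e \<oplus>\<^bsub>R\<^esub> (e \<otimes>\<^bsub>R\<^esub> inv\<^bsub>R\<^esub> e) \<otimes>\<^bsub>R\<^esub> (T \<otimes>\<^bsub>R\<^esub> c)"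
    using e c Q.t_closed by (simp add: Q.A.minus_eq Q.A.r_minus Q.A.r_distr Q.A.m_ac del: Q.A.Units_r_inv Q.A.Units_l_inv)
  also have "\<dots> = b" using e(1) c Q.t_closed by simp
  finally have "b = e \<otimes>\<^bsub>R\<^esub> (\<one>\<^bsub>R\<^esub> \<ominus>\<^bsub>R\<^esub> T \<otimes>\<^bsub>R\<^esub> ?y)" by (rule sym)
  moreover have "?y \<in> carrier R" using e c by simp
  ultimately show ?thesis unfolding e_def by (rule bexI)
qed

context
  fixes u v assumes u: "u \<in> lists (Units R)" and v: "v \<in> lists (Units R)"
begin

interpretation s: steinberg_symbol R "\<lambda>a b. frag_of (u @ a # b # v)" "milnor_rel R"
  by (rule word_symbol[OF Q.A u v])

text \<open>With \<open>q = p^N\<close> the constant becomes a \<open>q\<close>-th power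
  \<open>w^q\<close> under \<open>frob\<close>, and the exponent can be moved across:
  \<open>{X, w^q} = q {X, w} = {X^q, w} = {1, w}\<close>, where \<open>X\<close> is the image of the
  principal unit.\<close>

lemma kill_const:
  assumes q: "p ^ N \<ge> Suc m" and r: "r \<in> carrier R" and c: "c \<in> Units (rat1 k)"
  shows "frag_of (u @ frob (p ^ N) (\<one>\<^bsub>R\<^esub> \<ominus>\<^bsub>R\<^esub> T \<otimes>\<^bsub>R\<^esub> r) # frob (p ^ N) (\<sigma> c) # v) \<in> milnor_rel R"
    and "frag_of (u @ frob (p ^ N) (\<sigma> c) # frob (p ^ N) (\<one>\<^bsub>R\<^esub> \<ominus>\<^bsub>R\<^esub> T \<otimes>\<^bsub>R\<^esub> r) # v) \<in> milnor_rel R"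
proof -
  let ?q = "p ^ N"
  have cc: "c \<in> carrier (rat1 k)" using c by auto
  obtain d where d: "d \<in> carrier (rat1 k)" "frob ?q (\<sigma> c) = \<sigma> d [^]\<^bsub>R\<^esub> ?q" using frob_sigma[OF cc] by blast
  define w where "w = \<sigma> d"
  have w: "w \<in> carrier R" "frob ?q (\<sigma> c) = w [^]\<^bsub>R\<^esub> ?q" using d by (auto simp: w_def)
  \<comment> \<open>The root \<open>w\<close> is so far only an element of the ring; it is a unit
    because it divides the unit \<open>w^q\<close>.\<close>
  have "w [^]\<^bsub>R\<^esub> ?q \<in> Units R"
    using frob_Units[OF q_pos Q.iota_Units[OF c], of N] w(2) by simp
  moreover have "w [^]\<^bsub>R\<^esub> ?q = w \<otimes>\<^bsub>R\<^esub> w [^]\<^bsub>R\<^esub> (?q - 1)"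
    using Q.A.nat_pow_Suc2[OF w(1), of "?q - 1"] unfolding Suc_diff_1[OF q_pos[of N]] .
  ultimately have wU: "w \<in> Units R"
    using Q.A.unit_of_product[OF w(1), of "w [^]\<^bsub>R\<^esub> (?q - 1)"] w(1) by simp
  define X where "X = \<one>\<^bsub>R\<^esub> \<ominus>\<^bsub>R\<^esub> T \<otimes>\<^bsub>R\<^esub> frob ?q r"
  have fr: "frob ?q r \<in> carrier R" by (rule ring_hom_closed[OF frob_hom[OF q_pos] r])
  have X: "X \<in> Units R" "X [^]\<^bsub>R\<^esub> ?q = \<one>\<^bsub>R\<^esub>" "frob ?q (\<one>\<^bsub>R\<^esub> \<ominus>\<^bsub>R\<^esub> T \<otimes>\<^bsub>R\<^esub> r) = X"
    using Q.one_minus_t_unit[OF fr] one_minus_T_pow[OF q fr] frob_one_minus[OF q_pos r] by (simp_all add: X_def)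
  have "frag_of (u @ X # w [^]\<^bsub>R\<^esub> ?q # v) =
      (frag_of (u @ X # w [^]\<^bsub>R\<^esub> ?q # v) - frag_cmul (int ?q) (frag_of (u @ X # w # v)))
      - (frag_of (u @ X [^]\<^bsub>R\<^esub> ?q # w # v) - frag_cmul (int ?q) (frag_of (u @ X # w # v)))
      + frag_of (u @ X [^]\<^bsub>R\<^esub> ?q # w # v)"
    by (simp only: algebra_simps)
  also have "\<dots> \<in> milnor_rel R"
    using s.pow_right[OF wU X(1), of ?q] s.pow_left[OF X(1) wU, of ?q] s.one_left[OF wU]
    unfolding X(2) by (rule s.Z_add[OF s.Z_diff])
  finally show "frag_of (u @ frob ?q (\<one>\<^bsub>R\<^esub> \<ominus>\<^bsub>R\<^esub> T \<otimes>\<^bsub>R\<^esub> r) # frob ?q (\<sigma> c) # v) \<in> milnor_rel R"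
    unfolding X(3) w(2) .
  have "frag_of (u @ w [^]\<^bsub>R\<^esub> ?q # X # v) =
      (frag_of (u @ w [^]\<^bsub>R\<^esub> ?q # X # v) - frag_cmul (int ?q) (frag_of (u @ w # X # v)))
      - (frag_of (u @ w # X [^]\<^bsub>R\<^esub> ?q # v) - frag_cmul (int ?q) (frag_of (u @ w # X # v)))
      + frag_of (u @ w # X [^]\<^bsub>R\<^esub> ?q # v)"
    by (simp only: algebra_simps)
  also have "\<dots> \<in> milnor_rel R"
    using s.pow_left[OF wU X(1), of ?q] s.pow_right[OF X(1) wU, of ?q] s.one_right[OF wU]
    unfolding X(2) by (rule s.Z_add[OF s.Z_diff])
  finally show "frag_of (u @ frob ?q (\<sigma> c) # frob ?q (\<one>\<^bsub>R\<^esub> \<ominus>\<^bsub>R\<^esub> T \<otimes>\<^bsub>R\<^esub> r) # v) \<in> milnor_rel R"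
    unfolding X(3) w(2) .
qed

text \<open>After \<open>frob\<close> a constant pairs trivially with principal units but not with
  other constants. Subtracting the symbol of the two reductions removes the constant part, so that
  the difference vanishes as soon as one entry is constant, as \<open>reduced_symbol\<close>
  demands.\<close>

lemma reduced:
  assumes q: "p ^ N \<ge> Suc m"
  shows "reduced_symbol R (\<lambda>a b. frag_of (u @ frob (p ^ N) a # frob (p ^ N) b # v)
     - frag_of (u @ frob (p ^ N) (\<sigma> (\<rho> a)) # frob (p ^ N) (\<sigma> (\<rho> b)) # v)) (milnor_rel R) (\<lambda>a. \<sigma> (\<rho> a))"
proof -
  let ?f = "frob (p ^ N)" and ?e = "\<lambda>a. \<sigma> (\<rho> a)"
  interpret f: steinberg_symbol R "\<lambda>a b. frag_of (u @ ?f a # ?f b # v)" "milnor_rel R"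
    by (rule steinberg_symbol_pullback[OF s.steinberg_symbol_axioms Q.A frob_hom[OF q_pos]])
  have e: "?e \<in> ring_hom R R" using ring_hom_trans[OF Q.pi Q.iota] by (simp add: comp_def)
  interpret g: steinberg_symbol R "\<lambda>a b. frag_of (u @ ?f (?e a) # ?f (?e b) # v)" "milnor_rel R"
    by (rule steinberg_symbol_pullback[OF f.steinberg_symbol_axioms Q.A e])
  have eU: "?e a \<in> Units R" if "a \<in> Units R" for a using Q.iota_Units[OF Q.pi_Units[OF that]] .
  have ee: "?e (?e a) = ?e a" if "a \<in> carrier R" for a using Q.pi_iota[OF Q.pi.hom_closed[OF that]] by simp
  have one_nz: "\<one>\<^bsub>rat1 k\<^esub> \<noteq> \<zero>\<^bsub>rat1 k\<^esub>"
    by (rule domain.one_not_zero[OF field.axioms(1)[OF field_rat1[OF field_k]]])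
  show ?thesis
  proof (rule reduced_symbol.intro)
    show "steinberg_symbol R (\<lambda>a b. frag_of (u @ ?f a # ?f b # v) - frag_of (u @ ?f (?e a) # ?f (?e b) # v)) (milnor_rel R)"
    proof (rule steinberg_symbol.intro[OF Q.A], unfold_locales)
      fix a b c assume h: "a \<in> Units R" "b \<in> Units R" "c \<in> Units R"
      show "frag_of (u @ ?f (a \<otimes>\<^bsub>R\<^esub> b) # ?f c # v) - frag_of (u @ ?f (?e (a \<otimes>\<^bsub>R\<^esub> b)) # ?f (?e c) # v) -
          (frag_of (u @ ?f a # ?f c # v) - frag_of (u @ ?f (?e a) # ?f (?e c) # v)) -
          (frag_of (u @ ?f b # ?f c # v) - frag_of (u @ ?f (?e b) # ?f (?e c) # v)) \<in> milnor_rel R"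
        using f.Z_diff[OF f.mult_left[OF h] g.mult_left[OF h]] by (simp add: algebra_simps)
      show "frag_of (u @ ?f a # ?f (b \<otimes>\<^bsub>R\<^esub> c) # v) - frag_of (u @ ?f (?e a) # ?f (?e (b \<otimes>\<^bsub>R\<^esub> c)) # v) -
          (frag_of (u @ ?f a # ?f b # v) - frag_of (u @ ?f (?e a) # ?f (?e b) # v)) -
          (frag_of (u @ ?f a # ?f c # v) - frag_of (u @ ?f (?e a) # ?f (?e c) # v)) \<in> milnor_rel R"
        using f.Z_diff[OF f.mult_right[OF h] g.mult_right[OF h]] by (simp add: algebra_simps)
    next
      fix a assume h: "a \<in> Units R" "\<one>\<^bsub>R\<^esub> \<ominus>\<^bsub>R\<^esub> a \<in> Units R"
      show "frag_of (u @ ?f a # ?f (\<one>\<^bsub>R\<^esub> \<ominus>\<^bsub>R\<^esub> a) # v) - frag_of (u @ ?f (?e a) # ?f (?e (\<one>\<^bsub>R\<^esub> \<ominus>\<^bsub>R\<^esub> a)) # v) \<in> milnor_rel R"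
        by (rule f.Z_diff[OF f.steinberg[OF h] g.steinberg[OF h]])
    qed (rule s.Z_zero s.Z_diff; assumption)+
  next
    have split: "\<exists>y \<in> carrier R. b = ?e b \<otimes>\<^bsub>R\<^esub> (\<one>\<^bsub>R\<^esub> \<ominus>\<^bsub>R\<^esub> T \<otimes>\<^bsub>R\<^esub> y)" if "b \<in> Units R" for b
      using unit_decomp[OF that] .
    show "reduced_symbol_axioms R (\<lambda>a b. frag_of (u @ ?f a # ?f b # v) - frag_of (u @ ?f (?e a) # ?f (?e b) # v)) (milnor_rel R) ?e"
    proof (rule reduced_symbol_axioms.intro)
      show "?e \<in> ring_hom R R" by (rule e)
      show "?e (?e a) = ?e a" if "a \<in> carrier R" for a using ee[OF that] .
      show "a \<in> Units R" if "a \<in> carrier R" "?e a \<noteq> \<zero>\<^bsub>R\<^esub>" for a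
      proof -
        have "\<rho> a \<noteq> \<zero>\<^bsub>rat1 k\<^esub>" using that(2) Q.iota.hom_zero by metis
        then show ?thesis using that(1) Q.pi.hom_closed[OF that(1)] by (simp add: Q.Units_iff field.field_Units[OF field_rat1[OF field_k]])
      qed
      show "\<one>\<^bsub>R\<^esub> \<noteq> \<zero>\<^bsub>R\<^esub>"
        using Q.pi.hom_one Q.pi.hom_zero one_nz by metis
      show "infinite (?e ` carrier R)"
      proof
        assume "finite (?e ` carrier R)"
        then have "finite (\<rho> ` (?e ` carrier R))" by (rule finite_imageI)
        moreover have "carrier (rat1 k) \<subseteq> \<rho> ` (?e ` carrier R)"
        proof
          fix c assume c: "c \<in> carrier (rat1 k)"
          then have "c = \<rho> (?e (\<sigma> c))" "\<sigma> c \<in> carrier R" using Q.pi_iota by auto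
          then show "c \<in> \<rho> ` (?e ` carrier R)" by blast
        qed
        ultimately show False using infinite_rat1 finite_subset by blast
      qed
      fix a b assume h: "a \<in> Units R" "b \<in> Units R"
      have ac: "a \<in> carrier R" "b \<in> carrier R" using h by auto
      obtain y where y: "y \<in> carrier R" "b = ?e b \<otimes>\<^bsub>R\<^esub> (\<one>\<^bsub>R\<^esub> \<ominus>\<^bsub>R\<^esub> T \<otimes>\<^bsub>R\<^esub> y)" using split[OF h(2)] by blast
      obtain x where x: "x \<in> carrier R" "a = ?e a \<otimes>\<^bsub>R\<^esub> (\<one>\<^bsub>R\<^esub> \<ominus>\<^bsub>R\<^esub> T \<otimes>\<^bsub>R\<^esub> x)" using split[OF h(1)] by blast
      have "frag_of (u @ ?f (?e a) # ?f b # v) - frag_of (u @ ?f (?e a) # ?f (?e b) # v)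
          - frag_of (u @ ?f (?e a) # ?f (\<one>\<^bsub>R\<^esub> \<ominus>\<^bsub>R\<^esub> T \<otimes>\<^bsub>R\<^esub> y) # v) \<in> milnor_rel R"
        using f.mult_right[OF eU[OF h(1)] eU[OF h(2)] Q.one_minus_t_unit[OF y(1)]] unfolding y(2)[symmetric] .
      from f.Z_add[OF this kill_const(2)[OF q y(1) Q.pi_Units[OF h(1)]]]
      show "frag_of (u @ ?f (?e a) # ?f b # v) - frag_of (u @ ?f (?e (?e a)) # ?f (?e b) # v) \<in> milnor_rel R"
        unfolding ee[OF ac(1)] by simp
      have "frag_of (u @ ?f a # ?f (?e b) # v) - frag_of (u @ ?f (?e a) # ?f (?e b) # v)
          - frag_of (u @ ?f (\<one>\<^bsub>R\<^esub> \<ominus>\<^bsub>R\<^esub> T \<otimes>\<^bsub>R\<^esub> x) # ?f (?e b) # v) \<in> milnor_rel R"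
        using f.mult_left[OF eU[OF h(1)] Q.one_minus_t_unit[OF x(1)] eU[OF h(2)]] unfolding x(2)[symmetric] .
      from f.Z_add[OF this kill_const(1)[OF q x(1) Q.pi_Units[OF h(2)]]]
      show "frag_of (u @ ?f a # ?f (?e b) # v) - frag_of (u @ ?f (?e a) # ?f (?e (?e b)) # v) \<in> milnor_rel R"
        unfolding ee[OF ac(2)] by simp
    qed
  qed
qed

end

end

lemma (in ring_hom_cring) hom_Units_inv:
  assumes a: "a \<in> Units R" shows "h a \<in> Units S" "h (inv a) = inv\<^bsub>S\<^esub> (h a)"
proof -
  show "h a \<in> Units S"
    using symbol_map_ring_hom[OF R.ring_axioms S.ring_axioms homh] a by (simp add: symbol_map_def)
  have "h a \<otimes>\<^bsub>S\<^esub> h (inv a) = \<one>\<^bsub>S\<^esub>"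
    using hom_mult[of a "inv a"] a by (simp add: R.Units_closed)
  then show "h (inv a) = inv\<^bsub>S\<^esub> (h a)"
    using S.comm_inv_char[of "h a" "h (inv a)"] a by (simp add: R.Units_closed)
qed

context perfect_thickening
begin

interpretation Q: thickening R "rat1 k" \<sigma> \<rho> T m by (rule rat_thickening)

lemma pow_gt: "m \<le> N \<Longrightarrow> p ^ N \<ge> Suc m"
  using power_gt_expt[of p N] prime_gt_1_nat[OF p] by simp

lemma frob_image_subring: "M > 0 \<Longrightarrow> subring (frob M ` carrier R) R"
  using ring_hom_ring.img_is_subring[OF ring_hom_ringI2[OF Q.A.ring_axioms Q.A.ring_axioms frob_hom] Q.A.carrier_is_subring] .

text \<open>The image of \<open>frob\<close> is the subring \<open>B\<close> of the symbol calculus: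
  \<open>frob\<close> fixes \<open>T\<close> and turns the constant term of an element into a
  \<open>p^N\<close>-th power of a constant.\<close>

lemma frob_image_decomp:
  assumes b: "b \<in> frob (p ^ N) ` carrier R"
  shows "\<exists>d \<in> carrier R. \<exists>b' \<in> frob (p ^ N) ` carrier R.
    \<sigma> (\<rho> d) = d \<and> b = d [^]\<^bsub>R\<^esub> (p ^ N) \<oplus>\<^bsub>R\<^esub> T \<otimes>\<^bsub>R\<^esub> b'"
proof -
  obtain z where z: "b = frob (p ^ N) z" "z \<in> carrier R" using b by (rule imageE)
  obtain c where c: "c \<in> carrier R" "z = \<sigma> (\<rho> z) \<oplus>\<^bsub>R\<^esub> T \<otimes>\<^bsub>R\<^esub> c" using Q.decomp[OF z(2)] by (rule bexE)
  define e where "e = \<sigma> (\<rho> z)"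
  have e: "e \<in> carrier R" "z = e \<oplus>\<^bsub>R\<^esub> T \<otimes>\<^bsub>R\<^esub> c" using c(2) z(2) by (simp_all add: e_def)
  have rz: "\<rho> z \<in> carrier (rat1 k)" using z(2) by (rule Q.pi.hom_closed)
  obtain d where d: "d \<in> carrier (rat1 k)" "frob (p ^ N) e = \<sigma> d [^]\<^bsub>R\<^esub> (p ^ N)"
    using frob_sigma[OF rz, of N] unfolding e_def by (rule bexE)
  interpret h: ring_hom_cring R R "frob (p ^ N)" by (rule ring_hom_cringI[OF Q.A Q.A frob_hom[OF q_pos]])
  have "b = \<sigma> d [^]\<^bsub>R\<^esub> (p ^ N) \<oplus>\<^bsub>R\<^esub> T \<otimes>\<^bsub>R\<^esub> frob (p ^ N) c"
    unfolding z(1) d(2)[symmetric] e(2) using e(1) c(1) Q.t_closed by (simp add: frob_T[OF q_pos])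
  moreover have "\<sigma> (\<rho> (\<sigma> d)) = \<sigma> d" using Q.pi_iota[OF d(1)] by simp
  moreover have "\<sigma> d \<in> carrier R" using d(1) by (rule Q.iota.hom_closed)
  moreover have "frob (p ^ N) c \<in> frob (p ^ N) ` carrier R" using c(1) by (rule imageI)
  ultimately show ?thesis by blast
qed

context
  fixes M L assumes L: "2 * m \<le> L" and M: "M = p ^ L"
begin

lemma M_pos: "M > 0" unfolding M by (rule q_pos)

lemma M_split: "x \<in> carrier R \<Longrightarrow> frob (p ^ (L - m)) (frob (p ^ m) x) = frob M x"
  using frob_frob[OF q_pos q_pos, of x "L - m" m] L by (simp add: M power_add[symmetric])

text \<open>\<open>frob M\<close> is factored as \<open>frob (p^(L-m))\<close> after
  \<open>frob (p^m)\<close>. The inner map puts the entries into the subring with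
  \<open>p^m\<close>-th powers as coefficients, the outer map makes the symbol reduced. The latter
  needs \<open>p^(L-m) > m\<close>, which follows from \<open>L - m\<close> being at least
  \<open>m\<close>.\<close>

lemma kill_principal:
  assumes u: "u \<in> lists (Units R)" and v: "v \<in> lists (Units R)" and x: "x \<in> carrier R" and y: "y \<in> carrier R"
  shows "frag_of (u @ frob M (\<one>\<^bsub>R\<^esub> \<ominus>\<^bsub>R\<^esub> T \<otimes>\<^bsub>R\<^esub> x) # frob M (\<one>\<^bsub>R\<^esub> \<ominus>\<^bsub>R\<^esub> T \<otimes>\<^bsub>R\<^esub> y) # v) \<in> milnor_rel R"
proof -
  let ?N = "L - m"
  have q: "p ^ ?N \<ge> Suc m" using L by (intro pow_gt) simp
  interpret s: steinberg_symbol R "\<lambda>a b. frag_of (u @ a # b # v)" "milnor_rel R"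
    by (rule word_symbol[OF Q.A u v])
  define x' y' where "x' = frob (p ^ m) x" and "y' = frob (p ^ m) y"
  have x': "x' \<in> frob (p ^ m) ` carrier R" "y' \<in> frob (p ^ m) ` carrier R" "x' \<in> carrier R" "y' \<in> carrier R"
    using x y ring_hom_closed[OF frob_hom[OF q_pos], of _ m] by (simp_all add: x'_def y'_def)
  interpret h: ring_hom_cring R R "frob (p ^ m)" by (rule ring_hom_cringI[OF Q.A Q.A frob_hom[OF q_pos]])
  interpret h': ring_hom_cring R R "frob (p ^ ?N)" by (rule ring_hom_cringI[OF Q.A Q.A frob_hom[OF q_pos]])
  have inv: "inv\<^bsub>R\<^esub> (\<one>\<^bsub>R\<^esub> \<ominus>\<^bsub>R\<^esub> T \<otimes>\<^bsub>R\<^esub> b) \<in> frob (p ^ m) ` carrier R" if b: "b \<in> frob (p ^ m) ` carrier R" for b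
  proof -
    obtain z where z: "b = frob (p ^ m) z" "z \<in> carrier R" using b by (rule imageE)
    have U: "\<one>\<^bsub>R\<^esub> \<ominus>\<^bsub>R\<^esub> T \<otimes>\<^bsub>R\<^esub> z \<in> Units R" by (rule Q.one_minus_t_unit[OF z(2)])
    show ?thesis
      unfolding z(1) frob_one_minus[OF q_pos z(2), symmetric] h.hom_Units_inv(2)[OF U, symmetric]
      by (rule imageI[OF Q.A.Units_inv_closed[OF U]])
  qed
  have TB: "T \<in> frob (p ^ m) ` carrier R"
    using imageI[OF Q.t_closed, of "frob (p ^ m)"] unfolding frob_T[OF q_pos] .
  have eT: "\<sigma> (\<rho> T) = \<zero>\<^bsub>R\<^esub>" unfolding Q.pi_t by (rule Q.iota.hom_zero)
  have k: "frag_of (u @ frob (p ^ ?N) (\<one>\<^bsub>R\<^esub> \<ominus>\<^bsub>R\<^esub> T \<otimes>\<^bsub>R\<^esub> x') # frob (p ^ ?N) (\<one>\<^bsub>R\<^esub> \<ominus>\<^bsub>R\<^esub> T \<otimes>\<^bsub>R\<^esub> y') # v)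
     - frag_of (u @ frob (p ^ ?N) (\<sigma> (\<rho> (\<one>\<^bsub>R\<^esub> \<ominus>\<^bsub>R\<^esub> T \<otimes>\<^bsub>R\<^esub> x'))) # frob (p ^ ?N) (\<sigma> (\<rho> (\<one>\<^bsub>R\<^esub> \<ominus>\<^bsub>R\<^esub> T \<otimes>\<^bsub>R\<^esub> y'))) # v)
     \<in> milnor_rel R"
    by (rule reduced_symbol.principal_units_zero[OF reduced[OF u v q] Q.t_closed eT Q.t_nil p
          Q.A.geo_char[OF p char_R] one_minus_T_pow[OF q] frob_image_subring[OF q_pos] TB inv
          frob_image_decomp x'(1,2)])
  \<comment> \<open>Principal units have residue 1, so the term subtracted in the reduced symbol is
    just the symbol of 1 with itself.\<close>
  have e1: "\<sigma> (\<rho> (\<one>\<^bsub>R\<^esub> \<ominus>\<^bsub>R\<^esub> T \<otimes>\<^bsub>R\<^esub> z)) = \<one>\<^bsub>R\<^esub>" if z: "z \<in> carrier R" for z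
    using z Q.t_closed Q.k.ring_axioms by (simp add: a_minus_def Q.pi_t)
  have f1: "frob (p ^ ?N) (\<one>\<^bsub>R\<^esub> \<ominus>\<^bsub>R\<^esub> T \<otimes>\<^bsub>R\<^esub> frob (p ^ m) z) = frob M (\<one>\<^bsub>R\<^esub> \<ominus>\<^bsub>R\<^esub> T \<otimes>\<^bsub>R\<^esub> z)" if z: "z \<in> carrier R" for z
    unfolding frob_one_minus[OF q_pos z, symmetric] by (rule M_split[OF Q.A.Units_closed[OF Q.one_minus_t_unit[OF z]]])
  note k = k[unfolded e1[OF x'(3)] e1[OF x'(4)] h'.hom_one, unfolded x'_def y'_def f1[OF x] f1[OF y]]
  from s.Z_add[OF k s.one_left[OF Q.A.Units_one_closed]] show ?thesis by simp
qed

text \<open>A unit is a constant times a principal unit; \<open>kill_const\<close> and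
  \<open>kill_principal\<close> handle the two factors.\<close>

lemma kill_unit:
  assumes u: "u \<in> lists (Units R)" and v: "v \<in> lists (Units R)" and x: "x \<in> carrier R" and b: "b \<in> Units R"
  shows "frag_of (u @ frob M (\<one>\<^bsub>R\<^esub> \<ominus>\<^bsub>R\<^esub> T \<otimes>\<^bsub>R\<^esub> x) # frob M b # v) \<in> milnor_rel R"
    and "frag_of (u @ frob M b # frob M (\<one>\<^bsub>R\<^esub> \<ominus>\<^bsub>R\<^esub> T \<otimes>\<^bsub>R\<^esub> x) # v) \<in> milnor_rel R"
proof -
  have q: "p ^ L \<ge> Suc m" using L by (intro pow_gt) simp
  interpret f: steinberg_symbol R "\<lambda>a b. frag_of (u @ frob M a # frob M b # v)" "milnor_rel R"
    by (rule steinberg_symbol_pullback[OF word_symbol[OF Q.A u v] Q.A frob_hom[OF M_pos]])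
  obtain y where y: "y \<in> carrier R" "b = \<sigma> (\<rho> b) \<otimes>\<^bsub>R\<^esub> (\<one>\<^bsub>R\<^esub> \<ominus>\<^bsub>R\<^esub> T \<otimes>\<^bsub>R\<^esub> y)"
    using unit_decomp[OF b] by (rule bexE)
  have U: "\<one>\<^bsub>R\<^esub> \<ominus>\<^bsub>R\<^esub> T \<otimes>\<^bsub>R\<^esub> x \<in> Units R" "\<one>\<^bsub>R\<^esub> \<ominus>\<^bsub>R\<^esub> T \<otimes>\<^bsub>R\<^esub> y \<in> Units R" "\<sigma> (\<rho> b) \<in> Units R"
    by (rule Q.one_minus_t_unit x y(1) Q.iota_Units Q.pi_Units b)+
  note c = kill_const[OF u v q _ Q.pi_Units[OF b], folded M]
  from f.Z_add[OF f.Z_add[OF f.mult_right[OF U(1,3,2)] kill_principal[OF u v x y(1)]] c(1)[OF x]]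
  show "frag_of (u @ frob M (\<one>\<^bsub>R\<^esub> \<ominus>\<^bsub>R\<^esub> T \<otimes>\<^bsub>R\<^esub> x) # frob M b # v) \<in> milnor_rel R"
    unfolding y(2)[symmetric] by simp
  from f.Z_add[OF f.Z_add[OF f.mult_left[OF U(3,2,1)] kill_principal[OF u v y(1) x]] c(2)[OF x]]
  show "frag_of (u @ frob M b # frob M (\<one>\<^bsub>R\<^esub> \<ominus>\<^bsub>R\<^esub> T \<otimes>\<^bsub>R\<^esub> x) # v) \<in> milnor_rel R"
    unfolding y(2)[symmetric] by simp
qed

abbreviation (input) "frob_red \<equiv> \<lambda>a. frob M (\<sigma> (\<rho> a))"

lemma frob_M_Units: "a \<in> Units R \<Longrightarrow> frob M a \<in> Units R" "a \<in> Units R \<Longrightarrow> frob_red a \<in> Units R"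
  by (rule frob_Units[OF M_pos] Q.iota_Units Q.pi_Units; assumption?)+

lemma replace_letter:
  assumes u: "u \<in> lists (Units R)" and v: "v \<in> lists (Units R)" and a: "a \<in> Units R" and b: "b \<in> Units R"
  shows "frag_of (u @ frob M a # frob M b # v) - frag_of (u @ frob_red a # frob M b # v) \<in> milnor_rel R"
    and "frag_of (u @ frob M b # frob M a # v) - frag_of (u @ frob M b # frob_red a # v) \<in> milnor_rel R"
proof -
  interpret f: steinberg_symbol R "\<lambda>a b. frag_of (u @ frob M a # frob M b # v)" "milnor_rel R"
    by (rule steinberg_symbol_pullback[OF word_symbol[OF Q.A u v] Q.A frob_hom[OF M_pos]])
  obtain y where y: "y \<in> carrier R" "a = \<sigma> (\<rho> a) \<otimes>\<^bsub>R\<^esub> (\<one>\<^bsub>R\<^esub> \<ominus>\<^bsub>R\<^esub> T \<otimes>\<^bsub>R\<^esub> y)"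
    using unit_decomp[OF a] by (rule bexE)
  have U: "\<one>\<^bsub>R\<^esub> \<ominus>\<^bsub>R\<^esub> T \<otimes>\<^bsub>R\<^esub> y \<in> Units R" "\<sigma> (\<rho> a) \<in> Units R"
    by (rule Q.one_minus_t_unit y(1) Q.iota_Units Q.pi_Units a)+
  from f.Z_add[OF f.mult_left[OF U(2,1) b] kill_unit(1)[OF u v y(1) b]]
  show "frag_of (u @ frob M a # frob M b # v) - frag_of (u @ frob_red a # frob M b # v) \<in> milnor_rel R"
    unfolding y(2)[symmetric] by simp
  from f.Z_add[OF f.mult_right[OF b U(2,1)] kill_unit(2)[OF u v y(1) b]]
  show "frag_of (u @ frob M b # frob M a # v) - frag_of (u @ frob M b # frob_red a # v) \<in> milnor_rel R"
    unfolding y(2)[symmetric] by simp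
qed

text \<open>A letter can be replaced by its reduction only in the presence of a neighbour. Working
  from the right end keeps the left neighbour of each letter in the form
  \<open>frob M b\<close>.\<close>

lemma replace_tail:
  assumes "w \<in> lists (Units R)" "u \<in> lists (Units R)" "b \<in> Units R"
  shows "frag_of (u @ frob M b # map (frob M) w) - frag_of (u @ frob M b # map frob_red w) \<in> milnor_rel R"
  using assms
proof (induction w arbitrary: u b rule: list.induct)
  case Nil then show ?case by (simp add: word_rel.zero)
next
  case (Cons a w)
  have w: "w \<in> lists (Units R)" "a \<in> Units R" using Cons.prems(1) by auto
  have gw: "map frob_red w \<in> lists (Units R)" using w(1) frob_M_Units(2) by (induction w) simp_all
  have ub: "u @ [frob M b] \<in> lists (Units R)" using Cons.prems(2) frob_M_Units(1)[OF Cons.prems(3)] by simp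
  from word_rel_add[OF Cons.IH[OF w(1) ub w(2)] replace_letter(2)[OF Cons.prems(2) gw w(2) Cons.prems(3)]]
  show ?case by simp
qed

lemma replace_word:
  assumes w: "w \<in> lists (Units R)" "length w \<ge> 2"
  shows "frag_of (map (frob M) w) - frag_of (map frob_red w) \<in> milnor_rel R"
proof -
  obtain a b v where v: "w = a # b # v" using w(2) by (metis Suc_le_length_iff numeral_2_eq_2)
  have U: "a \<in> Units R" "b \<in> Units R" "v \<in> lists (Units R)" "b # v \<in> lists (Units R)" using w(1) v by auto
  have gv: "map frob_red v \<in> lists (Units R)" using U(3) frob_M_Units(2) by (induction v) simp_all
  \<comment> \<open>The first letter has no left neighbour. It is replaced last, against the already
    reduced second letter; here the length must be at least 2.\<close>
  from word_rel_add[OF replace_tail[OF U(4) lists.Nil U(1)]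
      replace_letter(1)[OF lists.Nil gv U(1) Q.iota_Units[OF Q.pi_Units[OF U(2)]]]]
  show ?thesis by (simp add: v)
qed

lemma replace_chain:
  assumes n: "n \<ge> 2" and c: "Poly_Mapping.keys c \<subseteq> words R n"
  shows "frag_map (frob M) c - frag_map frob_red c \<in> milnor_rel R"
  using c
proof (induction c rule: frag_induction)
  case zero then show ?case by (simp add: word_rel.zero)
next
  case (one w) then show ?case using n replace_word[of w] by simp
next
  case (diff a b)
  from word_rel.diff[OF diff(1,2)] show ?case by (simp add: frag_extend_diff algebra_simps)
qed

end

text \<open>Modulo relations \<open>c\<close> agrees with \<open>frob M c\<close>, and this with
  \<open>frob M\<close> of the lifted reduction of \<open>c\<close>, which is a relation when the
  reduction is one. A single \<open>M\<close> has to serve the relation over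
  \<open>A(s_1, s_2)\<close> and all letters of \<open>c\<close>.\<close>

theorem reduction_vanishing:
  assumes n: "n \<ge> 2" and c: "Poly_Mapping.keys c \<subseteq> words R n"
    and eq: "frag_map (rat_incl1 A) c - frag_map (rat_incl2 A) c \<in> milnor_rel (rat2 A)"
    and red: "frag_map \<rho> c \<in> milnor_rel (rat1 k)"
  shows "c \<in> milnor_rel R"
proof -
  interpret R2: cring "rat2 A" by (rule cring_rat2)
  have "eventually (\<lambda>M. frag_map (spec M) (frag_map (rat_incl1 A) c - frag_map (rat_incl2 A) c) \<in> milnor_rel R) sequentially"
  proof (rule word_rel_eventually[OF eq spec_unit])
    show "eventually (\<lambda>i. spec i (a \<otimes>\<^bsub>rat2 A\<^esub> b) = spec i a \<otimes>\<^bsub>R\<^esub> spec i b) sequentially"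
      if "a \<in> Units (rat2 A)" "b \<in> Units (rat2 A)" for a b
      by (rule spec_mult[OF R2.Units_closed[OF that(1)] R2.Units_closed[OF that(2)]])
    show "eventually (\<lambda>i. spec i (\<one>\<^bsub>rat2 A\<^esub> \<ominus>\<^bsub>rat2 A\<^esub> a) = \<one>\<^bsub>R\<^esub> \<ominus>\<^bsub>R\<^esub> spec i a) sequentially"
      if "a \<in> Units (rat2 A)" for a
      by (rule spec_one_minus[OF R2.Units_closed[OF that]])
  qed
  moreover define X where "X = (\<Union>w \<in> Poly_Mapping.keys c. set w)"
  have X: "finite X" "X \<subseteq> carrier R" "Poly_Mapping.keys c \<subseteq> lists X"
    using c Q.A.Units_closed by (auto simp: X_def)
  have "eventually (\<lambda>M. \<forall>x \<in> X. spec M (rat_incl1 A x) = x \<and> spec M (rat_incl2 A x) = frob M x) sequentially"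
    by (rule eventually_ball_finite[OF X(1)]) (use X(2) in \<open>intro ballI eventually_conj spec_incl1 spec_incl2; auto\<close>)
  ultimately have "eventually (\<lambda>M. frag_map (spec M) (frag_map (rat_incl1 A) c - frag_map (rat_incl2 A) c) \<in> milnor_rel R
      \<and> (\<forall>x \<in> X. spec M (rat_incl1 A x) = x \<and> spec M (rat_incl2 A x) = frob M x)) sequentially"
    by (rule eventually_conj)
  then obtain M0 where M0: "\<And>M. M \<ge> M0 \<Longrightarrow> frag_map (spec M) (frag_map (rat_incl1 A) c - frag_map (rat_incl2 A) c) \<in> milnor_rel R
      \<and> (\<forall>x \<in> X. spec M (rat_incl1 A x) = x \<and> spec M (rat_incl2 A x) = frob M x)"
    unfolding eventually_sequentially by blast
  \<comment> \<open>The exponent must be at least \<open>2 m\<close> for the replacement of letters,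
    while \<open>M\<close> itself must reach \<open>M0\<close>; the latter follows from
    \<open>p^L > L\<close>.\<close>
  define L M where "L = max M0 (2 * m)" and "M = p ^ L"
  have L: "2 * m \<le> L" by (simp add: L_def)
  have "M \<ge> M0"
    using power_gt_expt[of p L] prime_gt_1_nat[OF p] by (simp add: M_def L_def)
  note s = M0[OF this]
  have "frag_map (spec M) (frag_map (rat_incl1 A) c - frag_map (rat_incl2 A) c) = c - frag_map (frob M) c"
  proof -
    have "frag_map (spec M) (frag_map (rat_incl1 A) c) = frag_map (\<lambda>x. x) c"
      unfolding frag_map_comp by (rule frag_map_cong[OF _ X(3)]) (use s in simp)
    moreover have "frag_map (\<lambda>x. x) c = c" by (induction c rule: frag_induct) (simp_all add: frag_extend_diff)
    moreover have "frag_map (spec M) (frag_map (rat_incl2 A) c) = frag_map (frob M) c"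
      unfolding frag_map_comp by (rule frag_map_cong[OF _ X(3)]) (use s in simp)
    ultimately show ?thesis by (simp add: frag_extend_diff)
  qed
  then have 1: "c - frag_map (frob M) c \<in> milnor_rel R" using s by simp
  have 2: "frag_map (frob M) c - frag_map (\<lambda>a. frob M (\<sigma> (\<rho> a))) c \<in> milnor_rel R"
    by (rule replace_chain[OF L M_def n c])
  have hom: "frob M \<circ> \<sigma> \<in> ring_hom (rat1 k) R"
    using ring_hom_trans[OF Q.iota frob_hom] q_pos unfolding M_def by blast
  have "frag_map (frob M \<circ> \<sigma>) (frag_map \<rho> c) \<in> milnor_rel R"
    by (rule symbol_map_milnor_rel[OF symbol_map_ring_hom[OF Q.k.ring_axioms Q.A.ring_axioms hom] red])
  then have 3: "frag_map (\<lambda>a. frob M (\<sigma> (\<rho> a))) c \<in> milnor_rel R" unfolding frag_map_comp by (simp add: comp_def)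
  from word_rel_add[OF word_rel_add[OF 1 2] 3] show ?thesis by simp
qed

end

lemma symbol_map_comp_ring_hom:
  assumes R: "ring R" and S: "ring S" and f: "f \<in> ring_hom R S" and g: "symbol_map S L g"
  shows "symbol_map R L (\<lambda>a. g (f a))"
proof -
  interpret f: ring_hom_ring R S f by (rule ring_hom_ringI2[OF R S f])
  have U: "f a \<in> Units S" if "a \<in> Units R" for a
    using symbol_map_ring_hom[OF R S f] that by (simp add: symbol_map_def)
  have "f (\<one>\<^bsub>R\<^esub> \<ominus>\<^bsub>R\<^esub> a) = \<one>\<^bsub>S\<^esub> \<ominus>\<^bsub>S\<^esub> f a" if "a \<in> Units R" for a
    using that by (simp add: a_minus_def f.R.Units_closed)
  then show ?thesis
    unfolding symbol_map_def
    using g[unfolded symbol_map_def] U f.hom_mult[OF f.R.Units_closed f.R.Units_closed] by metis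
qed

section \<open>The field case\<close>

definition origin_map :: "('a, 'b) ring_scheme \<Rightarrow> ((nat \<Rightarrow> 'a) \<times> (nat \<Rightarrow> 'a)) set \<Rightarrow> 'a" where
  "origin_map k = low_map k k (\<lambda>a. a)"

text \<open>The specialization at \<open>s_2 = 0\<close> of \<open>k(s_1, s_2)\<close>: lowest
  coefficients in the outer variable are polynomials in \<open>s_1\<close>, viewed in
  \<open>k(s_1)\<close>.\<close>

definition origin_map2 :: "('a, 'b) ring_scheme \<Rightarrow>
    ((nat \<Rightarrow> nat \<Rightarrow> 'a) \<times> (nat \<Rightarrow> nat \<Rightarrow> 'a)) set \<Rightarrow> ((nat \<Rightarrow> 'a) \<times> (nat \<Rightarrow> 'a)) set" where
  "origin_map2 k = low_map (UP k) (rat1 k) (\<lambda>f. loc_frac (UP k) (unit_content1 k) f \<one>\<^bsub>UP k\<^esub>)"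

context
  fixes k :: "('a, 'b) ring_scheme" assumes k: "field k"
begin

lemmas field_self_thickening = trivial_thickening[OF k]

lemma cring_k: "cring k" by (rule fieldE(1)[OF k])

lemma domain_k: "domain k" by (rule field.axioms(1)[OF k])

lemma domain_UPk: "domain (UP k)"
  using thickening.k[OF thickening.UP_thickening[OF field_thickening.axioms(1)[OF field_self_thickening]]] .

lemma mult_set_k: "mult_set (UP k) (unit_content1 k)"
  by (rule field_thickening.mult_set1[OF field_self_thickening])

lemma poly_frac_hom: "(\<lambda>f. loc_frac (UP k) (unit_content1 k) f \<one>\<^bsub>UP k\<^esub>) \<in> ring_hom (UP k) (rat1 k)"
proof -
  interpret P: domain "UP k" by (rule domain_UPk)
  interpret M: mult_set "UP k" "unit_content1 k" by (rule mult_set_k)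
  show ?thesis unfolding rat1_def
  proof (rule ring_hom_memI)
    fix x y assume xy: "x \<in> carrier (UP k)" "y \<in> carrier (UP k)"
    show "loc_frac (UP k) (unit_content1 k) x \<one>\<^bsub>UP k\<^esub> \<in> carrier (localization (UP k) (unit_content1 k))"
      by (rule M.loc_frac_closed[OF xy(1) M.one_S])
    show "loc_frac (UP k) (unit_content1 k) (x \<otimes>\<^bsub>UP k\<^esub> y) \<one>\<^bsub>UP k\<^esub> =
        loc_frac (UP k) (unit_content1 k) x \<one>\<^bsub>UP k\<^esub> \<otimes>\<^bsub>localization (UP k) (unit_content1 k)\<^esub>
        loc_frac (UP k) (unit_content1 k) y \<one>\<^bsub>UP k\<^esub>"
      unfolding M.loc_mult[OF xy(1) M.one_S xy(2) M.one_S] P.l_one[OF P.one_closed] ..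
    show "loc_frac (UP k) (unit_content1 k) (x \<oplus>\<^bsub>UP k\<^esub> y) \<one>\<^bsub>UP k\<^esub> =
        loc_frac (UP k) (unit_content1 k) x \<one>\<^bsub>UP k\<^esub> \<oplus>\<^bsub>localization (UP k) (unit_content1 k)\<^esub>
        loc_frac (UP k) (unit_content1 k) y \<one>\<^bsub>UP k\<^esub>"
      unfolding M.loc_add[OF xy(1) M.one_S xy(2) M.one_S] P.l_one[OF P.one_closed] P.r_one[OF xy(1)] P.r_one[OF xy(2)] ..
  qed (rule M.loc_one[symmetric])
qed

lemma poly_frac_zero:
  assumes a: "a \<in> carrier (UP k)" "loc_frac (UP k) (unit_content1 k) a \<one>\<^bsub>UP k\<^esub> = \<zero>\<^bsub>rat1 k\<^esub>"
  shows "a = \<zero>\<^bsub>UP k\<^esub>"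
proof -
  interpret P: domain "UP k" by (rule domain_UPk)
  interpret M: mult_set "UP k" "unit_content1 k" by (rule mult_set_k)
  have "\<exists>u\<in>unit_content1 k. u \<otimes>\<^bsub>UP k\<^esub> (\<one>\<^bsub>UP k\<^esub> \<otimes>\<^bsub>UP k\<^esub> a) = u \<otimes>\<^bsub>UP k\<^esub> (\<one>\<^bsub>UP k\<^esub> \<otimes>\<^bsub>UP k\<^esub> \<zero>\<^bsub>UP k\<^esub>)"
    using a(2) unfolding rat1_def M.loc_zero M.loc_frac_eq_iff[OF a(1) M.one_S P.zero_closed M.one_S] .
  then obtain u where u: "u \<in> unit_content1 k" "u \<otimes>\<^bsub>UP k\<^esub> a = \<zero>\<^bsub>UP k\<^esub>"
    using a(1) M.S_closed by auto
  have "u \<in> carrier (UP k)" "u \<noteq> \<zero>\<^bsub>UP k\<^esub>" using u(1) unfolding unit_content1_field[OF k] by simp_all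
  then show ?thesis using P.integral[OF u(2) _ a(1)] by simp
qed

lemma origin_map_symbol_map: "symbol_map (rat1 k) k (origin_map k)"
  unfolding rat1_def unit_content1_field[OF k] origin_map_def
  by (rule domain.low_map_symbol_map[OF domain_k k id_hom])

lemma origin_map2_symbol_map: "symbol_map (rat2 k) (rat1 k) (origin_map2 k)"
proof -
  have "symbol_map (localization (UP (UP k)) (domain.nonzero_polys (UP k))) (rat1 k) (origin_map2 k)"
    unfolding origin_map2_def
    by (rule domain.low_map_symbol_map[OF domain_UPk field_rat1[OF k] poly_frac_hom poly_frac_zero])
  then show ?thesis unfolding rat2_def unit_content2_field[OF k] .
qed

lemma rat1_unit_frac:
  assumes x: "x \<in> Units (rat1 k)"
  obtains a s where "x = loc_frac (UP k) (unit_content1 k) a s" "a \<in> unit_content1 k" "s \<in> unit_content1 k"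
  using x unfolding rat1_def unit_content1_field[OF k] by (rule domain.unit_frac[OF domain_k])

lemma origin_map_frac:
  assumes "a \<in> unit_content1 k" "s \<in> unit_content1 k"
  shows "origin_map k (loc_frac (UP k) (unit_content1 k) a s) = low_coeff k a \<otimes>\<^bsub>k\<^esub> inv\<^bsub>k\<^esub> (low_coeff k s)"
  unfolding origin_map_def unit_content1_field[OF k]
  by (rule domain.low_map_frac[OF domain_k k id_hom _ assms[unfolded unit_content1_field[OF k]]])

lemma origin_map2_frac:
  assumes "a \<in> unit_content2 k" "s \<in> unit_content2 k"
  shows "origin_map2 k (loc_frac (UP (UP k)) (unit_content2 k) a s) =
    loc_frac (UP k) (unit_content1 k) (low_coeff (UP k) a) \<one>\<^bsub>UP k\<^esub> \<otimes>\<^bsub>rat1 k\<^esub>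
    inv\<^bsub>rat1 k\<^esub> (loc_frac (UP k) (unit_content1 k) (low_coeff (UP k) s) \<one>\<^bsub>UP k\<^esub>)"
  unfolding origin_map2_def unit_content2_field[OF k]
  by (rule domain.low_map_frac[OF domain_UPk field_rat1[OF k] poly_frac_hom poly_frac_zero
        assms[unfolded unit_content2_field[OF k]]])

lemma poly_const_eq_zero: "a \<in> carrier k \<Longrightarrow> poly_const k a = \<zero>\<^bsub>UP k\<^esub> \<longleftrightarrow> a = \<zero>\<^bsub>k\<^esub>"
proof
  assume a: "a \<in> carrier k" "poly_const k a = \<zero>\<^bsub>UP k\<^esub>"
  then have "poly_const k a 0 = \<zero>\<^bsub>UP k\<^esub> 0" by simp
  then show "a = \<zero>\<^bsub>k\<^esub>" using a(1) by (simp add: UP_apply(8,6)[OF cring_k])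
next
  assume "a = \<zero>\<^bsub>k\<^esub>"
  then show "poly_const k a = \<zero>\<^bsub>UP k\<^esub>"
    using ring_hom_zero[OF poly_const_hom[OF cring_k] cring.axioms(1)[OF cring_k] cring.axioms(1)[OF cring_UP[OF cring_k]]] by simp
qed

lemma low_coeff_up_const:
  assumes a: "a \<in> carrier (UP k)"
  shows "low_coeff (UP k) (up_map (poly_const k) a) = poly_const k (low_coeff k a)"
proof -
  have "ord0 (UP k) (up_map (poly_const k) a) = ord0 k a"
    unfolding ord0_def by (simp add: poly_const_eq_zero[OF UP_apply(2)[OF cring_k a]])
  then show ?thesis by (simp add: low_coeff_def)
qed

lemma low_coeff_Units: "s \<in> unit_content1 k \<Longrightarrow> low_coeff k s \<in> Units k"
  using domain.low_coeff_closed[OF domain_k] domain.low_coeff_nonzero[OF domain_k]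
  unfolding unit_content1_field[OF k] field.field_Units[OF k] by simp

lemma origin_map_const:
  assumes a: "a \<in> carrier k" "a \<noteq> \<zero>\<^bsub>k\<^esub>" shows "origin_map k (rat_const k a) = a"
proof -
  interpret k: field k by (rule k)
  interpret M: mult_set "UP k" "unit_content1 k" by (rule mult_set_k)
  have c: "poly_const k a \<in> unit_content1 k"
    using a poly_const_eq_zero UP_closed(1)[OF cring_k] unfolding unit_content1_field[OF k] by simp
  have "low_coeff k \<one>\<^bsub>UP k\<^esub> = \<one>\<^bsub>k\<^esub>"
    using domain.low_coeff_const[OF domain_k k.one_closed] ring_hom_one[OF poly_const_hom[OF cring_k]] by simp
  then show ?thesis
    unfolding rat_const_def origin_map_frac[OF c M.one_S] domain.low_coeff_const[OF domain_k a(1)] using a(1) by simp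
qed

lemma frac_eq:
  assumes a: "a \<in> carrier (UP k)" and s: "s \<in> unit_content1 k"
  shows "loc_frac (UP k) (unit_content1 k) a s = loc_frac (UP k) (unit_content1 k) a \<one>\<^bsub>UP k\<^esub> \<otimes>\<^bsub>rat1 k\<^esub>
    inv\<^bsub>rat1 k\<^esub> (loc_frac (UP k) (unit_content1 k) s \<one>\<^bsub>UP k\<^esub>)"
proof -
  interpret P: domain "UP k" by (rule domain_UPk)
  interpret M: mult_set "UP k" "unit_content1 k" by (rule mult_set_k)
  interpret L: cring "rat1 k" unfolding rat1_def by (rule M.cring_localization)
  let ?j = "\<lambda>f s. loc_frac (UP k) (unit_content1 k) f s"
  have sc: "s \<in> carrier (UP k)" by (rule M.S_closed[OF s])
  have U: "?j s \<one>\<^bsub>UP k\<^esub> \<in> Units (rat1 k)" unfolding rat1_def by (rule M.loc_frac_unit[OF s M.one_S])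
  have c: "?j a s \<in> carrier (rat1 k)" unfolding rat1_def by (rule M.loc_frac_closed[OF a s])
  have "?j a s \<otimes>\<^bsub>rat1 k\<^esub> ?j s \<one>\<^bsub>UP k\<^esub> = ?j a \<one>\<^bsub>UP k\<^esub>"
    unfolding rat1_def M.loc_mult[OF a s sc M.one_S] P.m_comm[OF a sc] by (rule M.loc_frac_cancel[OF a M.one_S s])
  then have e: "?j a \<one>\<^bsub>UP k\<^esub> = ?j a s \<otimes>\<^bsub>rat1 k\<^esub> ?j s \<one>\<^bsub>UP k\<^esub>" by (rule sym)
  show ?thesis
    unfolding e L.m_assoc[OF c L.Units_closed[OF U] L.Units_inv_closed[OF U]] L.Units_r_inv[OF U] L.r_one[OF c] ..
qed

lemma origin_map2_incl1:
  assumes x: "x \<in> Units (rat1 k)" shows "origin_map2 k (rat_incl1 k x) = x"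
proof -
  obtain a s where a: "x = loc_frac (UP k) (unit_content1 k) a s" "a \<in> unit_content1 k" "s \<in> unit_content1 k"
    using x by (rule rat1_unit_frac)
  interpret M: mult_set "UP k" "unit_content1 k" by (rule mult_set_k)
  note c = M.S_closed[OF a(2)] M.S_closed[OF a(3)]
  show ?thesis
    unfolding a(1) field_thickening.rat_incl1_frac[OF field_self_thickening c(1) a(3)]
      origin_map2_frac[OF field_thickening.const_unit_content2[OF field_self_thickening a(2)] field_thickening.const_unit_content2[OF field_self_thickening a(3)]]
      domain.low_coeff_const[OF domain_UPk c(1)] domain.low_coeff_const[OF domain_UPk c(2)]
    by (rule frac_eq[OF c(1) a(3), symmetric])
qed

text \<open>All \<open>s_2\<close>-coefficients of an element in the image of \<open>i_2\<close> are
  constants of \<open>k\<close>, so its lowest coefficient is a constant too, the same one that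
  \<open>origin_map\<close> reads off.\<close>

lemma origin_map2_incl2:
  assumes x: "x \<in> Units (rat1 k)" shows "origin_map2 k (rat_incl2 k x) = rat_const k (origin_map k x)"
proof -
  obtain a s where a: "x = loc_frac (UP k) (unit_content1 k) a s" "a \<in> unit_content1 k" "s \<in> unit_content1 k"
    using x by (rule rat1_unit_frac)
  interpret M: mult_set "UP k" "unit_content1 k" by (rule mult_set_k)
  interpret L: cring "rat1 k" unfolding rat1_def by (rule M.cring_localization)
  interpret c: ring_hom_cring k "rat1 k" "rat_const k"
    by (rule ring_hom_cringI[OF cring_k L.is_cring field_thickening.rat_const_hom[OF field_self_thickening]])
  note c = M.S_closed[OF a(2)] M.S_closed[OF a(3)]
  note U = low_coeff_Units[OF a(2)] low_coeff_Units[OF a(3)]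
  show ?thesis
    unfolding a(1) field_thickening.rat_incl2_frac[OF field_self_thickening c(1) a(3)]
      origin_map2_frac[OF field_thickening.up_const_unit_content2[OF field_self_thickening a(2)] field_thickening.up_const_unit_content2[OF field_self_thickening a(3)]]
      low_coeff_up_const[OF c(1)] low_coeff_up_const[OF c(2)] origin_map_frac[OF a(2,3)]
      c.hom_mult[OF c.R.Units_closed[OF U(1)] c.R.Units_inv_closed[OF U(2)]] c.hom_Units_inv(2)[OF U(2)] rat_const_def[symmetric] ..
qed

text \<open>As a symbol map, \<open>origin_map2\<close> may be applied to the relation expressing
  the improved condition, although it does not come from a ring homomorphism.\<close>

lemma field_chain:
  assumes c: "Poly_Mapping.keys c \<subseteq> lists (Units (rat1 k))"
    and eq: "frag_map (rat_incl1 k) c - frag_map (rat_incl2 k) c \<in> milnor_rel (rat2 k)"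
  shows "c - frag_map (\<lambda>x. rat_const k (origin_map k x)) c \<in> milnor_rel (rat1 k)"
proof -
  have "frag_map (origin_map2 k) (frag_map (rat_incl1 k) c) = frag_map (\<lambda>x. x) c"
    unfolding frag_map_comp by (rule frag_map_cong[OF _ c]) (simp add: origin_map2_incl1)
  moreover have "frag_map (\<lambda>x. x) c = c" by (induction c rule: frag_induct) (simp_all add: frag_extend_diff)
  moreover have "frag_map (origin_map2 k) (frag_map (rat_incl2 k) c) = frag_map (\<lambda>x. rat_const k (origin_map k x)) c"
    unfolding frag_map_comp by (rule frag_map_cong[OF _ c]) (simp add: origin_map2_incl2)
  ultimately show ?thesis
    using symbol_map_milnor_rel[OF origin_map2_symbol_map eq] by (simp add: frag_extend_diff)
qed

end

section \<open>Improved Milnor groups described by combinations of words\<close>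

lemma milnor_map_ring_hom:
  assumes "ring R" "ring S" "f \<in> ring_hom R S" "Poly_Mapping.keys c \<subseteq> words R n"
  shows "milnor_map S f (milnor_elem R c) = milnor_elem S (frag_map f c)"
    and "Poly_Mapping.keys (frag_map f c) \<subseteq> words S n"
proof -
  note s = symbol_map_ring_hom[OF assms(1-3)]
  show "milnor_map S f (milnor_elem R c) = milnor_elem S (frag_map f c)"
    by (rule symbol_map_milnor_map[OF assms(1,2) s ring.words_keys[OF assms(1,4)]])
  show "Poly_Mapping.keys (frag_map f c) \<subseteq> words S n"
    by (rule frag_map_words[OF _ assms(4)]) (use s in \<open>simp add: symbol_map_def\<close>)
qed

context field_thickening
begin

text \<open>Representatives of improved classes, with the kernel condition expressed on words. They
  are closed under differences, so injectivity can be tested on single chains.\<close>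

definition improved_chains :: "nat \<Rightarrow> (((nat \<Rightarrow> 'a) \<times> (nat \<Rightarrow> 'a)) set list \<Rightarrow>\<^sub>0 int) set" where
  "improved_chains n = {c. Poly_Mapping.keys c \<subseteq> words (rat1 A) n \<and>
     frag_map (rat_incl1 A) c - frag_map (rat_incl2 A) c \<in> milnor_rel (rat2 A)}"

lemma carrier_improved_K: "carrier (improved_K n A) = milnor_elem (rat1 A) ` improved_chains n"
proof -
  interpret R1: cring "rat1 A" by (rule cring_rat1)
  interpret R2: cring "rat2 A" by (rule cring_rat2)
  have d: "milnor_map (rat2 A) (rat_incl1 A) (milnor_elem (rat1 A) c) \<otimes>\<^bsub>milnor_K n (rat2 A)\<^esub>
      inv\<^bsub>milnor_K n (rat2 A)\<^esub> (milnor_map (rat2 A) (rat_incl2 A) (milnor_elem (rat1 A) c)) = \<one>\<^bsub>milnor_K n (rat2 A)\<^esub>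
    \<longleftrightarrow> c \<in> improved_chains n" if c: "Poly_Mapping.keys c \<subseteq> words (rat1 A) n" for c
  proof -
    note i1 = milnor_map_ring_hom[OF R1.ring_axioms R2.ring_axioms rat_incl1_hom c]
    note i2 = milnor_map_ring_hom[OF R1.ring_axioms R2.ring_axioms rat_incl2_hom c]
    have n2: "Poly_Mapping.keys (- frag_map (rat_incl2 A) c) \<subseteq> words (rat2 A) n" using i2(2) by (simp add: keys_minus)
    have s: "Poly_Mapping.keys (frag_map (rat_incl1 A) c + - frag_map (rat_incl2 A) c) \<subseteq> words (rat2 A) n"
      by (rule keys_add_subset[OF i1(2) n2])
    have z: "Poly_Mapping.keys (0 :: ((nat \<Rightarrow> nat \<Rightarrow> 'a) \<times> (nat \<Rightarrow> nat \<Rightarrow> 'a)) set list \<Rightarrow>\<^sub>0 int) \<subseteq> lists (Units (rat2 A))"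
      by simp
    show ?thesis
      unfolding i1(1) i2(1) R2.milnor_K_inv[OF i2(2)] R2.milnor_K_mult[OF i1(2) n2] R2.milnor_K_simps(3)
        R2.milnor_elem_eq_iff[OF R2.words_keys[OF s] z] improved_chains_def
      using c by simp
  qed
  show ?thesis
    unfolding improved_K_def kernel_def using d by (auto simp: R1.milnor_K_simps(1) improved_chains_def)
qed

lemma improved_K_mult: "x \<otimes>\<^bsub>improved_K n A\<^esub> y = x \<otimes>\<^bsub>milnor_K n (rat1 A)\<^esub> y"
  by (simp add: improved_K_def)

lemma improved_chains_keys: "c \<in> improved_chains n \<Longrightarrow> Poly_Mapping.keys c \<subseteq> words (rat1 A) n"
  by (simp add: improved_chains_def)

lemma improved_chains_diff: "c \<in> improved_chains n \<Longrightarrow> d \<in> improved_chains n \<Longrightarrow> c - d \<in> improved_chains n"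
proof -
  assume h: "c \<in> improved_chains n" "d \<in> improved_chains n"
  have e: "frag_map (rat_incl1 A) (c - d) - frag_map (rat_incl2 A) (c - d) =
     (frag_map (rat_incl1 A) c - frag_map (rat_incl2 A) c) - (frag_map (rat_incl1 A) d - frag_map (rat_incl2 A) d)"
    by (simp add: frag_extend_diff)
  show ?thesis
    using h keys_diff_subset[of c "words (rat1 A) n" d] unfolding improved_chains_def mem_Collect_eq e
    by (blast intro: word_rel.diff)
qed

lemma zero_improved_chains: "0 \<in> improved_chains n"
  by (simp add: improved_chains_def word_rel.zero)

end

section \<open>Finite fields\<close>

lemma frag_cmul_right_diff: "frag_cmul i (x - y) = frag_cmul i x - frag_cmul i y"
  using frag_cmul_distrib2[of i "x - y" y] by (simp add: eq_diff_eq)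

text \<open>Bezout for 2 and an odd number, for subgroups given by closure under
  differences.\<close>

lemma int_combination_mem:
  fixes x :: "'w \<Rightarrow>\<^sub>0 int"
  assumes d: "\<And>x y. x \<in> Z \<Longrightarrow> y \<in> Z \<Longrightarrow> x - y \<in> Z" and z: "0 \<in> Z"
    and 2: "frag_cmul 2 x \<in> Z" and j: "frag_cmul j x \<in> Z" "odd j"
  shows "x \<in> Z"
proof -
  have a: "x + y \<in> Z" if "x \<in> Z" "y \<in> Z" for x y using d[OF that(1) d[OF z that(2)]] by simp
  have n: "frag_cmul (int n) y \<in> Z" if "y \<in> Z" for n y
    by (induction n) (use z that a in \<open>simp_all add: frag_cmul_distrib\<close>)
  have i: "frag_cmul i y \<in> Z" if y: "y \<in> Z" for i y
  proof (cases "i \<ge> 0")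
    case True then show ?thesis using n[OF y, of "nat i"] by simp
  next
    case False
    then have "frag_cmul (int (nat (- i))) y = - frag_cmul i y" by simp
    then show ?thesis using d[OF z n[OF y, of "nat (- i)"]] by simp
  qed
  obtain l where l: "j = 2 * l + 1" using j(2) by (rule oddE)
  have "x = frag_cmul j x - frag_cmul l (frag_cmul 2 x)"
    by (simp add: l frag_cmul_distrib algebra_simps)
  then show ?thesis using d[OF j(1) i[OF 2, of l]] by simp
qed

text \<open>If the generator \<open>g\<close> of the unit group is not a square, there are not enough squares for
  \<open>a \<mapsto> 1 - a\<close> to map the non-squares to squares different from \<open>1\<close>.\<close>

lemma nonsquares_sum_one:
  assumes k: "field k" and fin: "finite (carrier k)" and g: "g \<in> Units k" "\<And>y. y \<in> Units k \<Longrightarrow> g \<noteq> y \<otimes>\<^bsub>k\<^esub> y"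
  shows "\<exists>a \<in> Units k. \<one>\<^bsub>k\<^esub> \<ominus>\<^bsub>k\<^esub> a \<in> Units k \<and> (\<forall>y \<in> Units k. a \<noteq> y \<otimes>\<^bsub>k\<^esub> y \<and> \<one>\<^bsub>k\<^esub> \<ominus>\<^bsub>k\<^esub> a \<noteq> y \<otimes>\<^bsub>k\<^esub> y)"
proof (rule ccontr)
  assume none: "\<not> ?thesis"
  interpret k: field k by (rule k)
  define S where "S = (\<lambda>y. y \<otimes>\<^bsub>k\<^esub> y) ` Units k"
  define N where "N = Units k - S"
  have sub: "S \<subseteq> Units k" by (auto simp: S_def)
  have finU: "finite (Units k)" using fin by (rule finite_subset[rotated]) auto
  have one: "\<one>\<^bsub>k\<^esub> \<in> S" unfolding S_def by (rule image_eqI[of _ _ "\<one>\<^bsub>k\<^esub>"]) simp_all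
  have "g \<otimes>\<^bsub>k\<^esub> x \<in> N" if x: "x \<in> S" for x
  proof -
    obtain y where y: "x = y \<otimes>\<^bsub>k\<^esub> y" "y \<in> Units k" using x unfolding S_def by (rule imageE)
    have "g \<otimes>\<^bsub>k\<^esub> x \<notin> S"
    proof
      assume "g \<otimes>\<^bsub>k\<^esub> x \<in> S"
      then obtain z where z: "g \<otimes>\<^bsub>k\<^esub> x = z \<otimes>\<^bsub>k\<^esub> z" "z \<in> Units k" unfolding S_def by (rule imageE)
      note c = k.Units_closed[OF g(1)] k.Units_closed[OF y(2)] k.Units_closed[OF z(2)] k.Units_inv_closed[OF y(2)]
      have "g = (g \<otimes>\<^bsub>k\<^esub> x) \<otimes>\<^bsub>k\<^esub> (inv\<^bsub>k\<^esub> y \<otimes>\<^bsub>k\<^esub> inv\<^bsub>k\<^esub> y)"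
      proof -
        have "(g \<otimes>\<^bsub>k\<^esub> x) \<otimes>\<^bsub>k\<^esub> (inv\<^bsub>k\<^esub> y \<otimes>\<^bsub>k\<^esub> inv\<^bsub>k\<^esub> y) = g \<otimes>\<^bsub>k\<^esub> ((y \<otimes>\<^bsub>k\<^esub> inv\<^bsub>k\<^esub> y) \<otimes>\<^bsub>k\<^esub> (y \<otimes>\<^bsub>k\<^esub> inv\<^bsub>k\<^esub> y))"
          unfolding y(1) using c by (simp add: k.m_ac del: k.Units_r_inv k.Units_l_inv)
        then show ?thesis using c y(2) by simp
      qed
      also have "\<dots> = (z \<otimes>\<^bsub>k\<^esub> inv\<^bsub>k\<^esub> y) \<otimes>\<^bsub>k\<^esub> (z \<otimes>\<^bsub>k\<^esub> inv\<^bsub>k\<^esub> y)" unfolding z(1) using c by (simp add: k.m_ac)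
      finally show False using g(2)[of "z \<otimes>\<^bsub>k\<^esub> inv\<^bsub>k\<^esub> y"] z(2) y(2) by simp
    qed
    moreover have "g \<otimes>\<^bsub>k\<^esub> x \<in> Units k" using g(1) y by simp
    ultimately show ?thesis by (simp add: N_def)
  qed
  then have "(\<lambda>x. g \<otimes>\<^bsub>k\<^esub> x) ` S \<subseteq> N" by (rule image_subsetI)
  moreover have "inj_on (\<lambda>x. g \<otimes>\<^bsub>k\<^esub> x) S"
    using sub g(1) k.Units_l_cancel k.Units_closed by (intro inj_onI) (metis subsetD)
  moreover have finN: "finite N" using finU by (simp add: N_def)
  ultimately have le: "card S \<le> card N" by (metis card_inj_on_le)
  have "\<one>\<^bsub>k\<^esub> \<ominus>\<^bsub>k\<^esub> a \<in> S - {\<one>\<^bsub>k\<^esub>}" if a: "a \<in> N" for a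
  proof -
    have aU: "a \<in> Units k" "a \<notin> S" using a by (simp_all add: N_def)
    have ac: "a \<in> carrier k" "a \<noteq> \<zero>\<^bsub>k\<^esub>" "a \<noteq> \<one>\<^bsub>k\<^esub>" using aU one by (auto simp: k.field_Units)
    then have b: "\<one>\<^bsub>k\<^esub> \<ominus>\<^bsub>k\<^esub> a \<in> Units k" by (simp add: k.field_Units)
    then have "\<one>\<^bsub>k\<^esub> \<ominus>\<^bsub>k\<^esub> a \<in> S" using none aU unfolding S_def by blast
    moreover have "\<one>\<^bsub>k\<^esub> \<ominus>\<^bsub>k\<^esub> a \<noteq> \<one>\<^bsub>k\<^esub>"
    proof
      assume "\<one>\<^bsub>k\<^esub> \<ominus>\<^bsub>k\<^esub> a = \<one>\<^bsub>k\<^esub>"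
      then have "\<one>\<^bsub>k\<^esub> \<ominus>\<^bsub>k\<^esub> (\<one>\<^bsub>k\<^esub> \<ominus>\<^bsub>k\<^esub> a) = \<zero>\<^bsub>k\<^esub>" by simp
      moreover have "\<one>\<^bsub>k\<^esub> \<ominus>\<^bsub>k\<^esub> (\<one>\<^bsub>k\<^esub> \<ominus>\<^bsub>k\<^esub> a) = a" using ac(1) by (simp add: k.cr)
      ultimately show False using ac(2) by simp
    qed
    ultimately show ?thesis by simp
  qed
  then have "(\<lambda>a. \<one>\<^bsub>k\<^esub> \<ominus>\<^bsub>k\<^esub> a) ` N \<subseteq> S - {\<one>\<^bsub>k\<^esub>}" by (rule image_subsetI)
  moreover have "inj_on (\<lambda>a. \<one>\<^bsub>k\<^esub> \<ominus>\<^bsub>k\<^esub> a) N"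
  proof (rule inj_onI)
    fix a b assume ab: "a \<in> N" "b \<in> N" "\<one>\<^bsub>k\<^esub> \<ominus>\<^bsub>k\<^esub> a = \<one>\<^bsub>k\<^esub> \<ominus>\<^bsub>k\<^esub> b"
    have c: "a \<in> carrier k" "b \<in> carrier k" using ab(1,2) by (auto simp: N_def)
    have "a = \<one>\<^bsub>k\<^esub> \<ominus>\<^bsub>k\<^esub> (\<one>\<^bsub>k\<^esub> \<ominus>\<^bsub>k\<^esub> a)" using c(1) by (simp add: k.cr)
    also have "\<dots> = b" unfolding ab(3) using c(2) by (simp add: k.cr)
    finally show "a = b" .
  qed
  moreover have finS: "finite S" using finU sub by (rule finite_subset[rotated])
  ultimately have "card N \<le> card (S - {\<one>\<^bsub>k\<^esub>})" by (metis card_inj_on_le finite_Diff)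
  moreover have "card (S - {\<one>\<^bsub>k\<^esub>}) < card S" using finS one by (rule card_Diff1_less)
  ultimately show False using le by simp
qed

text \<open>The unit group is cyclic with generator \<open>g\<close>, so every symbol is a multiple
  of \<open>G = {g, g}\<close>. From \<open>{g, -g} = 0\<close> one gets
  \<open>G = - {g, -1}\<close> and hence \<open>2 G = 0\<close>; it remains to find an odd multiple
  of \<open>G\<close> that vanishes.\<close>

lemma finite_field_symbol:
  assumes k: "field k" and fin: "finite (carrier k)" and u: "u \<in> lists (Units k)" and v: "v \<in> lists (Units k)"
    and ab: "a \<in> Units k" "b \<in> Units k"
  shows "frag_of (u @ a # b # v) \<in> milnor_rel k"
proof -
  interpret k: field k by (rule k)
  interpret s: steinberg_symbol k "\<lambda>a b. frag_of (u @ a # b # v)" "milnor_rel k"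
    by (rule word_symbol[OF k.is_cring u v])
  obtain g where g: "g \<in> carrier (mult_of k)" "carrier (mult_of k) = {g [^]\<^bsub>k\<^esub> i | i::nat. i \<in> UNIV}"
    using k.finite_field_mult_group_has_gen[OF fin] by blast
  have gU: "g \<in> Units k" using g(1) by (simp add: k.field_Units)
  have pow: "\<exists>i::nat. x = g [^]\<^bsub>k\<^esub> i" if "x \<in> Units k" for x
    using that g(2) by (auto simp: k.field_Units)
  define G where "G = frag_of (u @ g # g # v)"
  have pp: "frag_of (u @ g [^]\<^bsub>k\<^esub> i # g [^]\<^bsub>k\<^esub> j # v) - frag_cmul (int (i * j)) G \<in> milnor_rel k" for i j :: nat
  proof -
    have "g [^]\<^bsub>k\<^esub> j \<in> Units k" using gU by (rule k.Units_pow_closed)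
    from s.Z_add[OF s.pow_left[OF gU this, of i] s.Z_cmul[OF s.pow_right[OF gU gU, of j], of "int i"]]
    show ?thesis
      by (simp only: G_def frag_cmul_right_diff frag_cmul_cmul of_nat_mult add_diff_eq diff_add_cancel)
  qed
  have m1: "\<ominus>\<^bsub>k\<^esub> \<one>\<^bsub>k\<^esub> \<in> Units k" by (rule k.Units_minus_one_closed)
  have "frag_of (u @ g # (\<ominus>\<^bsub>k\<^esub> \<one>\<^bsub>k\<^esub>) # v) + G \<in> milnor_rel k"
  proof -
    have e: "g \<otimes>\<^bsub>k\<^esub> (\<ominus>\<^bsub>k\<^esub> \<one>\<^bsub>k\<^esub>) = \<ominus>\<^bsub>k\<^esub> g" using gU by (simp add: k.r_minus k.Units_closed)
    from s.Z_diff[OF field_word_neg[OF k gU u v] s.mult_right[OF gU gU m1, unfolded e]]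
    show ?thesis by (simp add: G_def algebra_simps)
  qed
  note A = this
  have "frag_cmul 2 (frag_of (u @ g # (\<ominus>\<^bsub>k\<^esub> \<one>\<^bsub>k\<^esub>) # v)) \<in> milnor_rel k"
  proof -
    have e: "(\<ominus>\<^bsub>k\<^esub> \<one>\<^bsub>k\<^esub>) \<otimes>\<^bsub>k\<^esub> (\<ominus>\<^bsub>k\<^esub> \<one>\<^bsub>k\<^esub>) = \<one>\<^bsub>k\<^esub>" by (simp add: k.l_minus)
    have h: "frag_cmul 2 x = x + x" for x :: "'a list \<Rightarrow>\<^sub>0 int"
      using frag_cmul_distrib[of 1 1 x] by simp
    from s.Z_diff[OF s.one_right[OF gU] s.mult_right[OF gU m1 m1, unfolded e]]
    show ?thesis by (simp add: h algebra_simps)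
  qed
  from s.Z_diff[OF s.Z_cmul[OF A, of 2] this]
  have 2: "frag_cmul 2 G \<in> milnor_rel k" by (simp add: frag_cmul_distrib2)
  have odd: "G \<in> milnor_rel k" if "frag_cmul j G \<in> milnor_rel k" "odd j" for j
    using int_combination_mem[OF s.Z_diff s.Z_zero 2 that] .
  have "G \<in> milnor_rel k"
  proof (cases "\<exists>y \<in> Units k. g = y \<otimes>\<^bsub>k\<^esub> y")
    case True
    \<comment> \<open>If \<open>g\<close> is a square, then \<open>g = g^(2 j)\<close> for some
      \<open>j\<close>, and \<open>1 - 2 j\<close> is the required odd multiple.\<close>
    then obtain y where y: "y \<in> Units k" "g = y \<otimes>\<^bsub>k\<^esub> y" by (rule bexE)
    obtain j :: nat where j: "y = g [^]\<^bsub>k\<^esub> j" using pow[OF y(1)] by (rule exE)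
    have "g [^]\<^bsub>k\<^esub> (2 * j) = g"
      using k.nat_pow_mult[OF k.Units_closed[OF gU], of j j] y(2)[symmetric] unfolding j mult_2 by simp
    then have "G - frag_cmul (int (2 * j)) G \<in> milnor_rel k"
      using s.pow_right[OF gU gU, of "2 * j"] by (simp add: G_def)
    moreover have "G - frag_cmul (int (2 * j)) G = frag_cmul (1 - 2 * int j) G"
      by (simp add: frag_cmul_diff_distrib left_diff_distrib)
    ultimately show ?thesis using odd[of "1 - 2 * int j"] by simp
  next
    case False
    then have ng: "g \<noteq> y \<otimes>\<^bsub>k\<^esub> y" if "y \<in> Units k" for y using that by blast
    obtain a where a: "a \<in> Units k" "\<one>\<^bsub>k\<^esub> \<ominus>\<^bsub>k\<^esub> a \<in> Units k"
        "\<And>y. y \<in> Units k \<Longrightarrow> a \<noteq> y \<otimes>\<^bsub>k\<^esub> y" "\<And>y. y \<in> Units k \<Longrightarrow> \<one>\<^bsub>k\<^esub> \<ominus>\<^bsub>k\<^esub> a \<noteq> y \<otimes>\<^bsub>k\<^esub> y"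
      using nonsquares_sum_one[OF k fin gU ng] by blast
    obtain i j :: nat where ij: "a = g [^]\<^bsub>k\<^esub> i" "\<one>\<^bsub>k\<^esub> \<ominus>\<^bsub>k\<^esub> a = g [^]\<^bsub>k\<^esub> j" using pow[OF a(1)] pow[OF a(2)] by blast
    have o: "odd l" if l: "x = g [^]\<^bsub>k\<^esub> l" and ns: "\<And>y. y \<in> Units k \<Longrightarrow> x \<noteq> y \<otimes>\<^bsub>k\<^esub> y" for x and l :: nat
    proof
      assume "even l"
      then obtain h where "l = h + h" by (auto elim!: evenE simp: mult_2)
      then have "x = g [^]\<^bsub>k\<^esub> h \<otimes>\<^bsub>k\<^esub> g [^]\<^bsub>k\<^esub> h"
        unfolding l using k.nat_pow_mult[OF k.Units_closed[OF gU], of h h] by simp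
      then show False using ns[OF k.Units_pow_closed[OF gU]] by blast
    qed
    \<comment> \<open>Even powers of \<open>g\<close> are squares, so \<open>i\<close> and
      \<open>j\<close> are odd, and the Steinberg relation of \<open>a\<close> says that the odd
      multiple \<open>i j\<close> of \<open>G\<close> vanishes.\<close>
    from s.Z_diff[OF s.steinberg[OF a(1,2)] pp[of i j, folded ij]]
    have "frag_cmul (int (i * j)) G \<in> milnor_rel k" by simp
    then show ?thesis using odd[of "int (i * j)"] o[OF ij(1) a(3)] o[OF ij(2) a(4)] by simp
  qed
  then have G: "frag_cmul (int (i * j)) G \<in> milnor_rel k" for i j :: nat by (rule s.Z_cmul)
  obtain i j :: nat where ij: "a = g [^]\<^bsub>k\<^esub> i" "b = g [^]\<^bsub>k\<^esub> j" using pow[OF ab(1)] pow[OF ab(2)] by blast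
  from s.Z_add[OF pp[of i j] G[of i j]] show ?thesis by (simp add: ij)
qed

lemma finite_field_chain:
  assumes k: "field k" and fin: "finite (carrier k)" and n: "n \<ge> 2" and c: "Poly_Mapping.keys c \<subseteq> words k n"
  shows "c \<in> milnor_rel k"
  using c
proof (induction c rule: frag_induction)
  case (one w)
  obtain a b v where "w = a # b # v" using one n by (cases w; cases "tl w") auto
  then show ?case using one finite_field_symbol[OF k fin lists.Nil, of v a b] by simp
qed (auto intro: word_rel.zero word_rel.diff)

section \<open>The residue isomorphism from the improved group of the thickening to the Milnor group
  of \<open>k\<close>\<close>

context perfect_thickening
begin

interpretation Q: thickening R "rat1 k" \<sigma> \<rho> T m by (rule rat_thickening)

text \<open>Reduction modulo \<open>t\<close> followed by specialization at \<open>s_1 = 0\<close>.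
  It lands in \<open>k\<close> itself, not in \<open>k(s_1)\<close>, and is a left inverse of the
  embedding of nonzero constants.\<close>

abbreviation "\<psi> \<equiv> \<lambda>x. origin_map k (\<rho> x)"

lemma residue_symbol_map: "symbol_map R k \<psi>"
  by (rule symbol_map_comp_ring_hom[OF Q.A.ring_axioms Q.k.ring_axioms Q.pi origin_map_symbol_map[OF field_k]])

lemma residue_Units: "a \<in> Units R \<Longrightarrow> \<psi> a \<in> Units k"
  using residue_symbol_map unfolding symbol_map_def by simp

lemma rat_const_k: "rat_const k \<in> ring_hom k (rat1 k)"
  by (rule field_thickening.rat_const_hom[OF trivial])

text \<open>By naturality of \<open>i_1\<close> and \<open>i_2\<close> the reduction of an improved
  chain is improved over \<open>k\<close>, where \<open>field_chain\<close> replaces it by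
  constants.\<close>

lemma residue_chain:
  assumes c: "c \<in> improved_chains n"
  shows "frag_map \<rho> c - frag_map (rat_const k) (frag_map \<psi> c) \<in> milnor_rel (rat1 k)"
proof -
  note ck = Q.A.words_keys[OF improved_chains_keys[OF c]]
  have R2: "ring (rat2 A)" "ring (rat2 k)"
    using cring.axioms(1)[OF cring_rat2] cring.axioms(1)[OF field_thickening.cring_rat2[OF trivial]] .
  have i: "frag_map (thickening_map.rat2_map k \<pi>) (frag_map (rat_incl1 A) c) = frag_map (rat_incl1 k) (frag_map \<rho> c)"
    unfolding frag_map_comp
    by (rule frag_map_cong[OF _ ck]) (simp add: thickening_map.rat2_map_incl1[OF thickening_map_pi] Q.A.Units_closed)
  have i': "frag_map (thickening_map.rat2_map k \<pi>) (frag_map (rat_incl2 A) c) = frag_map (rat_incl2 k) (frag_map \<rho> c)"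
    unfolding frag_map_comp
    by (rule frag_map_cong[OF _ ck]) (simp add: thickening_map.rat2_map_incl2[OF thickening_map_pi] Q.A.Units_closed)
  have "frag_map (thickening_map.rat2_map k \<pi>) (frag_map (rat_incl1 A) c - frag_map (rat_incl2 A) c) \<in> milnor_rel (rat2 k)"
    using c unfolding improved_chains_def
    by (intro symbol_map_milnor_rel[OF symbol_map_ring_hom[OF R2 thickening_map.rat2_map_hom[OF thickening_map_pi]]]) simp
  then have eq: "frag_map (rat_incl1 k) (frag_map \<rho> c) - frag_map (rat_incl2 k) (frag_map \<rho> c) \<in> milnor_rel (rat2 k)"
    unfolding frag_extend_diff i i' .
  have "Poly_Mapping.keys (frag_map \<rho> c) \<subseteq> lists (Units (rat1 k))"
    by (rule frag_map_keys[OF Q.pi_Units ck])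
  from field_chain[OF field_k this eq] show ?thesis unfolding frag_map_comp by (simp add: comp_def)
qed

text \<open>If the specialized chain is a relation over \<open>k\<close>, then so is its image over
  \<open>k(s_1)\<close>, hence the reduction modulo \<open>t\<close>;
  \<open>reduction_vanishing\<close> lifts this to the thickening.\<close>

lemma improved_chain_vanishing:
  assumes n: "n \<ge> 2" and c: "c \<in> improved_chains n" and red: "frag_map \<psi> c \<in> milnor_rel k"
  shows "c \<in> milnor_rel R"
proof -
  have "frag_map (rat_const k) (frag_map \<psi> c) \<in> milnor_rel (rat1 k)"
    by (rule symbol_map_milnor_rel[OF symbol_map_ring_hom[OF k.ring_axioms Q.k.ring_axioms rat_const_k] red])
  from word_rel_add[OF residue_chain[OF c] this]
  have "frag_map \<rho> c \<in> milnor_rel (rat1 k)" by simp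
  then show ?thesis
    using c reduction_vanishing[OF n] unfolding improved_chains_def by blast
qed

lemma improved_elem_eq_iff:
  assumes "c \<in> improved_chains n" "d \<in> improved_chains n"
  shows "milnor_elem R c = milnor_elem R d \<longleftrightarrow> c - d \<in> milnor_rel R"
  by (rule Q.A.milnor_elem_eq_iff[OF Q.A.words_keys Q.A.words_keys]) (rule improved_chains_keys; rule assms)+

lemma residue_map_elem:
  assumes c: "c \<in> improved_chains n"
  shows "milnor_map k \<psi> (milnor_elem R c) = milnor_elem k (frag_map \<psi> c)"
    and "Poly_Mapping.keys (frag_map \<psi> c) \<subseteq> words k n"
  by (rule symbol_map_milnor_map[OF Q.A.ring_axioms k.ring_axioms residue_symbol_map
        Q.A.words_keys[OF improved_chains_keys[OF c]]])
    (rule frag_map_words[OF residue_Units improved_chains_keys[OF c]])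

lemma residue_map_hom: "milnor_map k \<psi> \<in> hom (improved_K n A) (milnor_K n k)"
proof (rule homI)
  fix x assume "x \<in> carrier (improved_K n A)"
  then obtain c where c: "x = milnor_elem R c" "c \<in> improved_chains n" unfolding carrier_improved_K by (rule imageE)
  show "milnor_map k \<psi> x \<in> carrier (milnor_K n k)"
    unfolding c(1) residue_map_elem(1)[OF c(2)] k.milnor_K_simps(1) using residue_map_elem(2)[OF c(2)] by (intro imageI) simp
  fix y assume "y \<in> carrier (improved_K n A)"
  then obtain d where d: "y = milnor_elem R d" "d \<in> improved_chains n" unfolding carrier_improved_K by (rule imageE)
  have cd: "c + d \<in> improved_chains n"
    using improved_chains_diff[OF c(2) improved_chains_diff[OF zero_improved_chains d(2)]] by simp
  show "milnor_map k \<psi> (x \<otimes>\<^bsub>improved_K n A\<^esub> y) = milnor_map k \<psi> x \<otimes>\<^bsub>milnor_K n k\<^esub> milnor_map k \<psi> y"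
    unfolding improved_K_mult c(1) d(1) Q.A.milnor_K_mult[OF improved_chains_keys[OF c(2)] improved_chains_keys[OF d(2)]]
      residue_map_elem(1)[OF cd] residue_map_elem(1)[OF c(2)] residue_map_elem(1)[OF d(2)]
      k.milnor_K_mult[OF residue_map_elem(2)[OF c(2)] residue_map_elem(2)[OF d(2)]] frag_extend_add ..
qed

lemma residue_map_inj:
  assumes n: "n \<ge> 2" shows "inj_on (milnor_map k \<psi>) (carrier (improved_K n A))"
proof (rule inj_onI)
  fix x y assume xy: "x \<in> carrier (improved_K n A)" "y \<in> carrier (improved_K n A)" "milnor_map k \<psi> x = milnor_map k \<psi> y"
  obtain c where c: "x = milnor_elem R c" "c \<in> improved_chains n" using xy(1) unfolding carrier_improved_K by (rule imageE)
  obtain d where d: "y = milnor_elem R d" "d \<in> improved_chains n" using xy(2) unfolding carrier_improved_K by (rule imageE)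
  have "frag_map \<psi> c - frag_map \<psi> d \<in> milnor_rel k"
    using xy(3) unfolding c(1) d(1) residue_map_elem(1)[OF c(2)] residue_map_elem(1)[OF d(2)]
      k.milnor_elem_eq_iff[OF k.words_keys[OF residue_map_elem(2)[OF c(2)]] k.words_keys[OF residue_map_elem(2)[OF d(2)]]] .
  then have "frag_map \<psi> (c - d) \<in> milnor_rel k" unfolding frag_extend_diff .
  from improved_chain_vanishing[OF n improved_chains_diff[OF c(2) d(2)] this]
  show "x = y" unfolding c(1) d(1) improved_elem_eq_iff[OF c(2) d(2)] .
qed

lemma rat_incl_const: "a \<in> carrier A \<Longrightarrow> rat_incl1 A (rat_const A a) = rat_incl2 A (rat_const A a)"
proof -
  assume a: "a \<in> carrier A"
  have 1: "poly_const (UP A) \<one>\<^bsub>UP A\<^esub> = up_map (poly_const A) \<one>\<^bsub>UP A\<^esub>"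
    using ring_hom_one[OF poly_const_hom[OF UPA]] ring_hom_one[OF up_map_hom[OF A UPA poly_const_hom[OF A]]] by simp
  have c: "poly_const (UP A) (poly_const A a) = up_map (poly_const A) (poly_const A a)"
    using up_map_const[OF A UPA poly_const_hom[OF A] a] by simp
  show ?thesis
    unfolding rat_const_def rat_incl1_frac[OF UP_closed(1)[OF A a] R1.one_S] rat_incl2_frac[OF UP_closed(1)[OF A a] R1.one_S] 1 c ..
qed

lemma residue_map_surj: "milnor_map k \<psi> ` carrier (improved_K n A) = carrier (milnor_K n k)"
proof
  show "milnor_map k \<psi> ` carrier (improved_K n A) \<subseteq> carrier (milnor_K n k)"
    using hom_in_carrier[OF residue_map_hom] by (rule image_subsetI)
  show "carrier (milnor_K n k) \<subseteq> milnor_map k \<psi> ` carrier (improved_K n A)"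
  proof
    fix y assume "y \<in> carrier (milnor_K n k)"
    then obtain d where d: "y = milnor_elem k d" "Poly_Mapping.keys d \<subseteq> words k n" unfolding k.milnor_K_simps(1) by auto
    \<comment> \<open>A class of \<open>k\<close> is lifted through constants: on them
      \<open>i_1\<close> and \<open>i_2\<close> agree, so the lift is improved, and
      \<open>\<psi>\<close> undoes the lift.\<close>
    let ?f = "\<lambda>a. rat_const A (\<iota> a)"
    have f: "?f \<in> ring_hom k R" using ring_hom_trans[OF iota rat_const_hom] by (simp add: comp_def)
    define c where "c = frag_map ?f d"
    have ck: "Poly_Mapping.keys c \<subseteq> words R n"
      unfolding c_def by (rule milnor_map_ring_hom(2)[OF k.ring_axioms Q.A.ring_axioms f d(2)])
    have "frag_map (rat_incl1 A) c = frag_map (rat_incl2 A) c"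
      unfolding c_def frag_map_comp
      by (rule frag_map_cong[OF _ k.words_keys[OF d(2)]]) (simp add: rat_incl_const k.Units_closed)
    then have c: "c \<in> improved_chains n" using ck by (simp add: improved_chains_def word_rel.zero)
    have "frag_map \<psi> c = frag_map (\<lambda>x. x) d"
      unfolding c_def frag_map_comp
    proof (rule frag_map_cong[OF _ k.words_keys[OF d(2)]])
      fix a assume a: "a \<in> Units k"
      then have a': "a \<in> carrier k" "a \<noteq> \<zero>\<^bsub>k\<^esub>" by (simp_all add: Units_k)
      show "(\<psi> \<circ> ?f) a = a"
        using thickening_map.rat_map_const[OF thickening_map_pi iota.hom_closed[OF a'(1)]] pi_iota[OF a'(1)]
          origin_map_const[OF field_k a'] by simp
    qed
    also have "\<dots> = d" by (induction d rule: frag_induct) (simp_all add: frag_extend_diff)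
    finally have "y = milnor_map k \<psi> (milnor_elem R c)" unfolding d(1) residue_map_elem(1)[OF c] by simp
    then show "y \<in> milnor_map k \<psi> ` carrier (improved_K n A)"
      unfolding carrier_improved_K using c by blast
  qed
qed

lemma residue_map_iso: "n \<ge> 2 \<Longrightarrow> milnor_map k \<psi> \<in> iso (improved_K n A) (milnor_K n k)"
  using residue_map_hom residue_map_inj residue_map_surj by (simp add: iso_def bij_betw_def)

text \<open>Certifies that the isomorphism is the one induced by \<open>t -> 0\<close>: the target
  of the reduction map is the improved group of \<open>k\<close>, with which the Milnor group of
  \<open>k\<close> is compared by its natural map.\<close>

lemma milnor_to_improved_residue:
  assumes x: "x \<in> carrier (improved_K n A)"
  shows "milnor_to_improved k (milnor_map k \<psi> x) = improved_map A k \<pi> x"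
proof -
  obtain c where c: "x = milnor_elem R c" "c \<in> improved_chains n" using x unfolding carrier_improved_K by (rule imageE)
  note r = milnor_map_ring_hom[OF Q.A.ring_axioms Q.k.ring_axioms Q.pi improved_chains_keys[OF c(2)]]
  note s = milnor_map_ring_hom[OF k.ring_axioms Q.k.ring_axioms rat_const_k residue_map_elem(2)[OF c(2)]]
  have "frag_map (rat_const k) (frag_map \<psi> c) - frag_map \<rho> c \<in> milnor_rel (rat1 k)"
    using word_rel_uminus[OF residue_chain[OF c(2)]] by simp
  then show ?thesis
    unfolding c(1) milnor_to_improved_def improved_map_def residue_map_elem(1)[OF c(2)] r(1) s(1)
      Q.k.milnor_elem_eq_iff[OF Q.k.words_keys[OF s(2)] Q.k.words_keys[OF r(2)]] .
qed

lemma trivial_milnor_subgroup: "trivial_group (milnor_K n R\<lparr>carrier := {milnor_elem R 0}\<rparr>)"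
proof -
  interpret K: comm_group "milnor_K n R" by (rule Q.A.comm_group_milnor_K)
  have "group (milnor_K n R\<lparr>carrier := {\<one>\<^bsub>milnor_K n R\<^esub>}\<rparr>)"
    using subgroup.subgroup_is_group[OF K.triv_subgroup K.is_group] .
  then show ?thesis unfolding trivial_group_def by (simp add: Q.A.milnor_K_simps(3))
qed

lemma milnor_elem_zeroI: "c \<in> milnor_rel R \<Longrightarrow> milnor_elem R c = milnor_elem R 0"
  using Q.A.milnor_elem_eq_iff[OF Q.A.milnor_rel_keys, of c 0] by simp

text \<open>The relative group refers to the quotient ring \<open>A Quot I\<close>, which is not
  literally \<open>k\<close>. The reduction \<open>\<rho>\<close> factors through rational functions
  over that quotient, so a class that dies there has trivial reduction over
  \<open>k(s_1)\<close>.\<close>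

lemma relative_improved_K_trivial:
  assumes n: "n \<ge> 2" and f: "thickening_map A k \<iota> \<pi> t m (A Quot I) \<iota>' \<pi>' t' m' (\<lambda>a. I +>\<^bsub>A\<^esub> a)"
  shows "trivial_group (relative_improved_K n A I)"
proof -
  let ?B = "A Quot I" and ?q = "\<lambda>a. I +>\<^bsub>A\<^esub> a"
  interpret f: thickening_map A k \<iota> \<pi> t m ?B \<iota>' \<pi>' t' m' ?q by (rule f)
  interpret S: cring "rat1 ?B" by (rule f.B.cring_rat1)
  have "carrier (relative_improved_K n A I) = {milnor_elem R 0}"
  proof
    show "carrier (relative_improved_K n A I) \<subseteq> {milnor_elem R 0}"
    proof
      fix x assume "x \<in> carrier (relative_improved_K n A I)"
      then have x: "x \<in> carrier (improved_K n A)" "improved_map A ?B ?q x = \<one>\<^bsub>improved_K n ?B\<^esub>"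
        by (simp_all add: relative_improved_K_def kernel_def)
      obtain c where c: "x = milnor_elem R c" "c \<in> improved_chains n" using x(1) unfolding carrier_improved_K by (rule imageE)
      note r = milnor_map_ring_hom[OF Q.A.ring_axioms S.ring_axioms f.rat_map_hom improved_chains_keys[OF c(2)]]
      have "milnor_elem (rat1 ?B) (frag_map (rat_map A ?B ?q) c) = milnor_elem (rat1 ?B) 0"
        using x(2) unfolding c(1) improved_map_def r(1) by (simp add: improved_K_def S.milnor_K_simps(3))
      then have "frag_map (rat_map A ?B ?q) c \<in> milnor_rel (rat1 ?B)"
        using S.milnor_elem_eq_iff[OF S.words_keys[OF r(2)], of 0] by simp
      then have "frag_map (rat_map ?B k \<pi>') (frag_map (rat_map A ?B ?q) c) \<in> milnor_rel (rat1 k)"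
        by (rule symbol_map_milnor_rel[OF symbol_map_ring_hom[OF S.ring_axioms Q.k.ring_axioms
              thickening_map.rat_map_hom[OF f.B.thickening_map_pi]]])
      moreover have "frag_map (rat_map ?B k \<pi>') (frag_map (rat_map A ?B ?q) c) = frag_map \<rho> c"
        unfolding frag_map_comp
        by (rule frag_map_cong[OF _ Q.A.words_keys[OF improved_chains_keys[OF c(2)]]])
          (simp add: rat_map_comp[OF f f.B.thickening_map_pi thickening_map_pi f.f_pi[symmetric]] Q.A.Units_closed)
      ultimately have "c \<in> milnor_rel R"
        using c(2) reduction_vanishing[OF n] unfolding improved_chains_def by simp
      then show "x \<in> {milnor_elem R 0}" unfolding c(1) by (simp add: milnor_elem_zeroI)
    qed
    have z: "Poly_Mapping.keys 0 \<subseteq> words R n" by simp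
    have "milnor_elem R 0 \<in> carrier (improved_K n A)"
      unfolding carrier_improved_K by (rule imageI[OF zero_improved_chains])
    moreover have "\<one>\<^bsub>improved_K n ?B\<^esub> = milnor_elem (rat1 ?B) 0"
      by (simp add: improved_K_def S.milnor_K_simps(3))
    ultimately show "{milnor_elem R 0} \<subseteq> carrier (relative_improved_K n A I)"
      using milnor_map_ring_hom(1)[OF Q.A.ring_axioms S.ring_axioms f.rat_map_hom z]
      by (simp add: relative_improved_K_def kernel_def improved_map_def)
  qed
  then show ?thesis
    using trivial_milnor_subgroup by (simp add: relative_improved_K_def improved_K_def)
qed

lemma finite_improved_K_trivial:
  assumes n: "n \<ge> 2" and fin: "finite (carrier k)"
  shows "trivial_group (improved_K n A)"
proof -
  have "milnor_elem R c = milnor_elem R 0" if c: "c \<in> improved_chains n" for c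
    by (rule milnor_elem_zeroI[OF improved_chain_vanishing[OF n c
          finite_field_chain[OF field_k fin n residue_map_elem(2)[OF c]]]])
  then have "carrier (improved_K n A) = {milnor_elem R 0}"
    using zero_improved_chains unfolding carrier_improved_K by blast
  then show ?thesis
    using trivial_milnor_subgroup by (simp add: improved_K_def)
qed

end

section \<open>Homomorphisms on quotient rings and the quotient of a thickening by its nilpotent
  ideal\<close>

lemma quotient_rep: "X \<in> carrier (R Quot I) \<Longrightarrow> \<exists>x \<in> carrier R. X = I +>\<^bsub>R\<^esub> x"
  unfolding FactRing_def A_RCOSETS_def' by auto

lemma quotient_ring_hom:
  assumes R: "cring R" and S: "cring S" and I: "ideal I R" and h: "h \<in> ring_hom R S"
    and ker: "\<forall>x \<in> I. h x = \<zero>\<^bsub>S\<^esub>"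
  shows "(\<lambda>X. the_elem (h ` X)) \<in> ring_hom (R Quot I) S"
    and "x \<in> carrier R \<Longrightarrow> the_elem (h ` (I +>\<^bsub>R\<^esub> x)) = h x"
proof -
  interpret R: cring R by (rule R)
  interpret I: ideal I R by (rule I)
  interpret h: ring_hom_cring R S h by (rule ring_hom_cringI[OF R S h])
  show v: "the_elem (h ` (I +>\<^bsub>R\<^esub> x)) = h x" if x: "x \<in> carrier R" for x
  proof (rule the_elem_image)
    show "x \<in> I +>\<^bsub>R\<^esub> x"
      unfolding a_r_coset_def' by (rule UN_I[OF I.zero_closed]) (simp add: x)
    fix e assume "e \<in> I +>\<^bsub>R\<^esub> x"
    then obtain i where i: "i \<in> I" "e = i \<oplus>\<^bsub>R\<^esub> x" unfolding a_r_coset_def' by blast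
    show "h e = h x" unfolding i(2) h.hom_add[OF I.Icarr[OF i(1)] x] bspec[OF ker i(1)] by (rule h.S.l_zero[OF h.hom_closed[OF x]])
  qed
  have q: "(+>\<^bsub>R\<^esub>) I \<in> ring_hom R (R Quot I)" by (rule I.rcos_ring_hom)
  have rep: "\<exists>x \<in> carrier R. X = I +>\<^bsub>R\<^esub> x" if "X \<in> carrier (R Quot I)" for X
    by (rule quotient_rep[OF that])
  show "(\<lambda>X. the_elem (h ` X)) \<in> ring_hom (R Quot I) S"
  proof (rule ring_hom_memI)
    fix X Y assume X: "X \<in> carrier (R Quot I)" and Y: "Y \<in> carrier (R Quot I)"
    obtain x where x: "x \<in> carrier R" "X = I +>\<^bsub>R\<^esub> x" using rep[OF X] by (rule bexE)
    obtain y where y: "y \<in> carrier R" "Y = I +>\<^bsub>R\<^esub> y" using rep[OF Y] by (rule bexE)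
    show "the_elem (h ` (X \<otimes>\<^bsub>R Quot I\<^esub> Y)) = the_elem (h ` X) \<otimes>\<^bsub>S\<^esub> the_elem (h ` Y)"
      unfolding x(2) y(2) ring_hom_mult[OF q x(1) y(1), symmetric] v[OF x(1)] v[OF y(1)] v[OF R.m_closed[OF x(1) y(1)]]
      by (rule h.hom_mult[OF x(1) y(1)])
    show "the_elem (h ` (X \<oplus>\<^bsub>R Quot I\<^esub> Y)) = the_elem (h ` X) \<oplus>\<^bsub>S\<^esub> the_elem (h ` Y)"
      unfolding x(2) y(2) ring_hom_add[OF q x(1) y(1), symmetric] v[OF x(1)] v[OF y(1)] v[OF R.a_closed[OF x(1) y(1)]]
      by (rule h.hom_add[OF x(1) y(1)])
  next
    fix X assume X: "X \<in> carrier (R Quot I)"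
    obtain x where x: "x \<in> carrier R" "X = I +>\<^bsub>R\<^esub> x" using rep[OF X] by (rule bexE)
    show "the_elem (h ` X) \<in> carrier S" unfolding x(2) v[OF x(1)] by (rule h.hom_closed[OF x(1)])
  next
    show "the_elem (h ` \<one>\<^bsub>R Quot I\<^esub>) = \<one>\<^bsub>S\<^esub>"
      unfolding ring_hom_one[OF q, symmetric] v[OF R.one_closed] by (rule h.hom_one)
  qed
qed

lemma quotient_zero: "ideal I R \<Longrightarrow> x \<in> I \<Longrightarrow> I +>\<^bsub>R\<^esub> x = \<zero>\<^bsub>R Quot I\<^esub>"
proof -
  assume "ideal I R" "x \<in> I"
  then interpret I: ideal I R by simp
  show ?thesis using I.a_rcos_const[OF \<open>x \<in> I\<close>] by (simp add: FactRing_def)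
qed

lemma ring_hom_genideal_zero:
  assumes R: "cring R" and S: "cring S" and h: "h \<in> ring_hom R S" and a: "a \<in> carrier R" "h a = \<zero>\<^bsub>S\<^esub>"
    and x: "x \<in> Idl\<^bsub>R\<^esub> {a}"
  shows "h x = \<zero>\<^bsub>S\<^esub>"
proof -
  interpret h: ring_hom_cring R S h by (rule ring_hom_cringI[OF R S h])
  have "{a} \<subseteq> a_kernel R S h" using a unfolding a_kernel_def' by simp
  then have "Idl\<^bsub>R\<^esub> {a} \<subseteq> a_kernel R S h" by (rule h.R.genideal_minimal[OF
      ring_hom_ring.kernel_is_ideal[OF ring_hom_ringI2[OF h.R.ring_axioms h.S.ring_axioms h]]])
  then show ?thesis using x unfolding a_kernel_def' by blast
qed

text \<open>The quotient by \<open>t\<close> is isomorphic to \<open>k\<close> but consists of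
  cosets. It is presented as a thickening of \<open>k\<close> with zero as nilpotent element, and
  the coset map as a map of thickenings.\<close>

lemma (in field_thickening) quotient_thickening_map:
  defines "I \<equiv> Idl\<^bsub>A\<^esub> {t}"
  shows "thickening_map A k \<iota> \<pi> t m (A Quot I) (\<lambda>a. I +>\<^bsub>A\<^esub> \<iota> a) (\<lambda>X. the_elem (\<pi> ` X)) \<zero>\<^bsub>A Quot I\<^esub> 0 (\<lambda>a. I +>\<^bsub>A\<^esub> a)"
proof -
  have I: "ideal I A" unfolding I_def using t_closed by (intro A.genideal_ideal) simp
  have tI: "t \<in> I" unfolding I_def by (rule A.genideal_self'[OF t_closed])
  have ker: "\<forall>x \<in> I. \<pi> x = \<zero>\<^bsub>k\<^esub>"
    unfolding I_def by (intro ballI) (rule ring_hom_genideal_zero[OF A k.is_cring pi t_closed pi_t])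
  note h = quotient_ring_hom[OF A k.is_cring I pi ker]
  have q: "(\<lambda>a. I +>\<^bsub>A\<^esub> a) \<in> ring_hom A (A Quot I)" using ideal.rcos_ring_hom[OF I] by simp
  interpret B: cring "A Quot I" by (rule ideal.quotient_is_cring[OF I A])
  have i': "(\<lambda>a. I +>\<^bsub>A\<^esub> \<iota> a) \<in> ring_hom k (A Quot I)"
    using ring_hom_trans[OF iota q] by (simp add: comp_def)
  have "thickening (A Quot I) k (\<lambda>a. I +>\<^bsub>A\<^esub> \<iota> a) (\<lambda>X. the_elem (\<pi> ` X)) \<zero>\<^bsub>A Quot I\<^esub> 0"
  proof (rule thickening.intro)
    fix c assume c: "c \<in> carrier k"
    show "the_elem (\<pi> ` (I +>\<^bsub>A\<^esub> \<iota> c)) = c" unfolding h(2)[OF iota.hom_closed[OF c]] by (rule pi_iota[OF c])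
  next
    fix X assume X: "X \<in> carrier (A Quot I)"
    obtain x where x: "x \<in> carrier A" "X = I +>\<^bsub>A\<^esub> x" using quotient_rep[OF X] by (rule bexE)
    obtain b where b: "b \<in> carrier A" "x = \<iota> (\<pi> x) \<oplus>\<^bsub>A\<^esub> t \<otimes>\<^bsub>A\<^esub> b" using decomp[OF x(1)] by (rule bexE)
    define e where "e = \<iota> (\<pi> x)"
    have e: "e \<in> carrier A" "x = e \<oplus>\<^bsub>A\<^esub> t \<otimes>\<^bsub>A\<^esub> b" using x(1) b(2) by (simp_all add: e_def)
    have "t \<otimes>\<^bsub>A\<^esub> b \<in> I" using ideal.I_r_closed[OF I tI b(1)] .
    then have "X = (I +>\<^bsub>A\<^esub> e) \<oplus>\<^bsub>A Quot I\<^esub> \<zero>\<^bsub>A Quot I\<^esub>"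
      unfolding x(2) e(2) ring_hom_add[OF q e(1) A.m_closed[OF t_closed b(1)]] using quotient_zero[OF I] by simp
    then have "X = (I +>\<^bsub>A\<^esub> \<iota> (the_elem (\<pi> ` X))) \<oplus>\<^bsub>A Quot I\<^esub> \<zero>\<^bsub>A Quot I\<^esub> \<otimes>\<^bsub>A Quot I\<^esub> \<zero>\<^bsub>A Quot I\<^esub>"
      using h(2)[OF x(1)] x(2) by (simp add: e_def)
    then show "\<exists>b\<in>carrier (A Quot I). X = (I +>\<^bsub>A\<^esub> \<iota> (the_elem (\<pi> ` X))) \<oplus>\<^bsub>A Quot I\<^esub> \<zero>\<^bsub>A Quot I\<^esub> \<otimes>\<^bsub>A Quot I\<^esub> b"
      using B.zero_closed by (rule bexI)
  next
    show "\<zero>\<^bsub>A Quot I\<^esub> [^]\<^bsub>A Quot I\<^esub> Suc 0 = \<zero>\<^bsub>A Quot I\<^esub>" by simp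
  qed (rule B.is_cring k i' h(1) B.zero_closed)+
  then have "field_thickening (A Quot I) k (\<lambda>a. I +>\<^bsub>A\<^esub> \<iota> a) (\<lambda>X. the_elem (\<pi> ` X)) \<zero>\<^bsub>A Quot I\<^esub> 0"
    by (intro field_thickening.intro field_thickening_axioms.intro field_k)
  then show ?thesis
    using field_thickening_axioms q h(2) by (intro thickening_map.intro thickening_map_axioms.intro)
qed

section \<open>Truncated polynomials\<close>

text \<open>Evaluation at zero gives the constant coefficient, and \<open>g\<close> is
  \<open>f\<close> with its coefficients shifted down by one place.\<close>

lemma eval_zero_decomp:
  assumes k: "cring k" and f: "f \<in> carrier (UP k)"
  shows "\<exists>g \<in> carrier (UP k). f = poly_const k (eval k k (\<lambda>a. a) \<zero>\<^bsub>k\<^esub> f) \<oplus>\<^bsub>UP k\<^esub> poly_var k \<otimes>\<^bsub>UP k\<^esub> g"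
proof -
  interpret k: cring k by (rule k)
  interpret P: cring "UP k" by (rule cring_UP[OF k])
  note e = eval_hom[OF k k id_hom k.zero_closed]
  interpret e: ring_hom_cring "UP k" k "eval k k (\<lambda>a. a) \<zero>\<^bsub>k\<^esub>" by (rule ring_hom_cringI[OF P.is_cring k e(1)])
  note fc = UP_apply(2)[OF k f]
  obtain d where d: "\<forall>n > d. f n = \<zero>\<^bsub>k\<^esub>" using UP_memD[OF f] by (rule exE)
  define g where "g = (\<lambda>n. f (Suc n))"
  have g: "g \<in> carrier (UP k)" unfolding g_def by (rule UP_memI[of _ _ d]) (use fc d in auto)
  note c = UP_closed(1)[OF k fc, of 0] and X = UP_closed(2)[OF k]
  have "poly_var k = monom (UP k) \<one>\<^bsub>k\<^esub> 1" by (simp add: poly_var_def)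
  then have s: "(g \<otimes>\<^bsub>UP k\<^esub> poly_var k) n = (if 1 \<le> n then g (n - 1) else \<zero>\<^bsub>k\<^esub>)" for n
    using monom_shift[OF k g, of 1 n] by simp
  have fg: "f = poly_const k (f 0) \<oplus>\<^bsub>UP k\<^esub> g \<otimes>\<^bsub>UP k\<^esub> poly_var k"
  proof (rule ext)
    fix n
    have "(poly_const k (f 0) \<oplus>\<^bsub>UP k\<^esub> g \<otimes>\<^bsub>UP k\<^esub> poly_var k) n = poly_const k (f 0) n \<oplus>\<^bsub>k\<^esub> (g \<otimes>\<^bsub>UP k\<^esub> poly_var k) n"
      by (rule UP_apply(3)[OF k c P.m_closed[OF g X]])
    also have "\<dots> = (if n = 0 then f 0 else \<zero>\<^bsub>k\<^esub>) \<oplus>\<^bsub>k\<^esub> (if 1 \<le> n then g (n - 1) else \<zero>\<^bsub>k\<^esub>)"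
      unfolding s UP_apply(8)[OF k fc] ..
    also have "\<dots> = f n" using fc by (cases n) (simp_all add: g_def)
    finally show "f n = (poly_const k (f 0) \<oplus>\<^bsub>UP k\<^esub> g \<otimes>\<^bsub>UP k\<^esub> poly_var k) n" by (rule sym)
  qed
  have "eval k k (\<lambda>a. a) \<zero>\<^bsub>k\<^esub> (poly_const k (f 0) \<oplus>\<^bsub>UP k\<^esub> g \<otimes>\<^bsub>UP k\<^esub> poly_var k) = f 0"
    using c X g fc e(2)[OF fc] e(3) by simp
  then have "eval k k (\<lambda>a. a) \<zero>\<^bsub>k\<^esub> f = f 0" unfolding fg[symmetric] .
  then show ?thesis using fg g unfolding P.m_comm[OF g X] by (intro bexI[of _ g]) simp_all
qed

text \<open>Evaluation at zero kills the generator of the truncation ideal because the exponent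
  \<open>Suc m\<close> is positive; it is therefore constant on cosets and \<open>the_elem\<close>
  is meaningful.\<close>

lemma trunc_red_coset:
  assumes k: "cring k"
  shows "trunc_red k \<in> ring_hom (trunc_poly k (Suc m)) k"
    and "f \<in> carrier (UP k) \<Longrightarrow> trunc_red k (trunc_ideal k (Suc m) +>\<^bsub>UP k\<^esub> f) = eval k k (\<lambda>a. a) \<zero>\<^bsub>k\<^esub> f"
proof -
  interpret k: cring k by (rule k)
  interpret P: cring "UP k" by (rule cring_UP[OF k])
  note e = eval_hom[OF k k id_hom k.zero_closed]
  interpret e: ring_hom_cring "UP k" k "eval k k (\<lambda>a. a) \<zero>\<^bsub>k\<^esub>" by (rule ring_hom_cringI[OF P.is_cring k e(1)])
  have X: "poly_var k [^]\<^bsub>UP k\<^esub> Suc m \<in> carrier (UP k)" using UP_closed(2)[OF k] by (rule P.nat_pow_closed)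
  have z: "eval k k (\<lambda>a. a) \<zero>\<^bsub>k\<^esub> (poly_var k [^]\<^bsub>UP k\<^esub> Suc m) = \<zero>\<^bsub>k\<^esub>"
    unfolding e.hom_pow[OF UP_closed(2)[OF k]] e(3) by simp
  have ker: "\<forall>f \<in> trunc_ideal k (Suc m). eval k k (\<lambda>a. a) \<zero>\<^bsub>k\<^esub> f = \<zero>\<^bsub>k\<^esub>"
    unfolding trunc_ideal_def using ring_hom_genideal_zero[OF P.is_cring k e(1) X] z by blast
  have I: "ideal (trunc_ideal k (Suc m)) (UP k)" unfolding trunc_ideal_def using X by (intro P.genideal_ideal) simp
  have t: "trunc_red k = (\<lambda>Y. the_elem (eval k k (\<lambda>a. a) \<zero>\<^bsub>k\<^esub> ` Y))" by (rule ext) (rule trunc_red_def)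
  show "trunc_red k \<in> ring_hom (trunc_poly k (Suc m)) k"
    unfolding t trunc_poly_def by (rule quotient_ring_hom(1)[OF P.is_cring k I e(1) ker])
  show "f \<in> carrier (UP k) \<Longrightarrow> trunc_red k (trunc_ideal k (Suc m) +>\<^bsub>UP k\<^esub> f) = eval k k (\<lambda>a. a) \<zero>\<^bsub>k\<^esub> f"
    unfolding trunc_red_def by (rule quotient_ring_hom(2)[OF P.is_cring k I e(1) ker])
qed

lemma field_thickening_trunc:
  assumes k: "field k"
  shows "field_thickening (trunc_poly k (Suc m)) k (\<lambda>a. trunc_ideal k (Suc m) +>\<^bsub>UP k\<^esub> poly_const k a) (trunc_red k)
    (trunc_var k (Suc m)) m"
proof -
  interpret k: field k by (rule k)
  interpret P: cring "UP k" by (rule cring_UP[OF k.is_cring])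
  let ?J = "trunc_ideal k (Suc m)" and ?A = "trunc_poly k (Suc m)"
  have X: "poly_var k \<in> carrier (UP k)" by (rule UP_closed(2)[OF k.is_cring])
  have XN: "poly_var k [^]\<^bsub>UP k\<^esub> Suc m \<in> carrier (UP k)" using X by (rule P.nat_pow_closed)
  have J: "ideal ?J (UP k)" unfolding trunc_ideal_def using XN by (intro P.genideal_ideal) simp
  have q: "(\<lambda>f. ?J +>\<^bsub>UP k\<^esub> f) \<in> ring_hom (UP k) ?A"
    using ideal.rcos_ring_hom[OF J] unfolding trunc_poly_def by simp
  have A: "cring ?A" unfolding trunc_poly_def by (rule ideal.quotient_is_cring[OF J P.is_cring])
  interpret q: ring_hom_cring "UP k" ?A "\<lambda>f. ?J +>\<^bsub>UP k\<^esub> f" by (rule ring_hom_cringI[OF P.is_cring A q])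
  note e = eval_hom[OF k.is_cring k.is_cring id_hom k.zero_closed]
  note r = trunc_red_coset[OF k.is_cring, where m = m]
  have "thickening ?A k (\<lambda>a. ?J +>\<^bsub>UP k\<^esub> poly_const k a) (trunc_red k) (trunc_var k (Suc m)) m"
  proof (rule thickening.intro)
    show "(\<lambda>a. ?J +>\<^bsub>UP k\<^esub> poly_const k a) \<in> ring_hom k ?A"
      using ring_hom_trans[OF poly_const_hom[OF k.is_cring] q] by (simp add: comp_def)
    show "trunc_red k (?J +>\<^bsub>UP k\<^esub> poly_const k c) = c" if c: "c \<in> carrier k" for c
      unfolding r(2)[OF UP_closed(1)[OF k.is_cring c]] by (rule e(2)[OF c])
    show "trunc_var k (Suc m) \<in> carrier ?A" unfolding trunc_var_def by (rule q.hom_closed[OF X])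
    have "poly_var k [^]\<^bsub>UP k\<^esub> Suc m \<in> ?J" unfolding trunc_ideal_def by (rule P.genideal_self'[OF XN])
    then show "trunc_var k (Suc m) [^]\<^bsub>?A\<^esub> Suc m = \<zero>\<^bsub>?A\<^esub>"
      unfolding trunc_var_def q.hom_pow[OF X, symmetric] using quotient_zero[OF J] unfolding trunc_poly_def by simp
    fix Y assume Y: "Y \<in> carrier ?A"
    obtain f where f: "f \<in> carrier (UP k)" "Y = ?J +>\<^bsub>UP k\<^esub> f"
      using quotient_rep[OF Y[unfolded trunc_poly_def]] by (rule bexE)
    define c where "c = eval k k (\<lambda>a. a) \<zero>\<^bsub>k\<^esub> f"
    have c: "c \<in> carrier k" unfolding c_def by (rule ring_hom_closed[OF e(1) f(1)])
    obtain g where g: "g \<in> carrier (UP k)" "f = poly_const k c \<oplus>\<^bsub>UP k\<^esub> poly_var k \<otimes>\<^bsub>UP k\<^esub> g"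
      using eval_zero_decomp[OF k.is_cring f(1)] unfolding c_def by (rule bexE)
    have Yc: "trunc_red k Y = c" unfolding f(2) r(2)[OF f(1)] c_def ..
    have "Y = (?J +>\<^bsub>UP k\<^esub> poly_const k (trunc_red k Y)) \<oplus>\<^bsub>?A\<^esub> trunc_var k (Suc m) \<otimes>\<^bsub>?A\<^esub> (?J +>\<^bsub>UP k\<^esub> g)"
      unfolding Yc trunc_var_def q.hom_mult[OF X g(1), symmetric]
        q.hom_add[OF UP_closed(1)[OF k.is_cring c] P.m_closed[OF X g(1)], symmetric] g(2)[symmetric] by (rule f(2))
    then show "\<exists>b\<in>carrier ?A. Y = (?J +>\<^bsub>UP k\<^esub> poly_const k (trunc_red k Y)) \<oplus>\<^bsub>?A\<^esub> trunc_var k (Suc m) \<otimes>\<^bsub>?A\<^esub> b"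
      using q.hom_closed[OF g(1)] by (rule bexI)
  qed (rule A k.domain_axioms r(1))+
  then show ?thesis by (intro field_thickening.intro field_thickening_axioms.intro k)
qed

text \<open>\<open>perfect_field\<close> gives surjectivity of the power map only for a prime
  exponent, so primality has to be derived before perfectness can be used. A factorization of
  \<open>p\<close> gives a product of two integer multiples of 1 that vanishes, so one factor is
  divisible by \<open>p\<close>.\<close>

lemma (in field) has_char_prime:
  assumes c: "has_char R p" and p: "p > 0" shows "prime p"
proof -
  have z: "[n] \<cdot> \<one> = \<zero> \<longleftrightarrow> p dvd n" for n :: nat using c by (simp add: has_char_def)
  have "p \<noteq> 1" using z[of 1] one_not_zero by auto
  moreover have "m = 1 \<or> m = p" if "m dvd p" for m
  proof -
    obtain l where l: "p = m * l" using \<open>m dvd p\<close> by (rule dvdE)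
    have "([m] \<cdot> \<one>) \<otimes> ([l] \<cdot> \<one>) = [p] \<cdot> \<one>"
      unfolding l by (simp add: add_pow_ldistr add_pow_rdistr add.nat_pow_pow mult.commute)
    then have "[m] \<cdot> \<one> = \<zero> \<or> [l] \<cdot> \<one> = \<zero>" using z[of p] integral by simp
    then have "p dvd m \<or> p dvd l" unfolding z .
    then show ?thesis
    proof
      assume "p dvd m" then show ?thesis using \<open>m dvd p\<close> by (simp add: dvd_antisym)
    next
      assume "p dvd l"
      then have "m * l dvd l" unfolding l .
      then show ?thesis using p l by auto
    qed
  qed
  ultimately show ?thesis using p unfolding prime_nat_iff by simp
qed

theorem corollary1p3p2:
  fixes k :: "('a, 'b) ring_scheme" and p m n :: nat
  assumes "perfect_field k" and "has_char k p" and "p > 0"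
    and "m \<ge> 1" and "n \<ge> 2"
  shows "trivial_group (relative_improved_K n (trunc_poly k (m + 1))
           (Idl\<^bsub>trunc_poly k (m + 1)\<^esub> {trunc_var k (m + 1)})) \<and>
         (\<exists>\<phi> \<in> iso (improved_K n (trunc_poly k (m + 1))) (milnor_K n k).
           \<forall>x \<in> carrier (improved_K n (trunc_poly k (m + 1))).
             milnor_to_improved k (\<phi> x) =
               improved_map (trunc_poly k (m + 1)) k (trunc_red k) x) \<and>
         (finite (carrier k) \<longrightarrow> trivial_group (improved_K n (trunc_poly k (m + 1))))"
proof -
  have k: "field k" using assms(1) by (simp add: perfect_field_def)
  have p: "prime p" by (rule field.has_char_prime[OF k assms(2,3)])
  have pk: "[p] \<cdot>\<^bsub>k\<^esub> \<one>\<^bsub>k\<^esub> = \<zero>\<^bsub>k\<^esub>" using assms(2) by (simp add: has_char_def)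
  have "(\<lambda>x. x [^]\<^bsub>k\<^esub> p) ` carrier k = carrier k" using assms(1,2) p by (simp add: perfect_field_def)
  then have surj: "\<exists>y \<in> carrier k. y [^]\<^bsub>k\<^esub> p = x" if "x \<in> carrier k" for x
    using that by (metis imageE)
  \<comment> \<open>Perfectness enters here, as the existence of \<open>p\<close>-th roots in
    \<open>k\<close>.\<close>
  interpret perfect_thickening "trunc_poly k (Suc m)" k "\<lambda>a. trunc_ideal k (Suc m) +>\<^bsub>UP k\<^esub> poly_const k a"
      "trunc_red k" "trunc_var k (Suc m)" m p
    by (intro perfect_thickening.intro perfect_thickening_axioms.intro field_thickening_trunc[OF k] p pk surj)
  show ?thesis
    unfolding Suc_eq_plus1[symmetric]
    using relative_improved_K_trivial[OF assms(5) quotient_thickening_map] residue_map_iso[OF assms(5)]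
      milnor_to_improved_residue finite_improved_K_trivial[OF assms(5)] by blast
qed

end
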